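(* Let $M$ be a smooth manifold with a regular foliation $\mathcal{F}$ of dimension $p$ and even codimension $2n$, and let $\omega\in\Omega^2_B(M,\mathcal{F})$ be a transversely symplectic structure. Then the following conditions are equivalent: (1) every basic cohomology class (every class in $H^*_B(M,\mathcal{F})$) has a harmonic representative, i.e. a basic form $\xi$ with $d\xi=0$ and $\delta_t\xi=0$; (2) for each $k\in\{0,1,\ldots,n\}$ the mapping $L^k:H^{n-k}_B(M,\mathcal{F})\to H^{n+k}_B(M,\mathcal{F})$ is surjective, where $L[\xi]=[\omega\wedge\xi]$.
   Context: A form $\xi\in\Omega^*(M)$ is basic if $\iota_T\xi=\mathcal{L}_T\xi=0$ for every vector field $T$ tangent to $\mathcal{F}$. Basic forms make up a complex $\Omega^*_B(M,\mathcal{F})$ with the exterior derivative $d$; its cohomology is the basic cohomology $H^*_B(M,\mathcal{F})$. A transversely symplectic structure is a closed basic $2$-form $\omega$ that is nondegenerate in the transverse direction, i.e. nondegenerate on $TM/T\mathcal{F}$. Transverse star operator: choose any distribution $\mathcal{D}\subset TM$ complementary to $T\mathcal{F}$. The map $X\mapsto\iota_X\omega$ from sections of $\mathcal{D}$ to $1$-forms vanishing on $T\mathcal{F}$ extends multiplicatively to an isomorphism $\flat$ from sections of $\bigwedge^*\mathcal{D}$ to forms annihilated by all $\iota_T$, $T$ tangent to $\mathcal{F}$. For a basic $k$-form $\xi$ put $\star_t\xi=\iota_{\flat^{-1}(\xi)}\omega^n$, where $\iota_{X_1\wedge\dots\wedge X_k}\eta=\eta(X_1,\dots,X_k,\cdot)$.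 This gives an operator $\star_t:\Omega^k_B(M,\mathcal{F})\to\Omega^{2n-k}_B(M,\mathcal{F})$ independent of the choice of $\mathcal{D}$. The codifferential is $\delta_t\xi=(-1)^k\star_t d\star_t\xi$ for $\xi\in\Omega^k_B(M,\mathcal{F})$. *)

theory Defs
  imports "HOL-Analysis.Analysis"
begin

section \<open>Smooth functions on open subsets of Euclidean space\<close>

text \<open>
  As in \<^const>\<open>Euclidean_space\<close>, a point of $R^m$ is a function on the naturals that
  vanishes at all indices $\geq m$.
\<close>

definition pderivative :: "nat \<Rightarrow> ((nat \<Rightarrow> real) \<Rightarrow> real) \<Rightarrow> (nat \<Rightarrow> real) \<Rightarrow> real" where
  "pderivative i f x = deriv (\<lambda>t. f (x(i := t))) (x i)"

definition iter_pderivative :: "nat list \<Rightarrow> ((nat \<Rightarrow> real) \<Rightarrow> real) \<Rightarrow> (nat \<Rightarrow> real) \<Rightarrow> real" where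
  "iter_pderivative is f = foldr pderivative is f"

definition smooth_on :: "nat \<Rightarrow> (nat \<Rightarrow> real) set \<Rightarrow> ((nat \<Rightarrow> real) \<Rightarrow> real) \<Rightarrow> bool" where
  "smooth_on m U f \<longleftrightarrow>
     (\<forall>is. set is \<subseteq> {..<m} \<longrightarrow>
        continuous_on U (iter_pderivative is f) \<and>
        (\<forall>x\<in>U. \<forall>i<m. (\<lambda>t. iter_pderivative is f (x(i := t))) differentiable (at (x i))))"


section \<open>Foliated manifolds\<close>

type_synonym 'a chart = "'a set \<times> ('a \<Rightarrow> nat \<Rightarrow> real)"

record 'a foliated =
  points :: "'a topology"
  leaf_dim :: nat
  codim :: nat
  charts :: "'a chart set"
  foliated_charts :: "'a chart set"

abbreviation mdim :: "'a foliated \<Rightarrow> nat" where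
  "mdim M \<equiv> leaf_dim M + codim M"

definition chart_inv :: "'a chart \<Rightarrow> (nat \<Rightarrow> real) \<Rightarrow> 'a" where
  "chart_inv c = inv_into (fst c) (snd c)"

definition is_chart :: "nat \<Rightarrow> 'a topology \<Rightarrow> 'a chart \<Rightarrow> bool" where
  "is_chart m X c \<longleftrightarrow>
     openin X (fst c) \<and>
     openin (Euclidean_space m) (snd c ` fst c) \<and>
     homeomorphic_map (subtopology X (fst c))
       (subtopology (Euclidean_space m) (snd c ` fst c)) (snd c)"

definition smooth_transition :: "nat \<Rightarrow> 'a chart \<Rightarrow> 'a chart \<Rightarrow> bool" where
  "smooth_transition m c c' \<longleftrightarrow>
     (\<forall>i<m. smooth_on m (snd c ` (fst c \<inter> fst c')) (\<lambda>y. snd c' (chart_inv c y) i))"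

text \<open>The coordinates of a foliated chart are ordered with the \<open>p\<close> leaf coordinates first, so
  that the plaques are given by fixing the last \<open>q\<close> coordinates.  A foliated transition map is
  locally of the form $(x, y) \mapsto (g(x, y), h(y))$.\<close>

definition foliated_transition :: "nat \<Rightarrow> nat \<Rightarrow> 'a topology \<Rightarrow> 'a chart \<Rightarrow> 'a chart \<Rightarrow> bool" where
  "foliated_transition p q X c c' \<longleftrightarrow>
     (\<forall>x \<in> fst c \<inter> fst c'. \<exists>W. openin X W \<and> x \<in> W \<and> W \<subseteq> fst c \<inter> fst c' \<and>
        (\<forall>y\<in>W. \<forall>z\<in>W. (\<forall>i\<in>{p..<p + q}. snd c y i = snd c z i) \<longrightarrow>
                       (\<forall>i\<in>{p..<p + q}. snd c' y i = snd c' z i)))"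

text \<open>The set \<open>charts M\<close> is any smooth atlas, not necessarily the maximal one.\<close>

definition smooth_manifold :: "'a foliated \<Rightarrow> bool" where
  "smooth_manifold M \<longleftrightarrow>
     Hausdorff_space (points M) \<and> second_countable (points M) \<and>
     (\<forall>c \<in> charts M. is_chart (mdim M) (points M) c) \<and>
     (\<Union>c \<in> charts M. fst c) = topspace (points M) \<and>
     (\<forall>c \<in> charts M. \<forall>c' \<in> charts M. smooth_transition (mdim M) c c')"

definition foliated_manifold :: "'a foliated \<Rightarrow> bool" where
  "foliated_manifold M \<longleftrightarrow>
     smooth_manifold M \<and>
     foliated_charts M \<subseteq> charts M \<and>
     (\<Union>c \<in> foliated_charts M. fst c) = topspace (points M) \<and>
     (\<forall>c \<in> foliated_charts M. \<forall>c' \<in> foliated_charts M.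
        foliated_transition (leaf_dim M) (codim M) (points M) c c')"


section \<open>Tangent vectors and vector fields\<close>

text \<open>A tangent vector at \<open>x\<close> is the family of its coordinate vectors in the charts around \<open>x\<close>
  (and zero in the other charts); the coordinate vectors are related by the Jacobian matrices of
  the transition maps.\<close>

type_synonym 'a tvec = "'a chart \<Rightarrow> nat \<Rightarrow> real"

definition charts_at :: "'a foliated \<Rightarrow> 'a \<Rightarrow> 'a chart set" where
  "charts_at M x = {c \<in> charts M. x \<in> fst c}"

definition chart_dderiv ::
  "'a foliated \<Rightarrow> 'a chart \<Rightarrow> (nat \<Rightarrow> real) \<Rightarrow> ('a \<Rightarrow> real) \<Rightarrow> 'a \<Rightarrow> real" where
  "chart_dderiv M c u f x =
     (\<Sum>j<mdim M. u j * pderivative j (\<lambda>y. f (chart_inv c y)) (snd c x))"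

definition tangent_space :: "'a foliated \<Rightarrow> 'a \<Rightarrow> 'a tvec set" where
  "tangent_space M x =
     {v. (\<forall>c. c \<notin> charts_at M x \<longrightarrow> v c = (\<lambda>_. 0)) \<and>
         (\<forall>c \<in> charts_at M x. v c \<in> topspace (Euclidean_space (mdim M))) \<and>
         (\<forall>c \<in> charts_at M x. \<forall>c' \<in> charts_at M x. \<forall>i < mdim M.
            v c' i = chart_dderiv M c (v c) (\<lambda>y. snd c' y i) x)}"

definition tvec_comb :: "real \<Rightarrow> 'a tvec \<Rightarrow> real \<Rightarrow> 'a tvec \<Rightarrow> 'a tvec" where
  "tvec_comb a v b w = (\<lambda>c i. a * v c i + b * w c i)"

definition tvec_zero :: "'a tvec" where
  "tvec_zero = (\<lambda>_ _. 0)"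

definition coord_vec :: "'a foliated \<Rightarrow> 'a chart \<Rightarrow> 'a \<Rightarrow> (nat \<Rightarrow> real) \<Rightarrow> 'a tvec" where
  "coord_vec M c x u =
     (\<lambda>c' i. if c' \<in> charts_at M x \<and> i < mdim M
             then chart_dderiv M c u (\<lambda>y. snd c' y i) x else 0)"

definition leaf_space :: "'a foliated \<Rightarrow> 'a \<Rightarrow> 'a tvec set" where
  "leaf_space M x =
     {v \<in> tangent_space M x.
        \<forall>c \<in> foliated_charts M. x \<in> fst c \<longrightarrow> (\<forall>i \<in> {leaf_dim M..<mdim M}. v c i = 0)}"

definition chart_smooth :: "'a foliated \<Rightarrow> 'a chart \<Rightarrow> ('a \<Rightarrow> real) \<Rightarrow> bool" where
  "chart_smooth M c f \<longleftrightarrow> smooth_on (mdim M) (snd c ` fst c) (\<lambda>y. f (chart_inv c y))"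

definition vector_fields :: "'a foliated \<Rightarrow> ('a \<Rightarrow> 'a tvec) set" where
  "vector_fields M =
     {T. (\<forall>x \<in> topspace (points M). T x \<in> tangent_space M x) \<and>
         (\<forall>c \<in> charts M. \<forall>i < mdim M. chart_smooth M c (\<lambda>x. T x c i))}"

definition leaf_fields :: "'a foliated \<Rightarrow> ('a \<Rightarrow> 'a tvec) set" where
  "leaf_fields M = {T \<in> vector_fields M. \<forall>x \<in> topspace (points M). T x \<in> leaf_space M x}"


section \<open>Exterior algebra at a point\<close>

text \<open>An alternating form on a vector space is a function of the list of its arguments, which
  vanishes on lists of the wrong length.  The wedge product is the sum over shuffles, the set \<open>I\<close>
  being the set of positions of the arguments passed to the first factor; hence
  $(\alpha\wedge\beta)(v, w) = \alpha(v)\beta(w) - \alpha(w)\beta(v)$ for 1-forms.\<close>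

type_synonym 'v altform = "'v list \<Rightarrow> real"

definition shuffle_sign :: "nat \<Rightarrow> nat set \<Rightarrow> real" where
  "shuffle_sign N I = (-1) ^ card {(i, j). i \<in> I \<and> j < i \<and> j \<in> {..<N} - I}"

definition wedge :: "'v altform \<Rightarrow> 'v altform \<Rightarrow> 'v altform" where
  "wedge \<alpha> \<beta> = (\<lambda>vs. \<Sum>I \<in> Pow {..<length vs}.
     shuffle_sign (length vs) I * \<alpha> (nths vs I) * \<beta> (nths vs (- I)))"

definition unit_form :: "'v altform" where
  "unit_form = (\<lambda>vs. if vs = [] then 1 else 0)"

definition wedge_power :: "nat \<Rightarrow> 'v altform \<Rightarrow> 'v altform" where
  "wedge_power n \<alpha> = (wedge \<alpha> ^^ n) unit_form"

text \<open>A multivector $\sum_j a_j\, X^j_1\wedge\dots\wedge X^j_k$ is represented by the list of the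
  pairs $(a_j, [X^j_1,\dots,X^j_k])$.  The representation is not unique, but both maps below depend
  only on the multivector.\<close>

type_synonym 'v multivec = "(real \<times> 'v list) list"

definition multivecs :: "nat \<Rightarrow> 'v set \<Rightarrow> 'v multivec set" where
  "multivecs k D = {P. \<forall>(a, Xs) \<in> set P. length Xs = k \<and> set Xs \<subseteq> D}"

definition flat_map :: "'v altform \<Rightarrow> 'v multivec \<Rightarrow> 'v altform" where
  "flat_map \<omega> P = (\<lambda>vs. \<Sum>(a, Xs) \<leftarrow> P.
     a * foldr (\<lambda>X. wedge (\<lambda>ws. \<omega> (X # ws))) Xs unit_form vs)"

definition contract :: "'v multivec \<Rightarrow> 'v altform \<Rightarrow> 'v altform" where
  "contract P \<eta> = (\<lambda>vs. \<Sum>(a, Xs) \<leftarrow> P. a * \<eta> (Xs @ vs))"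


section \<open>Differential forms\<close>

type_synonym 'a dform = "'a \<Rightarrow> 'a tvec altform"

abbreviation zero_form :: "'a dform" where
  "zero_form \<equiv> \<lambda>_ _. 0"

text \<open>Forms are extended by zero to arguments that are not tangent vectors at a point of the
  manifold, so that equality of forms is equality of functions.\<close>

definition forms :: "'a foliated \<Rightarrow> nat \<Rightarrow> 'a dform set" where
  "forms M k = {\<xi>.
     (\<forall>x vs. \<not> (x \<in> topspace (points M) \<and> length vs = k \<and> set vs \<subseteq> tangent_space M x)
        \<longrightarrow> \<xi> x vs = 0) \<and>
     (\<forall>x \<in> topspace (points M). \<forall>us v w ws a b.
        set us \<subseteq> tangent_space M x \<and> v \<in> tangent_space M x \<and>
        w \<in> tangent_space M x \<and> set ws \<subseteq> tangent_space M x \<longrightarrow>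
        \<xi> x (us @ tvec_comb a v b w # ws) = a * \<xi> x (us @ v # ws) + b * \<xi> x (us @ w # ws)) \<and>
     (\<forall>x vs. \<not> distinct vs \<longrightarrow> \<xi> x vs = 0) \<and>
     (\<forall>c \<in> charts M. \<forall>js. length js = k \<and> set js \<subseteq> {..<mdim M} \<longrightarrow>
        chart_smooth M c
          (\<lambda>x. \<xi> x (map (\<lambda>j. coord_vec M c x (\<lambda>i. if i = j then 1 else 0)) js)))}"

text \<open>The exterior derivative and the Lie derivative at \<open>x\<close> are the usual formulas
  $$(d\xi)(v_0,\dots,v_k) = \sum_i (-1)^i v_i(\xi(V_0,\dots,\widehat{V_i},\dots,V_k)),$$
  $$(L_T\xi)(v_1,\dots,v_k) = T(\xi(V_1,\dots,V_k)) - \sum_i \xi(v_1,\dots,[T,V_i],\dots,v_k),$$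
  where $V_i$ extends $v_i$ with constant coordinates in a chart around \<open>x\<close>; thus the brackets
  $[V_i,V_j]$ vanish and $-[T,V_i]$ is the derivative of the coordinates of $T$ along $v_i$.
  The values do not depend on the chart.\<close>

definition chart_at :: "'a foliated \<Rightarrow> 'a \<Rightarrow> 'a chart" where
  "chart_at M x = (SOME c. c \<in> charts_at M x)"

definition ext_deriv :: "'a foliated \<Rightarrow> 'a dform \<Rightarrow> 'a dform" where
  "ext_deriv M \<xi> = (\<lambda>x vs.
     if x \<in> topspace (points M) \<and> set vs \<subseteq> tangent_space M x then
       (let c = chart_at M x in
        \<Sum>i<length vs. (-1) ^ i *
          chart_dderiv M c ((vs ! i) c)
            (\<lambda>z. \<xi> z (map (\<lambda>v. coord_vec M c z (v c)) (take i vs @ drop (Suc i) vs))) x)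
     else 0)"

definition interior_prod :: "('a \<Rightarrow> 'a tvec) \<Rightarrow> 'a dform \<Rightarrow> 'a dform" where
  "interior_prod T \<xi> = (\<lambda>x vs. \<xi> x (T x # vs))"

definition lie_deriv :: "'a foliated \<Rightarrow> ('a \<Rightarrow> 'a tvec) \<Rightarrow> 'a dform \<Rightarrow> 'a dform" where
  "lie_deriv M T \<xi> = (\<lambda>x vs.
     if x \<in> topspace (points M) \<and> set vs \<subseteq> tangent_space M x then
       (let c = chart_at M x in
        chart_dderiv M c (T x c) (\<lambda>z. \<xi> z (map (\<lambda>v. coord_vec M c z (v c)) vs)) x +
        (\<Sum>i<length vs.
           \<xi> x (vs[i := coord_vec M c x (\<lambda>l. chart_dderiv M c ((vs ! i) c) (\<lambda>z. T z c l) x)])))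
     else 0)"

definition wedge_form :: "'a dform \<Rightarrow> 'a dform \<Rightarrow> 'a dform" where
  "wedge_form \<xi> \<eta> = (\<lambda>x. wedge (\<xi> x) (\<eta> x))"


section \<open>Basic cohomology\<close>

definition basic_forms :: "'a foliated \<Rightarrow> nat \<Rightarrow> 'a dform set" where
  "basic_forms M k =
     {\<xi> \<in> forms M k. \<forall>T \<in> leaf_fields M.
        interior_prod T \<xi> = zero_form \<and> lie_deriv M T \<xi> = zero_form}"

definition closed_basic :: "'a foliated \<Rightarrow> nat \<Rightarrow> 'a dform set" where
  "closed_basic M k = {\<xi> \<in> basic_forms M k. ext_deriv M \<xi> = zero_form}"

definition exact_basic :: "'a foliated \<Rightarrow> nat \<Rightarrow> 'a dform set" where
  "exact_basic M k =
     (case k of 0 \<Rightarrow> {zero_form} | Suc j \<Rightarrow> ext_deriv M ` basic_forms M j)"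

definition cohomologous :: "'a foliated \<Rightarrow> nat \<Rightarrow> ('a dform \<times> 'a dform) set" where
  "cohomologous M k =
     {(\<xi>, \<eta>). \<xi> \<in> closed_basic M k \<and> \<eta> \<in> closed_basic M k \<and>
              (\<lambda>x vs. \<xi> x vs - \<eta> x vs) \<in> exact_basic M k}"

definition basic_cohomology :: "'a foliated \<Rightarrow> nat \<Rightarrow> 'a dform set set" where
  "basic_cohomology M k = closed_basic M k // cohomologous M k"


section \<open>Transversely symplectic structures\<close>

definition transversely_symplectic :: "'a foliated \<Rightarrow> 'a dform \<Rightarrow> bool" where
  "transversely_symplectic M \<omega> \<longleftrightarrow>
     \<omega> \<in> basic_forms M 2 \<and> ext_deriv M \<omega> = zero_form \<and>
     (\<forall>x \<in> topspace (points M). \<forall>v \<in> tangent_space M x.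
        (\<forall>w \<in> tangent_space M x. \<omega> x [v, w] = 0) \<longrightarrow> v \<in> leaf_space M x)"

text \<open>Smoothness of the distribution is not required: the star operator at \<open>x\<close> involves only
  its value at \<open>x\<close>, and does not depend on it.\<close>

definition complementary_distribution :: "'a foliated \<Rightarrow> ('a \<Rightarrow> 'a tvec set) \<Rightarrow> bool" where
  "complementary_distribution M D \<longleftrightarrow>
     (\<forall>x. tvec_zero \<in> D x \<and> D x \<subseteq> tangent_space M x \<and>
          (\<forall>v \<in> D x. \<forall>w \<in> D x. \<forall>a b. tvec_comb a v b w \<in> D x) \<and>
          D x \<inter> leaf_space M x = {tvec_zero} \<and>
          (\<forall>v \<in> tangent_space M x. \<exists>u \<in> D x. \<exists>w \<in> leaf_space M x. v = tvec_comb 1 u 1 w))"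

definition transverse_star :: "'a foliated \<Rightarrow> nat \<Rightarrow> 'a dform \<Rightarrow> nat \<Rightarrow> 'a dform \<Rightarrow> 'a dform" where
  "transverse_star M n \<omega> k \<xi> = (\<lambda>x.
     let D = (SOME D. complementary_distribution M D);
         P = (SOME P. P \<in> multivecs k (D x) \<and> flat_map (\<omega> x) P = \<xi> x)
     in contract P (wedge_power n (\<omega> x)))"

text \<open>The second star acts on the form \<open>d\<star>\<xi>\<close> of degree \<open>2n - k + 1\<close>.\<close>

definition codifferential :: "'a foliated \<Rightarrow> nat \<Rightarrow> 'a dform \<Rightarrow> nat \<Rightarrow> 'a dform \<Rightarrow> 'a dform" where
  "codifferential M n \<omega> k \<xi> = (\<lambda>x vs. (-1) ^ k *
     transverse_star M n \<omega> (2 * n + 1 - k)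
       (ext_deriv M (transverse_star M n \<omega> k \<xi>)) x vs)"

definition lefschetz ::
  "'a foliated \<Rightarrow> 'a dform \<Rightarrow> nat \<Rightarrow> 'a dform set \<Rightarrow> 'a dform set" where
  "lefschetz M \<omega> k C = (\<Union>\<xi>\<in>C. cohomologous M (k + 2) `` {wedge_form \<omega> \<xi>})"

text \<open>\<open>lefschetz_power M \<omega> j k\<close> is the map $L^j$ from degree \<open>k\<close> to degree \<open>k + 2j\<close>.\<close>

primrec lefschetz_power ::
  "'a foliated \<Rightarrow> 'a dform \<Rightarrow> nat \<Rightarrow> nat \<Rightarrow> 'a dform set \<Rightarrow> 'a dform set" where
  "lefschetz_power M \<omega> 0 k C = C"
| "lefschetz_power M \<omega> (Suc j) k C = lefschetz M \<omega> (k + 2 * j) (lefschetz_power M \<omega> j k C)"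

end

theory Submission
  imports Defs "HOL-Library.Function_Algebras"
begin

text \<open>Wedge multiplication \<open>L\<close> with \<open>\<omega>\<close> and contraction \<open>\<Lambda>\<close> with the transverse Poisson
  bivector satisfy \<open>[\<Lambda>, L] = n - k\<close> on horizontal \<open>k\<close>-forms, so they make the basic forms a
  representation of sl(2) in which a \<open>k\<close>-form has weight \<open>n - k\<close>.  A horizontal form of degree above
  \<open>2n\<close> vanishes; the weights are therefore bounded, and the Lefschetz decomposition holds as it does
  in a finite-dimensional representation, although the spaces of forms may be infinite-dimensional.

  Up to a nonzero constant in each degree, the star operator is the action of the nontrivial Weyl
  group element of sl(2), which is a polynomial in \<open>L\<close> and \<open>\<Lambda>\<close> (\<open>star_pointwise\<close>): both operators
  turn multiplication with the 1-form \<open>\<iota>\<^sub>X\<omega>\<close> into contraction with \<open>X\<close>, and both send the function 1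
  to a multiple of $\omega^n$.  It is injective, so a basic form is coclosed if and only if
  \<open>d\<star>\<xi> = 0\<close>.

  Since \<open>\<omega>\<close> is closed, \<open>d\<close> commutes with \<open>L\<close>.  Representation theory alone then gives
  \<open>[[d, \<Lambda>], \<Lambda>] = 0\<close> (\<open>koszul_zero\<close>), and with it \<open>d\<star>\<xi> = -\<star>d\<Lambda>\<xi>\<close> for closed \<open>\<xi>\<close>,
  if \<open>\<star>\<close> is normalised to be the Weyl group element (\<open>d_weyl_star\<close>).  So \<open>\<xi>\<close> is harmonic if and only if \<open>d\<xi> = 0\<close> and \<open>d\<Lambda>\<xi> = 0\<close>, and the harmonic
  forms are stable under \<open>L\<close> and \<open>\<Lambda>\<close> (\<open>harmonic_sl2\<close>).  If every class has a harmonic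
  representative, surjectivity of $L^k$ on cohomology follows from its surjectivity on harmonic
  forms.  Conversely, let $L^k$ be surjective on cohomology for all \<open>k\<close>, and let \<open>\<xi>\<close> be closed of
  weight \<open>k \<ge> 0\<close>.  Then $L^{k+1}\xi = L^{k+2}\eta + d\zeta$ with \<open>\<eta>\<close> closed, and
  $\zeta = L^{k+1}\gamma$.  The form $\xi - L\eta - d\gamma$ is closed and primitive, hence harmonic,
  and the class of \<open>\<eta>\<close>, of weight \<open>k + 2\<close>, has a harmonic representative by induction;
  classes of weight \<open>-k\<close> are images of classes of weight \<open>k\<close> (\<open>harmonic_representative\<close>).

  What remains is to see that \<open>L\<close>, \<open>\<Lambda>\<close> and \<open>d\<close> act on the basic forms.  A form is basic if and
  only if it and its derivative are annihilated by the vectors tangent to the leaves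
  (\<open>basic_forms_iff\<close>); this uses Cartan's formula, and bump functions to extend a leaf vector to a
  leaf field.  In a foliated chart, \<open>\<Lambda>\<close> is given by the inverse of the matrix of \<open>\<omega>\<close>, which is
  smooth and constant along the leaves, so \<open>\<Lambda>\<close> preserves basic forms (\<open>lam_basic\<close>).  It is
  independent of the chart because its commutator with the multiplication by \<open>\<iota>\<^sub>X\<omega>\<close> is \<open>-\<iota>\<^sub>X\<close>,
  which determines it (\<open>\<Lambda>_unique\<close>).\<close>

section \<open>Graded representations of sl(2)\<close>

lemma linear_funpow:
  fixes A :: "'v::real_vector \<Rightarrow> 'v"
  assumes "linear A"
  shows "linear (A ^^ a)"
proof (induction a)
  case 0
  show ?case using linear_id by (simp add: id_def)
next
  case (Suc a)
  then show ?case using linear_compose[OF Suc assms] by (simp add: o_def)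
qed

text \<open>A representation of sl(2) whose weights are at most \<open>N\<close> in absolute value: \<open>\<Lambda>\<close> raises and \<open>L\<close>
  lowers the weight by 2, and \<open>[\<Lambda>, L]\<close> acts on the weight space \<open>U w\<close> as the scalar \<open>w\<close>.
  Boundedness replaces finite dimension.  The letters and the sign of the weight are those of
  symplectic geometry, where \<open>w = n - k\<close> for \<open>k\<close>-forms.\<close>

locale sl2_graded =
  fixes U :: "int \<Rightarrow> 'v::real_vector set" and L \<Lambda> :: "'v \<Rightarrow> 'v" and N :: nat
  assumes subspace_U: "subspace (U w)"
    and linear_L: "linear L" and linear_\<Lambda>: "linear \<Lambda>"
    and L_in: "x \<in> U w \<Longrightarrow> L x \<in> U (w - 2)"
    and \<Lambda>_in: "x \<in> U w \<Longrightarrow> \<Lambda> x \<in> U (w + 2)"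
    and comm: "x \<in> U w \<Longrightarrow> \<Lambda> (L x) = L (\<Lambda> x) + of_int w *\<^sub>R x"
    and bounded: "x \<in> U w \<Longrightarrow> \<bar>w\<bar> > int N \<Longrightarrow> x = 0"
begin

lemmas L_simps = linear_add[OF linear_L] linear_diff[OF linear_L] linear_0[OF linear_L]
  linear_scale[OF linear_L]

lemmas \<Lambda>_simps = linear_add[OF linear_\<Lambda>] linear_diff[OF linear_\<Lambda>] linear_0[OF linear_\<Lambda>]
  linear_scale[OF linear_\<Lambda>]

lemmas linear_L_pow = linear_funpow[OF linear_L]
lemmas linear_\<Lambda>_pow = linear_funpow[OF linear_\<Lambda>]

lemmas L_pow_simps = linear_add[OF linear_L_pow] linear_diff[OF linear_L_pow]
  linear_0[OF linear_L_pow] linear_scale[OF linear_L_pow]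

lemmas \<Lambda>_pow_simps = linear_add[OF linear_\<Lambda>_pow] linear_diff[OF linear_\<Lambda>_pow]
  linear_0[OF linear_\<Lambda>_pow] linear_scale[OF linear_\<Lambda>_pow]

lemma L_pow_in: "x \<in> U w \<Longrightarrow> (L ^^ a) x \<in> U (w - 2 * int a)"
proof (induction a)
  case (Suc a)
  then have "L ((L ^^ a) x) \<in> U (w - 2 * int a - 2)" using L_in by blast
  then show ?case by (simp add: algebra_simps)
qed simp

lemma \<Lambda>_pow_in: "x \<in> U w \<Longrightarrow> (\<Lambda> ^^ a) x \<in> U (w + 2 * int a)"
proof (induction a)
  case (Suc a)
  then have "\<Lambda> ((\<Lambda> ^^ a) x) \<in> U (w + 2 * int a + 2)" using \<Lambda>_in by blast
  then show ?case by (simp add: algebra_simps)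
qed simp

lemma L_pow_zero: "x \<in> U w \<Longrightarrow> w - 2 * int a < - int N \<Longrightarrow> (L ^^ a) x = 0"
  using bounded[OF L_pow_in] by fastforce

lemma \<Lambda>_pow_zero: "x \<in> U w \<Longrightarrow> w + 2 * int a > int N \<Longrightarrow> (\<Lambda> ^^ a) x = 0"
  using bounded[OF \<Lambda>_pow_in] by fastforce

text \<open>Moving \<open>\<Lambda>\<close> past the factors \<open>L\<close> one at a time picks up the weights
  $w, w - 2, \dots, w - 2a$, whose sum is the coefficient.\<close>

lemma \<Lambda>_L_pow:
  assumes "x \<in> U w"
  shows "\<Lambda> ((L ^^ Suc a) x) =
    (L ^^ Suc a) (\<Lambda> x) + ((real a + 1) * (of_int w - real a)) *\<^sub>R (L ^^ a) x"
proof (induction a)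
  case 0
  then show ?case using comm[OF assms] by simp
next
  case (Suc a)
  have "\<Lambda> ((L ^^ Suc (Suc a)) x) = L (\<Lambda> ((L ^^ Suc a) x)) +
      of_int (w - 2 * int (Suc a)) *\<^sub>R (L ^^ Suc a) x"
    using comm[OF L_pow_in[OF assms, of "Suc a"]] by simp
  also have "\<dots> = (L ^^ Suc (Suc a)) (\<Lambda> x) +
      ((real a + 1) * (of_int w - real a)) *\<^sub>R (L ^^ Suc a) x +
      of_int (w - 2 * int (Suc a)) *\<^sub>R (L ^^ Suc a) x"
    unfolding Suc by (simp add: L_simps)
  also have "\<dots> = (L ^^ Suc (Suc a)) (\<Lambda> x) +
      ((real a + 1) * (of_int w - real a) + of_int (w - 2 * int (Suc a))) *\<^sub>R (L ^^ Suc a) x"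
    by (simp only: scaleR_left_distrib add.assoc)
  also have "(real a + 1) * (of_int w - real a) + of_int (w - 2 * int (Suc a)) =
      (real (Suc a) + 1) * (of_int w - real (Suc a))"
    by (simp add: algebra_simps)
  finally show ?case .
qed

lemma \<Lambda>_pow_L:
  assumes "x \<in> U w"
  shows "(\<Lambda> ^^ Suc a) (L x) =
    L ((\<Lambda> ^^ Suc a) x) + ((real a + 1) * (of_int w + real a)) *\<^sub>R (\<Lambda> ^^ a) x"
proof (induction a)
  case 0
  then show ?case using comm[OF assms] by simp
next
  case (Suc a)
  have "(\<Lambda> ^^ Suc (Suc a)) (L x) = \<Lambda> (L ((\<Lambda> ^^ Suc a) x)) +
      ((real a + 1) * (of_int w + real a)) *\<^sub>R (\<Lambda> ^^ Suc a) x"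
    using Suc by (simp add: \<Lambda>_simps)
  also have "\<Lambda> (L ((\<Lambda> ^^ Suc a) x)) = L ((\<Lambda> ^^ Suc (Suc a)) x) +
      of_int (w + 2 * int (Suc a)) *\<^sub>R (\<Lambda> ^^ Suc a) x"
    using comm[OF \<Lambda>_pow_in[OF assms, of "Suc a"]] by simp
  finally have "(\<Lambda> ^^ Suc (Suc a)) (L x) = L ((\<Lambda> ^^ Suc (Suc a)) x) +
      (of_int (w + 2 * int (Suc a)) + (real a + 1) * (of_int w + real a)) *\<^sub>R (\<Lambda> ^^ Suc a) x"
    by (simp only: scaleR_left_distrib add.assoc)
  also have "of_int (w + 2 * int (Suc a)) + (real a + 1) * (of_int w + real a) =
      (real (Suc a) + 1) * (of_int w + real (Suc a))"
    by (simp add: algebra_simps)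
  finally show ?case .
qed

text \<open>For a vector killed by \<open>\<Lambda>\<close>, the factors $(a + 1)(k - a)$ by which \<open>\<Lambda>\<close> undoes \<open>L\<close> are nonzero
  below the power \<open>k\<close>, so no power up to the \<open>k\<close>-th can kill it.\<close>

lemma primitive_L_pow_nonzero:
  assumes "x \<in> U (int k)" "\<Lambda> x = 0" "a \<le> k" "(L ^^ a) x = 0"
  shows "x = 0"
  using assms(3,4)
proof (induction a)
  case (Suc a)
  have "((real a + 1) * (of_int (int k) - real a)) *\<^sub>R (L ^^ a) x = 0"
    using \<Lambda>_L_pow[OF assms(1), of a] Suc.prems assms(2) by (simp add: \<Lambda>_simps L_pow_simps L_simps)
  then have "(L ^^ a) x = 0" using Suc.prems by auto
  then show ?case using Suc by simp
qed simp

text \<open>The dual statement for a vector killed by \<open>L\<close>: it can be recovered from its images under powers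
  of \<open>\<Lambda>\<close>, again because the factors $(a + 1)(k - a)$ are nonzero.\<close>

lemma L_kernel_multiple:
  assumes "x \<in> U (- int k)" "L x = 0" "a \<le> k"
  shows "\<exists>c. x = c *\<^sub>R (L ^^ a) ((\<Lambda> ^^ a) x)"
  using assms(3)
proof (induction a)
  case 0
  show ?case by (rule exI[of _ 1]) simp
next
  case (Suc a)
  then obtain c where c: "x = c *\<^sub>R (L ^^ a) ((\<Lambda> ^^ a) x)" by auto
  have "L ((\<Lambda> ^^ Suc a) x) = ((real a + 1) * (real k - real a)) *\<^sub>R (\<Lambda> ^^ a) x"
    using \<Lambda>_pow_L[OF assms(1), of a] assms(2)
    by (simp add: \<Lambda>_pow_simps \<Lambda>_simps eq_neg_iff_add_eq_0 minus_equation_iff algebra_simps)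
  then have "(\<Lambda> ^^ a) x = (1 / ((real a + 1) * (real k - real a))) *\<^sub>R L ((\<Lambda> ^^ Suc a) x)"
    using Suc.prems by simp
  then have "(L ^^ a) ((\<Lambda> ^^ a) x) =
      (1 / ((real a + 1) * (real k - real a))) *\<^sub>R (L ^^ Suc a) ((\<Lambda> ^^ Suc a) x)"
    by (metis L_pow_simps(4) comp_apply funpow_Suc_right)
  then show ?case using c by (metis scaleR_scaleR)
qed

text \<open>Descending induction on \<open>k\<close>.  The element \<open>L x\<close> has weight \<open>-(k + 2)\<close>, so it is $L^{k+2} y$; then
  $x - L^k (L y)$ is killed by \<open>L\<close> and lies in the image by the preceding lemma.\<close>

lemma L_pow_surj:
  "x \<in> U (- int k) \<Longrightarrow> \<exists>y\<in>U (int k). x = (L ^^ k) y"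
proof (induction "Suc N - k" arbitrary: k x rule: less_induct)
  case less
  show ?case
  proof (cases "k > N")
    case True
    then have "x = 0" using bounded[OF less.prems] by simp
    then show ?thesis using subspace_0[OF subspace_U] by (metis L_pow_simps(3))
  next
    case False
    have "L x \<in> U (- int (k + 2))" using L_in[OF less.prems] by (simp add: algebra_simps)
    then obtain y where y: "y \<in> U (int (k + 2))" "L x = (L ^^ (k + 2)) y"
      using less.hyps[of "k + 2" "L x"] False by (metis diff_less_mono2 le_imp_less_Suc less_add_same_cancel1 linorder_not_less zero_less_numeral)
    have Ly: "L y \<in> U (int k)" using L_in[OF y(1)] by simp
    define z where "z = x - (L ^^ k) (L y)"
    have z: "z \<in> U (- int k)"
      unfolding z_def using L_pow_in[OF Ly, of k] less.prems subspace_diff[OF subspace_U] by simp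
    have "L z = 0"
      unfolding z_def using y(2) by (simp add: L_simps funpow_swap1)
    then obtain c where c: "z = c *\<^sub>R (L ^^ k) ((\<Lambda> ^^ k) z)"
      using L_kernel_multiple[OF z, of k] by auto
    have "(\<Lambda> ^^ k) z \<in> U (int k)" using \<Lambda>_pow_in[OF z, of k] by simp
    then have "L y + c *\<^sub>R (\<Lambda> ^^ k) z \<in> U (int k)"
      using Ly by (intro subspace_add subspace_scale subspace_U)
    moreover have "x = (L ^^ k) (L y + c *\<^sub>R (\<Lambda> ^^ k) z)"
      using c by (simp add: L_pow_simps z_def algebra_simps)
    ultimately show ?thesis by blast
  qed
qed

text \<open>At the power \<open>k + 2\<close> the coefficient in \<open>\<Lambda>_L_pow\<close> multiplies $L^{k+1} x = 0$, so
  \<open>\<Lambda> x\<close> is killed by $L^{k+2}$.  By descending induction on \<open>k\<close> it is also killed by \<open>\<Lambda>\<close>, and such a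
  vector of weight \<open>k + 2\<close> must vanish.\<close>

lemma primitive_imp_\<Lambda>_zero:
  "x \<in> U (int k) \<Longrightarrow> (L ^^ Suc k) x = 0 \<Longrightarrow> \<Lambda> x = 0"
proof (induction "Suc N - k" arbitrary: k x rule: less_induct)
  case less
  show ?case
  proof (cases "k > N")
    case True
    then have "x = 0" using bounded[OF less.prems(1)] by simp
    then show ?thesis by (simp add: \<Lambda>_simps)
  next
    case False
    have z: "\<Lambda> x \<in> U (int (k + 2))" using \<Lambda>_in[OF less.prems(1)] by (simp add: algebra_simps)
    have L2: "(L ^^ (k + 2)) (\<Lambda> x) = 0"
      using \<Lambda>_L_pow[OF less.prems(1), of "Suc k"] less.prems(2) by (simp add: \<Lambda>_simps L_simps)
    then have "(L ^^ Suc (k + 2)) (\<Lambda> x) = 0" by (simp add: L_simps)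
    then have "\<Lambda> (\<Lambda> x) = 0" using less.hyps[OF _ z] False by simp
    then show ?thesis using primitive_L_pow_nonzero[OF z _ _ L2] by simp
  qed
qed

lemma L_pow_inj:
  assumes "x \<in> U (int k)" "(L ^^ k) x = 0"
  shows "x = 0"
proof -
  have "\<Lambda> x = 0" using primitive_imp_\<Lambda>_zero[OF assms(1)] assms(2) by (simp add: L_simps)
  then show ?thesis using primitive_L_pow_nonzero[OF assms(1) _ _ assms(2)] by simp
qed

lemma L_inj_positive:
  assumes "x \<in> U w" "w > 0" "L x = 0"
  shows "x = 0"
proof -
  obtain k where k: "w = int (Suc k)"
    using assms(2) by (metis gr0_implies_Suc zero_less_imp_eq_int)
  have "(L ^^ Suc k) x = (L ^^ k) (L x)" by (simp add: funpow_swap1)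
  then have "(L ^^ Suc k) x = 0" using assms(3) by (simp add: L_pow_simps)
  then show ?thesis using L_pow_inj assms(1) k by blast
qed

text \<open>The Lefschetz decomposition as an induction principle.  For \<open>x\<close> of weight \<open>k \<ge> 0\<close>, surjectivity
  gives $L^{k+1} x = L^{k+2} y$, and \<open>x - L y\<close> is primitive; negative weights are reached by powers
  of \<open>L\<close>.\<close>

lemma lefschetz_induct [consumes 1, case_names primitive L add]:
  assumes "x \<in> U w"
    and prim: "\<And>k x. x \<in> U (int k) \<Longrightarrow> (L ^^ Suc k) x = 0 \<Longrightarrow> P (int k) x"
    and L: "\<And>w x. x \<in> U w \<Longrightarrow> P w x \<Longrightarrow> P (w - 2) (L x)"
    and add: "\<And>w x y. x \<in> U w \<Longrightarrow> y \<in> U w \<Longrightarrow> P w x \<Longrightarrow> P w y \<Longrightarrow> P w (x + y)"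
  shows "P w x"
proof -
  have pos: "P (int k) x" if "x \<in> U (int k)" for k x
    using that
  proof (induction "Suc N - k" arbitrary: k x rule: less_induct)
    case less
    show ?case
    proof (cases "k > N")
      case True
      then have "x = 0" using bounded[OF less.prems(1)] by simp
      then show ?thesis using prim[OF less.prems] by (simp add: L_simps L_pow_simps)
    next
      case False
      have "(L ^^ Suc k) x \<in> U (- int (k + 2))"
        using L_pow_in[OF less.prems, of "Suc k"] by (simp add: algebra_simps)
      then obtain y where y: "y \<in> U (int (k + 2))" "(L ^^ Suc k) x = (L ^^ (k + 2)) y"
        using L_pow_surj by blast
      have Ly: "L y \<in> U (int k)" "P (int k) (L y)"
        using L_in[OF y(1)] L[OF y(1)] less.hyps[OF _ y(1)] False by auto
      have "(L ^^ Suc k) (x - L y) = 0"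
        using y(2) by (simp add: L_pow_simps L_simps funpow_swap1)
      then have "P (int k) (x - L y)"
        using prim[of "x - L y" k] less.prems Ly(1) subspace_diff[OF subspace_U] by blast
      then have "P (int k) ((x - L y) + L y)"
        using add less.prems Ly subspace_diff[OF subspace_U] by blast
      then show ?thesis by simp
    qed
  qed
  have pow: "P (w - 2 * int a) ((L ^^ a) x)" if "x \<in> U w" "P w x" for a w x
  proof (induction a)
    case (Suc a)
    then show ?case using L[OF L_pow_in[OF that(1), of a]] by (simp add: algebra_simps)
  qed (use that in simp)
  show ?thesis
  proof (cases "w \<ge> 0")
    case True
    then show ?thesis using pos[of x "nat w"] assms(1) by simp
  next
    case False
    then have w: "w = - int (nat (- w))" by simp
    then obtain y where y: "y \<in> U (int (nat (- w)))" "x = (L ^^ nat (- w)) y"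
      using L_pow_surj assms(1) by metis
    then have "P (int (nat (- w)) - 2 * int (nat (- w))) x" using pow pos by blast
    then show ?thesis using False by simp
  qed
qed

end

section \<open>The symplectic star operator of a representation\<close>

text \<open>The power divided by the factorial.  Setting it to zero for negative exponents lets the sums
  below run without case distinctions on the weight.\<close>

definition divided_power :: "('v::real_vector \<Rightarrow> 'v) \<Rightarrow> int \<Rightarrow> 'v \<Rightarrow> 'v" where
  "divided_power A a x = (if a < 0 then 0 else (1 / fact (nat a)) *\<^sub>R (A ^^ nat a) x)"

text \<open>The simple reflection of sl(2) on the weight \<open>w\<close>, written with all factors \<open>\<Lambda>\<close> on the right.
  The sum is cut off at \<open>J\<close>; for \<open>J \<ge> N\<close> all further terms vanish.\<close>

definition weyl_star :: "('v::real_vector \<Rightarrow> 'v) \<Rightarrow> ('v \<Rightarrow> 'v) \<Rightarrow> nat \<Rightarrow> int \<Rightarrow> 'v \<Rightarrow> 'v" where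
  "weyl_star L \<Lambda> J w x =
     (\<Sum>j\<le>J. (-1) ^ j *\<^sub>R divided_power L (w + int j) (divided_power \<Lambda> (int j) x))"

lemma divided_power_neg [simp]: "a < 0 \<Longrightarrow> divided_power A a x = 0"
  by (simp add: divided_power_def)

lemma divided_power_0 [simp]: "divided_power A 0 x = x"
  by (simp add: divided_power_def)

lemma divided_power_nat: "divided_power A (int a) x = (1 / fact a) *\<^sub>R (A ^^ a) x"
  by (simp add: divided_power_def)

lemma linear_divided_power:
  assumes "linear A"
  shows "linear (divided_power A a)"
proof (cases "a < 0")
  case True
  then have "divided_power A a = (\<lambda>x. 0)" by auto
  then show ?thesis by (simp add: linear_iff)
next
  case False
  then have "divided_power A a = (\<lambda>x. (1 / fact (nat a)) *\<^sub>R (A ^^ nat a) x)"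
    by (auto simp: divided_power_def)
  then show ?thesis using linear_funpow[OF assms] by (simp add: linear_compose_scale_right)
qed

lemma apply_divided_power:
  assumes "linear A"
  shows "A (divided_power A a x) = of_int (a + 1) *\<^sub>R divided_power A (a + 1) x"
proof (cases "a < 0")
  case True
  then show ?thesis using linear_0[OF assms] by (cases "a = -1") auto
next
  case False
  then obtain b where "a = int b" by (metis int_nat_eq linorder_not_less)
  moreover have "int b + 1 = int (Suc b)" by simp
  ultimately show ?thesis
    using linear_scale[OF assms] by (simp only: divided_power_nat) (simp add: divide_simps)
qed

lemma divided_power_apply:
  assumes "linear A"
  shows "divided_power A a (A x) = of_int (a + 1) *\<^sub>R divided_power A (a + 1) x"
proof -
  have "divided_power A a (A x) = A (divided_power A a x)"
    using linear_0[OF assms] linear_scale[OF assms]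
    by (simp add: divided_power_def funpow_swap1)
  then show ?thesis using apply_divided_power[OF assms] by simp
qed

context sl2_graded
begin

lemmas dpL_simps = linear_add[OF linear_divided_power[OF linear_L]]
  linear_diff[OF linear_divided_power[OF linear_L]] linear_0[OF linear_divided_power[OF linear_L]]
  linear_scale[OF linear_divided_power[OF linear_L]]

lemma divided_L_in: "x \<in> U w \<Longrightarrow> divided_power L a x \<in> U (w - 2 * a)"
  using L_pow_in[of x w "nat a"] subspace_0[OF subspace_U] subspace_scale[OF subspace_U]
  by (cases "a < 0") (auto simp: divided_power_def)

lemma divided_\<Lambda>_in: "x \<in> U w \<Longrightarrow> divided_power \<Lambda> a x \<in> U (w + 2 * a)"
  using \<Lambda>_pow_in[of x w "nat a"] subspace_0[OF subspace_U] subspace_scale[OF subspace_U]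
  by (cases "a < 0") (auto simp: divided_power_def)

lemma \<Lambda>_divided_L:
  assumes "x \<in> U w"
  shows "\<Lambda> (divided_power L a x) =
    divided_power L a (\<Lambda> x) + of_int (w - a + 1) *\<^sub>R divided_power L (a - 1) x"
proof (cases "a \<le> 0")
  case True
  then show ?thesis by (cases "a = 0") (auto simp: \<Lambda>_simps)
next
  case False
  then obtain b where b: "a = int (Suc b)" by (metis not_le zero_less_imp_eq_int gr0_implies_Suc)
  have b1: "a - 1 = int b" using b by simp
  have "(of_nat (Suc b) * (of_int w - real b)) / fact (Suc b) = (of_int w - real b) / fact b"
    by (simp add: divide_simps)
  then show ?thesis
    unfolding b1 unfolding b divided_power_nat \<Lambda>_simps \<Lambda>_L_pow[OF assms]
    by (simp add: scaleR_add_right add.commute mult.commute)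
qed

lemma divided_\<Lambda>_L:
  assumes "x \<in> U w"
  shows "divided_power \<Lambda> a (L x) =
    L (divided_power \<Lambda> a x) + of_int (w + a - 1) *\<^sub>R divided_power \<Lambda> (a - 1) x"
proof (cases "a \<le> 0")
  case True
  then show ?thesis by (cases "a = 0") (auto simp: L_simps)
next
  case False
  then obtain b where b: "a = int (Suc b)" by (metis not_le zero_less_imp_eq_int gr0_implies_Suc)
  have b1: "a - 1 = int b" using b by simp
  have "(of_nat (Suc b) * (of_int w + real b)) / fact (Suc b) = (of_int w + real b) / fact b"
    by (simp add: divide_simps)
  then show ?thesis
    unfolding b1 unfolding b divided_power_nat L_simps \<Lambda>_pow_L[OF assms]
    by (simp add: scaleR_add_right add.commute mult.commute)
qed

lemmas dp\<Lambda>_simps = linear_add[OF linear_divided_power[OF linear_\<Lambda>]]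
  linear_diff[OF linear_divided_power[OF linear_\<Lambda>]] linear_0[OF linear_divided_power[OF linear_\<Lambda>]]
  linear_scale[OF linear_divided_power[OF linear_\<Lambda>]]

lemma weyl_star_in:
  assumes "x \<in> U w"
  shows "weyl_star L \<Lambda> J w x \<in> U (- w)"
  unfolding weyl_star_def
proof (intro subspace_sum subspace_U subspace_scale)
  fix j assume "j \<in> {..J}"
  show "divided_power L (w + int j) (divided_power \<Lambda> (int j) x) \<in> U (- w)"
    using divided_L_in[OF divided_\<Lambda>_in[OF assms, of "int j"], of "w + int j"]
    by (simp add: algebra_simps)
qed

lemma weyl_term_zero:
  assumes "x \<in> U w" "j > N"
  shows "divided_power L b (divided_power \<Lambda> (int j) x) = 0"
proof -
  have *: "(\<Lambda> ^^ j) x = 0" if "w \<ge> - int N" using \<Lambda>_pow_zero[OF assms(1), of j] assms(2) that by simp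
  have "x = 0" if "w < - int N" using bounded[OF assms(1)] that by simp
  then have "(\<Lambda> ^^ j) x = 0" using * by (cases "w \<ge> - int N") (auto simp: \<Lambda>_pow_simps)
  then show ?thesis by (simp add: divided_power_nat dpL_simps)
qed

text \<open>The reflection interchanges \<open>L\<close> and \<open>-\<Lambda>\<close>.  After reordering, both sides are combinations of the
  terms \<open>T j\<close>; comparing the coefficients needs a shift of the index in one sum on each
  side.\<close>

lemma weyl_star_L:
  assumes x: "x \<in> U w" and J: "J \<ge> N"
  shows "weyl_star L \<Lambda> J (w - 2) (L x) = - \<Lambda> (weyl_star L \<Lambda> J w x)"
proof -
  define T where "T j = divided_power L (w - 1 + int j) (divided_power \<Lambda> (int j) x)" for j
  define R where "R j = divided_power L (w - 2 + int j) (divided_power \<Lambda> (int j - 1) x)" for j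
  have R_Suc: "R (Suc j) = T j" for j by (simp add: R_def T_def algebra_simps)
  have T_end: "T (Suc J) = 0"
    unfolding T_def using weyl_term_zero[OF x, of "Suc J"] J by (simp del: of_nat_Suc)
  have L_term: "divided_power L (w - 2 + int j) (divided_power \<Lambda> (int j) (L x)) =
      of_int (w - 1 + int j) *\<^sub>R T j + of_int (w + int j - 1) *\<^sub>R R j" for j
    unfolding divided_\<Lambda>_L[OF x] dpL_simps divided_power_apply[OF linear_L] T_def R_def
    by (simp add: algebra_simps)
  have \<Lambda>_term: "\<Lambda> (divided_power L (w + int j) (divided_power \<Lambda> (int j) x)) =
      of_int (int j + 1) *\<^sub>R T (Suc j) + of_int (int j + 1) *\<^sub>R T j" for j
  proof -
    have "w + 2 * int j - (w + int j) + 1 = int j + 1" "w + int j - 1 = w - 1 + int j" by auto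
    then have "\<Lambda> (divided_power L (w + int j) (divided_power \<Lambda> (int j) x)) =
        divided_power L (w + int j) (of_int (int j + 1) *\<^sub>R divided_power \<Lambda> (int j + 1) x) +
        of_int (int j + 1) *\<^sub>R T j"
      unfolding \<Lambda>_divided_L[OF divided_\<Lambda>_in[OF x, of "int j"]] apply_divided_power[OF linear_\<Lambda>] T_def
      by presburger
    moreover have "divided_power L (w + int j) (divided_power \<Lambda> (int j + 1) x) = T (Suc j)"
      unfolding T_def by (simp add: algebra_simps)
    ultimately show ?thesis unfolding dpL_simps by simp
  qed
  have S1: "(\<Sum>j\<le>J. (-1) ^ j *\<^sub>R (of_int (w + int j - 1) *\<^sub>R R j)) =
      - (\<Sum>j\<le>J. (-1) ^ j *\<^sub>R (of_int (w + int j) *\<^sub>R T j))"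
  proof -
    let ?f = "\<lambda>j. (-1) ^ j *\<^sub>R (of_int (w + int j - 1) *\<^sub>R R j)"
    have "?f 0 = 0" by (simp add: R_def dpL_simps)
    have "(\<Sum>j\<le>J. ?f j) + ?f (Suc J) = (\<Sum>j\<le>Suc J. ?f j)" by simp
    also have "\<dots> = ?f 0 + (\<Sum>j\<le>J. ?f (Suc j))"
      by (rule sum.atMost_Suc_shift)
    also have "(\<Sum>j\<le>J. ?f (Suc j)) = - (\<Sum>j\<le>J. (-1) ^ j *\<^sub>R (of_int (w + int j) *\<^sub>R T j))"
      by (simp add: R_Suc sum_negf[symmetric])
    finally have "(\<Sum>j\<le>J. ?f j) + ?f (Suc J) = ?f 0 - (\<Sum>j\<le>J. (-1) ^ j *\<^sub>R (of_int (w + int j) *\<^sub>R T j))"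
      by (simp only: diff_conv_add_uminus)
    moreover have "?f (Suc J) = 0"
    proof (cases "w + int J < 1")
      case True
      then show ?thesis by (cases "w + int J = 0") (auto simp: R_Suc T_def algebra_simps)
    next
      case False
      have "divided_power \<Lambda> (int J) x = 0 \<or> w + 2 * int J \<le> int N"
        using \<Lambda>_pow_zero[OF x, of J] by (auto simp: divided_power_nat)
      moreover have "w + 2 * int J > int N" using False J by auto
      ultimately show ?thesis by (simp add: R_Suc T_def dpL_simps)
    qed
    ultimately show ?thesis using \<open>?f 0 = 0\<close> by (simp only: add_0_right diff_0)
  qed
  have S2: "(\<Sum>j\<le>J. (-1) ^ j *\<^sub>R (of_int (int j + 1) *\<^sub>R T (Suc j))) =
      - (\<Sum>j\<le>J. (-1) ^ j *\<^sub>R (of_int (int j) *\<^sub>R T j))"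
  proof -
    let ?f = "\<lambda>j. (-1) ^ j *\<^sub>R (of_int (int j) *\<^sub>R T j)"
    have "(\<Sum>j\<le>J. ?f j) = (\<Sum>j\<le>Suc J. ?f j)" using T_end by simp
    also have "\<dots> = ?f 0 + (\<Sum>j\<le>J. ?f (Suc j))"
      by (rule sum.atMost_Suc_shift)
    also have "(\<Sum>j\<le>J. ?f (Suc j)) = - (\<Sum>j\<le>J. (-1) ^ j *\<^sub>R (of_int (int j + 1) *\<^sub>R T (Suc j)))"
      by (simp add: sum_negf[symmetric] add.commute)
    finally show ?thesis by simp
  qed
  have "weyl_star L \<Lambda> J (w - 2) (L x) =
      (\<Sum>j\<le>J. (-1) ^ j *\<^sub>R (of_int (w - 1 + int j) *\<^sub>R T j)) +
      (\<Sum>j\<le>J. (-1) ^ j *\<^sub>R (of_int (w + int j - 1) *\<^sub>R R j))"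
    unfolding weyl_star_def L_term by (simp only: scaleR_add_right sum.distrib)
  also have "\<dots> = (\<Sum>j\<le>J. (-1) ^ j *\<^sub>R (of_int (w - 1 + int j) *\<^sub>R T j)
      - (-1) ^ j *\<^sub>R (of_int (w + int j) *\<^sub>R T j))"
    unfolding S1 by (simp add: sum_subtractf)
  also have "\<dots> = (\<Sum>j\<le>J. - ((-1) ^ j *\<^sub>R T j))"
    by (intro sum.cong refl) (simp add: algebra_simps)
  finally have A: "weyl_star L \<Lambda> J (w - 2) (L x) = (\<Sum>j\<le>J. - ((-1) ^ j *\<^sub>R T j))" .
  have "\<Lambda> (weyl_star L \<Lambda> J w x) =
      (\<Sum>j\<le>J. (-1) ^ j *\<^sub>R (of_int (int j + 1) *\<^sub>R T (Suc j))) +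
      (\<Sum>j\<le>J. (-1) ^ j *\<^sub>R (of_int (int j + 1) *\<^sub>R T j))"
    unfolding weyl_star_def linear_sum[OF linear_\<Lambda>] \<Lambda>_simps \<Lambda>_term
    by (simp only: scaleR_add_right sum.distrib)
  also have "\<dots> = (\<Sum>j\<le>J. (-1) ^ j *\<^sub>R (of_int (int j + 1) *\<^sub>R T j)
      - (-1) ^ j *\<^sub>R (of_int (int j) *\<^sub>R T j))"
    unfolding S2 by (simp add: sum_subtractf)
  also have "\<dots> = (\<Sum>j\<le>J. (-1) ^ j *\<^sub>R T j)"
    by (intro sum.cong refl) (simp add: algebra_simps)
  finally show ?thesis using A by (simp add: sum_negf)
qed

lemma weyl_star_0 [simp]: "weyl_star L \<Lambda> J w 0 = 0"
  by (simp add: weyl_star_def dpL_simps dp\<Lambda>_simps)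

text \<open>On a vector killed by \<open>L\<close> only the summand \<open>j = k\<close> survives: lower exponents of \<open>L\<close> are negative,
  and $\Lambda^{k+1}$ kills the vector.\<close>

lemma weyl_star_L_kernel:
  assumes v: "v \<in> U (- int k)" "L v = 0" and J: "J \<ge> N"
    and zero: "weyl_star L \<Lambda> J (- int k) v = 0"
  shows "v = 0"
proof (cases "k > N")
  case True
  then show ?thesis using bounded[OF v(1)] by simp
next
  case False
  have "(\<Lambda> ^^ Suc k) v \<in> U (- int k + 2 * int (Suc k))" by (rule \<Lambda>_pow_in[OF v(1)])
  moreover have "L ((\<Lambda> ^^ Suc k) v) = 0"
    using \<Lambda>_pow_L[OF v(1), of k] v(2) by (simp add: \<Lambda>_pow_simps \<Lambda>_simps)
  ultimately have top: "(\<Lambda> ^^ Suc k) v = 0"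
    using L_inj_positive[of "(\<Lambda> ^^ Suc k) v" "- int k + 2 * int (Suc k)"] by simp
  have beyond: "(\<Lambda> ^^ (Suc k + i)) v = 0" for i
    using top by (induction i) (auto simp: \<Lambda>_simps)
  have trm: "divided_power L (- int k + int j) (divided_power \<Lambda> (int j) v) =
      (if j = k then (1 / fact k) *\<^sub>R (\<Lambda> ^^ k) v else 0)" for j
  proof (cases j k rule: linorder_cases)
    case greater
    then obtain i where "j = Suc k + i" using less_iff_Suc_add by auto
    then show ?thesis using beyond[of i] by (simp only: divided_power_nat) (simp add: dpL_simps)
  qed (simp_all add: divided_power_nat)
  have "weyl_star L \<Lambda> J (- int k) v = (-1) ^ k *\<^sub>R ((1 / fact k) *\<^sub>R (\<Lambda> ^^ k) v)"
    unfolding weyl_star_def trm using False J by (simp add: if_distrib[of "scaleR _"] sum.delta cong: if_cong)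
  then have "(\<Lambda> ^^ k) v = 0" using zero by simp
  then show ?thesis using L_kernel_multiple[OF v, of k] by (auto simp: L_pow_simps)
qed

text \<open>The kernel is stable under \<open>L\<close>, by \<open>weyl_star_L\<close>.  Since some power of \<open>L\<close> kills \<open>x\<close>, it is enough
  to descend from each power to the one below: for positive weight \<open>L\<close> is injective, otherwise
  \<open>weyl_star_L_kernel\<close> applies.\<close>

lemma weyl_star_inj:
  assumes x: "x \<in> U w" and J: "J \<ge> N" and zero: "weyl_star L \<Lambda> J w x = 0"
  shows "x = 0"
proof -
  have F: "weyl_star L \<Lambda> J (w - 2 * int r) ((L ^^ r) x) = 0" for r
  proof (induction r)
    case (Suc r)
    have "weyl_star L \<Lambda> J (w - 2 * int r - 2) (L ((L ^^ r) x)) = 0"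
      using weyl_star_L[OF L_pow_in[OF x, of r] J] Suc by (simp add: \<Lambda>_simps)
    then show ?case by (simp add: algebra_simps)
  qed (use zero in simp)
  have step: "(L ^^ r) x = 0" if "(L ^^ Suc r) x = 0" for r
  proof (cases "w - 2 * int r > 0")
    case True
    then show ?thesis using L_inj_positive[OF L_pow_in[OF x, of r]] that by simp
  next
    case False
    then obtain k where "w - 2 * int r = - int k"
      by (metis add.inverse_inverse int_cases2 linorder_not_less nonneg_int_cases neg_0_le_iff_le)
    then show ?thesis using weyl_star_L_kernel[OF _ _ J] L_pow_in[OF x, of r] that F[of r] by simp
  qed
  have "(L ^^ nat (w + int N + 1)) x = 0"
    using L_pow_zero[OF x] bounded[OF x] by (cases "w < - int N") (auto simp: L_pow_simps)
  then have "(L ^^ (nat (w + int N + 1) - i)) x = 0" for i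
  proof (induction i)
    case (Suc i)
    then show ?case
      using step[of "nat (w + int N + 1) - Suc i"]
      by (cases "i < nat (w + int N + 1)") (auto simp: Suc_diff_Suc)
  qed simp
  from this[of "nat (w + int N + 1)"] show ?thesis by simp
qed

end

section \<open>Harmonic elements of a differential representation\<close>

text \<open>A differential commuting with \<open>L\<close>; it lowers the weight by 1, as the exterior derivative does
  when \<open>w = n - k\<close>.\<close>

locale sl2_differential = sl2_graded U L \<Lambda> N
  for U :: "int \<Rightarrow> 'v::real_vector set" and L \<Lambda> :: "'v \<Rightarrow> 'v" and N +
  fixes d :: "'v \<Rightarrow> 'v"
  assumes d_add: "x \<in> U w \<Longrightarrow> y \<in> U w \<Longrightarrow> d (x + y) = d x + d y"
    and d_scale: "x \<in> U w \<Longrightarrow> d (c *\<^sub>R x) = c *\<^sub>R d x"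
    and d_in: "x \<in> U w \<Longrightarrow> d x \<in> U (w - 1)"
    and d_d: "x \<in> U w \<Longrightarrow> d (d x) = 0"
    and d_L: "x \<in> U w \<Longrightarrow> d (L x) = L (d x)"
begin

lemma d_0 [simp]: "d 0 = 0"
  using d_scale[OF subspace_0[OF subspace_U], of 0] by simp

lemma d_diff: "x \<in> U w \<Longrightarrow> y \<in> U w \<Longrightarrow> d (x - y) = d x - d y"
  using d_add[of x w "(-1) *\<^sub>R y"] d_scale[of y w "-1"] subspace_scale[OF subspace_U, of y w "-1"]
  by simp

lemma d_sum: "(\<And>i. i \<in> I \<Longrightarrow> f i \<in> U w) \<Longrightarrow> d (\<Sum>i\<in>I. f i) = (\<Sum>i\<in>I. d (f i))"
proof (induction I rule: infinite_finite_induct)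
  case (insert i I)
  then show ?case using d_add[of "f i" w "sum f I"] subspace_sum[OF subspace_U, of I f w] by simp
qed simp_all

lemma d_L_pow: "x \<in> U w \<Longrightarrow> d ((L ^^ a) x) = (L ^^ a) (d x)"
  by (induction a) (auto simp: d_L[OF L_pow_in])

lemma d_divided_L: "x \<in> U w \<Longrightarrow> d (divided_power L a x) = divided_power L a (d x)"
  by (simp add: divided_power_def d_scale[OF L_pow_in] d_L_pow)

text \<open>The iterated commutator \<open>[[d, \<Lambda>], \<Lambda>]\<close>.  Its vanishing says that the commutator \<open>[d, \<Lambda>]\<close>
  commutes with \<open>\<Lambda>\<close>.\<close>

definition koszul :: "'v \<Rightarrow> 'v" where
  "koszul x = d (\<Lambda> (\<Lambda> x)) - 2 *\<^sub>R \<Lambda> (d (\<Lambda> x)) + \<Lambda> (\<Lambda> (d x))"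

text \<open>The commutators of \<open>L\<close> with \<open>\<Lambda>\<close> contribute multiples of \<open>d (\<Lambda> x)\<close> and \<open>\<Lambda> (d x)\<close>, and these
  cancel in the combination.\<close>

lemma koszul_L:
  assumes x: "x \<in> U w"
  shows "koszul (L x) = L (koszul x)"
proof -
  note in1 = \<Lambda>_in[OF x] and in2 = \<Lambda>_in[OF \<Lambda>_in[OF x]]
  have \<Lambda>\<Lambda>L: "\<Lambda> (\<Lambda> (L y)) = L (\<Lambda> (\<Lambda> y)) + (2 * (of_int v + 1)) *\<^sub>R \<Lambda> y" if "y \<in> U v" for y v
    using \<Lambda>_pow_L[OF that, of 1] by simp
  have 1: "d (\<Lambda> (\<Lambda> (L x))) = L (d (\<Lambda> (\<Lambda> x))) + (2 * (of_int w + 1)) *\<^sub>R d (\<Lambda> x)"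
    unfolding \<Lambda>\<Lambda>L[OF x]
  proof -
    have "L (\<Lambda> (\<Lambda> x)) \<in> U (w + 2)" using L_in[OF in2] by (simp add: add.commute)
    then show "d (L (\<Lambda> (\<Lambda> x)) + c *\<^sub>R \<Lambda> x) = L (d (\<Lambda> (\<Lambda> x))) + c *\<^sub>R d (\<Lambda> x)" for c
      using d_add[OF _ subspace_scale[OF subspace_U in1]] d_scale[OF in1] d_L[OF in2] by simp
  qed
  have "d (\<Lambda> (L x)) = L (d (\<Lambda> x)) + of_int w *\<^sub>R d x"
    unfolding comm[OF x]
    using d_add[OF _ subspace_scale[OF subspace_U x]] L_in[OF in1] d_scale[OF x] d_L[OF in1]
    by simp
  then have 2: "\<Lambda> (d (\<Lambda> (L x))) = L (\<Lambda> (d (\<Lambda> x))) + (of_int w + 1) *\<^sub>R d (\<Lambda> x) + of_int w *\<^sub>R \<Lambda> (d x)"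
    using comm[OF d_in[OF in1]] by (simp add: \<Lambda>_simps)
  have 3: "\<Lambda> (\<Lambda> (d (L x))) = L (\<Lambda> (\<Lambda> (d x))) + (2 * of_int w) *\<^sub>R \<Lambda> (d x)"
    unfolding d_L[OF x] \<Lambda>\<Lambda>L[OF d_in[OF x]] by simp
  show ?thesis
    unfolding koszul_def 1 2 3 L_simps
    by (simp add: scaleR_add_right)
qed

lemma koszul_in: "x \<in> U w \<Longrightarrow> koszul x \<in> U (w + 3)"
proof -
  assume x: "x \<in> U w"
  have "d (\<Lambda> (\<Lambda> x)) \<in> U (w + 3)" "\<Lambda> (d (\<Lambda> x)) \<in> U (w + 3)" "\<Lambda> (\<Lambda> (d x)) \<in> U (w + 3)"
    using d_in[OF \<Lambda>_in[OF \<Lambda>_in[OF x]]] \<Lambda>_in[OF d_in[OF \<Lambda>_in[OF x]]]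
      \<Lambda>_in[OF \<Lambda>_in[OF d_in[OF x]]] by (simp_all add: algebra_simps)
  then show ?thesis
    unfolding koszul_def by (intro subspace_add subspace_diff subspace_scale subspace_U)
qed

text \<open>A primitive \<open>x\<close> of weight \<open>k\<close> is killed by $L^{k+1}$, hence so is its image, which has weight
  \<open>k + 3\<close>; but $L^{k+3}$ is injective there.  The Lefschetz decomposition extends this to all
  elements.\<close>

lemma koszul_zero: "x \<in> U w \<Longrightarrow> koszul x = 0"
proof (induction rule: lefschetz_induct)
  case (primitive k x)
  have "koszul ((L ^^ a) x) = (L ^^ a) (koszul x)" for a
    by (induction a) (auto simp: koszul_L[OF L_pow_in[OF primitive(1)]])
  moreover have "koszul 0 = 0" by (simp add: koszul_def \<Lambda>_simps)
  ultimately have "(L ^^ Suc k) (koszul x) = 0" using primitive(2) by metis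
  then have "(L ^^ (k + 3)) (koszul x) = 0" by (simp add: numeral_3_eq_3 L_simps)
  then show ?case using L_pow_inj[of "koszul x" "k + 3"] koszul_in[OF primitive(1)] by simp
next
  case (L w x)
  then show ?case using koszul_L by (simp add: L_simps)
next
  case (add w x y)
  have "koszul (x + y) = koszul x + koszul y"
    using d_add[OF add(1,2)] d_add[OF \<Lambda>_in \<Lambda>_in, OF add(1,2)]
      d_add[OF \<Lambda>_in[OF \<Lambda>_in] \<Lambda>_in[OF \<Lambda>_in], OF add(1,2)]
    by (simp add: koszul_def \<Lambda>_simps scaleR_add_right)
  then show ?case using add by simp
qed

text \<open>For closed \<open>x\<close> the condition \<open>d (\<Lambda> x) = 0\<close> is that \<open>x\<close> is coclosed for the star operator; see
  \<open>coclosed_iff\<close>.\<close>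

definition harmonic :: "int \<Rightarrow> 'v set" where
  "harmonic w = {x \<in> U w. d x = 0 \<and> d (\<Lambda> x) = 0}"

text \<open>Stability under \<open>L\<close> is the commutation relation, and stability under \<open>\<Lambda>\<close> is \<open>koszul_zero\<close>.\<close>

lemma harmonic_sl2: "sl2_graded harmonic L \<Lambda> N"
proof (rule sl2_graded.intro)
  fix w
  show "subspace (harmonic w)"
    unfolding harmonic_def subspace_def
    using subspace_0[OF subspace_U] subspace_add[OF subspace_U] subspace_scale[OF subspace_U]
    by (auto simp: d_add[OF \<Lambda>_in \<Lambda>_in] d_add d_scale d_scale[OF \<Lambda>_in] \<Lambda>_simps)
next
  fix x w assume "x \<in> harmonic w"
  then have x: "x \<in> U w" "d x = 0" "d (\<Lambda> x) = 0" by (auto simp: harmonic_def)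
  show "L x \<in> harmonic (w - 2)"
    using L_in[OF x(1)] d_L[OF x(1)] x(2,3) comm[OF x(1)] d_L[OF \<Lambda>_in[OF x(1)]] d_scale[OF x(1)]
      d_add[OF L_in[OF \<Lambda>_in[OF x(1)]], of "of_int w *\<^sub>R x"] subspace_scale[OF subspace_U x(1)]
    by (auto simp: harmonic_def L_simps)
  show "\<Lambda> x \<in> harmonic (w + 2)"
    using \<Lambda>_in[OF x(1)] x koszul_zero[OF x(1)] by (auto simp: harmonic_def koszul_def \<Lambda>_simps)
  show "\<Lambda> (L x) = L (\<Lambda> x) + of_int w *\<^sub>R x" by (rule comm[OF x(1)])
  show "int N < \<bar>w\<bar> \<Longrightarrow> x = 0" by (rule bounded[OF x(1)])
qed (rule linear_L linear_\<Lambda>)+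

text \<open>Since \<open>[d, \<Lambda>]\<close> commutes with \<open>\<Lambda>\<close>, the derivative of a power of \<open>\<Lambda>\<close> is as in calculus.  The
  recursion has two steps, so two consecutive powers are treated at once.\<close>

lemma d_\<Lambda>_pow:
  assumes x: "x \<in> U w" "d x = 0"
  shows "d ((\<Lambda> ^^ Suc j) x) = (real j + 1) *\<^sub>R (\<Lambda> ^^ j) (d (\<Lambda> x))"
proof -
  have rec: "d (\<Lambda> (\<Lambda> y)) = 2 *\<^sub>R \<Lambda> (d (\<Lambda> y)) - \<Lambda> (\<Lambda> (d y))" if "y \<in> U v" for y v
    using koszul_zero[OF that] by (simp add: koszul_def algebra_simps add_eq_0_iff2)
  have "d ((\<Lambda> ^^ Suc j) x) = (real j + 1) *\<^sub>R (\<Lambda> ^^ j) (d (\<Lambda> x)) \<and>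
      d ((\<Lambda> ^^ Suc (Suc j)) x) = (real j + 2) *\<^sub>R (\<Lambda> ^^ Suc j) (d (\<Lambda> x))"
  proof (induction j)
    case 0
    then show ?case using rec[OF x(1)] x(2) by (simp add: \<Lambda>_simps)
  next
    case (Suc j)
    define y where "y = (\<Lambda> ^^ Suc (Suc j)) (d (\<Lambda> x))"
    have "d ((\<Lambda> ^^ Suc (Suc (Suc j))) x) =
        2 *\<^sub>R \<Lambda> (d ((\<Lambda> ^^ Suc (Suc j)) x)) - \<Lambda> (\<Lambda> (d ((\<Lambda> ^^ Suc j) x)))"
      using rec[OF \<Lambda>_pow_in[OF x(1), of "Suc j"]] by simp
    also have "\<dots> = (2 * (real j + 2)) *\<^sub>R y - (real j + 1) *\<^sub>R y"
      using Suc by (simp add: \<Lambda>_simps y_def)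
    also have "\<dots> = (real (Suc j) + 2) *\<^sub>R y"
      unfolding scaleR_left_diff_distrib[symmetric] by (rule arg_cong[of _ _ "\<lambda>c. c *\<^sub>R y"]) simp
    finally show ?case using Suc by (simp add: y_def)
  qed
  then show ?thesis by simp
qed

text \<open>By \<open>d_\<Lambda>_pow\<close>, \<open>d\<close> lowers the divided power of \<open>\<Lambda>\<close> in each summand by one and leaves
  \<open>d (\<Lambda> x)\<close>; shifting the index gives the sign.\<close>

lemma d_weyl_star:
  assumes x: "x \<in> U w" "d x = 0" and J: "J \<ge> N"
  shows "d (weyl_star L \<Lambda> J w x) = - weyl_star L \<Lambda> J (w + 1) (d (\<Lambda> x))"
proof -
  define T where "T j = divided_power L (w + 1 + int j) (divided_power \<Lambda> (int j) (d (\<Lambda> x)))" for j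
  have d_term: "d (divided_power \<Lambda> (int (Suc j)) x) = divided_power \<Lambda> (int j) (d (\<Lambda> x))" for j
  proof -
    have "(real j + 1) / fact (Suc j) = 1 / fact j" by (simp add: divide_simps)
    then show ?thesis
      unfolding divided_power_nat d_scale[OF \<Lambda>_pow_in[OF x(1)]] d_\<Lambda>_pow[OF x] by simp
  qed
  have "d (weyl_star L \<Lambda> J w x) =
      (\<Sum>j\<le>J. d ((-1) ^ j *\<^sub>R divided_power L (w + int j) (divided_power \<Lambda> (int j) x)))"
    unfolding weyl_star_def
  proof (rule d_sum)
    fix j
    have "divided_power L (w + int j) (divided_power \<Lambda> (int j) x) \<in> U (- w)"
      using divided_L_in[OF divided_\<Lambda>_in[OF x(1), of "int j"], of "w + int j"]
      by (simp add: algebra_simps)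
    then show "(-1) ^ j *\<^sub>R divided_power L (w + int j) (divided_power \<Lambda> (int j) x) \<in> U (- w)"
      by (intro subspace_scale subspace_U)
  qed
  also have "\<dots> = (\<Sum>j\<le>J. (-1) ^ j *\<^sub>R divided_power L (w + int j) (d (divided_power \<Lambda> (int j) x)))"
    by (simp add: d_scale[OF divided_L_in[OF divided_\<Lambda>_in[OF x(1)]]]
        d_divided_L[OF divided_\<Lambda>_in[OF x(1)]])
  also have "\<dots> = (\<Sum>j\<le>Suc J. (-1) ^ j *\<^sub>R divided_power L (w + int j) (d (divided_power \<Lambda> (int j) x)))"
  proof -
    have "divided_power \<Lambda> (int (Suc J)) x = 0 \<or> w + int (Suc J) < 0"
    proof (cases "w + int (Suc J) < 0")
      case False
      have "N < Suc J" using J by simp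
      then have "int N < int (Suc J)" by (simp only: of_nat_less_iff)
      then have "int N + 0 < int (Suc J) + (w + int (Suc J))"
        using False by (intro add_less_le_mono) (simp_all only: not_less)
      then have "int N < w + 2 * int (Suc J)" unfolding mult_2 add_0_right by (simp only: ac_simps)
      then have "(\<Lambda> ^^ Suc J) x = 0" by (rule \<Lambda>_pow_zero[OF x(1)])
      then show ?thesis unfolding divided_power_nat by simp
    qed simp
    then show ?thesis by (auto simp: dpL_simps)
  qed
  also have "\<dots> = (\<Sum>j\<le>J. (-1) ^ Suc j *\<^sub>R divided_power L (w + int (Suc j)) (d (divided_power \<Lambda> (int (Suc j)) x)))"
    unfolding sum.atMost_Suc_shift[of _ J] using x(2) by (simp add: dpL_simps)
  also have "\<dots> = (\<Sum>j\<le>J. - ((-1) ^ j *\<^sub>R T j))"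
    unfolding d_term T_def by (simp add: algebra_simps)
  finally show ?thesis by (simp add: weyl_star_def T_def sum_negf)
qed

lemma coclosed_iff:
  assumes x: "x \<in> U w" "d x = 0" and J: "J \<ge> N"
  shows "d (weyl_star L \<Lambda> J w x) = 0 \<longleftrightarrow> d (\<Lambda> x) = 0"
proof -
  have "d (\<Lambda> x) \<in> U (w + 1)" using d_in[OF \<Lambda>_in[OF x(1)]] by (simp add: add.commute)
  then show ?thesis
    unfolding d_weyl_star[OF assms] using weyl_star_inj[OF _ J] by auto
qed

text \<open>Descending induction on the weight \<open>k \<ge> 0\<close>.  By assumption $L^{k+1} x = L^{k+2} y + d z$, and \<open>z\<close> is
  of the form $L^{k+1} g$ because \<open>L\<close> is surjective in that range.  The remainder
  \<open>x - L y - d g\<close> is closed and primitive, thus harmonic, while \<open>y\<close> has higher weight.  A class of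
  weight \<open>-k\<close> is $L^k$ of a class of weight \<open>k\<close>.\<close>

lemma harmonic_representative:
  assumes surj: "\<And>k x. x \<in> U (- int k) \<Longrightarrow> d x = 0 \<Longrightarrow>
      \<exists>y\<in>U (int k). d y = 0 \<and> (\<exists>z\<in>U (1 - int k). x = (L ^^ k) y + d z)"
    and x: "x \<in> U w" "d x = 0"
  shows "\<exists>h\<in>harmonic w. \<exists>z\<in>U (w + 1). x = h + d z"
proof -
  interpret H: sl2_graded harmonic L \<Lambda> N by (rule harmonic_sl2)
  have pos: "\<exists>h\<in>harmonic (int k). \<exists>z\<in>U (int k + 1). x = h + d z"
    if "x \<in> U (int k)" "d x = 0" for k x
    using that
  proof (induction "Suc N - k" arbitrary: k x rule: less_induct)
    case less
    show ?case
    proof (cases "k > N")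
      case True
      then have "x = 0" using bounded[OF less.prems(1)] by simp
      then have "x = 0 + d 0" by simp
      then show ?thesis using subspace_0[OF subspace_U] subspace_0[OF H.subspace_U] by blast
    next
      case False
      have "(L ^^ Suc k) x \<in> U (- int (k + 2))"
        using L_pow_in[OF less.prems(1), of "Suc k"] by (simp add: algebra_simps)
      moreover have "d ((L ^^ Suc k) x) = 0"
        unfolding d_L_pow[OF less.prems(1)] less.prems(2) by (rule L_pow_simps)
      ultimately obtain y z where y: "y \<in> U (int (k + 2))" "d y = 0"
        and z: "z \<in> U (1 - int (k + 2))" "(L ^^ Suc k) x = (L ^^ (k + 2)) y + d z"
        using surj by blast
      have "z \<in> U (- int (Suc k))" using z(1) by (simp add: algebra_simps)
      then obtain g where g: "g \<in> U (int (Suc k))" "z = (L ^^ Suc k) g"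
        using L_pow_surj by blast
      define x' where "x' = x - L y - d g"
      have in_k: "L y \<in> U (int k)" "d g \<in> U (int k)"
        using L_in[OF y(1)] d_in[OF g(1)] by simp_all
      have x': "x' \<in> U (int k)"
        unfolding x'_def using less.prems(1) in_k by (intro subspace_diff subspace_U)
      have "(L ^^ Suc k) x' = 0"
        unfolding x'_def L_pow_simps z(2) g(2) d_L_pow[OF g(1)] by (simp add: funpow_swap1)
      then have "\<Lambda> x' = 0" by (rule primitive_imp_\<Lambda>_zero[OF x'])
      moreover have "d x' = 0"
        unfolding x'_def using less.prems in_k d_d[OF g(1)] d_L[OF y(1)] y(2)
        by (simp add: d_diff[OF subspace_diff[OF subspace_U]] d_diff L_simps)
      ultimately have hx': "x' \<in> harmonic (int k)" using x' by (simp add: harmonic_def)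
      have "Suc N - (k + 2) < Suc N - k" using False by simp
      from less.hyps[OF this y] obtain h e
        where h: "h \<in> harmonic (int (k + 2))" "e \<in> U (int (k + 2) + 1)" "y = h + d e"
        by blast
      have de: "d e \<in> U (int (k + 2))" using d_in[OF h(2)] by simp
      have Le: "L e \<in> U (int k + 1)" using L_in[OF h(2)] by (simp add: algebra_simps)
      have g': "g \<in> U (int k + 1)" using g(1) by (simp add: add.commute)
      have "x = (x' + L h) + d (g + L e)"
        unfolding d_add[OF g' Le] d_L[OF h(2)] x'_def h(3) by (simp add: L_simps)
      moreover have "x' + L h \<in> harmonic (int k)"
        using H.L_in[OF h(1)] hx' by (intro subspace_add H.subspace_U) simp_all
      ultimately show ?thesis using subspace_add[OF subspace_U g' Le] by blast
    qed
  qed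
  show ?thesis
  proof (cases "w \<ge> 0")
    case True
    then show ?thesis using pos[of x "nat w"] x by simp
  next
    case False
    define k where "k = nat (- w)"
    have w: "w = - int k" using False by (simp add: k_def)
    obtain y z where y: "y \<in> U (int k)" "d y = 0"
      and z: "z \<in> U (1 - int k)" "x = (L ^^ k) y + d z"
      using surj x w by blast
    obtain h e where h: "h \<in> harmonic (int k)" "e \<in> U (int k + 1)" "y = h + d e"
      using pos[OF y] by blast
    have Le: "(L ^^ k) e \<in> U (1 - int k)" using L_pow_in[OF h(2), of k] by (simp add: algebra_simps)
    have "x = (L ^^ k) h + d ((L ^^ k) e + z)"
      unfolding z(2) h(3) L_pow_simps d_add[OF Le z(1)] d_L_pow[OF h(2)] by simp
    moreover have "(L ^^ k) h \<in> harmonic w" using H.L_pow_in[OF h(1), of k] w by simp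
    moreover have "(L ^^ k) e + z \<in> U (w + 1)"
      using subspace_add[OF subspace_U Le z(1)] w by (simp add: algebra_simps)
    ultimately show ?thesis by blast
  qed
qed

text \<open>From left to right, a harmonic representative of weight \<open>-k\<close> is $L^k$ of a harmonic element, by
  \<open>L_pow_surj\<close> in the representation on harmonic elements.\<close>

theorem hard_lefschetz_iff_harmonic:
  assumes J: "J \<ge> N"
  shows "(\<forall>w. \<forall>x\<in>U w. d x = 0 \<longrightarrow>
      (\<exists>y\<in>U w. d y = 0 \<and> d (weyl_star L \<Lambda> J w y) = 0 \<and> (\<exists>z\<in>U (w + 1). x = y + d z))) \<longleftrightarrow>
    (\<forall>k. \<forall>x\<in>U (- int k). d x = 0 \<longrightarrow>
      (\<exists>y\<in>U (int k). d y = 0 \<and> (\<exists>z\<in>U (1 - int k). x = (L ^^ k) y + d z)))"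
    (is "?harm \<longleftrightarrow> ?lef")
proof
  interpret H: sl2_graded harmonic L \<Lambda> N by (rule harmonic_sl2)
  show ?lef if harm: ?harm
  proof (intro allI ballI impI)
    fix k x assume "x \<in> U (- int k)" "d x = 0"
    then obtain y z where y: "y \<in> U (- int k)" "d y = 0" "d (weyl_star L \<Lambda> J (- int k) y) = 0"
      and z: "z \<in> U (- int k + 1)" "x = y + d z"
      using harm by blast
    have "y \<in> harmonic (- int k)" using y coclosed_iff[OF y(1,2) J] by (simp add: harmonic_def)
    then obtain u where "u \<in> harmonic (int k)" "y = (L ^^ k) u" using H.L_pow_surj by blast
    then show "\<exists>y\<in>U (int k). d y = 0 \<and> (\<exists>z\<in>U (1 - int k). x = (L ^^ k) y + d z)"
      using z by (auto simp: harmonic_def algebra_simps)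
  qed
  show ?harm if ?lef
  proof (intro allI ballI impI)
    fix w x assume x: "x \<in> U w" "d x = 0"
    have "\<exists>h\<in>harmonic w. \<exists>z\<in>U (w + 1). x = h + d z"
      by (rule harmonic_representative[OF _ x]) (use that in blast)
    then obtain h z where h: "h \<in> harmonic w" "z \<in> U (w + 1)" "x = h + d z" by blast
    moreover have "d (weyl_star L \<Lambda> J w h) = 0"
      using h(1) coclosed_iff[OF _ _ J] by (simp add: harmonic_def)
    ultimately show "\<exists>y\<in>U w. d y = 0 \<and> d (weyl_star L \<Lambda> J w y) = 0 \<and> (\<exists>z\<in>U (w + 1). x = y + d z)"
      by (auto simp: harmonic_def)
  qed
qed

end

section \<open>Pointwise vector space structure on functions\<close>

instantiation "fun" :: (type, real_vector) real_vector
begin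

definition scaleR_fun_def: "c *\<^sub>R f = (\<lambda>x. c *\<^sub>R f x)"

instance
  by standard (auto simp: scaleR_fun_def fun_eq_iff algebra_simps)

end

lemma scaleR_fun_apply [simp]: "(c *\<^sub>R f) x = c *\<^sub>R f x"
  by (simp add: scaleR_fun_def)

lemma sum_fun_apply: "(\<Sum>i\<in>I. f i) x = (\<Sum>i\<in>I. f i x)"
  by (induction I rule: infinite_finite_induct) auto

section \<open>Exterior algebra on lists of vectors\<close>

definition contr :: "'v \<Rightarrow> 'v altform \<Rightarrow> 'v altform" where
  "contr v \<alpha> = (\<lambda>vs. \<alpha> (v # vs))"

text \<open>The degree involution, which produces the signs of the Leibniz rules.\<close>

definition twist :: "'v altform \<Rightarrow> 'v altform" where
  "twist \<alpha> = (\<lambda>vs. (-1) ^ length vs * \<alpha> vs)"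

definition homog :: "nat \<Rightarrow> 'v altform \<Rightarrow> bool" where
  "homog k \<alpha> \<longleftrightarrow> (\<forall>vs. length vs \<noteq> k \<longrightarrow> \<alpha> vs = 0)"

definition alternating :: "'v altform \<Rightarrow> bool" where
  "alternating \<alpha> \<longleftrightarrow> (\<forall>us v w ws. \<alpha> (us @ v # w # ws) = - \<alpha> (us @ w # v # ws))"

lemma contr_apply: "contr v \<alpha> vs = \<alpha> (v # vs)"
  by (simp add: contr_def)

lemma contr_add [simp]: "contr v (\<alpha> + \<beta>) = contr v \<alpha> + contr v \<beta>"
  and contr_diff [simp]: "contr v (\<alpha> - \<beta>) = contr v \<alpha> - contr v \<beta>"
  and contr_minus [simp]: "contr v (- \<alpha>) = - contr v \<alpha>"
  and contr_scale [simp]: "contr v (c *\<^sub>R \<alpha>) = c *\<^sub>R contr v \<alpha>"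
  and contr_0 [simp]: "contr v 0 = 0"
  by (auto simp: contr_def fun_eq_iff)

lemma linear_contr: "linear (contr v)"
  by (rule linearI) auto

lemma contr_sum: "contr v (\<Sum>i\<in>I. f i) = (\<Sum>i\<in>I. contr v (f i))"
  by (rule linear_sum[OF linear_contr])

lemma twist_twist [simp]: "twist (twist \<alpha>) = \<alpha>"
  by (auto simp: twist_def fun_eq_iff simp flip: power_add mult.assoc)

lemma contr_twist [simp]: "contr v (twist \<alpha>) = - twist (contr v \<alpha>)"
  by (auto simp: twist_def contr_def fun_eq_iff)

lemma twist_add [simp]: "twist (\<alpha> + \<beta>) = twist \<alpha> + twist \<beta>"
  and twist_scale [simp]: "twist (c *\<^sub>R \<alpha>) = c *\<^sub>R twist \<alpha>"
  and twist_minus [simp]: "twist (- \<alpha>) = - twist \<alpha>"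
  by (auto simp: twist_def fun_eq_iff algebra_simps)

lemma twist_homog: "homog k \<alpha> \<Longrightarrow> twist \<alpha> = (-1) ^ k *\<^sub>R \<alpha>"
  by (auto simp: twist_def homog_def fun_eq_iff)

lemma linear_wedge_right: "linear (wedge \<alpha>)"
  by (rule linearI) (auto simp: wedge_def fun_eq_iff algebra_simps sum.distrib sum_distrib_left)

lemma linear_wedge_left: "linear (\<lambda>\<alpha>. wedge \<alpha> \<beta>)"
  by (rule linearI) (auto simp: wedge_def fun_eq_iff algebra_simps sum.distrib sum_distrib_left)

lemmas wedge_simps = linear_add[OF linear_wedge_right] linear_diff[OF linear_wedge_right]
  linear_neg[OF linear_wedge_right] linear_scale[OF linear_wedge_right] linear_0[OF linear_wedge_right]
  linear_add[OF linear_wedge_left] linear_diff[OF linear_wedge_left]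
  linear_neg[OF linear_wedge_left] linear_scale[OF linear_wedge_left] linear_0[OF linear_wedge_left]

lemma wedge_Nil [simp]: "wedge \<alpha> \<beta> [] = \<alpha> [] * \<beta> []"
  by (simp add: wedge_def shuffle_sign_def)

lemma shuffle_sign_Suc:
  assumes "J \<subseteq> {..<N}"
  shows "shuffle_sign (Suc N) (insert 0 (Suc ` J)) = shuffle_sign N J"
    and "shuffle_sign (Suc N) (Suc ` J) = (-1) ^ card J * shuffle_sign N J"
proof -
  let ?S = "{(i, j). i \<in> J \<and> j < i \<and> j \<in> {..<N} - J}"
  have fin: "finite ?S" "finite J"
    using assms finite_subset[of ?S "{..<N} \<times> {..<N}"] by (auto intro: finite_subset)
  have 1: "{(i, j). i \<in> insert 0 (Suc ` J) \<and> j < i \<and> j \<in> {..<Suc N} - insert 0 (Suc ` J)} =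
      map_prod Suc Suc ` ?S"
  proof (intro set_eqI iffI)
    fix z assume "z \<in> {(i, j). i \<in> insert 0 (Suc ` J) \<and> j < i \<and> j \<in> {..<Suc N} - insert 0 (Suc ` J)}"
    then obtain i j where z: "z = (Suc i, j)" "i \<in> J" "j < Suc i" "j < Suc N" "j \<noteq> 0" "j \<notin> Suc ` J"
      by auto
    then obtain j' where "j = Suc j'" using not0_implies_Suc by blast
    with z show "z \<in> map_prod Suc Suc ` ?S"
      by (intro image_eqI[of _ _ "(i, j')"]) auto
  qed auto
  have 2: "{(i, j). i \<in> Suc ` J \<and> j < i \<and> j \<in> {..<Suc N} - Suc ` J} =
      map_prod Suc Suc ` ?S \<union> (\<lambda>i. (Suc i, 0)) ` J"
  proof (intro set_eqI iffI)
    fix z assume "z \<in> {(i, j). i \<in> Suc ` J \<and> j < i \<and> j \<in> {..<Suc N} - Suc ` J}"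
    then obtain i j where z: "z = (Suc i, j)" "i \<in> J" "j < Suc i" "j < Suc N" "j \<notin> Suc ` J"
      by auto
    show "z \<in> map_prod Suc Suc ` ?S \<union> (\<lambda>i. (Suc i, 0)) ` J"
    proof (cases j)
      case (Suc j')
      with z have "z \<in> map_prod Suc Suc ` ?S" by (intro image_eqI[of _ _ "(i, j')"]) auto
      then show ?thesis by simp
    qed (use z in auto)
  qed auto
  have inj: "inj_on (map_prod Suc Suc) ?S" "inj_on (\<lambda>i. (Suc i, 0::nat)) J"
    by (auto simp: inj_on_def)
  show "shuffle_sign (Suc N) (insert 0 (Suc ` J)) = shuffle_sign N J"
    unfolding shuffle_sign_def 1 card_image[OF inj(1)] by simp
  have "card (map_prod Suc Suc ` ?S \<union> (\<lambda>i. (Suc i, 0)) ` J) = card ?S + card J"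
    by (subst card_Un_disjoint) (use fin inj in \<open>auto simp: card_image\<close>)
  then show "shuffle_sign (Suc N) (Suc ` J) = (-1) ^ card J * shuffle_sign N J"
    unfolding shuffle_sign_def 2 by (simp add: power_add)
qed

text \<open>The shuffles are split according to the factor that receives the first argument \<open>v\<close>; if it is
  the second factor, \<open>v\<close> passes all arguments of the first.  This says that contraction with \<open>v\<close> is
  an antiderivation, and it reduces identities for wedge products to inductions on the list of
  arguments that need no combinatorics of shuffles.\<close>

lemma wedge_Cons: "wedge \<alpha> \<beta> (v # vs) = wedge (contr v \<alpha>) \<beta> vs + wedge (twist \<alpha>) (contr v \<beta>) vs"
proof -
  define N where "N = length vs"
  define A where "A = (\<lambda>J. insert 0 (Suc ` J)) ` Pow {..<N}"
  define B where "B = (\<lambda>J. Suc ` J) ` Pow {..<N}"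
  define t where "t I = shuffle_sign (Suc N) I * \<alpha> (nths (v # vs) I) * \<beta> (nths (v # vs) (- I))" for I
  have "Pow {..<Suc N} = A \<union> B"
  proof (intro set_eqI iffI)
    fix I assume I: "I \<in> Pow {..<Suc N}"
    define J where "J = {j. Suc j \<in> I}"
    have J: "J \<in> Pow {..<N}" using I by (auto simp: J_def)
    have "I = (if 0 \<in> I then insert 0 (Suc ` J) else Suc ` J)"
    proof (intro set_eqI)
      fix i show "i \<in> I \<longleftrightarrow> i \<in> (if 0 \<in> I then insert 0 (Suc ` J) else Suc ` J)"
        by (cases i) (auto simp: J_def)
    qed
    then show "I \<in> A \<union> B" using J by (cases "0 \<in> I") (auto simp: A_def B_def)
  qed (auto simp: A_def B_def)
  moreover have "A \<inter> B = {}" by (auto simp: A_def B_def)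
  ultimately have "wedge \<alpha> \<beta> (v # vs) = sum t A + sum t B"
    unfolding wedge_def t_def N_def by (simp add: sum.union_disjoint A_def B_def N_def)
  moreover have "sum t A = wedge (contr v \<alpha>) \<beta> vs"
  proof -
    have "inj_on (\<lambda>J. insert 0 (Suc ` J)) (Pow {..<N})"
      by (auto simp: inj_on_def)
    moreover have "t (insert 0 (Suc ` J)) = shuffle_sign N J * \<alpha> (v # nths vs J) * \<beta> (nths vs (- J))"
      if "J \<in> Pow {..<N}" for J
    proof -
      have "{j. Suc j \<in> insert 0 (Suc ` J)} = J" "{j. Suc j \<in> - insert 0 (Suc ` J)} = - J" by auto
      then show ?thesis
        using that shuffle_sign_Suc(1)[of J N] unfolding t_def nths_Cons by simp
    qed
    ultimately show ?thesis
      unfolding A_def wedge_def by (simp add: sum.reindex N_def contr_apply)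
  qed
  moreover have "sum t B = wedge (twist \<alpha>) (contr v \<beta>) vs"
  proof -
    have "inj_on (\<lambda>J. Suc ` J) (Pow {..<N})"
      by (auto simp: inj_on_def)
    moreover have "t (Suc ` J) =
        shuffle_sign N J * ((-1) ^ length (nths vs J) * \<alpha> (nths vs J)) * \<beta> (v # nths vs (- J))"
      if "J \<in> Pow {..<N}" for J
    proof -
      have "{i. i < length vs \<and> i \<in> J} = J" using that by (auto simp: N_def)
      then have "length (nths vs J) = card J" by (simp add: length_nths)
      moreover have "{j. Suc j \<in> Suc ` J} = J" "{j. Suc j \<in> - Suc ` J} = - J" by auto
      ultimately show ?thesis
        using that shuffle_sign_Suc(2)[of J N] unfolding t_def nths_Cons by simp
    qed
    ultimately show ?thesis
      unfolding B_def wedge_def twist_def by (simp add: sum.reindex N_def contr_apply)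
  qed
  ultimately show ?thesis by simp
qed

lemma contr_wedge: "contr v (wedge \<alpha> \<beta>) = wedge (contr v \<alpha>) \<beta> + wedge (twist \<alpha>) (contr v \<beta>)"
  by (simp add: fun_eq_iff contr_apply wedge_Cons)

lemma twist_wedge: "twist (wedge \<alpha> \<beta>) = wedge (twist \<alpha>) (twist \<beta>)"
proof
  fix vs show "twist (wedge \<alpha> \<beta>) vs = wedge (twist \<alpha>) (twist \<beta>) vs"
  proof (induction vs arbitrary: \<alpha> \<beta>)
    case (Cons v vs)
    have "twist (wedge \<alpha> \<beta>) (v # vs) = - twist (contr v (wedge \<alpha> \<beta>)) vs"
      by (simp add: twist_def contr_apply)
    also have "\<dots> = - (wedge (twist (contr v \<alpha>)) (twist \<beta>) vs + wedge \<alpha> (twist (contr v \<beta>)) vs)"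
      using Cons by (simp add: contr_wedge)
    finally show ?case by (simp add: wedge_Cons wedge_simps)
  qed (simp add: twist_def)
qed

lemma wedge_assoc: "wedge (wedge \<alpha> \<beta>) \<gamma> = wedge \<alpha> (wedge \<beta> \<gamma>)"
proof
  fix vs show "wedge (wedge \<alpha> \<beta>) \<gamma> vs = wedge \<alpha> (wedge \<beta> \<gamma>) vs"
    by (induction vs arbitrary: \<alpha> \<beta> \<gamma>)
      (simp_all add: wedge_Cons contr_wedge twist_wedge wedge_simps)
qed

lemma wedge_unit_left [simp]: "wedge unit_form \<alpha> = \<alpha>"
proof
  fix vs show "wedge unit_form \<alpha> vs = \<alpha> vs"
  proof (induction vs arbitrary: \<alpha>)
    case (Cons v vs)
    have "contr v (unit_form :: 'a altform) = 0" "twist (unit_form :: 'a altform) = unit_form"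
      by (auto simp: unit_form_def twist_def fun_eq_iff contr_apply)
    then show ?case using Cons by (simp add: wedge_Cons wedge_simps contr_apply)
  qed (simp add: unit_form_def)
qed

lemma homog_contr: "homog k \<alpha> \<Longrightarrow> homog (k - 1) (contr v \<alpha>)"
  by (auto simp: homog_def contr_apply)

lemma homog_0_contr: "homog 0 \<alpha> \<Longrightarrow> contr v \<alpha> = 0"
  by (auto simp: homog_def fun_eq_iff contr_apply)

text \<open>The iterated involution is multiplication by $(-1)^{k \deg \beta}$ on homogeneous \<open>\<beta>\<close>; in this
  form the rule is stated without assuming \<open>\<beta>\<close> homogeneous, which the induction requires.\<close>

lemma wedge_commute:
  "homog k \<alpha> \<Longrightarrow> wedge \<beta> \<alpha> = wedge \<alpha> ((twist ^^ k) \<beta>)"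
proof
  have tw: "contr v ((twist ^^ k) \<beta>) = (-1) ^ k *\<^sub>R (twist ^^ k) (contr v \<beta>)" for v k and \<beta> :: "'a altform"
  proof (induction k)
    case (Suc k)
    have "contr v ((twist ^^ Suc k) \<beta>) = - twist (contr v ((twist ^^ k) \<beta>))" by simp
    also have "\<dots> = - ((-1) ^ k *\<^sub>R twist ((twist ^^ k) (contr v \<beta>)))" by (simp only: Suc twist_scale)
    finally show ?case by (simp add: fun_eq_iff)
  qed simp
  fix vs assume "homog k \<alpha>"
  then show "wedge \<beta> \<alpha> vs = wedge \<alpha> ((twist ^^ k) \<beta>) vs"
  proof (induction vs arbitrary: \<alpha> \<beta> k)
    case Nil
    have "((twist ^^ k) \<beta>) [] = \<beta> []" by (induction k) (auto simp: twist_def)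
    then show ?case by simp
  next
    case (Cons v vs)
    have *: "wedge \<alpha> ((twist ^^ k) (contr v \<beta>)) vs = wedge (twist \<alpha>) (contr v ((twist ^^ k) \<beta>)) vs"
      using twist_homog[OF Cons.prems] by (simp add: tw wedge_simps del: contr_twist flip: power_add)
    show ?case
    proof (cases k)
      case 0
      then show ?thesis using Cons.IH[OF Cons.prems] * homog_0_contr[OF Cons.prems[unfolded 0]]
        by (simp add: wedge_Cons wedge_simps)
    next
      case (Suc j)
      have "wedge (twist \<beta>) (contr v \<alpha>) vs = wedge (contr v \<alpha>) ((twist ^^ j) (twist \<beta>)) vs"
        using Cons.IH homog_contr[OF Cons.prems] Suc by simp
      also have "(twist ^^ j) (twist \<beta>) = (twist ^^ k) \<beta>" using Suc by (simp add: funpow_swap1)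
      finally show ?thesis using Cons.IH[OF Cons.prems, of "contr v \<beta>"] * by (simp add: wedge_Cons)
    qed
  qed
qed

lemma wedge_homog_even_commute:
  assumes "homog (2 * k) \<alpha>"
  shows "wedge \<beta> \<alpha> = wedge \<alpha> \<beta>"
proof -
  have "(twist ^^ (2 * k)) \<beta> = \<beta>" by (induction k) auto
  then show ?thesis using wedge_commute[OF assms] by simp
qed

lemma homog_wedge:
  assumes "homog a \<alpha>" "homog b \<beta>"
  shows "homog (a + b) (wedge \<alpha> \<beta>)"
  unfolding homog_def
proof (intro allI impI)
  fix vs :: "'a list" assume len: "length vs \<noteq> a + b"
  have "\<alpha> (nths vs I) * \<beta> (nths vs (- I)) = 0" for I
  proof -
    have "length (nths vs I) + length (nths vs (- I)) = length vs"
    proof -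
      have "card {i. i < length vs \<and> i \<in> I} + card {i. i < length vs \<and> i \<in> - I} =
          card ({i. i < length vs \<and> i \<in> I} \<union> {i. i < length vs \<and> i \<in> - I})"
        by (rule card_Un_disjoint[symmetric]) auto
      also have "{i. i < length vs \<and> i \<in> I} \<union> {i. i < length vs \<and> i \<in> - I} = {..<length vs}" by auto
      finally show ?thesis by (simp add: length_nths)
    qed
    then have "length (nths vs I) \<noteq> a \<or> length (nths vs (- I)) \<noteq> b" using len by auto
    then show ?thesis using assms by (auto simp: homog_def)
  qed
  then have "shuffle_sign (length vs) I * \<alpha> (nths vs I) * \<beta> (nths vs (- I)) = 0" for I
    by (metis mult.assoc mult_zero_right)
  then show "wedge \<alpha> \<beta> vs = 0" unfolding wedge_def by (intro sum.neutral) blast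
qed

lemma alternatingD: "alternating \<alpha> \<Longrightarrow> \<alpha> (us @ v # w # ws) = - \<alpha> (us @ w # v # ws)"
  unfolding alternating_def by blast

lemma alternating_contr: "alternating \<alpha> \<Longrightarrow> alternating (contr v \<alpha>)"
  unfolding alternating_def contr_apply by (metis append_Cons)

lemma alternating_twist: "alternating \<alpha> \<Longrightarrow> alternating (twist \<alpha>)"
proof -
  assume "alternating \<alpha>"
  then have "twist \<alpha> (us @ v # w # ws) = - twist \<alpha> (us @ w # v # ws)" for us v w ws
    using alternatingD[of \<alpha> us v w ws] by (simp add: twist_def)
  then show ?thesis unfolding alternating_def by blast
qed

lemma alternating_contr_swap: "alternating \<alpha> \<Longrightarrow> contr w (contr v \<alpha>) = - contr v (contr w \<alpha>)"
proof
  fix ws assume "alternating \<alpha>"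
  then show "contr w (contr v \<alpha>) ws = (- contr v (contr w \<alpha>)) ws"
    using alternatingD[of \<alpha> "[]" v w ws] by (simp add: contr_apply)
qed

lemma alternating_wedge:
  assumes "alternating \<alpha>" "alternating \<beta>"
  shows "alternating (wedge \<alpha> \<beta>)"
  unfolding alternating_def
proof (intro allI)
  fix us v w ws
  show "wedge \<alpha> \<beta> (us @ v # w # ws) = - wedge \<alpha> \<beta> (us @ w # v # ws)"
    using assms
  proof (induction us arbitrary: \<alpha> \<beta>)
    case Nil
    then show ?case
      using alternating_contr_swap[of \<alpha> w v] alternating_contr_swap[of \<beta> w v]
      by (simp add: wedge_Cons wedge_simps)
  next
    case (Cons u us)
    show ?case
      using Cons.IH[OF alternating_contr[OF Cons.prems(1)] Cons.prems(2), of u]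
        Cons.IH[OF alternating_twist[OF Cons.prems(1)] alternating_contr[OF Cons.prems(2)], of u]
      by (simp add: wedge_Cons)
  qed
qed

lemma alternating_not_distinct:
  fixes \<alpha> :: "'v altform"
  assumes alt: "alternating \<alpha>" and "\<not> distinct vs"
  shows "\<alpha> vs = 0"
proof -
  have *: "\<alpha> (us @ x # ys @ x # ws) = 0" for us x ys ws
  proof (induction ys arbitrary: us)
    case Nil
    have "\<alpha> (us @ x # x # ws) = - \<alpha> (us @ x # x # ws)" by (rule alternatingD[OF alt])
    then show ?case by simp
  next
    case (Cons y ys)
    have "\<alpha> (us @ x # (y # ys) @ x # ws) = - \<alpha> ((us @ [y]) @ x # ys @ x # ws)"
      using alternatingD[OF alt, of us x y "ys @ x # ws"] by simp
    then show ?case using Cons[of "us @ [y]"] by simp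
  qed
  obtain us ys ws x where "vs = us @ [x] @ ys @ [x] @ ws"
    using not_distinct_decomp[OF assms(2)] by blast
  then show ?thesis using * by simp
qed

lemma alternating_move_front:
  fixes \<alpha> :: "'v altform"
  assumes "alternating \<alpha>"
  shows "\<alpha> (us @ v # ws) = (-1) ^ length us * \<alpha> (v # us @ ws)"
proof (induction us arbitrary: ws rule: rev_induct)
  case (snoc u us)
  have "\<alpha> ((us @ [u]) @ v # ws) = - \<alpha> (us @ v # u # ws)"
    using alternatingD[OF assms, of us u v ws] by simp
  then show ?case using snoc[of "u # ws"] by simp
qed simp

lemma contr_wedge_even:
  assumes "homog 2 \<omega>"
  shows "contr v (wedge \<omega> \<alpha>) = wedge (contr v \<omega>) \<alpha> + wedge \<omega> (contr v \<alpha>)"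
  using twist_homog[OF assms] by (simp add: contr_wedge)

lemma contr_wedge_one_form:
  assumes "homog 1 \<theta>"
  shows "contr v (wedge \<theta> \<alpha>) = \<theta> [v] *\<^sub>R \<alpha> - wedge \<theta> (contr v \<alpha>)"
proof -
  have "contr v \<theta> = \<theta> [v] *\<^sub>R unit_form"
    using assms by (auto simp: homog_def unit_form_def fun_eq_iff contr_apply)
  then show ?thesis using twist_homog[OF assms] by (simp add: contr_wedge wedge_simps)
qed

lemmas fun_ops = plus_fun_apply minus_apply uminus_apply zero_fun_apply scaleR_fun_apply

section \<open>Horizontal forms in a transverse frame\<close>

text \<open>Here \<open>T\<close> is a tangent space, the vectors \<open>E i\<close> span a complement of the directions tangent to
  the leaf, and \<open>e i\<close> are the corresponding transverse coordinates.  With a full coordinate frame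
  the same locale describes arbitrary forms.\<close>

locale transverse_frame =
  fixes T :: "'v set" and E :: "nat \<Rightarrow> 'v" and e :: "nat \<Rightarrow> 'v \<Rightarrow> real" and q :: nat
  assumes E_in: "i < q \<Longrightarrow> E i \<in> T"
begin

text \<open>Multilinearity and horizontality in one: an argument may be replaced by its transverse
  components, so that vectors without transverse components are annihilated.\<close>

definition expands :: "'v altform \<Rightarrow> bool" where
  "expands \<alpha> \<longleftrightarrow> (\<forall>us v ws. v \<in> T \<longrightarrow> \<alpha> (us @ v # ws) = (\<Sum>i<q. e i v * \<alpha> (us @ E i # ws)))"

definition supported :: "nat \<Rightarrow> 'v altform \<Rightarrow> bool" where
  "supported k \<alpha> \<longleftrightarrow> (\<forall>vs. length vs \<noteq> k \<or> \<not> set vs \<subseteq> T \<longrightarrow> \<alpha> vs = 0)"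

definition hform :: "nat \<Rightarrow> 'v altform \<Rightarrow> bool" where
  "hform k \<alpha> \<longleftrightarrow> supported k \<alpha> \<and> expands \<alpha> \<and> alternating \<alpha>"

lemma expandsD: "expands \<alpha> \<Longrightarrow> v \<in> T \<Longrightarrow> \<alpha> (us @ v # ws) = (\<Sum>i<q. e i v * \<alpha> (us @ E i # ws))"
  unfolding expands_def by blast

lemma expands_contr_eq:
  assumes "expands \<alpha>" "v \<in> T"
  shows "contr v \<alpha> = (\<Sum>i<q. e i v *\<^sub>R contr (E i) \<alpha>)"
  using expandsD[OF assms, of "[]"] by (simp add: fun_eq_iff contr_apply sum_fun_apply)

lemma expands_contr: "expands \<alpha> \<Longrightarrow> expands (contr v \<alpha>)"
  using expandsD[of \<alpha> _ "v # _"] unfolding expands_def contr_apply by simp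

lemma expands_add: "expands \<alpha> \<Longrightarrow> expands \<beta> \<Longrightarrow> expands (\<alpha> + \<beta>)"
  unfolding expands_def by (simp add: sum.distrib algebra_simps)

lemma expands_scale: "expands \<alpha> \<Longrightarrow> expands (c *\<^sub>R \<alpha>)"
  unfolding expands_def by (simp add: sum_distrib_left algebra_simps)

lemma expands_twist: "expands \<alpha> \<Longrightarrow> expands (twist \<alpha>)"
  unfolding expands_def twist_def by (simp add: sum_distrib_left algebra_simps)

lemma expands_wedge:
  assumes "expands \<alpha>" "expands \<beta>"
  shows "expands (wedge \<alpha> \<beta>)"
proof -
  have "wedge \<alpha> \<beta> (us @ v # ws) = (\<Sum>i<q. e i v * wedge \<alpha> \<beta> (us @ E i # ws))"
    if v: "v \<in> T" for us v ws
    using assms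
  proof (induction us arbitrary: \<alpha> \<beta>)
    case Nil
    have "wedge \<alpha> \<beta> (v # ws) =
        wedge (\<Sum>i<q. e i v *\<^sub>R contr (E i) \<alpha>) \<beta> ws +
        wedge (twist \<alpha>) (\<Sum>i<q. e i v *\<^sub>R contr (E i) \<beta>) ws"
      unfolding wedge_Cons using expands_contr_eq[OF _ v] Nil by simp
    also have "\<dots> = (\<Sum>i<q. e i v * wedge (contr (E i) \<alpha>) \<beta> ws) +
        (\<Sum>i<q. e i v * wedge (twist \<alpha>) (contr (E i) \<beta>) ws)"
      by (simp add: linear_sum[OF linear_wedge_right] linear_sum[OF linear_wedge_left]
          wedge_simps sum_fun_apply)
    finally show ?case by (simp add: wedge_Cons algebra_simps sum.distrib)
  next
    case (Cons u us)
    show ?case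
      using Cons.IH[OF expands_contr[OF Cons.prems(1)] Cons.prems(2), of u]
        Cons.IH[OF expands_twist[OF Cons.prems(1)] expands_contr[OF Cons.prems(2)], of u]
      by (simp add: wedge_Cons algebra_simps sum.distrib)
  qed
  then show ?thesis unfolding expands_def by blast
qed

lemma supported_homog: "supported k \<alpha> \<Longrightarrow> homog k \<alpha>"
  by (auto simp: supported_def homog_def)

lemma supported_wedge:
  assumes "supported a \<alpha>" "supported b \<beta>"
  shows "supported (a + b) (wedge \<alpha> \<beta>)"
  unfolding supported_def
proof (intro allI impI)
  fix vs :: "'v list" assume *: "length vs \<noteq> a + b \<or> \<not> set vs \<subseteq> T"
  show "wedge \<alpha> \<beta> vs = 0"
  proof (cases "length vs = a + b")
    case False
    then show ?thesis
      using homog_wedge[OF supported_homog[OF assms(1)] supported_homog[OF assms(2)]]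
      by (simp add: homog_def)
  next
    case True
    then obtain i where i: "i < length vs" "vs ! i \<notin> T"
      using * by (metis in_set_conv_nth subsetI)
    have "\<alpha> (nths vs I) * \<beta> (nths vs (- I)) = 0" for I
    proof (cases "i \<in> I")
      case True
      then have "vs ! i \<in> set (nths vs I)" using i by (auto simp: set_nths)
      then have "\<alpha> (nths vs I) = 0" using assms(1) i(2) unfolding supported_def by blast
      then show ?thesis by simp
    next
      case False
      then have "vs ! i \<in> set (nths vs (- I))" using i by (auto simp: set_nths)
      then have "\<beta> (nths vs (- I)) = 0" using assms(2) i(2) unfolding supported_def by blast
      then show ?thesis by simp
    qed
    then have "shuffle_sign (length vs) I * \<alpha> (nths vs I) * \<beta> (nths vs (- I)) = 0" for I
      by (metis mult.assoc mult_zero_right)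
    then show ?thesis unfolding wedge_def by (intro sum.neutral) blast
  qed
qed

lemma hform_homog: "hform k \<alpha> \<Longrightarrow> homog k \<alpha>"
  by (simp add: hform_def supported_homog)

lemma hform_wedge: "hform a \<alpha> \<Longrightarrow> hform b \<beta> \<Longrightarrow> hform (a + b) (wedge \<alpha> \<beta>)"
  by (simp add: hform_def supported_wedge expands_wedge alternating_wedge)

lemma alternating_add:
  assumes "alternating \<alpha>" "alternating \<beta>"
  shows "alternating (\<alpha> + \<beta>)"
  unfolding alternating_def
proof (intro allI)
  fix us v w ws show "(\<alpha> + \<beta>) (us @ v # w # ws) = - (\<alpha> + \<beta>) (us @ w # v # ws)"
    using alternatingD[OF assms(1), of us v w ws] alternatingD[OF assms(2), of us v w ws] by simp
qed

lemma alternating_scale: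
  assumes "alternating \<alpha>"
  shows "alternating (c *\<^sub>R \<alpha>)"
  unfolding alternating_def
proof (intro allI)
  fix us v w ws show "(c *\<^sub>R \<alpha>) (us @ v # w # ws) = - (c *\<^sub>R \<alpha>) (us @ w # v # ws)"
    using alternatingD[OF assms, of us v w ws] by simp
qed

lemma hform_add: "hform k \<alpha> \<Longrightarrow> hform k \<beta> \<Longrightarrow> hform k (\<alpha> + \<beta>)"
  by (simp add: hform_def expands_add alternating_add) (simp add: supported_def)

lemma hform_scale: "hform k \<alpha> \<Longrightarrow> hform k (c *\<^sub>R \<alpha>)"
  by (simp add: hform_def expands_scale alternating_scale) (simp add: supported_def)

lemma hform_0: "hform k 0"
  by (simp add: hform_def expands_def supported_def alternating_def)

lemma hform_sum: "(\<And>i. i \<in> I \<Longrightarrow> hform k (f i)) \<Longrightarrow> hform k (\<Sum>i\<in>I. f i)"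
  by (induction I rule: infinite_finite_induct) (auto simp: hform_0 hform_add)

lemma hform_contr: "hform k \<alpha> \<Longrightarrow> hform (k - 1) (contr v \<alpha>)"
  by (simp add: hform_def expands_contr alternating_contr) (auto simp: supported_def contr_apply)

lemma hform_contr_zero: "hform 0 \<alpha> \<Longrightarrow> contr v \<alpha> = 0"
  by (simp add: homog_0_contr hform_homog)

lemma hform_unit: "hform 0 unit_form"
  by (auto simp: hform_def supported_def expands_def alternating_def unit_form_def)

text \<open>Expanding all arguments leaves values on more than \<open>q\<close> frame vectors, two of which coincide.\<close>

lemma hform_vanishes_above:
  assumes "hform k \<alpha>" "k > q"
  shows "\<alpha> = 0"
proof -
  have "\<alpha> (map E is @ vs) = 0" if "set is \<subseteq> {..<q}" "length is + length vs = k" for vs "is"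
    using that
  proof (induction vs arbitrary: "is")
    case Nil
    have "\<not> distinct is"
      using Nil assms(2) by (metis add_0_right card_lessThan card_mono distinct_card finite_lessThan leD list.size(3))
    then have "\<not> distinct (map E is)" by (simp add: distinct_map)
    then show ?case
      using alternating_not_distinct[of \<alpha> "map E is"] assms(1) by (simp add: hform_def)
  next
    case (Cons v vs)
    show ?case
    proof (cases "v \<in> T")
      case True
      have "\<alpha> (map E is @ E i # vs) = 0" if "i < q" for i
        using Cons.IH[of "is @ [i]"] Cons.prems that by simp
      then show ?thesis
        using expandsD[of \<alpha> v "map E is" vs] True assms(1) by (simp add: hform_def)
    next
      case False
      then show ?thesis using assms(1) by (simp add: hform_def supported_def)
    qed
  qed
  from this[of "[]"] have "\<alpha> vs = 0" if "length vs = k" for vs using that by simp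
  then show ?thesis
    using hform_homog[OF assms(1)] by (auto simp: homog_def fun_eq_iff)
qed

definition coframe :: "nat \<Rightarrow> 'v altform" where
  "coframe i = (\<lambda>vs. case vs of [v] \<Rightarrow> if v \<in> T then e i v else 0 | _ \<Rightarrow> 0)"

lemma coframe_single [simp]: "coframe i [v] = (if v \<in> T then e i v else 0)"
  by (simp add: coframe_def)

lemma homog_coframe: "homog 1 (coframe i)"
  by (auto simp: homog_def coframe_def split: list.split)

text \<open>The operator $\sum_i e^i \wedge \iota_{E_i}$ counts the degree.  Contraction with the first
  argument reproduces the form once and leaves the same operator in one degree less.\<close>

lemma euler_identity:
  assumes "hform k \<alpha>"
  shows "(\<Sum>i<q. wedge (coframe i) (contr (E i) \<alpha>)) = real k *\<^sub>R \<alpha>"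
proof
  fix vs show "(\<Sum>i<q. wedge (coframe i) (contr (E i) \<alpha>)) vs = (real k *\<^sub>R \<alpha>) vs"
    using assms
  proof (induction vs arbitrary: k \<alpha>)
    case Nil
    have "\<alpha> [] = 0 \<or> k = 0" using hform_homog[OF Nil] by (auto simp: homog_def)
    then show ?case by (auto simp: sum_fun_apply coframe_def)
  next
    case (Cons v vs)
    have alt: "alternating \<alpha>" using Cons.prems by (simp add: hform_def)
    have "(\<Sum>i<q. wedge (coframe i) (contr (E i) \<alpha>)) (v # vs) =
        (\<Sum>i<q. contr v (wedge (coframe i) (contr (E i) \<alpha>)) vs)"
      by (simp add: sum_fun_apply contr_apply)
    also have "\<dots> = (\<Sum>i<q. coframe i [v] * \<alpha> (E i # vs)) +
        (\<Sum>i<q. wedge (coframe i) (contr (E i) (contr v \<alpha>)) vs)"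
      unfolding contr_wedge_one_form[OF homog_coframe] alternating_contr_swap[OF alt, of v]
      by (simp add: wedge_simps sum.distrib contr_apply)
    also have "(\<Sum>i<q. wedge (coframe i) (contr (E i) (contr v \<alpha>)) vs) = real (k - 1) * \<alpha> (v # vs)"
      using Cons.IH[OF hform_contr[OF Cons.prems, of v]]
      by (simp only: sum_fun_apply scaleR_fun_apply real_scaleR_def contr_apply[of v \<alpha> vs])
    also have "(\<Sum>i<q. coframe i [v] * \<alpha> (E i # vs)) = \<alpha> (v # vs)"
    proof (cases "v \<in> T")
      case True
      then show ?thesis
        using expandsD[of \<alpha> v "[]" vs] Cons.prems by (simp add: hform_def)
    next
      case False
      then show ?thesis using Cons.prems by (simp add: hform_def supported_def)
    qed
    finally show ?case
      using hform_homog[OF Cons.prems] by (cases k) (auto simp: homog_def algebra_simps)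
  qed
qed

end

section \<open>The symplectic contraction at a point\<close>

declare fun_ops [simp del]

text \<open>Contraction with the bivector that has the coefficients \<open>W\<close>.  When \<open>W\<close> is the inverse of the
  matrix of \<open>\<omega>\<close>, the order of the two arguments is the one for which \<open>[\<Lambda>, L]\<close> is \<open>n - k\<close> and not its negative.\<close>

definition poisson_contr :: "nat \<Rightarrow> (nat \<Rightarrow> nat \<Rightarrow> real) \<Rightarrow> (nat \<Rightarrow> 'v) \<Rightarrow> 'v altform \<Rightarrow> 'v altform" where
  "poisson_contr q W E \<alpha> = (\<lambda>vs. (1/2) * (\<Sum>i<q. \<Sum>j<q. W i j * \<alpha> (E j # E i # vs)))"

lemma poisson_contr_eq:
  "poisson_contr q W E \<alpha> = (1/2) *\<^sub>R (\<Sum>i<q. \<Sum>j<q. W i j *\<^sub>R contr (E i) (contr (E j) \<alpha>))"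
  by (simp add: poisson_contr_def fun_eq_iff fun_ops sum_fun_apply fun_ops contr_apply)

lemma linear_poisson_contr: "linear (poisson_contr q W E)"
  by (rule linearI)
    (auto simp: poisson_contr_def fun_eq_iff fun_ops algebra_simps sum.distrib sum_distrib_left)

text \<open>The sign $(-1)^{k(k-1)/2}$ of the reversal of \<open>k\<close> arguments.\<close>

primrec star_sign :: "nat \<Rightarrow> real" where
  "star_sign 0 = 1"
| "star_sign (Suc k) = (-1) ^ k * star_sign k"

lemma star_sign_nonzero: "star_sign k \<noteq> 0"
  by (induction k) auto

text \<open>The matrix \<open>W\<close> is the inverse of the matrix of \<open>\<omega>\<close> in the frame.\<close>

locale symplectic_frame = transverse_frame T E e q
  for T :: "'v set" and E :: "nat \<Rightarrow> 'v" and e :: "nat \<Rightarrow> 'v \<Rightarrow> real" and q :: nat +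
  fixes \<omega> :: "'v altform" and W :: "nat \<Rightarrow> nat \<Rightarrow> real" and n :: nat
  assumes q: "q = 2 * n" and hform_\<omega>: "hform 2 \<omega>"
    and W_\<omega>: "i < q \<Longrightarrow> k < q \<Longrightarrow> (\<Sum>j<q. W i j * \<omega> [E j, E k]) = (if i = k then 1 else 0)"
    and \<omega>_W: "i < q \<Longrightarrow> k < q \<Longrightarrow> (\<Sum>j<q. \<omega> [E i, E j] * W j k) = (if i = k then 1 else 0)"
begin

abbreviation L where "L \<equiv> wedge \<omega>"
abbreviation \<Lambda> where "\<Lambda> \<equiv> poisson_contr q W E"

lemmas homog_\<omega> = hform_homog[OF hform_\<omega>]

lemma \<omega>_skew: "\<omega> [v, w] = - \<omega> [w, v]"
  using hform_\<omega> alternatingD[of \<omega> "[]" v w "[]"] by (simp add: hform_def)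

lemma W_skew:
  assumes "i < q" "j < q"
  shows "W i j = - W j i"
proof -
  have "- W j i = - (\<Sum>k<q. W j k * (if i = k then 1 else 0))"
    using assms by (simp add: if_distrib cong: if_cong)
  also have "\<dots> = - (\<Sum>k<q. W j k * (\<Sum>l<q. W i l * \<omega> [E l, E k]))"
    using assms W_\<omega> by (intro arg_cong[of _ _ uminus] sum.cong) auto
  also have "\<dots> = (\<Sum>k<q. \<Sum>l<q. W i l * (W j k * \<omega> [E k, E l]))"
  proof -
    have "- (W j k * (W i l * \<omega> [E l, E k])) = W i l * (W j k * \<omega> [E k, E l])" for k l
      unfolding \<omega>_skew[of "E l" "E k"] by simp
    then show ?thesis by (simp add: sum_distrib_left flip: sum_negf)
  qed
  also have "\<dots> = (\<Sum>l<q. \<Sum>k<q. W i l * (W j k * \<omega> [E k, E l]))"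
    by (rule sum.swap)
  also have "\<dots> = (\<Sum>l<q. W i l * (if j = l then 1 else 0))"
    using assms W_\<omega> by (intro sum.cong) (auto simp flip: sum_distrib_left)
  finally show ?thesis using assms by (simp add: if_distrib cong: if_cong)
qed

text \<open>Row \<open>i\<close> of \<open>W\<close> gives the vector that the flat map sends to the \<open>i\<close>-th element of the coframe.\<close>

lemma sum_W_flat:
  assumes i: "i < q"
  shows "(\<Sum>j<q. W i j *\<^sub>R contr (E j) \<omega>) = coframe i"
proof
  fix vs
  show "(\<Sum>j<q. W i j *\<^sub>R contr (E j) \<omega>) vs = coframe i vs"
  proof (cases "\<exists>v\<in>T. vs = [v]")
    case True
    then obtain v where v: "v \<in> T" "vs = [v]" by blast
    have "(\<Sum>j<q. W i j *\<^sub>R contr (E j) \<omega>) vs = (\<Sum>j<q. W i j * (\<Sum>k<q. e k v * \<omega> [E j, E k]))"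
      using v expandsD[of \<omega> v "[E _]" "[]"] hform_\<omega>
      by (simp add: sum_fun_apply fun_ops contr_apply hform_def)
    also have "\<dots> = (\<Sum>k<q. e k v * (\<Sum>j<q. W i j * \<omega> [E j, E k]))"
      by (subst (1) sum_distrib_left, subst sum.swap) (simp add: sum_distrib_left algebra_simps)
    also have "\<dots> = e i v" using i by (simp add: W_\<omega> if_distrib cong: if_cong)
    finally show ?thesis using v by simp
  next
    case False
    then have "coframe i vs = 0" by (auto simp: coframe_def split: list.split)
    moreover have "contr (E j) \<omega> vs = 0" for j
    proof -
      have "length (E j # vs) \<noteq> 2 \<or> \<not> set (E j # vs) \<subseteq> T"
        using False by (cases vs; cases "tl vs") auto
      then show ?thesis using hform_\<omega> by (auto simp: hform_def supported_def contr_apply)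
    qed
    ultimately show ?thesis by (simp add: sum_fun_apply fun_ops)
  qed
qed

lemma euler_identity_flat:
  assumes "hform k \<alpha>"
  shows "real k *\<^sub>R \<alpha> = (\<Sum>i<q. \<Sum>j<q. W i j *\<^sub>R wedge (contr (E j) \<omega>) (contr (E i) \<alpha>))"
proof -
  have "(\<Sum>j<q. W i j *\<^sub>R wedge (contr (E j) \<omega>) (contr (E i) \<alpha>)) = wedge (coframe i) (contr (E i) \<alpha>)"
    if "i < q" for i
    unfolding sum_W_flat[OF that, symmetric] linear_sum[OF linear_wedge_left]
    by (simp add: wedge_simps)
  then show ?thesis using euler_identity[OF assms] by simp
qed

lemma hform_\<Lambda>: "hform k \<alpha> \<Longrightarrow> hform (k - 2) (\<Lambda> \<alpha>)"
  unfolding poisson_contr_eq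
  using hform_contr[OF hform_contr] by (intro hform_scale hform_sum) (simp add: numeral_2_eq_2)

lemma \<Lambda>_low_degree: "hform k \<alpha> \<Longrightarrow> k < 2 \<Longrightarrow> \<Lambda> \<alpha> = 0"
  using hform_homog[of k \<alpha>] by (auto simp: poisson_contr_def fun_eq_iff fun_ops homog_def)

lemma contr_contr_L:
  "contr u (contr v (L \<alpha>)) =
     \<omega> [v, u] *\<^sub>R \<alpha> - wedge (contr v \<omega>) (contr u \<alpha>) + wedge (contr u \<omega>) (contr v \<alpha>) +
     L (contr u (contr v \<alpha>))"
proof -
  have h: "homog 1 (contr v \<omega>)" using homog_contr[OF homog_\<omega>] by simp
  show ?thesis
    unfolding contr_wedge_even[OF homog_\<omega>] contr_add contr_wedge_one_form[OF h]
    by (simp add: contr_apply algebra_simps)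
qed

text \<open>Contracting \<open>\<omega> \<and> \<alpha>\<close> twice gives four terms.  The one with both contractions on \<open>\<omega>\<close> sums to
  \<open>q = 2n\<close> times \<open>\<alpha>\<close>, each of the two mixed ones to \<open>-k\<close> times \<open>\<alpha>\<close> by the Euler identity, and the
  last one is \<open>L (\<Lambda> \<alpha>)\<close>.\<close>

lemma \<Lambda>_L:
  assumes \<alpha>: "hform k \<alpha>"
  shows "\<Lambda> (L \<alpha>) = L (\<Lambda> \<alpha>) + (real n - real k) *\<^sub>R \<alpha>"
proof -
  let ?S = "\<lambda>f. \<Sum>i<q. \<Sum>j<q. W i j *\<^sub>R f i j"
  have S1: "?S (\<lambda>i j. \<omega> [E j, E i] *\<^sub>R \<alpha>) = real q *\<^sub>R \<alpha>"
  proof -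
    have "(\<Sum>j<q. W i j *\<^sub>R \<omega> [E j, E i] *\<^sub>R \<alpha>) = \<alpha>" if "i < q" for i
      using W_\<omega>[OF that that] by (simp flip: scaleR_sum_left)
    then show ?thesis by (simp add: sum_constant_scaleR del: sum_constant)
  qed
  have S2: "?S (\<lambda>i j. wedge (contr (E j) \<omega>) (contr (E i) \<alpha>)) = real k *\<^sub>R \<alpha>"
    by (rule euler_identity_flat[OF \<alpha>, symmetric])
  have S3: "?S (\<lambda>i j. wedge (contr (E i) \<omega>) (contr (E j) \<alpha>)) = - (real k *\<^sub>R \<alpha>)"
  proof -
    have "?S (\<lambda>i j. wedge (contr (E i) \<omega>) (contr (E j) \<alpha>)) =
        - (\<Sum>i<q. \<Sum>j<q. W j i *\<^sub>R wedge (contr (E i) \<omega>) (contr (E j) \<alpha>))"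
      unfolding sum_negf[symmetric]
    proof (intro sum.cong refl)
      fix i j assume "i \<in> {..<q}" "j \<in> {..<q}"
      then show "W i j *\<^sub>R wedge (contr (E i) \<omega>) (contr (E j) \<alpha>) =
          - (W j i *\<^sub>R wedge (contr (E i) \<omega>) (contr (E j) \<alpha>))"
        using W_skew[of i j] by simp
    qed
    also have "(\<Sum>i<q. \<Sum>j<q. W j i *\<^sub>R wedge (contr (E i) \<omega>) (contr (E j) \<alpha>)) =
        ?S (\<lambda>i j. wedge (contr (E j) \<omega>) (contr (E i) \<alpha>))"
      by (rule sum.swap)
    finally show ?thesis unfolding S2 .
  qed
  have S4: "?S (\<lambda>i j. L (contr (E i) (contr (E j) \<alpha>))) = L (?S (\<lambda>i j. contr (E i) (contr (E j) \<alpha>)))"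
    by (simp add: linear_sum[OF linear_wedge_right] wedge_simps)
  have "?S (\<lambda>i j. contr (E i) (contr (E j) (L \<alpha>))) =
      ?S (\<lambda>i j. \<omega> [E j, E i] *\<^sub>R \<alpha>) - ?S (\<lambda>i j. wedge (contr (E j) \<omega>) (contr (E i) \<alpha>)) +
      ?S (\<lambda>i j. wedge (contr (E i) \<omega>) (contr (E j) \<alpha>)) + ?S (\<lambda>i j. L (contr (E i) (contr (E j) \<alpha>)))"
    unfolding contr_contr_L
    by (simp only: scaleR_add_right scaleR_diff_right sum.distrib sum_subtractf)
  then have "\<Lambda> (L \<alpha>) = (1/2) *\<^sub>R (real q *\<^sub>R \<alpha> - real k *\<^sub>R \<alpha> - real k *\<^sub>R \<alpha>) + L (\<Lambda> \<alpha>)"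
    unfolding poisson_contr_eq S1 S2 S3 S4 by (simp add: wedge_simps scaleR_add_right)
  also have "real q *\<^sub>R \<alpha> - real k *\<^sub>R \<alpha> - real k *\<^sub>R \<alpha> = (real q - real k - real k) *\<^sub>R \<alpha>"
    by (simp only: scaleR_left_diff_distrib)
  finally show ?thesis
    by (simp add: q field_simps)
qed

text \<open>The commutator of \<open>\<Lambda>\<close> with multiplication by \<open>\<iota>\<^sub>X\<omega>\<close> is \<open>-\<iota>\<^sub>X\<close>: the bivector is inverse to \<open>\<omega>\<close>.\<close>

lemma \<Lambda>_flat:
  assumes \<alpha>: "hform k \<alpha>" and X: "X \<in> T"
  shows "\<Lambda> (wedge (contr X \<omega>) \<alpha>) = wedge (contr X \<omega>) (\<Lambda> \<alpha>) - contr X \<alpha>"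
proof -
  let ?S = "\<lambda>f. \<Sum>i<q. \<Sum>j<q. W i j *\<^sub>R f i j"
  have h: "homog 1 (contr X \<omega>)" using homog_contr[OF homog_\<omega>] by simp
  have "contr u (contr v (wedge (contr X \<omega>) \<alpha>)) =
      \<omega> [X, v] *\<^sub>R contr u \<alpha> - \<omega> [X, u] *\<^sub>R contr v \<alpha> + wedge (contr X \<omega>) (contr u (contr v \<alpha>))" for u v
    by (simp add: contr_wedge_one_form[OF h]) (simp add: contr_apply fun_ops)
  then have "?S (\<lambda>i j. contr (E i) (contr (E j) (wedge (contr X \<omega>) \<alpha>))) =
      ?S (\<lambda>i j. \<omega> [X, E j] *\<^sub>R contr (E i) \<alpha>) - ?S (\<lambda>i j. \<omega> [X, E i] *\<^sub>R contr (E j) \<alpha>) +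
      ?S (\<lambda>i j. wedge (contr X \<omega>) (contr (E i) (contr (E j) \<alpha>)))"
    by (simp only: scaleR_add_right scaleR_diff_right sum.distrib sum_subtractf)
  moreover have S1: "?S (\<lambda>i j. \<omega> [X, E j] *\<^sub>R contr (E i) \<alpha>) = - contr X \<alpha>"
  proof -
    have "(\<Sum>j<q. W i j *\<^sub>R \<omega> [X, E j] *\<^sub>R contr (E i) \<alpha>) = - (e i X *\<^sub>R contr (E i) \<alpha>)" if "i < q" for i
    proof -
      have "(\<Sum>j<q. W i j * \<omega> [X, E j]) = - (\<Sum>j<q. W i j * \<omega> [E j, X])"
        unfolding \<omega>_skew[of X] by (simp add: sum_negf)
      also have "\<dots> = - (\<Sum>j<q. W i j *\<^sub>R contr (E j) \<omega>) [X]"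
        by (simp add: sum_fun_apply fun_ops contr_apply)
      also have "\<dots> = - e i X" unfolding sum_W_flat[OF that] using X by simp
      finally show ?thesis by (simp flip: scaleR_sum_left)
    qed
    then show ?thesis
      using expands_contr_eq[of \<alpha> X] \<alpha> X by (simp add: hform_def sum_negf)
  qed
  moreover have "?S (\<lambda>i j. \<omega> [X, E i] *\<^sub>R contr (E j) \<alpha>) = contr X \<alpha>"
  proof -
    have "?S (\<lambda>i j. \<omega> [X, E i] *\<^sub>R contr (E j) \<alpha>) =
        (\<Sum>j<q. \<Sum>i<q. W i j *\<^sub>R \<omega> [X, E i] *\<^sub>R contr (E j) \<alpha>)"
      by (rule sum.swap)
    also have "\<dots> = - ?S (\<lambda>i j. \<omega> [X, E j] *\<^sub>R contr (E i) \<alpha>)"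
      unfolding sum_negf[symmetric]
    proof (intro sum.cong refl)
      fix i j assume "i \<in> {..<q}" "j \<in> {..<q}"
      then show "W j i *\<^sub>R \<omega> [X, E j] *\<^sub>R contr (E i) \<alpha> = - (W i j *\<^sub>R \<omega> [X, E j] *\<^sub>R contr (E i) \<alpha>)"
        using W_skew[of j i] by simp
    qed
    finally show ?thesis using S1 by simp
  qed
  moreover have "?S (\<lambda>i j. wedge (contr X \<omega>) (contr (E i) (contr (E j) \<alpha>))) =
      wedge (contr X \<omega>) (?S (\<lambda>i j. contr (E i) (contr (E j) \<alpha>)))"
    by (simp add: linear_sum[OF linear_wedge_right] wedge_simps)
  ultimately have "\<Lambda> (wedge (contr X \<omega>) \<alpha>) =
      (1/2) *\<^sub>R (- contr X \<alpha> - contr X \<alpha>) + wedge (contr X \<omega>) (\<Lambda> \<alpha>)"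
    unfolding poisson_contr_eq by (simp add: wedge_simps scaleR_add_right scaleR_diff_right)
  moreover have "(1/2) *\<^sub>R (- contr X \<alpha> - contr X \<alpha>) = - contr X \<alpha>"
    by (simp add: fun_eq_iff fun_ops)
  ultimately show ?thesis by simp
qed

lemma contr_\<Lambda>:
  assumes "alternating \<alpha>"
  shows "contr X (\<Lambda> \<alpha>) = \<Lambda> (contr X \<alpha>)"
proof -
  have "contr X (contr (E i) (contr (E j) \<alpha>)) = contr (E i) (contr (E j) (contr X \<alpha>))" for i j
    using alternating_contr_swap[OF assms, of X "E j"]
      alternating_contr_swap[OF alternating_contr[OF assms], of X "E i" "E j"] by simp
  then show ?thesis unfolding poisson_contr_eq by (simp add: contr_sum)
qed

text \<open>The preceding commutation rule determines \<open>\<Lambda>\<close>, because by the Euler identity every form of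
  positive degree is a sum of products with 1-forms \<open>\<iota>\<^sub>X\<omega>\<close>.  The predicate \<open>P\<close> describes the
  forms on which the rule is known for the other operator; in the application these are the
  horizontal forms of a second frame.\<close>

lemma \<Lambda>_unique:
  assumes M: "linear M"
    and M_flat: "\<And>k \<alpha> X. P k \<alpha> \<Longrightarrow> X \<in> T \<Longrightarrow>
      M (wedge (contr X \<omega>) \<alpha>) = wedge (contr X \<omega>) (M \<alpha>) - contr X \<alpha>"
    and M_0: "\<And>\<alpha>. P 0 \<alpha> \<Longrightarrow> M \<alpha> = 0"
    and P_contr: "\<And>k \<alpha> X. P k \<alpha> \<Longrightarrow> P (k - 1) (contr X \<alpha>)"
  shows "hform k \<alpha> \<Longrightarrow> P k \<alpha> \<Longrightarrow> M \<alpha> = \<Lambda> \<alpha>"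
proof (induction k arbitrary: \<alpha>)
  case 0
  then show ?case using M_0 \<Lambda>_low_degree by simp
next
  case (Suc k)
  have h: "hform k (contr (E i) \<alpha>)" and P: "P k (contr (E i) \<alpha>)" for i
    using hform_contr[OF Suc.prems(1)] P_contr[OF Suc.prems(2)] by simp_all
  have "real (Suc k) *\<^sub>R M \<alpha> = M (real (Suc k) *\<^sub>R \<alpha>)"
    by (rule linear_scale[OF M, symmetric])
  also have "\<dots> = (\<Sum>i<q. \<Sum>j<q. W i j *\<^sub>R M (wedge (contr (E j) \<omega>) (contr (E i) \<alpha>)))"
    unfolding euler_identity_flat[OF Suc.prems(1)] linear_sum[OF M] linear_scale[OF M] ..
  also have "\<dots> = (\<Sum>i<q. \<Sum>j<q. W i j *\<^sub>R \<Lambda> (wedge (contr (E j) \<omega>) (contr (E i) \<alpha>)))"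
    using M_flat[OF P] \<Lambda>_flat[OF h] Suc.IH[OF h P] E_in by (intro sum.cong refl) simp
  also have "\<dots> = \<Lambda> (real (Suc k) *\<^sub>R \<alpha>)"
    unfolding euler_identity_flat[OF Suc.prems(1)] linear_sum[OF linear_poisson_contr]
      linear_scale[OF linear_poisson_contr] ..
  also have "\<dots> = real (Suc k) *\<^sub>R \<Lambda> \<alpha>"
    by (rule linear_scale[OF linear_poisson_contr])
  finally show ?case by (simp del: of_nat_Suc)
qed

lemma flat_L_commute: "wedge (contr X \<omega>) (L \<alpha>) = L (wedge (contr X \<omega>) \<alpha>)"
proof -
  have "wedge (contr X \<omega>) \<omega> = wedge \<omega> (contr X \<omega>)"
    using wedge_homog_even_commute[of 1 \<omega>] homog_\<omega> by simp
  then show ?thesis by (metis wedge_assoc)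
qed

text \<open>Contraction is a derivation with respect to \<open>\<omega>\<close>, which has even degree, and \<open>\<iota>\<^sub>X\<omega>\<close> commutes with
  \<open>L\<close>; the divided powers absorb the binomial factor.\<close>

lemma contr_divided_L:
  "contr X (divided_power L a \<alpha>) =
     divided_power L a (contr X \<alpha>) + divided_power L (a - 1) (wedge (contr X \<omega>) \<alpha>)"
proof (cases "a \<le> 0")
  case True
  then show ?thesis by (cases "a = 0") (auto simp: divided_power_neg)
next
  case False
  have pow: "contr X ((L ^^ Suc b) \<alpha>) =
      (L ^^ Suc b) (contr X \<alpha>) + real (Suc b) *\<^sub>R (L ^^ b) (wedge (contr X \<omega>) \<alpha>)" for b
  proof (induction b)
    case 0
    then show ?case by (simp add: contr_wedge_even[OF homog_\<omega>] add.commute)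
  next
    case (Suc b)
    have "wedge (contr X \<omega>) ((L ^^ Suc b) \<alpha>) = (L ^^ Suc b) (wedge (contr X \<omega>) \<alpha>)"
      by (induction b) (auto simp: flat_L_commute)
    then have "contr X ((L ^^ Suc (Suc b)) \<alpha>) = (L ^^ Suc b) (wedge (contr X \<omega>) \<alpha>) +
        L ((L ^^ Suc b) (contr X \<alpha>) + real (Suc b) *\<^sub>R (L ^^ b) (wedge (contr X \<omega>) \<alpha>))"
      using Suc contr_wedge_even[OF homog_\<omega>, of X "(L ^^ Suc b) \<alpha>"] by simp
    also have "\<dots> = (L ^^ Suc (Suc b)) (contr X \<alpha>) +
        (1 *\<^sub>R (L ^^ Suc b) (wedge (contr X \<omega>) \<alpha>) + real (Suc b) *\<^sub>R (L ^^ Suc b) (wedge (contr X \<omega>) \<alpha>))"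
      by (simp add: wedge_simps del: of_nat_Suc)
    also have "1 *\<^sub>R (L ^^ Suc b) (wedge (contr X \<omega>) \<alpha>) + real (Suc b) *\<^sub>R (L ^^ Suc b) (wedge (contr X \<omega>) \<alpha>)
        = real (Suc (Suc b)) *\<^sub>R (L ^^ Suc b) (wedge (contr X \<omega>) \<alpha>)"
      unfolding scaleR_left_distrib[symmetric] by (simp only: of_nat_Suc)
    finally show ?case .
  qed
  obtain b where b: "a = int (Suc b)" using False by (metis not_le zero_less_imp_eq_int gr0_implies_Suc)
  have b1: "a - 1 = int b" using b by simp
  have "(1 / fact (Suc b)) * real (Suc b) = 1 / fact b"
    by (simp add: divide_simps del: of_nat_Suc)
  then show ?thesis
    unfolding b1 unfolding b divided_power_nat contr_scale pow scaleR_add_right scaleR_scaleR by simp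
qed

lemma hform_\<Lambda>_pow: "hform k \<alpha> \<Longrightarrow> hform (k - 2 * a) ((\<Lambda> ^^ a) \<alpha>)"
proof (induction a)
  case (Suc a)
  then show ?case using hform_\<Lambda>[of "k - 2 * a"] by (simp add: algebra_simps)
qed simp

lemma \<Lambda>_pow_zero: "hform k \<alpha> \<Longrightarrow> k < 2 * a \<Longrightarrow> (\<Lambda> ^^ a) \<alpha> = 0"
proof (cases a)
  case (Suc b)
  assume "hform k \<alpha>" "k < 2 * a"
  then show ?thesis using \<Lambda>_low_degree[OF hform_\<Lambda>_pow[of k \<alpha> b]] Suc by simp
qed simp

lemma contr_\<Lambda>_pow: "hform k \<alpha> \<Longrightarrow> contr X ((\<Lambda> ^^ a) \<alpha>) = (\<Lambda> ^^ a) (contr X \<alpha>)"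
proof (induction a)
  case (Suc a)
  then show ?case using contr_\<Lambda>[of "(\<Lambda> ^^ a) \<alpha>" X] hform_\<Lambda>_pow[of k \<alpha> a] by (simp add: hform_def)
qed simp

lemma contr_divided_\<Lambda>:
  "hform k \<alpha> \<Longrightarrow> contr X (divided_power \<Lambda> a \<alpha>) = divided_power \<Lambda> a (contr X \<alpha>)"
  by (simp add: divided_power_def contr_\<Lambda>_pow)

lemma divided_\<Lambda>_flat:
  assumes \<alpha>: "hform k \<alpha>" and X: "X \<in> T"
  shows "divided_power \<Lambda> a (wedge (contr X \<omega>) \<alpha>) =
    wedge (contr X \<omega>) (divided_power \<Lambda> a \<alpha>) - divided_power \<Lambda> (a - 1) (contr X \<alpha>)"
proof (cases "a \<le> 0")
  case True
  then show ?thesis by (cases "a = 0") (auto simp: divided_power_neg wedge_simps)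
next
  case False
  have pow: "(\<Lambda> ^^ Suc b) (wedge (contr X \<omega>) \<alpha>) =
      wedge (contr X \<omega>) ((\<Lambda> ^^ Suc b) \<alpha>) - real (Suc b) *\<^sub>R (\<Lambda> ^^ b) (contr X \<alpha>)" for b
  proof (induction b)
    case 0
    then show ?case using \<Lambda>_flat[OF \<alpha> X] by simp
  next
    case (Suc b)
    let ?y = "(\<Lambda> ^^ Suc b) (contr X \<alpha>)"
    have "(\<Lambda> ^^ Suc (Suc b)) (wedge (contr X \<omega>) \<alpha>) =
        \<Lambda> (wedge (contr X \<omega>) ((\<Lambda> ^^ Suc b) \<alpha>)) - real (Suc b) *\<^sub>R ?y"
      using Suc
      by (simp add: linear_diff[OF linear_poisson_contr] linear_scale[OF linear_poisson_contr] del: of_nat_Suc)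
    also have "\<Lambda> (wedge (contr X \<omega>) ((\<Lambda> ^^ Suc b) \<alpha>)) =
        wedge (contr X \<omega>) ((\<Lambda> ^^ Suc (Suc b)) \<alpha>) - 1 *\<^sub>R ?y"
      using \<Lambda>_flat[OF hform_\<Lambda>_pow[OF \<alpha>, of "Suc b"] X] contr_\<Lambda>_pow[OF \<alpha>, of X "Suc b"] by simp
    finally have "(\<Lambda> ^^ Suc (Suc b)) (wedge (contr X \<omega>) \<alpha>) =
        wedge (contr X \<omega>) ((\<Lambda> ^^ Suc (Suc b)) \<alpha>) - (1 *\<^sub>R ?y + real (Suc b) *\<^sub>R ?y)"
      by (simp only: diff_diff_eq)
    also have "1 *\<^sub>R ?y + real (Suc b) *\<^sub>R ?y = real (Suc (Suc b)) *\<^sub>R ?y"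
      unfolding scaleR_left_distrib[symmetric] by (simp only: of_nat_Suc)
    finally show ?case .
  qed
  obtain b where b: "a = int (Suc b)" using False by (metis not_le zero_less_imp_eq_int gr0_implies_Suc)
  have b1: "a - 1 = int b" using b by simp
  have "(1 / fact (Suc b)) * real (Suc b) = 1 / fact b"
    by (simp add: divide_simps del: of_nat_Suc)
  then show ?thesis
    unfolding b1 unfolding b divided_power_nat pow scaleR_diff_right scaleR_scaleR wedge_simps by simp
qed

lemma linear_weyl_star: "linear (weyl_star L \<Lambda> J w)"
proof -
  have "linear (\<lambda>x. divided_power L (w + int j) (divided_power \<Lambda> (int j) x))" for j
    using linear_compose[OF linear_divided_power[OF linear_poisson_contr] linear_divided_power[OF linear_wedge_right]]
    by (simp add: o_def)
  then show ?thesis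
    unfolding weyl_star_def[abs_def] by (intro linear_compose_sum ballI linear_compose_scale_right)
qed

text \<open>The commutator of \<open>\<Lambda>\<close> with \<open>\<iota>\<^sub>X\<omega> \<and>\<close> is \<open>-\<iota>\<^sub>X\<close> and that of \<open>\<iota>\<^sub>X\<close> with \<open>L\<close> is \<open>\<iota>\<^sub>X\<omega> \<and>\<close>.  Hence both sides
  consist of the terms \<open>P j\<close> and \<open>Q j\<close>, up to a shift of the index.\<close>

lemma star_wedge_flat:
  assumes \<alpha>: "hform k \<alpha>" and X: "X \<in> T" and J: "k \<le> 2 * J"
  shows "weyl_star L \<Lambda> J (int n - int (Suc k)) (wedge (contr X \<omega>) \<alpha>) =
    contr X (weyl_star L \<Lambda> J (int n - int k) \<alpha>)"
proof -
  define w where "w = int n - int k"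
  define P where "P j = divided_power L (w - 1 + int j) (wedge (contr X \<omega>) (divided_power \<Lambda> (int j) \<alpha>))" for j
  define Q where "Q j = divided_power L (w + int j) (divided_power \<Lambda> (int j) (contr X \<alpha>))" for j
  define R where "R j = divided_power L (w - 1 + int j) (divided_power \<Lambda> (int j - 1) (contr X \<alpha>))" for j
  have lin: "linear (divided_power L a)" for a by (rule linear_divided_power[OF linear_wedge_right])
  have "R (Suc j) = Q j" for j by (simp add: R_def Q_def algebra_simps)
  moreover have "R 0 = 0" by (simp add: R_def linear_0[OF lin])
  moreover have "Q J = 0"
  proof -
    have "(\<Lambda> ^^ J) (contr X \<alpha>) = 0"
    proof (cases k)
      case 0
      then show ?thesis
        using hform_contr_zero[of \<alpha> X] \<alpha> linear_0[OF linear_funpow[OF linear_poisson_contr]] by simp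
    next
      case (Suc i)
      then show ?thesis using \<Lambda>_pow_zero[OF hform_contr[OF \<alpha>, of X], of J] J by simp
    qed
    then show ?thesis by (simp add: Q_def divided_power_nat linear_0[OF lin])
  qed
  ultimately have shift: "(\<Sum>j\<le>J. (-1) ^ j *\<^sub>R R j) = - (\<Sum>j\<le>J. (-1) ^ j *\<^sub>R Q j)"
    using sum.atMost_Suc_shift[of "\<lambda>j. (-1) ^ j *\<^sub>R R j" J] by (simp add: sum_negf)
  have "weyl_star L \<Lambda> J (w - 1) (wedge (contr X \<omega>) \<alpha>) = (\<Sum>j\<le>J. (-1) ^ j *\<^sub>R (P j - R j))"
    unfolding weyl_star_def divided_\<Lambda>_flat[OF \<alpha> X] linear_diff[OF lin] P_def R_def ..
  also have "\<dots> = (\<Sum>j\<le>J. (-1) ^ j *\<^sub>R P j) - (\<Sum>j\<le>J. (-1) ^ j *\<^sub>R R j)"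
    by (simp only: scaleR_diff_right sum_subtractf)
  also have "\<dots> = (\<Sum>j\<le>J. (-1) ^ j *\<^sub>R (Q j + P j))"
    unfolding shift by (simp add: scaleR_add_right sum.distrib)
  also have "\<dots> = contr X (weyl_star L \<Lambda> J w \<alpha>)"
    unfolding weyl_star_def contr_sum contr_scale contr_divided_L contr_divided_\<Lambda>[OF \<alpha>] P_def Q_def
    by (simp add: algebra_simps)
  finally show ?thesis by (simp add: w_def algebra_simps)
qed

abbreviation flat_list :: "'v list \<Rightarrow> 'v altform" where
  "flat_list Xs \<equiv> foldr (\<lambda>X. wedge (contr X \<omega>)) Xs unit_form"

lemma hform_flat: "X \<in> T \<Longrightarrow> hform 1 (contr X \<omega>)"
  using hform_contr[OF hform_\<omega>] by simp

lemma hform_flat_list: "set Xs \<subseteq> T \<Longrightarrow> hform (length Xs) (flat_list Xs)"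
  using hform_wedge[OF hform_flat] by (induction Xs) (auto simp: hform_unit)

lemma flat_list_snoc:
  assumes "set Xs \<subseteq> T" "X \<in> T"
  shows "flat_list (Xs @ [X]) = (-1) ^ length Xs *\<^sub>R wedge (contr X \<omega>) (flat_list Xs)"
proof -
  have unit_right: "wedge \<alpha> unit_form = \<alpha>" for \<alpha> :: "'v altform"
    using wedge_commute[OF hform_homog[OF hform_unit], of \<alpha>] by simp
  have "flat_list (Xs @ [X]) = wedge (flat_list Xs) (contr X \<omega>)"
    by (induction Xs) (auto simp: wedge_assoc unit_right)
  also have "\<dots> = wedge (contr X \<omega>) (twist (flat_list Xs))"
    using wedge_commute[OF hform_homog[OF hform_flat[OF assms(2)]]] by simp
  finally show ?thesis
    by (simp add: twist_homog[OF hform_homog[OF hform_flat_list[OF assms(1)]]] wedge_simps)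
qed

lemma wedge_power_eq: "wedge_power n \<omega> = fact n *\<^sub>R divided_power L (int n) unit_form"
  by (simp add: wedge_power_def divided_power_nat)

text \<open>Both sides start with $\omega^n$ for the empty list, and appending a vector \<open>X\<close> applies \<open>\<iota>\<^sub>X\<close> to
  both, on the right by \<open>star_wedge_flat\<close>.  Moving the new 1-form to the front produces the sign.\<close>

lemma volume_contract_list:
  assumes "set Xs \<subseteq> T" "length Xs \<le> 2 * J"
  shows "(\<lambda>vs. wedge_power n \<omega> (Xs @ vs)) =
    (star_sign (length Xs) * fact n) *\<^sub>R weyl_star L \<Lambda> J (int n - int (length Xs)) (flat_list Xs)"
  using assms
proof (induction Xs rule: rev_induct)
  case Nil
  have "divided_power \<Lambda> (int j) unit_form = (if j = 0 then unit_form else 0)" for j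
    using \<Lambda>_pow_zero[OF hform_unit, of j] by (simp add: divided_power_nat)
  then have "weyl_star L \<Lambda> J (int n) unit_form = divided_power L (int n) unit_form"
    unfolding weyl_star_def
    by (simp add: if_distrib[of "divided_power _ _"] linear_0[OF linear_divided_power[OF linear_wedge_right]]
        if_distrib[of "scaleR _"] sum.delta cong: if_cong)
  then show ?case by (simp add: wedge_power_eq)
next
  case (snoc X Xs)
  then have Xs: "set Xs \<subseteq> T" "X \<in> T" "length Xs \<le> 2 * J" by auto
  let ?k = "length Xs"
  have "(\<lambda>vs. wedge_power n \<omega> ((Xs @ [X]) @ vs)) = contr X (\<lambda>vs. wedge_power n \<omega> (Xs @ vs))"
    by (simp add: contr_def)
  also have "\<dots> = (star_sign ?k * fact n) *\<^sub>R weyl_star L \<Lambda> J (int n - int (Suc ?k)) (wedge (contr X \<omega>) (flat_list Xs))"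
    unfolding snoc.IH[OF Xs(1,3)] contr_scale
      star_wedge_flat[OF hform_flat_list[OF Xs(1)] Xs(2,3)] ..
  also have "wedge (contr X \<omega>) (flat_list Xs) = (-1) ^ ?k *\<^sub>R flat_list (Xs @ [X])"
    unfolding flat_list_snoc[OF Xs(1,2)] by (simp add: fun_eq_iff fun_ops flip: power_add mult.assoc)
  finally show ?case by (simp add: linear_scale[OF linear_weyl_star] mult_ac)
qed

text \<open>So the star operator at a point is the Weyl group element, for whatever multivector \<open>P\<close> is chosen
  to represent the form.\<close>

lemma star_pointwise:
  assumes P: "P \<in> multivecs k T" and k: "k \<le> 2 * J"
  shows "contract P (wedge_power n \<omega>) =
    (star_sign k * fact n) *\<^sub>R weyl_star L \<Lambda> J (int n - int k) (flat_map \<omega> P)"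
proof -
  have [simp]: "(\<lambda>ws. \<omega> (X # ws)) = contr X \<omega>" for X by (simp add: contr_def)
  show ?thesis
    using P
  proof (induction P)
    case Nil
    then show ?case
      using linear_0[OF linear_weyl_star] by (simp add: contract_def flat_map_def fun_eq_iff fun_ops zero_fun_def[symmetric])
  next
    case (Cons aX P)
    obtain a Xs where aX: "aX = (a, Xs)" by (cases aX)
    have Xs: "length Xs = k" "set Xs \<subseteq> T" "P \<in> multivecs k T"
      using Cons.prems by (auto simp: multivecs_def aX)
    have "contract (aX # P) (wedge_power n \<omega>) =
        a *\<^sub>R (\<lambda>vs. wedge_power n \<omega> (Xs @ vs)) + contract P (wedge_power n \<omega>)"
      by (simp add: contract_def aX fun_eq_iff fun_ops)
    moreover have "flat_map \<omega> (aX # P) = a *\<^sub>R flat_list Xs + flat_map \<omega> P"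
      by (simp add: flat_map_def aX fun_eq_iff fun_ops)
    ultimately show ?case
      using volume_contract_list[OF Xs(2)] Xs k Cons.IH[OF Xs(3)]
      by (simp add: linear_add[OF linear_weyl_star] linear_scale[OF linear_weyl_star] scaleR_add_right mult_ac)
  qed
qed

text \<open>By the Euler identity a form is a combination of products of elements of the coframe, which are
  in the image of the flat map, with its contractions, which are by induction.\<close>

lemma flat_map_surj:
  assumes D: "\<And>i. i < q \<Longrightarrow> \<exists>X\<in>D. contr X \<omega> = coframe i"
  shows "hform k \<alpha> \<Longrightarrow> \<exists>P\<in>multivecs k D. flat_map \<omega> P = \<alpha>"
proof (induction k arbitrary: \<alpha>)
  case 0
  have "flat_map \<omega> [(\<alpha> [], [])] = \<alpha>"
    using hform_homog[OF 0] by (auto simp: flat_map_def unit_form_def homog_def fun_eq_iff fun_ops)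
  moreover have "[(\<alpha> [], [])] \<in> multivecs 0 D" by (simp add: multivecs_def)
  ultimately show ?case by blast
next
  case (Suc k)
  have "\<forall>i\<in>{..<q}. \<exists>P\<in>multivecs k D. flat_map \<omega> P = contr (E i) \<alpha>"
    using Suc.IH hform_contr[OF Suc.prems] by simp
  then obtain P where P: "\<And>i. i < q \<Longrightarrow> P i \<in> multivecs k D" "\<And>i. i < q \<Longrightarrow> flat_map \<omega> (P i) = contr (E i) \<alpha>"
    by (metis lessThan_iff)
  obtain X where X: "\<And>i. i < q \<Longrightarrow> X i \<in> D" "\<And>i. i < q \<Longrightarrow> contr (X i) \<omega> = coframe i"
    using D by metis
  define c where "c = 1 / real (Suc k)"
  define R where "R i = map (\<lambda>(a, Xs). (c * a, X i # Xs)) (P i)" for i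
  have R: "flat_map \<omega> (R i) = c *\<^sub>R wedge (contr (X i) \<omega>) (flat_map \<omega> (P i))" for i
    unfolding R_def
  proof -
    have eq: "(\<lambda>ws. \<omega> (X i # ws)) = contr (X i) \<omega>" by (simp add: contr_def)
    have nil: "flat_map \<omega> [] = 0" by (simp add: flat_map_def fun_eq_iff fun_ops)
    have cons: "flat_map \<omega> ((a, Xs) # Q) = a *\<^sub>R foldr (\<lambda>X. wedge (\<lambda>ws. \<omega> (X # ws))) Xs unit_form + flat_map \<omega> Q"
      for a Xs Q by (simp add: flat_map_def fun_eq_iff fun_ops)
    have "flat_map \<omega> (map (\<lambda>(a, Xs). (c * a, X i # Xs)) Q) = c *\<^sub>R wedge (contr (X i) \<omega>) (flat_map \<omega> Q)" for Q
    proof (induction Q)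
      case (Cons aX Q)
      obtain a Xs where "aX = (a, Xs)" by (cases aX)
      then show ?case using Cons by (simp add: cons eq wedge_simps scaleR_add_right)
    qed (simp add: nil wedge_simps)
    then show "flat_map \<omega> (map (\<lambda>(a, Xs). (c * a, X i # Xs)) (P i)) =
        c *\<^sub>R wedge (contr (X i) \<omega>) (flat_map \<omega> (P i))" .
  qed
  have mv: "concat (map R [0..<q]) \<in> multivecs (Suc k) D"
    using P(1) X(1) by (fastforce simp: multivecs_def R_def)
  have "flat_map \<omega> (concat (map R js)) = (\<Sum>i\<leftarrow>js. flat_map \<omega> (R i))" for js
    by (induction js) (auto simp: flat_map_def fun_eq_iff fun_ops)
  then have "flat_map \<omega> (concat (map R [0..<q])) = (\<Sum>i<q. flat_map \<omega> (R i))"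
    by (simp add: interv_sum_list_conv_sum_set_nat atLeast0LessThan)
  also have "\<dots> = c *\<^sub>R (\<Sum>i<q. wedge (coframe i) (contr (E i) \<alpha>))"
    unfolding R scaleR_sum_right using P(2) X(2) by (intro sum.cong) auto
  also have "\<dots> = \<alpha>" unfolding euler_identity[OF Suc.prems] by (simp add: c_def del: of_nat_Suc)
  finally show ?case using mv by blast
qed

end

section \<open>Open subsets of Euclidean space\<close>

lemma mem_Euclidean_space: "x \<in> topspace (Euclidean_space m) \<longleftrightarrow> (\<forall>i\<ge>m. x i = 0)"
  by (simp add: topspace_Euclidean_space)

lemma openin_Euclidean_space_iff:
  "openin (Euclidean_space m) U \<longleftrightarrow> (\<exists>S. open S \<and> U = S \<inter> topspace (Euclidean_space m))"
  unfolding Euclidean_space_def openin_subtopology open_fun_def by simp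

lemma openin_box:
  assumes "openin (Euclidean_space m) U" "x \<in> U"
  obtains \<delta> where "\<delta> > 0"
    and "\<And>y. y \<in> topspace (Euclidean_space m) \<Longrightarrow> (\<And>i. i < m \<Longrightarrow> \<bar>y i - x i\<bar> < \<delta>) \<Longrightarrow> y \<in> U"
proof -
  obtain S where S: "open S" "U = S \<inter> topspace (Euclidean_space m)"
    using assms(1) openin_Euclidean_space_iff by blast
  then have "openin (product_topology (\<lambda>_. euclidean) UNIV) S" "x \<in> S"
    using assms(2) by (auto simp: open_fun_def)
  from product_topology_open_contains_basis[OF this] obtain X
    where X: "x \<in> (\<Pi>\<^sub>E i\<in>UNIV. X i)" "\<And>i. open (X i)" "(\<Pi>\<^sub>E i\<in>UNIV. X i) \<subseteq> S"
    by auto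
  have xi: "x i \<in> X i" for i using X(1) by auto
  have "\<exists>d>0. \<forall>t. \<bar>t - x i\<bar> < d \<longrightarrow> t \<in> X i" for i
    using X(2)[of i] xi[of i] unfolding open_dist dist_real_def by blast
  then obtain d where d: "\<And>i. d i > 0" "\<And>i t. \<bar>t - x i\<bar> < d i \<Longrightarrow> t \<in> X i" by metis
  define \<delta> where "\<delta> = Min (insert 1 (d ` {..<m}))"
  have "\<delta> > 0" using d(1) by (auto simp: \<delta>_def)
  moreover have "y \<in> U" if y: "y \<in> topspace (Euclidean_space m)" "\<And>i. i < m \<Longrightarrow> \<bar>y i - x i\<bar> < \<delta>" for y
  proof -
    have "y i \<in> X i" for i
    proof (cases "i < m")
      case True
      then have "\<delta> \<le> d i" by (auto simp: \<delta>_def)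
      then show ?thesis using d(2) y(2)[OF True] by simp
    next
      case False
      then have "y i = x i" using y(1) assms(2) S(2) by (simp add: mem_Euclidean_space)
      then show ?thesis using xi by simp
    qed
    then have "y \<in> S" using X(3) by auto
    then show ?thesis using y(1) S(2) by simp
  qed
  ultimately show ?thesis using that by blast
qed

lemma open_subset_Euclidean: "openin (Euclidean_space m) U \<Longrightarrow> x \<in> U \<Longrightarrow> x \<in> topspace (Euclidean_space m)"
  using openin_subset by blast

lemma eventually_line_in:
  assumes "openin (Euclidean_space m) U" "x \<in> U" "i < m"
  shows "\<forall>\<^sub>F t in nhds (x i). x(i := t) \<in> U"
proof -
  obtain \<delta> where \<delta>: "\<delta> > 0"
    "\<And>y. y \<in> topspace (Euclidean_space m) \<Longrightarrow> (\<And>i. i < m \<Longrightarrow> \<bar>y i - x i\<bar> < \<delta>) \<Longrightarrow> y \<in> U"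
    using openin_box[OF assms(1,2)] by blast
  have "x(i := t) \<in> U" if "\<bar>t - x i\<bar> < \<delta>" for t
    using that \<delta> open_subset_Euclidean[OF assms(1,2)] assms(3) by (intro \<delta>(2)) (auto simp: mem_Euclidean_space)
  then show ?thesis
    unfolding eventually_nhds_metric dist_real_def using \<delta>(1) by blast
qed

lemma continuous_on_box:
  fixes f :: "(nat \<Rightarrow> real) \<Rightarrow> real"
  assumes "openin (Euclidean_space m) U" "x \<in> U" "continuous_on U f" "\<epsilon> > 0"
  obtains \<delta> where "\<delta> > 0"
    and "\<And>y. y \<in> topspace (Euclidean_space m) \<Longrightarrow> (\<And>i. i < m \<Longrightarrow> \<bar>y i - x i\<bar> < \<delta>) \<Longrightarrow>
      y \<in> U \<and> \<bar>f y - f x\<bar> < \<epsilon>"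
proof -
  have "openin (top_of_set U) (U \<inter> f -` ball (f x) \<epsilon>)"
    using continuous_openin_preimage_gen[OF assms(3) open_ball] .
  then obtain S' where "open S'" "U \<inter> f -` ball (f x) \<epsilon> = U \<inter> S'"
    by (auto simp: openin_open)
  moreover obtain S where "open S" "U = S \<inter> topspace (Euclidean_space m)"
    using assms(1) openin_Euclidean_space_iff by blast
  ultimately have "openin (Euclidean_space m) (U \<inter> f -` ball (f x) \<epsilon>)"
    unfolding openin_Euclidean_space_iff by (intro exI[of _ "S \<inter> S'"]) auto
  moreover have "x \<in> U \<inter> f -` ball (f x) \<epsilon>" using assms by simp
  ultimately show ?thesis
    using that by (rule openin_box) (auto simp: dist_real_def abs_minus_commute)
qed

section \<open>Partial derivatives\<close>

lemma pderivative_cong: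
  assumes "openin (Euclidean_space m) U" "x \<in> U" "i < m" "\<And>y. y \<in> U \<Longrightarrow> f y = g y"
  shows "pderivative i f x = pderivative i g x"
  unfolding pderivative_def
  by (rule deriv_cong_ev) (use eventually_mono[OF eventually_line_in[OF assms(1-3)]] assms(4) in auto)

text \<open>Smoothness refers to all iterated partial derivatives at once.  Recursion on the order of
  differentiability is what closure under products and composition needs, because the first
  derivatives of a product or composition again involve the functions themselves.\<close>

primrec Ck :: "nat \<Rightarrow> (nat \<Rightarrow> real) set \<Rightarrow> nat \<Rightarrow> ((nat \<Rightarrow> real) \<Rightarrow> real) \<Rightarrow> bool" where
  "Ck m U 0 f \<longleftrightarrow> continuous_on U f"
| "Ck m U (Suc N) f \<longleftrightarrow> continuous_on U f \<and>
     (\<forall>x\<in>U. \<forall>i<m. (\<lambda>t. f (x(i := t))) differentiable (at (x i))) \<and>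
     (\<forall>i<m. Ck m U N (pderivative i f))"

lemma Ck_continuous: "Ck m U N f \<Longrightarrow> continuous_on U f"
  by (cases N) auto

lemma Ck_Suc_imp: "Ck m U (Suc N) f \<Longrightarrow> Ck m U N f"
  by (induction N arbitrary: f) auto

lemma Ck_mono: "Ck m U N f \<Longrightarrow> K \<le> N \<Longrightarrow> Ck m U K f"
  by (induction N) (auto simp: le_Suc_eq dest: Ck_Suc_imp simp del: Ck.simps)

lemma Ck_subset: "Ck m U N f \<Longrightarrow> V \<subseteq> U \<Longrightarrow> Ck m V N f"
  by (induction N arbitrary: f) (auto intro: continuous_on_subset)

lemma iter_pderivative_simps [simp]:
  "iter_pderivative [] f = f"
  "iter_pderivative (i # is) f = pderivative i (iter_pderivative is f)"
  by (simp_all add: iter_pderivative_def)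

lemma smooth_on_iff_Ck: "smooth_on m U f \<longleftrightarrow> (\<forall>N. Ck m U N f)"
proof
  assume "smooth_on m U f"
  moreover have "Ck m U N (iter_pderivative is f)" if "smooth_on m U f" "set is \<subseteq> {..<m}" for N "is"
    using that
  proof (induction N arbitrary: "is")
    case (Suc N)
    then show ?case using Suc.IH[of "_ # is"] by (auto simp: smooth_on_def)
  qed (auto simp: smooth_on_def)
  from this[of "[]"] show "\<forall>N. Ck m U N f" using calculation by simp
next
  assume C: "\<forall>N. Ck m U N f"
  have "Ck m U N (iter_pderivative is f)" if "set is \<subseteq> {..<m}" for N "is"
    using that
  proof (induction "is" arbitrary: N)
    case (Cons i "is")
    then show ?case using Cons.IH[of "Suc N"] by simp
  qed (use C in simp)
  from this[of _ "Suc 0"] show "smooth_on m U f" by (auto simp: smooth_on_def)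
qed

lemma smooth_imp_Ck: "smooth_on m U f \<Longrightarrow> Ck m U N f"
  by (simp add: smooth_on_iff_Ck)

lemma smooth_pderivative: "smooth_on m U f \<Longrightarrow> i < m \<Longrightarrow> smooth_on m U (pderivative i f)"
  unfolding smooth_on_iff_Ck by (metis Ck.simps(2))

lemma smooth_on_subset: "smooth_on m U f \<Longrightarrow> V \<subseteq> U \<Longrightarrow> smooth_on m V f"
  unfolding smooth_on_iff_Ck using Ck_subset by blast

lemma has_pderivative:
  assumes "Ck m U (Suc 0) f" "x \<in> U" "i < m"
  shows "((\<lambda>t. f (x(i := t))) has_real_derivative pderivative i f x) (at (x i))"
  using assms unfolding pderivative_def by (simp add: DERIV_deriv_iff_real_differentiable)

lemma has_pderivative_line:
  assumes "Ck m U (Suc 0) f" "x(i := t) \<in> U" "i < m"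
  shows "((\<lambda>t. f (x(i := t))) has_real_derivative pderivative i f (x(i := t))) (at t)"
  using has_pderivative[OF assms] by simp

lemma pderivativeI:
  "((\<lambda>t. f (x(i := t))) has_real_derivative D) (at (x i)) \<Longrightarrow> pderivative i f x = D"
  unfolding pderivative_def by (rule DERIV_imp_deriv)

locale euclidean_open =
  fixes m :: nat and U :: "(nat \<Rightarrow> real) set"
  assumes openU: "openin (Euclidean_space m) U"
begin

lemma Ck_cong:
  assumes "\<And>x. x \<in> U \<Longrightarrow> f x = g x"
  shows "Ck m U N f \<longleftrightarrow> Ck m U N g"
  using assms
proof (induction N arbitrary: f g)
  case 0
  then show ?case using continuous_on_cong[of U U f g] by simp
next
  case (Suc N)
  have "(\<lambda>t. f (x(i := t))) differentiable (at (x i)) \<longleftrightarrow> (\<lambda>t. g (x(i := t))) differentiable (at (x i))"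
    if x: "x \<in> U" "i < m" for x i
  proof -
    have "\<forall>\<^sub>F t in nhds (x i). f (x(i := t)) = g (x(i := t))"
      by (rule eventually_mono[OF eventually_line_in[OF openU x]]) (rule Suc.prems)
    then show ?thesis
      unfolding real_differentiable_def by (simp only: DERIV_cong_ev[OF refl _ refl])
  qed
  moreover have "Ck m U N (pderivative i f) \<longleftrightarrow> Ck m U N (pderivative i g)" if "i < m" for i
    by (rule Suc.IH) (rule pderivative_cong[OF openU _ that Suc.prems])
  moreover have "continuous_on U f \<longleftrightarrow> continuous_on U g"
    using Suc.prems continuous_on_cong[of U U f g] by simp
  ultimately show ?case by auto
qed

lemma smooth_on_cong: "(\<And>x. x \<in> U \<Longrightarrow> f x = g x) \<Longrightarrow> smooth_on m U f \<longleftrightarrow> smooth_on m U g"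
  unfolding smooth_on_iff_Ck using Ck_cong by blast

lemma Ck_SucI:
  assumes "continuous_on U f"
    and "\<And>x i. x \<in> U \<Longrightarrow> i < m \<Longrightarrow> ((\<lambda>t. f (x(i := t))) has_real_derivative f' i x) (at (x i))"
    and "\<And>i. i < m \<Longrightarrow> Ck m U N (f' i)"
  shows "Ck m U (Suc N) f"
proof -
  have "Ck m U N (pderivative i f)" if "i < m" for i
  proof -
    have "pderivative i f x = f' i x" if "x \<in> U" for x
      by (rule pderivativeI) (rule assms(2)[OF that \<open>i < m\<close>])
    then show ?thesis using Ck_cong[of "pderivative i f" "f' i"] assms(3)[OF that] by blast
  qed
  moreover have "(\<lambda>t. f (x(i := t))) differentiable (at (x i))" if "x \<in> U" "i < m" for x i
    unfolding real_differentiable_def using assms(2)[OF that] by blast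
  ultimately show ?thesis using assms(1) by simp
qed

lemma Ck_const: "Ck m U N (\<lambda>_. c)"
  by (induction N arbitrary: c) (auto intro!: Ck_SucI[where f' = "\<lambda>_ _. 0"] simp del: Ck.simps(2))

lemma Ck_coord: "Ck m U N (\<lambda>x. x i)"
proof (cases N)
  case 0
  then show ?thesis by (auto intro!: continuous_on_product_then_coordinatewise continuous_intros)
next
  case (Suc K)
  show ?thesis unfolding Suc
  proof (rule Ck_SucI[where f' = "\<lambda>j _. if i = j then 1 else 0"])
    show "continuous_on U (\<lambda>x. x i)"
      by (auto intro!: continuous_on_product_then_coordinatewise continuous_intros)
  qed (auto intro!: derivative_eq_intros Ck_const)
qed

lemma Ck_add: "Ck m U N f \<Longrightarrow> Ck m U N g \<Longrightarrow> Ck m U N (\<lambda>x. f x + g x)"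
proof (induction N arbitrary: f g)
  case (Suc N)
  show ?case
  proof (rule Ck_SucI[where f' = "\<lambda>i x. pderivative i f x + pderivative i g x"])
    fix x i assume x: "x \<in> U" "i < m"
    show "((\<lambda>t. f (x(i := t)) + g (x(i := t))) has_real_derivative pderivative i f x + pderivative i g x) (at (x i))"
      using has_pderivative[OF Ck_mono[OF Suc.prems(1)] x] has_pderivative[OF Ck_mono[OF Suc.prems(2)] x]
      by (intro DERIV_add) (simp_all only: le0 Suc_le_mono)
  qed (use Suc in \<open>auto intro!: continuous_intros\<close>)
qed (auto intro: continuous_intros)

lemma Ck_mult: "Ck m U N f \<Longrightarrow> Ck m U N g \<Longrightarrow> Ck m U N (\<lambda>x. f x * g x)"
proof (induction N arbitrary: f g)
  case (Suc N)
  show ?case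
  proof (rule Ck_SucI[where f' = "\<lambda>i x. pderivative i f x * g x + pderivative i g x * f x"])
    fix x i assume x: "x \<in> U" "i < m"
    show "((\<lambda>t. f (x(i := t)) * g (x(i := t))) has_real_derivative
        pderivative i f x * g x + pderivative i g x * f x) (at (x i))"
      using DERIV_mult[OF has_pderivative[OF Ck_mono[OF Suc.prems(1)] x] has_pderivative[OF Ck_mono[OF Suc.prems(2)] x]]
      unfolding fun_upd_triv by (simp only: le0 Suc_le_mono)
  next
    fix i assume "i < m"
    then show "Ck m U N (\<lambda>x. pderivative i f x * g x + pderivative i g x * f x)"
      using Suc Ck_Suc_imp[OF Suc.prems(1)] Ck_Suc_imp[OF Suc.prems(2)] by (intro Ck_add Suc.IH) auto
  qed (use Suc in \<open>auto intro!: continuous_intros\<close>)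
qed (auto intro: continuous_intros)

lemma Ck_sum: "(\<And>j. j \<in> I \<Longrightarrow> Ck m U N (f j)) \<Longrightarrow> Ck m U N (\<lambda>x. \<Sum>j\<in>I. f j x)"
  by (induction I rule: infinite_finite_induct) (auto intro!: Ck_const Ck_add)

text \<open>The function \<open>h k\<close> is the \<open>k\<close>-th derivative of \<open>h 0\<close>.\<close>

lemma Ck_compose_real:
  assumes h: "\<And>k t. (h k has_real_derivative h (Suc k) t) (at t)"
  shows "Ck m U N f \<Longrightarrow> Ck m U N (\<lambda>x. h k (f x))"
proof (induction N arbitrary: k)
  case 0
  have "continuous_on UNIV (h k)" using h by (meson DERIV_isCont continuous_at_imp_continuous_on)
  then show ?case using 0 by (auto intro: continuous_on_compose2)
next
  case (Suc N)
  have cont: "continuous_on UNIV (h k)" using h by (meson DERIV_isCont continuous_at_imp_continuous_on)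
  show ?case
  proof (rule Ck_SucI[where f' = "\<lambda>i x. h (Suc k) (f x) * pderivative i f x"])
    fix x i assume x: "x \<in> U" "i < m"
    show "((\<lambda>t. h k (f (x(i := t)))) has_real_derivative h (Suc k) (f x) * pderivative i f x) (at (x i))"
      by (rule DERIV_cong[OF DERIV_chain2[OF h has_pderivative[OF Ck_mono[OF Suc.prems(1)] x]]]) simp_all
  next
    fix i assume "i < m"
    then show "Ck m U N (\<lambda>x. h (Suc k) (f x) * pderivative i f x)"
      using Suc Ck_Suc_imp[OF Suc.prems(1)] by (intro Ck_mult Suc.IH) auto
  qed (use Suc cont in \<open>auto intro: continuous_on_compose2\<close>)
qed

lemma smooth_const: "smooth_on m U (\<lambda>_. c)"
  and smooth_coord: "smooth_on m U (\<lambda>x. x i)"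
  by (simp_all add: smooth_on_iff_Ck Ck_const Ck_coord)

lemma smooth_add: "smooth_on m U f \<Longrightarrow> smooth_on m U g \<Longrightarrow> smooth_on m U (\<lambda>x. f x + g x)"
  and smooth_mult: "smooth_on m U f \<Longrightarrow> smooth_on m U g \<Longrightarrow> smooth_on m U (\<lambda>x. f x * g x)"
  by (simp_all add: smooth_on_iff_Ck Ck_add Ck_mult)

lemma smooth_sum: "(\<And>j. j \<in> I \<Longrightarrow> smooth_on m U (f j)) \<Longrightarrow> smooth_on m U (\<lambda>x. \<Sum>j\<in>I. f j x)"
  by (simp add: smooth_on_iff_Ck Ck_sum)

lemma smooth_prod: "(\<And>j. j \<in> I \<Longrightarrow> smooth_on m U (f j)) \<Longrightarrow> smooth_on m U (\<lambda>x. \<Prod>j\<in>I. f j x)"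
  by (induction I rule: infinite_finite_induct) (auto intro: smooth_const smooth_mult)

section \<open>The chain rule and the symmetry of second derivatives\<close>

text \<open>The coordinates are changed one at a time, and the mean value theorem is applied to each step.\<close>

lemma C1_approx:
  assumes C1: "Ck m U (Suc 0) f" and x: "x \<in> U" and "\<epsilon> > 0"
  obtains \<delta> where "\<delta> > 0"
    and "\<And>y. y \<in> topspace (Euclidean_space m) \<Longrightarrow> (\<And>i. i < m \<Longrightarrow> \<bar>y i - x i\<bar> < \<delta>) \<Longrightarrow>
      \<bar>f y - f x - (\<Sum>j<m. (y j - x j) * pderivative j f x)\<bar> \<le> \<epsilon> * (\<Sum>j<m. \<bar>y j - x j\<bar>)"
proof -
  have xE: "x \<in> topspace (Euclidean_space m)" by (rule open_subset_Euclidean[OF openU x])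
  have "\<forall>j. \<exists>d>0. j < m \<longrightarrow> (\<forall>y\<in>topspace (Euclidean_space m). (\<forall>i<m. \<bar>y i - x i\<bar> < d) \<longrightarrow>
      y \<in> U \<and> \<bar>pderivative j f y - pderivative j f x\<bar> < \<epsilon>)"
  proof
    fix j
    show "\<exists>d>0. j < m \<longrightarrow> (\<forall>y\<in>topspace (Euclidean_space m). (\<forall>i<m. \<bar>y i - x i\<bar> < d) \<longrightarrow>
      y \<in> U \<and> \<bar>pderivative j f y - pderivative j f x\<bar> < \<epsilon>)"
    proof (cases "j < m")
      case True
      then have "continuous_on U (pderivative j f)" using C1 by simp
      from continuous_on_box[OF openU x this \<open>\<epsilon> > 0\<close>] show ?thesis by metis
    qed (use zero_less_one in blast)
  qed
  then obtain d where d: "\<And>j. d j > 0" "\<And>j y. j < m \<Longrightarrow> y \<in> topspace (Euclidean_space m) \<Longrightarrow>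
      (\<And>i. i < m \<Longrightarrow> \<bar>y i - x i\<bar> < d j) \<Longrightarrow> y \<in> U \<and> \<bar>pderivative j f y - pderivative j f x\<bar> < \<epsilon>"
    by metis
  define \<delta> where "\<delta> = Min (insert 1 (d ` {..<m}))"
  have "\<delta> > 0" using d(1) by (auto simp: \<delta>_def)
  have \<delta>d: "\<delta> \<le> d j" if "j < m" for j using that by (auto simp: \<delta>_def)
  have near: "z \<in> U \<and> \<bar>pderivative j f z - pderivative j f x\<bar> < \<epsilon>"
    if "j < m" "z \<in> topspace (Euclidean_space m)" "\<And>i. i < m \<Longrightarrow> \<bar>z i - x i\<bar> < \<delta>" for j z
    using d(2)[OF that(1,2)] that(3) \<delta>d[OF that(1)] by force
  have "\<bar>f y - f x - (\<Sum>j<m. (y j - x j) * pderivative j f x)\<bar> \<le> \<epsilon> * (\<Sum>j<m. \<bar>y j - x j\<bar>)"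
    if y: "y \<in> topspace (Euclidean_space m)" "\<And>i. i < m \<Longrightarrow> \<bar>y i - x i\<bar> < \<delta>" for y
  proof -
    \<comment> \<open>The path from \<open>x\<close> to \<open>y\<close> along the coordinate axes.\<close>
    define z where "z k = (\<lambda>i. if i < k then y i else x i)" for k
    have z0: "z 0 = x" by (simp add: z_def)
    have zm: "z m = y" using xE y(1) by (auto simp: z_def mem_Euclidean_space fun_eq_iff)
    have step: "\<bar>f (z (Suc k)) - f (z k) - (y k - x k) * pderivative k f x\<bar> \<le> \<epsilon> * \<bar>y k - x k\<bar>"
      if k: "k < m" for k
    proof -
      have zk: "z (Suc k) = (z k)(k := y k)" "(z k)(k := x k) = z k" by (auto simp: z_def fun_eq_iff)
      have seg: "(z k)(k := t) \<in> topspace (Euclidean_space m) \<and>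
          (\<forall>i<m. \<bar>((z k)(k := t)) i - x i\<bar> < \<delta>)" if t: "t \<in> closed_segment (x k) (y k)" for t
      proof -
        have "\<bar>t - x k\<bar> \<le> \<bar>y k - x k\<bar>" using t by (auto simp: closed_segment_eq_real_ivl split: if_splits)
        then show ?thesis
          using k y xE \<open>\<delta> > 0\<close> by (auto simp: z_def mem_Euclidean_space intro: le_less_trans)
      qed
      have der: "((\<lambda>t. f ((z k)(k := t))) has_real_derivative pderivative k f ((z k)(k := t))) (at t)"
        if t: "t \<in> closed_segment (x k) (y k)" for t
        using has_pderivative_line[OF C1 _ k] near[OF k] seg[OF t] by blast
      obtain \<xi> where \<xi>: "\<xi> \<in> closed_segment (x k) (y k)"
        "f ((z k)(k := y k)) - f ((z k)(k := x k)) = (y k - x k) * pderivative k f ((z k)(k := \<xi>))"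
      proof (cases "x k" "y k" rule: linorder_cases)
        case less
        from MVT2[OF less der] obtain \<xi> where "x k < \<xi>" "\<xi> < y k"
          "f ((z k)(k := y k)) - f ((z k)(k := x k)) = (y k - x k) * pderivative k f ((z k)(k := \<xi>))"
          using less by (auto simp: closed_segment_eq_real_ivl)
        then show ?thesis using that[of \<xi>] by (auto simp: closed_segment_eq_real_ivl)
      next
        case equal
        then show ?thesis using that[of "x k"] by simp
      next
        case greater
        from MVT2[OF greater der] obtain \<xi> where "y k < \<xi>" "\<xi> < x k"
          "f ((z k)(k := x k)) - f ((z k)(k := y k)) = (x k - y k) * pderivative k f ((z k)(k := \<xi>))"
          using greater by (auto simp: closed_segment_eq_real_ivl)
        then show ?thesis using that[of \<xi>] by (auto simp: closed_segment_eq_real_ivl algebra_simps)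
      qed
      have "\<bar>pderivative k f ((z k)(k := \<xi>)) - pderivative k f x\<bar> < \<epsilon>"
        using near[OF k] seg[OF \<xi>(1)] by blast
      moreover have "f (z (Suc k)) - f (z k) - (y k - x k) * pderivative k f x =
          (pderivative k f ((z k)(k := \<xi>)) - pderivative k f x) * (y k - x k)"
        using \<xi>(2) zk by (simp add: algebra_simps)
      ultimately show ?thesis by (simp add: abs_mult mult_right_mono)
    qed
    have "f y - f x = (\<Sum>k<m. f (z (Suc k)) - f (z k))"
      using z0 zm sum_lessThan_telescope[of "\<lambda>k. f (z k)" m] by simp
    then have "\<bar>f y - f x - (\<Sum>j<m. (y j - x j) * pderivative j f x)\<bar> =
        \<bar>\<Sum>k<m. f (z (Suc k)) - f (z k) - (y k - x k) * pderivative k f x\<bar>"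
      by (simp add: sum_subtractf)
    also have "\<dots> \<le> (\<Sum>k<m. \<epsilon> * \<bar>y k - x k\<bar>)"
      using step by (intro order_trans[OF sum_abs] sum_mono) auto
    finally show ?thesis by (simp add: sum_distrib_left)
  qed
  with \<open>\<delta> > 0\<close> show ?thesis using that by blast
qed

lemma chain_curve:
  assumes C1: "Ck m U (Suc 0) f" and x: "\<gamma> t0 \<in> U"
    and E: "\<forall>\<^sub>F t in nhds t0. \<gamma> t \<in> topspace (Euclidean_space m)"
    and D: "\<And>j. j < m \<Longrightarrow> ((\<lambda>t. \<gamma> t j) has_real_derivative \<gamma>' j) (at t0)"
  shows "((\<lambda>t. f (\<gamma> t)) has_real_derivative (\<Sum>j<m. \<gamma>' j * pderivative j f (\<gamma> t0))) (at t0)"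
proof -
  let ?x = "\<gamma> t0"
  let ?q = "\<lambda>j t. (\<gamma> t j - ?x j) / (t - t0)"
  define B where "B = (\<Sum>j<m. \<bar>\<gamma>' j\<bar>) + 1"
  define r where "r t = (f (\<gamma> t) - f ?x) / (t - t0) - (\<Sum>j<m. ?q j t * pderivative j f ?x)" for t
  have B: "B > 0" unfolding B_def by (smt (verit) sum_nonneg abs_ge_zero)
  have q: "(?q j \<longlongrightarrow> \<gamma>' j) (at t0)" if "j < m" for j
    using D[OF that] unfolding has_field_derivative_iff .
  have bound: "\<forall>\<^sub>F t in at t0. (\<Sum>j<m. \<bar>?q j t\<bar>) < B"
  proof -
    have "((\<lambda>t. \<Sum>j<m. \<bar>?q j t\<bar>) \<longlongrightarrow> (\<Sum>j<m. \<bar>\<gamma>' j\<bar>)) (at t0)"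
      using q by (intro tendsto_sum tendsto_rabs) auto
    then show ?thesis by (rule order_tendstoD) (simp add: B_def)
  qed
  have "(r \<longlongrightarrow> 0) (at t0)"
  proof (rule tendstoI)
    fix \<epsilon> :: real assume "\<epsilon> > 0"
    then have "\<epsilon> / B > 0" using B by simp
    from C1_approx[OF C1 x this] obtain \<delta> where \<delta>: "\<delta> > 0"
      "\<And>y. y \<in> topspace (Euclidean_space m) \<Longrightarrow> (\<And>i. i < m \<Longrightarrow> \<bar>y i - ?x i\<bar> < \<delta>) \<Longrightarrow>
      \<bar>f y - f ?x - (\<Sum>j<m. (y j - ?x j) * pderivative j f ?x)\<bar> \<le> \<epsilon> / B * (\<Sum>j<m. \<bar>y j - ?x j\<bar>)"
      by blast
    have "\<forall>\<^sub>F t in at t0. \<forall>j\<in>{..<m}. \<bar>\<gamma> t j - ?x j\<bar> < \<delta>"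
    proof (intro eventually_ball_finite ballI)
      fix j assume "j \<in> {..<m}"
      then have "((\<lambda>t. \<gamma> t j) \<longlongrightarrow> ?x j) (at t0)"
        using DERIV_isCont[OF D] by (simp add: isCont_def)
      from tendstoD[OF this \<delta>(1)] show "\<forall>\<^sub>F t in at t0. \<bar>\<gamma> t j - ?x j\<bar> < \<delta>"
        unfolding dist_real_def .
    qed simp
    moreover have "\<forall>\<^sub>F t in at t0. \<gamma> t \<in> topspace (Euclidean_space m)"
      using E by (auto simp: eventually_at_filter elim: eventually_mono)
    moreover have "\<forall>\<^sub>F t in at t0. t \<noteq> t0" by (simp add: eventually_at_filter)
    ultimately show "\<forall>\<^sub>F t in at t0. dist (r t) 0 < \<epsilon>"
      using bound
    proof eventually_elim
      case (elim t)
      have rt: "r t = (f (\<gamma> t) - f ?x - (\<Sum>j<m. (\<gamma> t j - ?x j) * pderivative j f ?x)) / (t - t0)"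
      proof -
        have "?q j t * c = (\<gamma> t j - ?x j) * c / (t - t0)" for j c by simp
        then show ?thesis unfolding r_def by (simp only: sum_divide_distrib diff_divide_distrib)
      qed
      have "\<bar>r t\<bar> \<le> \<epsilon> / B * (\<Sum>j<m. \<bar>\<gamma> t j - ?x j\<bar>) / \<bar>t - t0\<bar>"
        unfolding rt abs_divide using elim by (intro divide_right_mono \<delta>(2)) auto
      also have "\<dots> = \<epsilon> / B * (\<Sum>j<m. \<bar>?q j t\<bar>)"
        unfolding abs_divide sum_divide_distrib[symmetric] by simp
      also have "\<dots> < \<epsilon> / B * B"
        using elim \<open>\<epsilon> / B > 0\<close> by (intro mult_strict_left_mono) auto
      finally show ?case using B by (simp add: dist_real_def)
    qed
  qed
  then have "((\<lambda>t. (\<Sum>j<m. ?q j t * pderivative j f ?x) + r t) \<longlongrightarrow>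
      (\<Sum>j<m. \<gamma>' j * pderivative j f ?x) + 0) (at t0)"
    using q by (intro tendsto_add tendsto_sum tendsto_mult_right) auto
  then show ?thesis unfolding has_field_derivative_iff r_def by simp
qed

text \<open>The mean value theorem, applied first in the \<open>i\<close>-th and then in the \<open>j\<close>-th coordinate.\<close>

lemma second_difference:
  assumes C2: "Ck m U 2 f" and ij: "i < m" "j < m" "i \<noteq> j" and h: "h > 0"
    and box: "\<And>s t. s \<in> {x i..x i + h} \<Longrightarrow> t \<in> {x j..x j + h} \<Longrightarrow> x(i := s, j := t) \<in> U"
  obtains s t where "s \<in> {x i..x i + h}" "t \<in> {x j..x j + h}"
    "f (x(i := x i + h, j := x j + h)) - f (x(i := x i + h)) - f (x(j := x j + h)) + f x =
      h * h * pderivative j (pderivative i f) (x(i := s, j := t))"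
proof -
  let ?g = "\<lambda>s. f (x(i := s, j := x j + h)) - f (x(i := s, j := x j))"
  have C1: "Ck m U (Suc 0) f" and C1': "Ck m U (Suc 0) (pderivative i f)"
    using C2 ij(1) by (auto simp: numeral_2_eq_2)
  have upd: "x(i := s, j := t) = (x(j := t))(i := s)" for s t using ij(3) by auto
  have "(?g has_real_derivative pderivative i f (x(i := s, j := x j + h)) - pderivative i f (x(i := s, j := x j))) (at s)"
    if s: "x i \<le> s" "s \<le> x i + h" for s
    unfolding upd
    using box[of s "x j + h"] box[of s "x j"] s h
    by (intro DERIV_diff has_pderivative_line[OF C1 _ ij(1)]) (auto simp: upd)
  from MVT2[OF _ this, of "x i" "x i + h"] h obtain s where s: "x i < s" "s < x i + h"
    "?g (x i + h) - ?g (x i) = h * (pderivative i f (x(i := s, j := x j + h)) - pderivative i f (x(i := s, j := x j)))"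
    by auto
  have "((\<lambda>t. pderivative i f (x(i := s, j := t))) has_real_derivative pderivative j (pderivative i f) (x(i := s, j := t))) (at t)"
    if "x j \<le> t" "t \<le> x j + h" for t
    using box[of s t] s that by (intro has_pderivative_line[OF C1' _ ij(2)]) auto
  from MVT2[OF _ this, of "x j" "x j + h"] h obtain t where t: "x j < t" "t < x j + h"
    "pderivative i f (x(i := s, j := x j + h)) - pderivative i f (x(i := s, j := x j)) =
      h * pderivative j (pderivative i f) (x(i := s, j := t))"
    by auto
  have "x(i := x i + h, j := x j) = x(i := x i + h)" "x(i := x i, j := x j + h) = x(j := x j + h)"
    "x(i := x i, j := x j) = x" using ij(3) by auto
  then show ?thesis using that[of s t] s t by (auto simp: algebra_simps)
qed

text \<open>The second difference is symmetric in the two coordinates, so both mixed derivatives take the same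
  value at points arbitrarily close to \<open>x\<close>.\<close>

lemma pderivative_commute:
  assumes C2: "Ck m U 2 f" and x: "x \<in> U" and ij: "i < m" "j < m"
  shows "pderivative i (pderivative j f) x = pderivative j (pderivative i f) x"
proof (cases "i = j")
  case False
  have cont: "continuous_on U (pderivative i (pderivative j f))" "continuous_on U (pderivative j (pderivative i f))"
    using C2 ij by (auto simp: numeral_2_eq_2)
  have "\<bar>pderivative i (pderivative j f) x - pderivative j (pderivative i f) x\<bar> \<le> 2 * \<epsilon>" if e: "\<epsilon> > 0" for \<epsilon>
  proof -
    obtain \<delta>1 where \<delta>1: "\<delta>1 > 0" "\<And>y. y \<in> topspace (Euclidean_space m) \<Longrightarrow> (\<And>i. i < m \<Longrightarrow> \<bar>y i - x i\<bar> < \<delta>1) \<Longrightarrow>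
      y \<in> U \<and> \<bar>pderivative i (pderivative j f) y - pderivative i (pderivative j f) x\<bar> < \<epsilon>"
      using continuous_on_box[OF openU x cont(1) e] by blast
    obtain \<delta>2 where \<delta>2: "\<delta>2 > 0" "\<And>y. y \<in> topspace (Euclidean_space m) \<Longrightarrow> (\<And>i. i < m \<Longrightarrow> \<bar>y i - x i\<bar> < \<delta>2) \<Longrightarrow>
      y \<in> U \<and> \<bar>pderivative j (pderivative i f) y - pderivative j (pderivative i f) x\<bar> < \<epsilon>"
      using continuous_on_box[OF openU x cont(2) e] by blast
    define h where "h = min \<delta>1 \<delta>2 / 2"
    have h: "h > 0" "h < \<delta>1" "h < \<delta>2" using \<delta>1(1) \<delta>2(1) by (auto simp: h_def)
    have xE: "x \<in> topspace (Euclidean_space m)" by (rule open_subset_Euclidean[OF openU x])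
    have near: "x(i := s, j := t) \<in> U \<and>
        \<bar>pderivative i (pderivative j f) (x(i := s, j := t)) - pderivative i (pderivative j f) x\<bar> < \<epsilon> \<and>
        \<bar>pderivative j (pderivative i f) (x(i := s, j := t)) - pderivative j (pderivative i f) x\<bar> < \<epsilon>"
      if "s \<in> {x i..x i + h}" "t \<in> {x j..x j + h}" for s t
    proof -
      have "x(i := s, j := t) \<in> topspace (Euclidean_space m)"
        using xE ij by (auto simp: mem_Euclidean_space)
      moreover have "\<bar>(x(i := s, j := t)) k - x k\<bar> \<le> h" for k using that h by auto
      ultimately show ?thesis using \<delta>1(2) \<delta>2(2) h by (meson le_less_trans)
    qed
    have upd: "x(i := s, j := t) = x(j := t, i := s)" for s t using False by auto
    obtain s t where st: "s \<in> {x i..x i + h}" "t \<in> {x j..x j + h}"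
      "f (x(i := x i + h, j := x j + h)) - f (x(i := x i + h)) - f (x(j := x j + h)) + f x =
        h * h * pderivative j (pderivative i f) (x(i := s, j := t))"
      using second_difference[OF C2 ij False h(1)] near by metis
    obtain s' t' where st': "t' \<in> {x j..x j + h}" "s' \<in> {x i..x i + h}"
      "f (x(j := x j + h, i := x i + h)) - f (x(j := x j + h)) - f (x(i := x i + h)) + f x =
        h * h * pderivative i (pderivative j f) (x(j := t', i := s'))"
      using second_difference[OF C2 ij(2,1) False[symmetric] h(1)] near upd by metis
    have "h * h * pderivative j (pderivative i f) (x(i := s, j := t)) =
        h * h * pderivative i (pderivative j f) (x(i := s', j := t'))"
      using st(3) st'(3) unfolding upd by linarith
    then have "pderivative j (pderivative i f) (x(i := s, j := t)) =
        pderivative i (pderivative j f) (x(i := s', j := t'))" using h(1) by simp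
    then show ?thesis using near[OF st(1,2)] near[OF st'(2,1)] by linarith
  qed
  from this[of "\<bar>pderivative i (pderivative j f) x - pderivative j (pderivative i f) x\<bar> / 4"]
  show ?thesis by force
qed simp

end

section \<open>Composition and locality\<close>

locale euclidean_map = src: euclidean_open m V + tgt: euclidean_open m' U
  for m V m' U +
  fixes \<phi> :: "(nat \<Rightarrow> real) \<Rightarrow> (nat \<Rightarrow> real)"
  assumes \<phi>_in: "y \<in> V \<Longrightarrow> \<phi> y \<in> U"
    and \<phi>_smooth: "i < m' \<Longrightarrow> smooth_on m V (\<lambda>y. \<phi> y i)"
begin

lemma continuous_\<phi>: "continuous_on V \<phi>"
proof (rule continuous_on_coordinatewise_then_product)
  fix i
  show "continuous_on V (\<lambda>y. \<phi> y i)"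
  proof (cases "i < m'")
    case True
    then show ?thesis using Ck_continuous smooth_imp_Ck[OF \<phi>_smooth] by blast
  next
    case False
    then have zero: "\<phi> y i = 0" if "y \<in> V" for y
      using open_subset_Euclidean[OF tgt.openU \<phi>_in[OF that]] by (simp add: mem_Euclidean_space)
    have "continuous_on V (\<lambda>y. \<phi> y i) \<longleftrightarrow> continuous_on V (\<lambda>_. 0 :: real)"
      by (rule continuous_on_cong[OF refl zero])
    then show ?thesis by simp
  qed
qed

lemma chain_rule:
  assumes "Ck m' U (Suc 0) f" "y \<in> V" "i < m"
  shows "((\<lambda>t. f (\<phi> (y(i := t)))) has_real_derivative
    (\<Sum>j<m'. pderivative i (\<lambda>y. \<phi> y j) y * pderivative j f (\<phi> y))) (at (y i))"
proof -
  have "\<forall>\<^sub>F t in nhds (y i). \<phi> (y(i := t)) \<in> topspace (Euclidean_space m')"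
    by (rule eventually_mono[OF eventually_line_in[OF src.openU assms(2,3)]])
      (rule open_subset_Euclidean[OF tgt.openU \<phi>_in])
  moreover have "((\<lambda>t. \<phi> (y(i := t)) j) has_real_derivative pderivative i (\<lambda>y. \<phi> y j) y) (at (y i))"
    if "j < m'" for j
    using has_pderivative[OF smooth_imp_Ck[OF \<phi>_smooth[OF that]] assms(2,3)] .
  ultimately show ?thesis
    using tgt.chain_curve[OF assms(1), of "\<lambda>t. \<phi> (y(i := t))" "y i"] \<phi>_in[OF assms(2)] by simp
qed

lemma Ck_compose: "Ck m' U N f \<Longrightarrow> Ck m V N (\<lambda>y. f (\<phi> y))"
proof (induction N arbitrary: f)
  case 0
  then show ?case using continuous_on_compose2[OF _ continuous_\<phi>, of U f] \<phi>_in by auto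
next
  case (Suc N)
  show ?case
  proof (rule src.Ck_SucI)
    show "continuous_on V (\<lambda>y. f (\<phi> y))"
      using continuous_on_compose2[OF Ck_continuous[OF Suc.prems] continuous_\<phi>] \<phi>_in by auto
    show "((\<lambda>t. f (\<phi> (y(i := t)))) has_real_derivative
      (\<Sum>j<m'. pderivative i (\<lambda>y. \<phi> y j) y * pderivative j f (\<phi> y))) (at (y i))"
      if "y \<in> V" "i < m" for y i
      by (rule chain_rule[OF Ck_mono[OF Suc.prems] that]) simp
    show "Ck m V N (\<lambda>y. \<Sum>j<m'. pderivative i (\<lambda>y. \<phi> y j) y * pderivative j f (\<phi> y))"
      if "i < m" for i
      using Suc.prems smooth_imp_Ck[OF smooth_pderivative[OF \<phi>_smooth that]]
      by (intro src.Ck_sum src.Ck_mult Suc.IH) auto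
  qed
qed

lemma smooth_compose: "smooth_on m' U f \<Longrightarrow> smooth_on m V (\<lambda>y. f (\<phi> y))"
  unfolding smooth_on_iff_Ck using Ck_compose by blast

end

lemma Ck_local:
  assumes "openin (Euclidean_space m) U"
    and "\<And>x. x \<in> U \<Longrightarrow> \<exists>V. openin (Euclidean_space m) V \<and> x \<in> V \<and> V \<subseteq> U \<and> Ck m V N f"
  shows "Ck m U N f"
  using assms(2)
proof (induction N arbitrary: f)
  case 0
  show ?case unfolding Ck.simps continuous_on_eq_continuous_within
  proof
    fix x assume x: "x \<in> U"
    from 0[OF x] obtain V where V: "openin (Euclidean_space m) V" "x \<in> V" "V \<subseteq> U" "continuous_on V f"
      by auto
    obtain S where S: "open S" "V = S \<inter> topspace (Euclidean_space m)"
      using V(1) openin_Euclidean_space_iff by blast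
    have "at x within U = at x within V"
      by (rule at_within_nhd[of x S]) (use S V open_subset_Euclidean[OF assms(1)] in auto)
    then show "continuous (at x within U) f"
      using V by (simp add: continuous_on_eq_continuous_within)
  qed
next
  case (Suc N)
  have loc: "Ck m U N g" if "\<And>V. Ck m V (Suc N) f \<Longrightarrow> Ck m V N g" for g
  proof (rule Suc.IH)
    fix x assume "x \<in> U"
    from Suc.prems[OF this] that
    show "\<exists>V. openin (Euclidean_space m) V \<and> x \<in> V \<and> V \<subseteq> U \<and> Ck m V N g" by blast
  qed
  have "Ck m U N f" by (rule loc) (rule Ck_Suc_imp)
  then have "continuous_on U f" by (rule Ck_continuous)
  moreover have "Ck m U N (pderivative i f)" if "i < m" for i
    by (rule loc) (use that in simp)
  moreover have "(\<lambda>t. f (x(i := t))) differentiable (at (x i))" if "x \<in> U" "i < m" for x i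
  proof -
    from Suc.prems[OF that(1)] obtain V where "x \<in> V" "Ck m V (Suc N) f" by blast
    then show ?thesis using that(2) by simp
  qed
  ultimately show ?case by simp
qed

lemma smooth_on_local:
  assumes "openin (Euclidean_space m) U"
    and "\<And>x. x \<in> U \<Longrightarrow> \<exists>V. openin (Euclidean_space m) V \<and> x \<in> V \<and> V \<subseteq> U \<and> smooth_on m V f"
  shows "smooth_on m U f"
  unfolding smooth_on_iff_Ck
proof
  fix N show "Ck m U N f"
  proof (rule Ck_local[OF assms(1)])
    fix x assume "x \<in> U"
    from assms(2)[OF this] obtain V
      where "openin (Euclidean_space m) V" "x \<in> V" "V \<subseteq> U" "smooth_on m V f" by blast
    then show "\<exists>V. openin (Euclidean_space m) V \<and> x \<in> V \<and> V \<subseteq> U \<and> Ck m V N f"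
      using smooth_imp_Ck[of m V f N] by (intro exI[of _ V]) simp
  qed
qed

section \<open>The exterior derivative in coordinates\<close>

definition std_vec :: "nat \<Rightarrow> nat \<Rightarrow> real" where
  "std_vec j = (\<lambda>i. if i = j then 1 else 0)"

definition dird :: "nat \<Rightarrow> (nat \<Rightarrow> real) \<Rightarrow> ((nat \<Rightarrow> real) \<Rightarrow> real) \<Rightarrow> (nat \<Rightarrow> real) \<Rightarrow> real" where
  "dird m u f y = (\<Sum>j<m. u j * pderivative j f y)"

definition remove_nth :: "nat \<Rightarrow> 'v list \<Rightarrow> 'v list" where
  "remove_nth i vs = take i vs @ drop (Suc i) vs"

text \<open>The exterior derivative of a family of alternating forms; the arguments are extended to constant
  vector fields, whose brackets vanish.\<close>

definition coord_d ::
  "nat \<Rightarrow> ((nat \<Rightarrow> real) \<Rightarrow> (nat \<Rightarrow> real) altform) \<Rightarrow> (nat \<Rightarrow> real) \<Rightarrow> (nat \<Rightarrow> real) altform" where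
  "coord_d m F y = (\<lambda>vs. \<Sum>i<length vs. (-1) ^ i * dird m (vs ! i) (\<lambda>y. F y (remove_nth i vs)) y)"

interpretation coord: transverse_frame UNIV std_vec "\<lambda>j v. v j" m for m
  by unfold_locales simp

lemma remove_nth_simps [simp]:
  "remove_nth 0 (v # vs) = vs"
  "remove_nth (Suc i) (v # vs) = v # remove_nth i vs"
  by (simp_all add: remove_nth_def)

lemma length_remove_nth [simp]: "i < length vs \<Longrightarrow> length (remove_nth i vs) = length vs - 1"
  by (simp add: remove_nth_def)

lemma remove_nth_map: "remove_nth i (map f vs) = map f (remove_nth i vs)"
  by (simp add: remove_nth_def take_map drop_map)

lemma coord_d_Nil [simp]: "coord_d m F y [] = 0"
  by (simp add: coord_d_def)

text \<open>Cartan's formula for a constant vector field: \<open>\<iota>\<^sub>v d = \<partial>\<^sub>v - d \<iota>\<^sub>v\<close>.  It turns the rules for \<open>d\<close> into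
  inductions on the list of arguments.\<close>

lemma coord_d_Cons:
  "coord_d m F y (v # vs) = dird m v (\<lambda>y. F y vs) y - coord_d m (\<lambda>y. contr v (F y)) y vs"
  unfolding coord_d_def length_Cons sum.lessThan_Suc_shift by (simp add: contr_apply sum_negf)

text \<open>Inserting a new vector in place of the \<open>l\<close>-th argument, or in front after deleting that argument,
  differs by the sign $(-1)^l$.\<close>

lemma alternating_sum_update:
  fixes \<alpha> :: "'v altform"
  assumes "alternating \<alpha>"
  shows "(\<Sum>l<length vs. (-1) ^ l * \<alpha> (h l # remove_nth l vs)) = (\<Sum>l<length vs. \<alpha> (vs[l := h l]))"
proof (intro sum.cong refl)
  fix l assume "l \<in> {..<length vs}"
  then have "\<alpha> (vs[l := h l]) = \<alpha> (take l vs @ h l # drop (Suc l) vs)"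
    by (simp add: upd_conv_take_nth_drop)
  also have "\<dots> = (-1) ^ l * \<alpha> (h l # remove_nth l vs)"
    using alternating_move_front[OF assms, of "take l vs" "h l" "drop (Suc l) vs"] \<open>l \<in> _\<close>
    by (simp add: remove_nth_def min_def)
  finally show "(-1) ^ l * \<alpha> (h l # remove_nth l vs) = \<alpha> (vs[l := h l])" ..
qed

context euclidean_open
begin

lemma has_pderivative_smooth:
  "smooth_on m U f \<Longrightarrow> x \<in> U \<Longrightarrow> i < m \<Longrightarrow>
    ((\<lambda>t. f (x(i := t))) has_real_derivative pderivative i f x) (at (x i))"
  using has_pderivative smooth_imp_Ck by blast

lemma pderivative_add:
  assumes "smooth_on m U f" "smooth_on m U g" "x \<in> U" "i < m"
  shows "pderivative i (\<lambda>y. f y + g y) x = pderivative i f x + pderivative i g x"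
  by (intro pderivativeI DERIV_add has_pderivative_smooth assms)

lemma pderivative_mult:
  assumes "smooth_on m U f" "smooth_on m U g" "x \<in> U" "i < m"
  shows "pderivative i (\<lambda>y. f y * g y) x = pderivative i f x * g x + pderivative i g x * f x"
  using DERIV_mult[OF has_pderivative_smooth[OF assms(1,3,4)] has_pderivative_smooth[OF assms(2,3,4)]]
  unfolding fun_upd_triv by (rule pderivativeI)

lemma pderivative_const [simp]: "pderivative i (\<lambda>_. c) x = 0"
  by (intro pderivativeI DERIV_const)

lemma smooth_scale: "smooth_on m U f \<Longrightarrow> smooth_on m U (\<lambda>y. c * f y)"
  by (intro smooth_mult smooth_const)

lemma smooth_minus: "smooth_on m U f \<Longrightarrow> smooth_on m U (\<lambda>y. - f y)"
  using smooth_scale[of f "-1"] by simp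

lemma smooth_diff: "smooth_on m U f \<Longrightarrow> smooth_on m U g \<Longrightarrow> smooth_on m U (\<lambda>y. f y - g y)"
  using smooth_add[of f "\<lambda>y. - g y"] smooth_minus[of g] by simp

lemma smooth_dird: "smooth_on m U f \<Longrightarrow> smooth_on m U (dird m u f)"
  unfolding dird_def[abs_def] by (intro smooth_sum smooth_scale smooth_pderivative) auto

lemma dird_cong: "(\<And>y. y \<in> U \<Longrightarrow> f y = g y) \<Longrightarrow> x \<in> U \<Longrightarrow> dird m u f x = dird m u g x"
  unfolding dird_def by (intro sum.cong refl arg_cong2[of _ _ _ _ "(*)"] pderivative_cong[OF openU]) auto

lemma dird_add:
  "smooth_on m U f \<Longrightarrow> smooth_on m U g \<Longrightarrow> x \<in> U \<Longrightarrow>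
    dird m u (\<lambda>y. f y + g y) x = dird m u f x + dird m u g x"
  unfolding dird_def by (simp add: pderivative_add algebra_simps sum.distrib)

lemma dird_mult:
  "smooth_on m U f \<Longrightarrow> smooth_on m U g \<Longrightarrow> x \<in> U \<Longrightarrow>
    dird m u (\<lambda>y. f y * g y) x = dird m u f x * g x + f x * dird m u g x"
  unfolding dird_def by (simp add: pderivative_mult algebra_simps sum.distrib sum_distrib_left)

lemma dird_const [simp]: "dird m u (\<lambda>_. c) x = 0"
  by (simp add: dird_def)

lemma dird_scale: "smooth_on m U f \<Longrightarrow> x \<in> U \<Longrightarrow> dird m u (\<lambda>y. c * f y) x = c * dird m u f x"
  using dird_mult[OF smooth_const, of f x u c] by simp

lemma dird_minus: "smooth_on m U f \<Longrightarrow> x \<in> U \<Longrightarrow> dird m u (\<lambda>y. - f y) x = - dird m u f x"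
  using dird_scale[of f x u "-1"] by simp

lemma dird_sum:
  "(\<And>j. j \<in> I \<Longrightarrow> smooth_on m U (f j)) \<Longrightarrow> x \<in> U \<Longrightarrow>
    dird m u (\<lambda>y. \<Sum>j\<in>I. f j y) x = (\<Sum>j\<in>I. dird m u (f j) x)"
proof (induction I rule: infinite_finite_induct)
  case (insert i I)
  then show ?case by (simp add: dird_add smooth_sum)
qed simp_all

lemma dird_commute:
  assumes "smooth_on m U f" "x \<in> U"
  shows "dird m u (dird m v f) x = dird m v (dird m u f) x"
proof -
  have eq: "dird m u (dird m v f) x = (\<Sum>j<m. \<Sum>i<m. v j * (u i * pderivative i (pderivative j f) x))" for u v
  proof -
    have "dird m u (dird m v f) x = (\<Sum>j<m. dird m u (\<lambda>y. v j * pderivative j f y) x)"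
      unfolding dird_def[of m v f, abs_def]
      by (rule dird_sum) (use assms smooth_scale smooth_pderivative in auto)
    also have "\<dots> = (\<Sum>j<m. v j * dird m u (pderivative j f) x)"
      by (intro sum.cong refl dird_scale smooth_pderivative assms) auto
    finally show ?thesis by (simp add: dird_def sum_distrib_left)
  qed
  have "dird m u (dird m v f) x = (\<Sum>i<m. \<Sum>j<m. v j * (u i * pderivative i (pderivative j f) x))"
    unfolding eq by (rule sum.swap)
  also have "\<dots> = (\<Sum>i<m. \<Sum>j<m. u i * (v j * pderivative j (pderivative i f) x))"
    using pderivative_commute[OF smooth_imp_Ck[OF assms(1)] assms(2)]
    by (intro sum.cong refl) simp
  finally show ?thesis unfolding eq .
qed

lemma dird_std_sum: "dird m v f x = (\<Sum>j<m. v j * dird m (std_vec j) f x)"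
proof -
  have "dird m (std_vec j) f x = pderivative j f x" if "j < m" for j
    using that by (simp add: dird_def std_vec_def if_distrib[of "\<lambda>c. c * _"] cong: if_cong)
  then show ?thesis by (simp add: dird_def)
qed

text \<open>Families of forms with smooth values on constant vectors.\<close>

definition sfam :: "((nat \<Rightarrow> real) \<Rightarrow> (nat \<Rightarrow> real) altform) \<Rightarrow> bool" where
  "sfam F \<longleftrightarrow> (\<forall>vs. smooth_on m U (\<lambda>y. F y vs))"

lemma sfamD: "sfam F \<Longrightarrow> smooth_on m U (\<lambda>y. F y vs)"
  by (simp add: sfam_def)

lemma sfam_contr: "sfam F \<Longrightarrow> sfam (\<lambda>y. contr v (F y))"
  by (simp add: sfam_def contr_apply)

lemma sfam_twist: "sfam F \<Longrightarrow> sfam (\<lambda>y. twist (F y))"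
  by (simp add: sfam_def twist_def smooth_scale)

lemma sfam_add: "sfam F \<Longrightarrow> sfam G \<Longrightarrow> sfam (\<lambda>y. F y + G y)"
  by (simp add: sfam_def fun_ops smooth_add)

lemma sfam_scale: "sfam F \<Longrightarrow> sfam (\<lambda>y. c *\<^sub>R F y)"
  by (simp add: sfam_def fun_ops smooth_scale)

lemma sfam_coord_d: "sfam F \<Longrightarrow> sfam (coord_d m F)"
  unfolding sfam_def coord_d_def by (intro allI smooth_sum smooth_scale smooth_dird) blast

lemma sfam_dird: "sfam F \<Longrightarrow> sfam (\<lambda>y vs. dird m v (\<lambda>y. F y vs) y)"
  unfolding sfam_def by (intro allI smooth_dird) blast

lemma sfam_wedge: "sfam F \<Longrightarrow> sfam G \<Longrightarrow> sfam (\<lambda>y. wedge (F y) (G y))"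
  unfolding sfam_def wedge_def by (intro allI smooth_sum smooth_mult smooth_const) blast+

lemma coord_d_cong: "(\<And>y. y \<in> U \<Longrightarrow> F y = G y) \<Longrightarrow> x \<in> U \<Longrightarrow> coord_d m F x = coord_d m G x"
  unfolding coord_d_def by (intro ext sum.cong refl arg_cong2[of _ _ _ _ "(*)"] dird_cong) auto

lemma coord_d_add:
  "sfam F \<Longrightarrow> sfam G \<Longrightarrow> x \<in> U \<Longrightarrow> coord_d m (\<lambda>y. F y + G y) x = coord_d m F x + coord_d m G x"
  unfolding coord_d_def fun_eq_iff fun_ops
  by (auto simp: dird_add sfamD algebra_simps sum.distrib)

lemma coord_d_scale: "sfam F \<Longrightarrow> x \<in> U \<Longrightarrow> coord_d m (\<lambda>y. c *\<^sub>R F y) x = c *\<^sub>R coord_d m F x"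
  unfolding coord_d_def fun_eq_iff fun_ops
  by (auto simp: dird_scale sfamD algebra_simps sum_distrib_left)

lemma coord_d_minus: "sfam F \<Longrightarrow> x \<in> U \<Longrightarrow> coord_d m (\<lambda>y. - F y) x = - coord_d m F x"
  using coord_d_scale[of F x "-1"] by simp

lemma coord_d_diff:
  assumes "sfam F" "sfam G" "x \<in> U"
  shows "coord_d m (\<lambda>y. F y - G y) x = coord_d m F x - coord_d m G x"
  using coord_d_add[OF assms(1) sfam_scale[OF assms(2), of "-1"] assms(3)]
    coord_d_scale[OF assms(2,3), of "-1"] by simp

lemma sfam_0: "sfam (\<lambda>_. 0)"
  by (simp add: sfam_def fun_ops smooth_const)

lemma sfam_sum: "(\<And>j. j \<in> I \<Longrightarrow> sfam (F j)) \<Longrightarrow> sfam (\<lambda>y. \<Sum>j\<in>I. F j y)"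
  by (induction I rule: infinite_finite_induct) (auto intro: sfam_0 sfam_add)

lemma coord_d_0: "coord_d m (\<lambda>_. 0) x = 0"
  by (simp add: coord_d_def fun_eq_iff fun_ops)

lemma coord_d_sum:
  "(\<And>j. j \<in> I \<Longrightarrow> sfam (F j)) \<Longrightarrow> x \<in> U \<Longrightarrow>
    coord_d m (\<lambda>y. \<Sum>j\<in>I. F j y) x = (\<Sum>j\<in>I. coord_d m (F j) x)"
proof (induction I rule: infinite_finite_induct)
  case (insert i I)
  then show ?case by (simp add: coord_d_add sfam_sum)
qed (simp_all add: coord_d_0)

lemma coord_d_twist:
  assumes "sfam F" "x \<in> U"
  shows "coord_d m (\<lambda>y. twist (F y)) x = - twist (coord_d m F x)"
proof
  fix vs
  have "coord_d m (\<lambda>y. twist (F y)) x vs =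
      (\<Sum>i<length vs. (-1) ^ i * ((-1) ^ (length vs - 1) * dird m (vs ! i) (\<lambda>y. F y (remove_nth i vs)) x))"
    unfolding coord_d_def twist_def
    using dird_scale[OF sfamD[OF assms(1)] assms(2)] by (intro sum.cong refl) simp
  also have "\<dots> = (-1) ^ (length vs - 1) * coord_d m F x vs"
    by (simp add: coord_d_def sum_distrib_left mult_ac)
  finally show "coord_d m (\<lambda>y. twist (F y)) x vs = (- twist (coord_d m F x)) vs"
    by (cases vs) (simp_all add: twist_def fun_ops)
qed

lemma contr_coord_d:
  "contr v (coord_d m F x) = (\<lambda>vs. dird m v (\<lambda>y. F y vs) x) - coord_d m (\<lambda>y. contr v (F y)) x"
  by (simp add: fun_eq_iff fun_ops contr_apply[of v "coord_d m F x"] coord_d_Cons)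

lemma dird_wedge:
  assumes "sfam F" "sfam G" "x \<in> U"
  shows "dird m v (\<lambda>y. wedge (F y) (G y) vs) x =
    wedge (\<lambda>vs. dird m v (\<lambda>y. F y vs) x) (G x) vs + wedge (F x) (\<lambda>vs. dird m v (\<lambda>y. G y vs) x) vs"
proof -
  have "dird m v (\<lambda>y. wedge (F y) (G y) vs) x = (\<Sum>I\<in>Pow {..<length vs}.
      dird m v (\<lambda>y. shuffle_sign (length vs) I * F y (nths vs I) * G y (nths vs (- I))) x)"
    unfolding wedge_def
    by (rule dird_sum[OF _ assms(3)]) (intro smooth_mult smooth_const sfamD assms)
  also have "\<dots> = (\<Sum>I\<in>Pow {..<length vs}.
      shuffle_sign (length vs) I * dird m v (\<lambda>y. F y (nths vs I)) x * G x (nths vs (- I)) +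
      shuffle_sign (length vs) I * F x (nths vs I) * dird m v (\<lambda>y. G y (nths vs (- I))) x)"
    using assms by (intro sum.cong refl) (simp add: dird_mult dird_scale smooth_scale sfamD)
  finally show ?thesis by (simp add: wedge_def sum.distrib)
qed

lemma leibniz:
  assumes "sfam F" "sfam G" "x \<in> U"
  shows "coord_d m (\<lambda>y. wedge (F y) (G y)) x =
    wedge (coord_d m F x) (G x) + wedge (twist (F x)) (coord_d m G x)"
proof
  fix vs
  show "coord_d m (\<lambda>y. wedge (F y) (G y)) x vs =
    (wedge (coord_d m F x) (G x) + wedge (twist (F x)) (coord_d m G x)) vs"
    using assms(1,2)
  proof (induction vs arbitrary: F G)
    case (Cons v vs)
    note s = Cons.prems sfam_contr[OF Cons.prems(1), of v] sfam_contr[OF Cons.prems(2), of v]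
      sfam_twist[OF Cons.prems(1)]
    have "coord_d m (\<lambda>y. wedge (F y) (G y)) x (v # vs) = dird m v (\<lambda>y. wedge (F y) (G y) vs) x
        - coord_d m (\<lambda>y. wedge (contr v (F y)) (G y) + wedge (twist (F y)) (contr v (G y))) x vs"
      by (simp add: coord_d_Cons contr_wedge)
    also have "coord_d m (\<lambda>y. wedge (contr v (F y)) (G y) + wedge (twist (F y)) (contr v (G y))) x vs =
        coord_d m (\<lambda>y. wedge (contr v (F y)) (G y)) x vs + coord_d m (\<lambda>y. wedge (twist (F y)) (contr v (G y))) x vs"
      using coord_d_add[OF sfam_wedge[OF s(3,2)] sfam_wedge[OF s(5,4)] assms(3)] by (simp add: fun_ops)
    finally show ?case
      unfolding Cons.IH[OF s(3,2)] Cons.IH[OF s(5,4)] dird_wedge[OF s(1,2) assms(3)]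
        coord_d_twist[OF s(1) assms(3)]
      by (simp add: wedge_Cons contr_coord_d wedge_simps fun_ops)
  qed (simp add: fun_ops)
qed

lemma dird_coord_d:
  assumes "sfam F" "x \<in> U"
  shows "dird m v (\<lambda>y. coord_d m F y vs) x = coord_d m (\<lambda>y vs. dird m v (\<lambda>y. F y vs) y) x vs"
proof -
  have "dird m v (\<lambda>y. coord_d m F y vs) x =
      (\<Sum>i<length vs. dird m v (\<lambda>y. (-1) ^ i * dird m (vs ! i) (\<lambda>y. F y (remove_nth i vs)) y) x)"
    unfolding coord_d_def
    by (rule dird_sum[OF _ assms(2)]) (intro smooth_scale smooth_dird sfamD assms)
  also have "\<dots> = (\<Sum>i<length vs. (-1) ^ i * dird m (vs ! i) (dird m v (\<lambda>y. F y (remove_nth i vs))) x)"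
    using assms dird_scale[OF smooth_dird[OF sfamD[OF assms(1)]] assms(2)] dird_commute[OF sfamD[OF assms(1)] assms(2)]
    by (intro sum.cong refl) simp
  finally show ?thesis by (simp add: coord_d_def)
qed

lemma coord_d_d:
  assumes "sfam F" "x \<in> U"
  shows "coord_d m (coord_d m F) x = 0"
proof
  fix vs show "coord_d m (coord_d m F) x vs = 0 vs"
    using assms(1)
  proof (induction vs arbitrary: F)
    case (Cons v vs)
    note s = sfam_contr[OF Cons.prems, of v]
    have "coord_d m (\<lambda>y. contr v (coord_d m F y)) x vs =
        coord_d m (\<lambda>y vs. dird m v (\<lambda>y. F y vs) y) x vs - coord_d m (coord_d m (\<lambda>y. contr v (F y))) x vs"
      unfolding contr_coord_d
      using coord_d_diff[OF sfam_dird[OF Cons.prems] sfam_coord_d[OF s] assms(2)] by (simp add: fun_ops)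
    then show ?case
      using Cons.IH[OF s] dird_coord_d[OF Cons.prems assms(2)] by (simp add: coord_d_Cons fun_ops)
  qed (simp add: fun_ops)
qed

lemma expands_coord_d:
  assumes "sfam F" "\<And>y. y \<in> U \<Longrightarrow> coord.expands m (F y)" "x \<in> U"
  shows "coord.expands m (coord_d m F x)"
proof -
  have "coord_d m F x (us @ v # ws) = (\<Sum>j<m. v j * coord_d m F x (us @ std_vec j # ws))" for us v ws
    using assms(1,2)
  proof (induction us arbitrary: F)
    case Nil
    note s = sfam_contr[OF Nil(1)]
    have "coord_d m (\<lambda>y. contr v (F y)) x = coord_d m (\<lambda>y. \<Sum>j<m. v j *\<^sub>R contr (std_vec j) (F y)) x"
      using coord.expands_contr_eq[OF Nil(2) UNIV_I] by (rule coord_d_cong[OF _ assms(3)])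
    also have "\<dots> = (\<Sum>j<m. v j *\<^sub>R coord_d m (\<lambda>y. contr (std_vec j) (F y)) x)"
      by (simp add: coord_d_sum[OF sfam_scale[OF s] assms(3)] coord_d_scale[OF s assms(3)])
    finally show ?case
      using dird_std_sum[of v "\<lambda>y. F y ws" x]
      by (simp add: coord_d_Cons sum_fun_apply fun_ops algebra_simps sum_subtractf)
  next
    case (Cons u us)
    have "dird m u (\<lambda>y. F y (us @ v # ws)) x = dird m u (\<lambda>y. \<Sum>j<m. v j * F y (us @ std_vec j # ws)) x"
      using coord.expandsD[OF Cons.prems(2) UNIV_I] by (rule dird_cong[OF _ assms(3)])
    also have "\<dots> = (\<Sum>j<m. v j * dird m u (\<lambda>y. F y (us @ std_vec j # ws)) x)"
      by (simp add: dird_sum[OF smooth_scale[OF sfamD[OF Cons.prems(1)]] assms(3)]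
          dird_scale[OF sfamD[OF Cons.prems(1)] assms(3)])
    finally show ?case
      using Cons.IH[OF sfam_contr[OF Cons.prems(1)] coord.expands_contr[OF Cons.prems(2)], of u]
      by (simp add: coord_d_Cons algebra_simps sum_subtractf)
  qed
  then show ?thesis unfolding coord.expands_def by blast
qed

lemma alternating_coord_d:
  assumes "sfam F" "\<And>y. y \<in> U \<Longrightarrow> alternating (F y)" "x \<in> U"
  shows "alternating (coord_d m F x)"
proof -
  have "coord_d m F x (us @ v # w # ws) = - coord_d m F x (us @ w # v # ws)" for us v w ws
    using assms(1,2)
  proof (induction us arbitrary: F)
    case Nil
    have "coord_d m (\<lambda>y. contr w (contr v (F y))) x = coord_d m (\<lambda>y. - contr v (contr w (F y))) x"
      by (rule coord_d_cong[OF _ assms(3)]) (rule alternating_contr_swap[OF Nil(2)])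
    also have "\<dots> = - coord_d m (\<lambda>y. contr v (contr w (F y))) x"
      by (rule coord_d_minus[OF sfam_contr[OF sfam_contr[OF Nil(1)]] assms(3)])
    finally show ?case by (simp add: coord_d_Cons contr_apply fun_ops)
  next
    case (Cons u us)
    have "dird m u (\<lambda>y. F y (us @ v # w # ws)) x = dird m u (\<lambda>y. - F y (us @ w # v # ws)) x"
      by (rule dird_cong[OF _ assms(3)]) (rule alternatingD[OF Cons.prems(2)])
    also have "\<dots> = - dird m u (\<lambda>y. F y (us @ w # v # ws)) x"
      by (rule dird_minus[OF sfamD[OF Cons.prems(1)] assms(3)])
    finally show ?case
      using Cons.IH[OF sfam_contr[OF Cons.prems(1)] alternating_contr[OF Cons.prems(2)], of u]
      by (simp add: coord_d_Cons)
  qed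
  then show ?thesis unfolding alternating_def by blast
qed

text \<open>For a vector field with variable coefficients, \<open>d \<iota>\<^sub>X\<close> contains additional terms with the
  derivatives of the coefficients.  They are the terms of the Lie derivative that come from
  brackets.\<close>

lemma coord_d_contr_field:
  assumes F: "sfam F" "\<And>y. y \<in> U \<Longrightarrow> coord.expands m (F y)" and x: "x \<in> U"
    and X: "\<And>j. j < m \<Longrightarrow> smooth_on m U (\<lambda>y. X y j)"
  shows "coord_d m (\<lambda>y. contr (X y) (F y)) x vs =
    coord_d m (\<lambda>y. contr (X x) (F y)) x vs +
    (\<Sum>l<length vs. (-1) ^ l * F x ((\<lambda>j. dird m (vs ! l) (\<lambda>y. X y j) x) # remove_nth l vs))"
proof -
  have "dird m u (\<lambda>y. F y (X y # ws)) x =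
      dird m u (\<lambda>y. F y (X x # ws)) x + F x ((\<lambda>j. dird m u (\<lambda>y. X y j) x) # ws)" for u ws
  proof -
    have exp: "F y (v # ws) = (\<Sum>j<m. v j * F y (std_vec j # ws))" if "y \<in> U" for y v
      using coord.expandsD[OF F(2)[OF that] UNIV_I, of "[]" v ws] by simp
    note s = sfamD[OF F(1)]
    have "dird m u (\<lambda>y. F y (X y # ws)) x = dird m u (\<lambda>y. \<Sum>j<m. X y j * F y (std_vec j # ws)) x"
      by (rule dird_cong[OF exp x])
    also have "\<dots> = (\<Sum>j<m. dird m u (\<lambda>y. X y j * F y (std_vec j # ws)) x)"
      by (rule dird_sum[OF _ x]) (use X s smooth_mult in blast)
    also have "\<dots> = (\<Sum>j<m. dird m u (\<lambda>y. X y j) x * F x (std_vec j # ws) +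
        X x j * dird m u (\<lambda>y. F y (std_vec j # ws)) x)"
      by (intro sum.cong refl dird_mult X s x) simp
    also have "\<dots> = F x ((\<lambda>j. dird m u (\<lambda>y. X y j) x) # ws) +
        (\<Sum>j<m. X x j * dird m u (\<lambda>y. F y (std_vec j # ws)) x)"
      by (simp add: sum.distrib exp[OF x, of "\<lambda>j. dird m u (\<lambda>y. X y j) x"])
    also have "(\<Sum>j<m. X x j * dird m u (\<lambda>y. F y (std_vec j # ws)) x) = dird m u (\<lambda>y. F y (X x # ws)) x"
    proof -
      have "dird m u (\<lambda>y. F y (X x # ws)) x = dird m u (\<lambda>y. \<Sum>j<m. X x j * F y (std_vec j # ws)) x"
        by (rule dird_cong[OF exp x])
      then show ?thesis
        by (simp add: dird_sum[OF smooth_scale[OF s] x] dird_scale[OF s x])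
    qed
    finally show ?thesis by simp
  qed
  then show ?thesis
    unfolding coord_d_def contr_apply by (simp add: algebra_simps sum.distrib)
qed

end

section \<open>Pullback along smooth maps\<close>

text \<open>Here \<open>H\<close> stands for the second derivative of a map and \<open>J\<close> for its first derivative.  In the
  alternating sum each pair of arguments enters \<open>H\<close> twice, in both orders and with opposite signs.\<close>

lemma symmetric_update_sum_zero:
  fixes \<alpha> :: "'w altform" and J :: "'v \<Rightarrow> 'w"
  assumes sym: "\<And>v w. H v w = H w v"
  shows "alternating \<alpha> \<Longrightarrow>
    (\<Sum>i<length ws. (-1) ^ i * (\<Sum>l<length ws - 1.
      \<alpha> ((map J (remove_nth i ws))[l := H (ws ! i) (remove_nth i ws ! l)]))) = (0 :: real)"
proof (induction ws arbitrary: \<alpha>)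
  case (Cons w ws)
  let ?n = "length ws"
  have split: "(\<Sum>l<?n. \<alpha> ((map J (w # remove_nth i ws))[l := H (ws ! i) ((w # remove_nth i ws) ! l)])) =
      \<alpha> (H (ws ! i) w # map J (remove_nth i ws)) +
      (\<Sum>l<?n - 1. contr (J w) \<alpha> ((map J (remove_nth i ws))[l := H (ws ! i) (remove_nth i ws ! l)]))"
    if "i < ?n" for i
  proof -
    obtain k where k: "?n = Suc k" using \<open>i < ?n\<close> by (cases "length ws") auto
    show ?thesis unfolding k sum.lessThan_Suc_shift by (simp add: contr_apply)
  qed
  have "(\<Sum>i<length (w # ws). (-1) ^ i * (\<Sum>l<length (w # ws) - 1.
      \<alpha> ((map J (remove_nth i (w # ws)))[l := H ((w # ws) ! i) (remove_nth i (w # ws) ! l)]))) =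
      (\<Sum>l<?n. \<alpha> ((map J ws)[l := H w (ws ! l)])) +
      (\<Sum>i<?n. - ((-1) ^ i * (\<Sum>l<?n. \<alpha> ((map J (w # remove_nth i ws))[l := H (ws ! i) ((w # remove_nth i ws) ! l)]))))"
    unfolding length_Cons sum.lessThan_Suc_shift by simp
  also have "(\<Sum>i<?n. - ((-1) ^ i * (\<Sum>l<?n. \<alpha> ((map J (w # remove_nth i ws))[l := H (ws ! i) ((w # remove_nth i ws) ! l)])))) =
      - (\<Sum>i<?n. (-1) ^ i * \<alpha> (H (ws ! i) w # map J (remove_nth i ws))) -
      (\<Sum>i<?n. (-1) ^ i * (\<Sum>l<?n - 1. contr (J w) \<alpha> ((map J (remove_nth i ws))[l := H (ws ! i) (remove_nth i ws ! l)])))"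
    unfolding sum_negf[symmetric] sum_subtractf[symmetric]
  proof (intro sum.cong refl)
    fix i assume "i \<in> {..<?n}"
    then have "i < ?n" by simp
    from split[OF this] show "- ((-1) ^ i * (\<Sum>l<?n. \<alpha> ((map J (w # remove_nth i ws))[l := H (ws ! i) ((w # remove_nth i ws) ! l)]))) =
      - ((-1) ^ i * \<alpha> (H (ws ! i) w # map J (remove_nth i ws))) -
      (-1) ^ i * (\<Sum>l<?n - 1. contr (J w) \<alpha> ((map J (remove_nth i ws))[l := H (ws ! i) (remove_nth i ws ! l)]))"
      by (simp only: distrib_left minus_add_distrib diff_conv_add_uminus)
  qed
  also have "(\<Sum>i<?n. (-1) ^ i * \<alpha> (H (ws ! i) w # map J (remove_nth i ws))) =
      (\<Sum>l<?n. \<alpha> ((map J ws)[l := H w (ws ! l)]))"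
    using alternating_sum_update[OF Cons.prems, where vs = "map J ws" and h = "\<lambda>l. H w (ws ! l)"]
    by (simp add: remove_nth_map sym)
  finally show ?case using Cons.IH[OF alternating_contr[OF Cons.prems]] by simp
qed simp

context euclidean_map
begin

definition jac :: "(nat \<Rightarrow> real) \<Rightarrow> (nat \<Rightarrow> real) \<Rightarrow> nat \<Rightarrow> real" where
  "jac y v = (\<lambda>k. dird m v (\<lambda>y. \<phi> y k) y)"

lemma smooth_expand:
  assumes "tgt.sfam G" "\<And>z. z \<in> U \<Longrightarrow> coord.expands m' (G z)"
    and "\<And>u j. u \<in> set us \<Longrightarrow> j < m' \<Longrightarrow> smooth_on m V (\<lambda>y. u y j)"
  shows "smooth_on m V (\<lambda>y. G (\<phi> y) (map (\<lambda>u. u y) us))"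
  using assms
proof (induction us arbitrary: G)
  case Nil
  then show ?case using smooth_compose[OF tgt.sfamD[OF Nil(1)]] by simp
next
  case (Cons u us)
  have "smooth_on m V (\<lambda>y. \<Sum>j<m'. u y j * contr (std_vec j) (G (\<phi> y)) (map (\<lambda>u. u y) us))"
  proof (intro src.smooth_sum src.smooth_mult)
    fix j assume j: "j \<in> {..<m'}"
    show "smooth_on m V (\<lambda>y. u y j)" using Cons.prems(3)[of u j] j by simp
    show "smooth_on m V (\<lambda>y. contr (std_vec j) (G (\<phi> y)) (map (\<lambda>u. u y) us))"
      by (rule Cons.IH[OF tgt.sfam_contr[OF Cons.prems(1)] coord.expands_contr[OF Cons.prems(2)]])
        (use Cons.prems(3) in auto)
  qed
  moreover have "G (\<phi> y) (map (\<lambda>u. u y) (u # us)) =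
      (\<Sum>j<m'. u y j * contr (std_vec j) (G (\<phi> y)) (map (\<lambda>u. u y) us))" if "y \<in> V" for y
    using coord.expandsD[OF Cons.prems(2)[OF \<phi>_in[OF that]] UNIV_I, of "[]" "u y"] by (simp add: contr_apply)
  ultimately show ?case using src.smooth_on_cong by (metis (no_types, lifting))
qed

lemma dird_compose:
  assumes "smooth_on m' U f" "y \<in> V"
  shows "dird m v (\<lambda>y. f (\<phi> y)) y = dird m' (jac y v) f (\<phi> y)"
proof -
  have "pderivative i (\<lambda>y. f (\<phi> y)) y = (\<Sum>j<m'. pderivative i (\<lambda>y. \<phi> y j) y * pderivative j f (\<phi> y))"
    if "i < m" for i
    by (intro pderivativeI chain_rule[OF smooth_imp_Ck[OF assms(1)] assms(2) that])
  then have "dird m v (\<lambda>y. f (\<phi> y)) y =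
      (\<Sum>i<m. \<Sum>j<m'. v i * pderivative i (\<lambda>y. \<phi> y j) y * pderivative j f (\<phi> y))"
    by (simp add: dird_def sum_distrib_left mult.assoc)
  also have "\<dots> = (\<Sum>j<m'. \<Sum>i<m. v i * pderivative i (\<lambda>y. \<phi> y j) y * pderivative j f (\<phi> y))"
    by (rule sum.swap)
  finally show ?thesis by (simp add: dird_def jac_def sum_distrib_right)
qed

text \<open>The product rule for a form that is evaluated on vectors depending on the point.\<close>

lemma dird_expand:
  assumes "tgt.sfam G" "\<And>z. z \<in> U \<Longrightarrow> coord.expands m' (G z)" and y: "y0 \<in> V"
    and "\<And>u j. u \<in> set us \<Longrightarrow> j < m' \<Longrightarrow> smooth_on m V (\<lambda>y. u y j)"
  shows "dird m v (\<lambda>y. G (\<phi> y) (map (\<lambda>u. u y) us)) y0 =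
    dird m' (jac y0 v) (\<lambda>z. G z (map (\<lambda>u. u y0) us)) (\<phi> y0) +
    (\<Sum>l<length us. G (\<phi> y0) ((map (\<lambda>u. u y0) us)[l := (\<lambda>j. dird m v (\<lambda>y. (us ! l) y j) y0)]))"
  using assms(1,2,4)
proof (induction us arbitrary: G)
  case Nil
  then show ?case using dird_compose[OF tgt.sfamD[OF Nil(1)] y] by simp
next
  case (Cons u us)
  define Gj where "Gj j = (\<lambda>z. contr (std_vec j) (G z))" for j
  have Gj: "tgt.sfam (Gj j)" "\<And>z. z \<in> U \<Longrightarrow> coord.expands m' (Gj j z)" for j
    using tgt.sfam_contr[OF Cons.prems(1)] coord.expands_contr[OF Cons.prems(2)] by (auto simp: Gj_def)
  have us: "\<And>u j. u \<in> set us \<Longrightarrow> j < m' \<Longrightarrow> smooth_on m V (\<lambda>y. u y j)"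
    and u: "\<And>j. j < m' \<Longrightarrow> smooth_on m V (\<lambda>y. u y j)" using Cons.prems(3) by auto
  have exp: "G z (w # ws) = (\<Sum>j<m'. w j * Gj j z ws)" if "z \<in> U" for z w ws
    using coord.expandsD[OF Cons.prems(2)[OF that] UNIV_I, of "[]" w ws] by (simp add: Gj_def contr_apply)
  let ?ms = "\<lambda>y. map (\<lambda>u. u y) us"
  have sm: "smooth_on m V (\<lambda>y. Gj j (\<phi> y) (?ms y))" for j
    by (rule smooth_expand[OF Gj(1)[of j] Gj(2)[of _ j]]) (use us in auto)
  let ?D = "\<lambda>u j. dird m v (\<lambda>y. u y j) y0"
  have "dird m v (\<lambda>y. G (\<phi> y) (u y # ?ms y)) y0 = dird m v (\<lambda>y. \<Sum>j<m'. u y j * Gj j (\<phi> y) (?ms y)) y0"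
    by (rule src.dird_cong[OF exp[OF \<phi>_in] y])
  also have "\<dots> = (\<Sum>j<m'. dird m v (\<lambda>y. u y j * Gj j (\<phi> y) (?ms y)) y0)"
    by (rule src.dird_sum[OF _ y]) (intro src.smooth_mult u sm, auto)
  also have "\<dots> = (\<Sum>j<m'. ?D u j * Gj j (\<phi> y0) (?ms y0) + u y0 j * dird m v (\<lambda>y. Gj j (\<phi> y) (?ms y)) y0)"
    by (intro sum.cong refl src.dird_mult u sm y) auto
  also have "\<dots> = G (\<phi> y0) (?D u # ?ms y0) + (\<Sum>j<m'. u y0 j * dird m v (\<lambda>y. Gj j (\<phi> y) (?ms y)) y0)"
    by (simp add: sum.distrib exp[OF \<phi>_in[OF y]])
  also have "(\<Sum>j<m'. u y0 j * dird m v (\<lambda>y. Gj j (\<phi> y) (?ms y)) y0) =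
      (\<Sum>j<m'. u y0 j * (dird m' (jac y0 v) (\<lambda>z. Gj j z (?ms y0)) (\<phi> y0) +
        (\<Sum>l<length us. Gj j (\<phi> y0) ((?ms y0)[l := ?D (us ! l)]))))"
    by (intro sum.cong refl arg_cong2[of _ _ _ _ "(*)"] Cons.IH[OF Gj(1) Gj(2)] us) auto
  also have "\<dots> = (\<Sum>j<m'. u y0 j * dird m' (jac y0 v) (\<lambda>z. Gj j z (?ms y0)) (\<phi> y0)) +
      (\<Sum>l<length us. \<Sum>j<m'. u y0 j * Gj j (\<phi> y0) ((?ms y0)[l := ?D (us ! l)]))"
    unfolding distrib_left sum.distrib sum_distrib_left
    by (intro arg_cong2[of _ _ _ _ "(+)"] refl sum.swap)
  also have "(\<Sum>j<m'. u y0 j * dird m' (jac y0 v) (\<lambda>z. Gj j z (?ms y0)) (\<phi> y0)) =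
      dird m' (jac y0 v) (\<lambda>z. \<Sum>j<m'. u y0 j * Gj j z (?ms y0)) (\<phi> y0)"
    by (simp add: tgt.dird_sum[OF tgt.smooth_scale[OF tgt.sfamD[OF Gj(1)]] \<phi>_in[OF y]]
        tgt.dird_scale[OF tgt.sfamD[OF Gj(1)] \<phi>_in[OF y]])
  also have "\<dots> = dird m' (jac y0 v) (\<lambda>z. G z (u y0 # ?ms y0)) (\<phi> y0)"
    by (rule tgt.dird_cong[OF exp[symmetric] \<phi>_in[OF y]])
  also have "(\<Sum>l<length us. \<Sum>j<m'. u y0 j * Gj j (\<phi> y0) ((?ms y0)[l := ?D (us ! l)])) =
      (\<Sum>l<length us. G (\<phi> y0) (u y0 # (?ms y0)[l := ?D (us ! l)]))"
    by (simp add: exp[OF \<phi>_in[OF y]])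
  finally show ?case
    unfolding list.map length_Cons sum.lessThan_Suc_shift by simp
qed

lemma smooth_jac: "j < m' \<Longrightarrow> smooth_on m V (\<lambda>y. jac y v j)"
  unfolding jac_def by (intro src.smooth_dird \<phi>_smooth)

text \<open>The exterior derivative commutes with pullback.  The chain rule yields the pullback of \<open>d G\<close> and
  terms with the second derivatives of \<open>\<phi>\<close>; the latter cancel by symmetry.\<close>

lemma coord_d_pullback:
  assumes G: "tgt.sfam G" "\<And>z. z \<in> U \<Longrightarrow> coord.expands m' (G z)" "\<And>z. z \<in> U \<Longrightarrow> alternating (G z)"
    and y: "y \<in> V"
  shows "coord_d m (\<lambda>y ws. G (\<phi> y) (map (jac y) ws)) y ws = coord_d m' G (\<phi> y) (map (jac y) ws)"
proof -
  \<comment> \<open>Symmetry is known for the components below \<open>m'\<close>; the others do not affect values of \<open>G\<close> and are set to zero.\<close>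
  define H where "H v w = (\<lambda>j. if j < m' then dird m v (\<lambda>y. jac y w j) y else 0)" for v w
  have sym: "H v w = H w v" for v w
    unfolding H_def jac_def using src.dird_commute[OF \<phi>_smooth y] by (simp add: fun_eq_iff)
  have upd: "G (\<phi> y) (ws[l := (\<lambda>j. dird m v (\<lambda>y. jac y w j) y)]) = G (\<phi> y) (ws[l := H v w])" for l v w ws
  proof (cases "l < length ws")
    case True
    have e: "coord.expands m' (G (\<phi> y))" by (rule G(2)[OF \<phi>_in[OF y]])
    have "(\<Sum>j<m'. dird m v (\<lambda>y. jac y w j) y * G (\<phi> y) (take l ws @ std_vec j # drop (Suc l) ws)) =
        (\<Sum>j<m'. H v w j * G (\<phi> y) (take l ws @ std_vec j # drop (Suc l) ws))"
      by (intro sum.cong refl) (simp add: H_def)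
    then show ?thesis
      unfolding upd_conv_take_nth_drop[OF True]
        coord.expandsD[OF e UNIV_I, of "take l ws" "H v w" "drop (Suc l) ws"]
        coord.expandsD[OF e UNIV_I, of "take l ws" "\<lambda>j. dird m v (\<lambda>y. jac y w j) y" "drop (Suc l) ws"] .
  qed (simp only: list_update_beyond not_less)
  have trm: "dird m v (\<lambda>y. G (\<phi> y) (map (jac y) us)) y =
      dird m' (jac y v) (\<lambda>z. G z (map (jac y) us)) (\<phi> y) +
      (\<Sum>l<length us. G (\<phi> y) ((map (jac y) us)[l := H v (us ! l)]))" for v us
  proof -
    have "dird m v (\<lambda>y. G (\<phi> y) (map (\<lambda>u. u y) (map (\<lambda>w y. jac y w) us))) y =
      dird m' (jac y v) (\<lambda>z. G z (map (\<lambda>u. u y) (map (\<lambda>w y. jac y w) us))) (\<phi> y) +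
      (\<Sum>l<length (map (\<lambda>w y. jac y w) us). G (\<phi> y) ((map (\<lambda>u. u y) (map (\<lambda>w y. jac y w) us))
        [l := (\<lambda>j. dird m v (\<lambda>y. (map (\<lambda>w y. jac y w) us ! l) y j) y)]))"
      by (rule dird_expand[OF G(1,2) y]) (use smooth_jac in auto)
    then show ?thesis by (simp add: o_def upd[symmetric])
  qed
  have "coord_d m (\<lambda>y ws. G (\<phi> y) (map (jac y) ws)) y ws =
      (\<Sum>i<length ws. (-1) ^ i * dird m' (jac y (ws ! i)) (\<lambda>z. G z (map (jac y) (remove_nth i ws))) (\<phi> y)) +
      (\<Sum>i<length ws. (-1) ^ i * (\<Sum>l<length ws - 1.
        G (\<phi> y) ((map (jac y) (remove_nth i ws))[l := H (ws ! i) (remove_nth i ws ! l)])))"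
    unfolding coord_d_def trm by (simp add: distrib_left sum.distrib)
  also have "(\<Sum>i<length ws. (-1) ^ i * (\<Sum>l<length ws - 1.
        G (\<phi> y) ((map (jac y) (remove_nth i ws))[l := H (ws ! i) (remove_nth i ws ! l)]))) = 0"
    by (rule symmetric_update_sum_zero[OF sym G(3)[OF \<phi>_in[OF y]]])
  finally show ?thesis by (simp add: coord_d_def remove_nth_map)
qed

end

section \<open>Charts and tangent vectors\<close>

lemma tvec_comb_eq: "tvec_comb a v b w = a *\<^sub>R v + b *\<^sub>R w"
  by (simp add: tvec_comb_def fun_eq_iff fun_ops)

lemma tvec_zero_eq: "tvec_zero = 0"
  by (simp add: tvec_zero_def fun_eq_iff fun_ops)

declare split_paired_All [simp del] split_paired_Ex [simp del]

locale smooth_mfd =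
  fixes M :: "'a foliated" and m :: nat
  assumes smooth_manifold: "smooth_manifold M" and m: "mdim M = m"
begin

abbreviation "X \<equiv> points M"
abbreviation "S \<equiv> topspace (points M)"
abbreviation "EE \<equiv> Euclidean_space m"
abbreviation "img c \<equiv> snd c ` fst c"

lemma chart: "c \<in> charts M \<Longrightarrow> is_chart m X c"
  and charts_cover: "x \<in> S \<Longrightarrow> \<exists>c. c \<in> charts_at M x"
  and transition: "c \<in> charts M \<Longrightarrow> c' \<in> charts M \<Longrightarrow> smooth_transition m c c'"
  using smooth_manifold unfolding smooth_manifold_def charts_at_def m by blast+

lemma dom_open: "c \<in> charts M \<Longrightarrow> openin X (fst c)"
  and img_open: "c \<in> charts M \<Longrightarrow> openin EE (img c)"
  and chart_homeo: "c \<in> charts M \<Longrightarrow>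
    homeomorphic_map (subtopology X (fst c)) (subtopology EE (img c)) (snd c)"
  using chart unfolding is_chart_def by auto

lemma dom_subset: "c \<in> charts M \<Longrightarrow> fst c \<subseteq> S"
  using dom_open openin_subset by blast

lemma chart_inj: "c \<in> charts M \<Longrightarrow> inj_on (snd c) (fst c)"
  using homeomorphic_imp_injective_map[OF chart_homeo] dom_subset
  by (metis topspace_subtopology_subset)

lemma chart_inv_left [simp]: "c \<in> charts M \<Longrightarrow> x \<in> fst c \<Longrightarrow> chart_inv c (snd c x) = x"
  unfolding chart_inv_def by (rule inv_into_f_f[OF chart_inj])

lemma chart_inv_right [simp]: "y \<in> img c \<Longrightarrow> snd c (chart_inv c y) = y"
  unfolding chart_inv_def by (rule f_inv_into_f)

lemma chart_inv_in [simp]: "y \<in> img c \<Longrightarrow> chart_inv c y \<in> fst c"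
  unfolding chart_inv_def by (rule inv_into_into)

lemma image_open:
  assumes "c \<in> charts M" "openin X W" "W \<subseteq> fst c"
  shows "openin EE (snd c ` W)"
proof -
  have "openin (subtopology X (fst c)) W" using assms(2,3) openin_open_subtopology[OF dom_open[OF assms(1)]] by blast
  then have "openin (subtopology EE (img c)) (snd c ` W)"
    using homeomorphic_imp_open_map[OF chart_homeo[OF assms(1)]] by (auto simp: open_map_def)
  then show ?thesis using openin_open_subtopology[OF img_open[OF assms(1)]] by blast
qed

lemma euclid_img: "c \<in> charts M \<Longrightarrow> euclidean_open m (img c)"
  by unfold_locales (rule img_open)

lemma transition_map:
  assumes "c \<in> charts M" "c' \<in> charts M" "openin X W" "W \<subseteq> fst c \<inter> fst c'"
  shows "euclidean_map m (snd c ` W) m (snd c' ` W) (\<lambda>y. snd c' (chart_inv c y))"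
proof unfold_locales
  show "openin EE (snd c ` W)" "openin EE (snd c' ` W)" using image_open assms by auto
  show "snd c' (chart_inv c y) \<in> snd c' ` W" if "y \<in> snd c ` W" for y
    using that assms chart_inv_left[OF assms(1)] by auto
  have "snd c ` W \<subseteq> snd c ` (fst c \<inter> fst c')" using assms(4) by blast
  then show "smooth_on m (snd c ` W) (\<lambda>y. snd c' (chart_inv c y) i)" if "i < m" for i
    using transition[OF assms(1,2)] that smooth_on_subset unfolding smooth_transition_def by blast
qed

lemma chart_dderiv_eq: "chart_dderiv M c u f x = dird m u (\<lambda>y. f (chart_inv c y)) (snd c x)"
  by (simp add: chart_dderiv_def dird_def m)

lemma charts_atD: "c \<in> charts_at M x \<Longrightarrow> c \<in> charts M" "c \<in> charts_at M x \<Longrightarrow> x \<in> fst c"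
  by (auto simp: charts_at_def)

lemma chart_dderiv_change:
  assumes c: "c \<in> charts_at M x" "c' \<in> charts_at M x"
    and W: "openin X W" "x \<in> W" "W \<subseteq> fst c \<inter> fst c'"
    and f: "smooth_on m (snd c' ` W) (\<lambda>y. f (chart_inv c' y))"
  shows "chart_dderiv M c u f x = chart_dderiv M c' (coord_vec M c x u c') f x"
proof -
  note cs = charts_atD[OF c(1)] charts_atD[OF c(2)]
  interpret T: euclidean_map m "snd c ` W" m "snd c' ` W" "\<lambda>y. snd c' (chart_inv c y)"
    by (rule transition_map[OF cs(1,3) W(1,3)])
  have x: "snd c x \<in> snd c ` W" using W by blast
  have "chart_dderiv M c u f x = dird m u (\<lambda>y. f (chart_inv c' (snd c' (chart_inv c y)))) (snd c x)"
    unfolding chart_dderiv_eq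
  proof (rule T.src.dird_cong[OF _ x])
    fix y assume "y \<in> snd c ` W"
    then have "chart_inv c y \<in> W" using W(3) cs(1) by auto
    then show "f (chart_inv c y) = f (chart_inv c' (snd c' (chart_inv c y)))"
      using W(3) cs(3) by auto
  qed
  also have "\<dots> = dird m (T.jac (snd c x) u) (\<lambda>y. f (chart_inv c' y)) (snd c' x)"
    using T.dird_compose[OF f x] cs by simp
  also have "\<dots> = dird m (coord_vec M c x u c') (\<lambda>y. f (chart_inv c' y)) (snd c' x)"
    unfolding dird_def using c(2) m
    by (intro sum.cong refl) (simp add: T.jac_def coord_vec_def chart_dderiv_eq)
  finally show ?thesis unfolding chart_dderiv_eq .
qed

lemma coord_vec_support: "i \<ge> m \<Longrightarrow> coord_vec M c x u c' i = 0"
  using m by (simp add: coord_vec_def)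

lemma coord_vec_outside: "c' \<notin> charts_at M x \<Longrightarrow> coord_vec M c x u c' = (\<lambda>_. 0)"
  by (simp add: coord_vec_def)

lemma coord_vec_apply:
  "c' \<in> charts_at M x \<Longrightarrow> i < m \<Longrightarrow> coord_vec M c x u c' i = chart_dderiv M c u (\<lambda>y. snd c' y i) x"
  using m by (simp add: coord_vec_def)

lemma coord_smooth:
  assumes "c \<in> charts M" "c' \<in> charts M" "W \<subseteq> fst c \<inter> fst c'" "i < m"
  shows "smooth_on m (snd c ` W) (\<lambda>y. snd c' (chart_inv c y) i)"
proof -
  have "snd c ` W \<subseteq> snd c ` (fst c \<inter> fst c')" using assms(3) by blast
  then show ?thesis
    using transition[OF assms(1,2)] assms(4) smooth_on_subset unfolding smooth_transition_def by blast
qed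

lemma overlap_open: "c \<in> charts M \<Longrightarrow> c' \<in> charts M \<Longrightarrow> openin X (fst c \<inter> fst c')"
  by (intro openin_Int dom_open)

lemma coord_vec_in_tangent:
  assumes c: "c \<in> charts_at M x"
  shows "coord_vec M c x u \<in> tangent_space M x"
  unfolding tangent_space_def
proof (intro CollectI conjI ballI allI impI)
  fix c1 assume "c1 \<notin> charts_at M x"
  then show "coord_vec M c x u c1 = (\<lambda>_. 0)" by (rule coord_vec_outside)
next
  fix c1 show "coord_vec M c x u c1 \<in> topspace (Euclidean_space (mdim M))"
    using coord_vec_support m by (simp add: mem_Euclidean_space)
next
  fix c1 c2 i assume c12: "c1 \<in> charts_at M x" "c2 \<in> charts_at M x" and i: "i < mdim M"
  note cs = charts_atD[OF c(1)] charts_atD[OF c12(1)] charts_atD[OF c12(2)]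
  let ?W = "fst c \<inter> fst c1 \<inter> fst c2"
  have W: "openin X ?W" "x \<in> ?W" "?W \<subseteq> fst c \<inter> fst c1" using cs by (auto intro!: openin_Int dom_open)
  have "smooth_on m (snd c1 ` ?W) (\<lambda>y. snd c2 (chart_inv c1 y) i)"
    by (rule coord_smooth) (use cs i m in auto)
  from chart_dderiv_change[OF c(1) c12(1) W this]
  show "coord_vec M c x u c2 i = chart_dderiv M c1 (coord_vec M c x u c1) (\<lambda>y. snd c2 y i) x"
    using i c12(2) m by (simp add: coord_vec_apply)
qed

lemma tangent_coord_vec:
  assumes "v \<in> tangent_space M x" "c \<in> charts_at M x"
  shows "coord_vec M c x (v c) = v"
proof (intro ext)
  fix c' i
  have v: "c' \<notin> charts_at M x \<Longrightarrow> v c' = (\<lambda>_. 0)" "c' \<in> charts_at M x \<Longrightarrow> i \<ge> m \<Longrightarrow> v c' i = 0"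
    "c' \<in> charts_at M x \<Longrightarrow> i < m \<Longrightarrow> v c' i = chart_dderiv M c (v c) (\<lambda>y. snd c' y i) x"
    using assms unfolding tangent_space_def m mem_Euclidean_space by blast+
  consider "c' \<notin> charts_at M x" | "c' \<in> charts_at M x" "i \<ge> m" | "c' \<in> charts_at M x" "i < m"
    by linarith
  then show "coord_vec M c x (v c) c' i = v c' i"
    using v by cases (auto simp: coord_vec_outside coord_vec_support coord_vec_apply)
qed

lemma coord_vec_self:
  assumes "c \<in> charts_at M x" "i < m"
  shows "coord_vec M c x u c i = u i"
proof -
  note cs = charts_atD[OF assms(1)]
  interpret euclidean_open m "img c" by (rule euclid_img[OF cs(1)])
  have "coord_vec M c x u c i = dird m u (\<lambda>y. snd c (chart_inv c y) i) (snd c x)"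
    by (simp add: coord_vec_apply assms chart_dderiv_eq)
  also have "\<dots> = dird m u (\<lambda>y. y i) (snd c x)"
    by (rule dird_cong) (use cs in auto)
  also have "\<dots> = (\<Sum>j<m. u j * (if j = i then 1 else 0))"
  proof -
    have "pderivative j (\<lambda>y. y i) (snd c x) = (if j = i then 1 else 0)" for j
      by (rule pderivativeI) (auto intro!: derivative_eq_intros)
    then show ?thesis by (simp add: dird_def)
  qed
  finally show ?thesis using assms(2) by (simp add: if_distrib cong: if_cong)
qed

lemma coord_vec_std_self:
  assumes "c \<in> charts_at M x" "j < m"
  shows "coord_vec M c x (std_vec j) c = std_vec j"
proof
  fix i show "coord_vec M c x (std_vec j) c i = std_vec j i"
    using coord_vec_self[OF assms(1), of i "std_vec j"] coord_vec_support[of i c x "std_vec j" c] assms(2)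
    by (cases "i < m") (auto simp: std_vec_def)
qed

lemma coord_vec_trans:
  assumes "c \<in> charts_at M x" "c' \<in> charts_at M x"
  shows "coord_vec M c' x (coord_vec M c x u c') = coord_vec M c x u"
  by (rule tangent_coord_vec[OF coord_vec_in_tangent[OF assms(1)] assms(2)])

lemma coord_vec_expand: "coord_vec M c x u = (\<Sum>j<m. u j *\<^sub>R coord_vec M c x (std_vec j))"
proof (intro ext)
  fix c' i
  have dd: "chart_dderiv M c u f x = (\<Sum>j<m. u j * chart_dderiv M c (std_vec j) f x)" for f
    unfolding chart_dderiv_eq dird_def
    by (simp add: std_vec_def if_distrib[of "\<lambda>c. c * _"] cong: if_cong)
  show "coord_vec M c x u c' i = (\<Sum>j<m. u j *\<^sub>R coord_vec M c x (std_vec j)) c' i"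
    unfolding sum_fun_apply fun_ops
    by (cases "c' \<in> charts_at M x \<and> i < m") (auto simp: coord_vec_def dd m)
qed

lemma subspace_tangent: "subspace (tangent_space M x)"
proof -
  have "a *\<^sub>R v + b *\<^sub>R w \<in> tangent_space M x" if vw: "v \<in> tangent_space M x" "w \<in> tangent_space M x" for a b v w
  proof -
    have dd: "chart_dderiv M c (\<lambda>i. a * u i + b * u' i) f x = a * chart_dderiv M c u f x + b * chart_dderiv M c u' f x"
      for c u u' f
      by (simp add: chart_dderiv_def algebra_simps sum.distrib sum_distrib_left)
    have eq: "(a *\<^sub>R v + b *\<^sub>R w) c = (\<lambda>i. a * v c i + b * w c i)" for c
      by (simp add: fun_eq_iff fun_ops)
    show ?thesis
      unfolding tangent_space_def
    proof (intro CollectI conjI ballI allI impI)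
      fix c assume "c \<notin> charts_at M x"
      then show "(a *\<^sub>R v + b *\<^sub>R w) c = (\<lambda>_. 0)" using vw unfolding tangent_space_def eq by auto
    next
      fix c assume "c \<in> charts_at M x"
      then show "(a *\<^sub>R v + b *\<^sub>R w) c \<in> topspace (Euclidean_space (mdim M))"
        using vw unfolding tangent_space_def eq mem_Euclidean_space by auto
    next
      fix c c' i assume "c \<in> charts_at M x" "c' \<in> charts_at M x" "i < mdim M"
      then have "v c' i = chart_dderiv M c (v c) (\<lambda>y. snd c' y i) x"
        "w c' i = chart_dderiv M c (w c) (\<lambda>y. snd c' y i) x"
        using vw unfolding tangent_space_def by blast+
      then show "(a *\<^sub>R v + b *\<^sub>R w) c' i = chart_dderiv M c ((a *\<^sub>R v + b *\<^sub>R w) c) (\<lambda>y. snd c' y i) x"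
        unfolding eq dd by simp
    qed
  qed
  moreover have "0 \<in> tangent_space M x"
    by (simp add: tangent_space_def zero_fun_def mem_Euclidean_space chart_dderiv_def)
  ultimately show ?thesis
    unfolding subspace_def by (metis scaleR_one add.right_neutral scaleR_zero_right)
qed

lemma tangent_outside:
  assumes "x \<notin> S"
  shows "tangent_space M x = {0}"
proof -
  have "charts_at M x = {}" using assms dom_subset unfolding charts_at_def by blast
  then have "v = 0" if "v \<in> tangent_space M x" for v
    using that by (auto simp: tangent_space_def fun_eq_iff fun_ops)
  then show ?thesis using subspace_0[OF subspace_tangent] by auto
qed

section \<open>Differential forms in coordinates\<close>

lemma full_frame:
  "c \<in> charts_at M x \<Longrightarrow> transverse_frame (tangent_space M x) (\<lambda>j. coord_vec M c x (std_vec j)) m"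
  by unfold_locales (rule coord_vec_in_tangent)

abbreviation full_form :: "'a chart \<Rightarrow> 'a \<Rightarrow> nat \<Rightarrow> 'a tvec altform \<Rightarrow> bool" where
  "full_form c x \<equiv> transverse_frame.hform (tangent_space M x)
     (\<lambda>j. coord_vec M c x (std_vec j)) (\<lambda>j v. v c j) m"

text \<open>The representation of a form in the coordinates of a chart, as a family of forms on coordinate
  vectors.\<close>

definition rep :: "'a chart \<Rightarrow> 'a dform \<Rightarrow> (nat \<Rightarrow> real) \<Rightarrow> (nat \<Rightarrow> real) altform" where
  "rep c \<xi> y = (\<lambda>vs. \<xi> (chart_inv c y) (map (coord_vec M c (chart_inv c y)) vs))"

lemma forms_support:
  "\<xi> \<in> forms M k \<Longrightarrow> \<not> (x \<in> S \<and> length vs = k \<and> set vs \<subseteq> tangent_space M x) \<Longrightarrow> \<xi> x vs = 0"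
  unfolding forms_def by blast

lemma forms_linear:
  assumes "\<xi> \<in> forms M k" "v \<in> tangent_space M x" "w \<in> tangent_space M x"
  shows "\<xi> x (us @ (a *\<^sub>R v + b *\<^sub>R w) # ws) = a * \<xi> x (us @ v # ws) + b * \<xi> x (us @ w # ws)"
proof (cases "x \<in> S \<and> set us \<subseteq> tangent_space M x \<and> set ws \<subseteq> tangent_space M x")
  case True
  then show ?thesis using assms unfolding forms_def tvec_comb_eq by blast
next
  case False
  then have "\<xi> x (us @ z # ws) = 0" for z by (intro forms_support[OF assms(1)]) auto
  then show ?thesis by simp
qed

lemma forms_sum:
  assumes "\<xi> \<in> forms M k" "\<And>i. i \<in> I \<Longrightarrow> w i \<in> tangent_space M x" "finite I"
  shows "\<xi> x (us @ (\<Sum>i\<in>I. a i *\<^sub>R w i) # ws) = (\<Sum>i\<in>I. a i * \<xi> x (us @ w i # ws))"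
  using assms(3,2)
proof (induction I rule: finite_induct)
  case empty
  show ?case
    using forms_linear[OF assms(1) subspace_0[OF subspace_tangent] subspace_0[OF subspace_tangent],
      where us = us and a = 0 and b = 0 and ws = ws] by simp
next
  case (insert i I)
  have "(\<Sum>i\<in>I. a i *\<^sub>R w i) \<in> tangent_space M x"
    using insert.prems by (intro subspace_sum subspace_scale subspace_tangent) auto
  then have "\<xi> x (us @ (a i *\<^sub>R w i + 1 *\<^sub>R (\<Sum>i\<in>I. a i *\<^sub>R w i)) # ws) =
      a i * \<xi> x (us @ w i # ws) + 1 * \<xi> x (us @ (\<Sum>i\<in>I. a i *\<^sub>R w i) # ws)"
    using insert.prems by (intro forms_linear[OF assms(1)]) auto
  then show ?case using insert by simp
qed

lemma forms_alternating:
  assumes \<xi>: "\<xi> \<in> forms M k"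
  shows "alternating (\<xi> x)"
  unfolding alternating_def
proof (intro allI)
  fix us v w ws
  show "\<xi> x (us @ v # w # ws) = - \<xi> x (us @ w # v # ws)"
  proof (cases "x \<in> S \<and> v \<in> tangent_space M x \<and> w \<in> tangent_space M x")
    case True
    then have T: "v \<in> tangent_space M x" "w \<in> tangent_space M x" by auto
    have nd: "\<xi> x (us @ z # z # ws) = 0" for z
      using \<xi> True unfolding forms_def by auto
    have "\<xi> x (us @ (1 *\<^sub>R v + 1 *\<^sub>R w) # (1 *\<^sub>R v + 1 *\<^sub>R w) # ws) =
        \<xi> x (us @ v # (1 *\<^sub>R v + 1 *\<^sub>R w) # ws) + \<xi> x (us @ w # (1 *\<^sub>R v + 1 *\<^sub>R w) # ws)"
      unfolding forms_linear[OF \<xi> T] by simp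
    moreover have "\<xi> x (us @ z # (1 *\<^sub>R v + 1 *\<^sub>R w) # ws) = \<xi> x (us @ z # v # ws) + \<xi> x (us @ z # w # ws)" for z
      using forms_linear[OF \<xi> T, of "us @ [z]" 1 1 ws] by simp
    ultimately show ?thesis using nd[of v] nd[of w] nd[of "1 *\<^sub>R v + 1 *\<^sub>R w"] by simp
  next
    case False
    then have "\<xi> x (us @ v # w # ws) = 0" "\<xi> x (us @ w # v # ws) = 0"
      by (intro forms_support[OF \<xi>]; auto)+
    then show ?thesis by simp
  qed
qed

lemma forms_full_form:
  assumes \<xi>: "\<xi> \<in> forms M k" and c: "c \<in> charts_at M x"
  shows "full_form c x k (\<xi> x)"
proof -
  interpret F: transverse_frame "tangent_space M x" "\<lambda>j. coord_vec M c x (std_vec j)" "\<lambda>j v. v c j" m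
    by (rule full_frame[OF c])
  have "F.supported k (\<xi> x)"
    unfolding F.supported_def using forms_support[OF \<xi>] by blast
  moreover have "F.expands (\<xi> x)"
    unfolding F.expands_def
  proof (intro allI impI)
    fix us v ws assume v: "v \<in> tangent_space M x"
    have "v = (\<Sum>j<m. v c j *\<^sub>R coord_vec M c x (std_vec j))"
      using tangent_coord_vec[OF v c] coord_vec_expand[of c x "v c"] by simp
    then have "\<xi> x (us @ v # ws) = \<xi> x (us @ (\<Sum>j<m. v c j *\<^sub>R coord_vec M c x (std_vec j)) # ws)" by simp
    also have "\<dots> = (\<Sum>j<m. v c j * \<xi> x (us @ coord_vec M c x (std_vec j) # ws))"
      by (rule forms_sum[OF \<xi> F.E_in]) auto
    finally show "\<xi> x (us @ v # ws) = (\<Sum>j<m. v c j * \<xi> x (us @ coord_vec M c x (std_vec j) # ws))" .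
  qed
  ultimately show ?thesis unfolding F.hform_def using forms_alternating[OF \<xi>] by blast
qed

lemma rep_homog: "\<xi> \<in> forms M k \<Longrightarrow> length vs \<noteq> k \<Longrightarrow> rep c \<xi> y vs = 0"
  unfolding rep_def by (rule forms_support) auto

lemma charts_at_inv: "c \<in> charts M \<Longrightarrow> y \<in> img c \<Longrightarrow> c \<in> charts_at M (chart_inv c y)"
  by (simp add: charts_at_def)

lemma charts_at_in_S: "c \<in> charts_at M x \<Longrightarrow> x \<in> S"
  using charts_atD dom_subset by blast

lemma full_form_pull_expands:
  assumes \<alpha>: "full_form c x k \<alpha>" and c: "c \<in> charts_at M x"
  shows "coord.expands m (\<lambda>vs. \<alpha> (map (coord_vec M c x) vs))"
proof -
  interpret F: transverse_frame "tangent_space M x" "\<lambda>j. coord_vec M c x (std_vec j)" "\<lambda>j v. v c j" m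
    by (rule full_frame[OF c])
  show ?thesis
    unfolding coord.expands_def
  proof (intro allI impI)
    fix us v ws
    have e: "F.expands \<alpha>" using \<alpha> by (simp add: F.hform_def)
    show "\<alpha> (map (coord_vec M c x) (us @ v # ws)) = (\<Sum>j<m. v j * \<alpha> (map (coord_vec M c x) (us @ std_vec j # ws)))"
      using F.expandsD[OF e coord_vec_in_tangent[OF c], of "map (coord_vec M c x) us" v "map (coord_vec M c x) ws"]
      by (simp add: coord_vec_self[OF c])
  qed
qed

lemma rep_expands: "\<xi> \<in> forms M k \<Longrightarrow> c \<in> charts M \<Longrightarrow> y \<in> img c \<Longrightarrow> coord.expands m (rep c \<xi> y)"
  unfolding rep_def using full_form_pull_expands[OF forms_full_form] charts_at_inv by blast

lemma alternating_map:
  assumes "alternating \<alpha>"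
  shows "alternating (\<lambda>vs. \<alpha> (map f vs))"
  unfolding alternating_def
proof (intro allI)
  fix us v w ws
  show "\<alpha> (map f (us @ v # w # ws)) = - \<alpha> (map f (us @ w # v # ws))"
    using alternatingD[OF assms, of "map f us" "f v" "f w" "map f ws"] by simp
qed

lemma rep_alternating: "\<xi> \<in> forms M k \<Longrightarrow> alternating (rep c \<xi> y)"
  unfolding rep_def by (rule alternating_map[OF forms_alternating])

end

lemma (in euclidean_open) sfam_of_basis:
  assumes "\<And>js. set js \<subseteq> {..<m} \<Longrightarrow> smooth_on m U (\<lambda>y. F y (map std_vec js))"
    and exp: "\<And>y. y \<in> U \<Longrightarrow> coord.expands m (F y)"
  shows "sfam F"
proof -
  have "smooth_on m U (\<lambda>y. F y (map std_vec js @ vs))" if "set js \<subseteq> {..<m}" for js vs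
    using that
  proof (induction vs arbitrary: js)
    case Nil
    then show ?case using assms(1) by simp
  next
    case (Cons v vs)
    have "smooth_on m U (\<lambda>y. \<Sum>j<m. v j * F y (map std_vec js @ std_vec j # vs))"
    proof (intro smooth_sum smooth_scale)
      fix j assume "j \<in> {..<m}"
      then show "smooth_on m U (\<lambda>y. F y (map std_vec js @ std_vec j # vs))"
        using Cons.IH[of "js @ [j]"] Cons.prems by simp
    qed
    moreover have "F y (map std_vec js @ v # vs) = (\<Sum>j<m. v j * F y (map std_vec js @ std_vec j # vs))" if "y \<in> U" for y
      by (rule coord.expandsD[OF exp[OF that] UNIV_I])
    ultimately show ?case using smooth_on_cong by (metis (no_types, lifting))
  qed
  from this[of "[]"] show ?thesis by (simp add: sfam_def)
qed

lemma coord_expands_cong: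
  assumes e: "coord.expands m \<alpha>" and fg: "\<And>v i. v \<in> set vs \<Longrightarrow> i < m \<Longrightarrow> f v i = g v i"
  shows "\<alpha> (us @ map f vs) = \<alpha> (us @ map g vs)"
  using fg
proof (induction vs arbitrary: us)
  case (Cons v vs)
  have "\<alpha> (us @ f v # map f vs) = (\<Sum>j<m. f v j * \<alpha> (us @ std_vec j # map f vs))"
    by (rule coord.expandsD[OF e UNIV_I])
  also have "\<dots> = (\<Sum>j<m. g v j * \<alpha> (us @ std_vec j # map f vs))"
    using Cons.prems by (intro sum.cong) auto
  also have "\<dots> = \<alpha> (us @ g v # map f vs)"
    by (rule coord.expandsD[OF e UNIV_I, symmetric])
  also have "\<dots> = \<alpha> (us @ g v # map g vs)"
    using Cons.IH[of "us @ [g v]"] Cons.prems by simp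
  finally show ?case by simp
qed simp

context smooth_mfd
begin

lemma rep_sfam:
  assumes \<xi>: "\<xi> \<in> forms M k" and c: "c \<in> charts M"
  shows "euclidean_open.sfam m (img c) (rep c \<xi>)"
proof -
  interpret euclidean_open m "img c" by (rule euclid_img[OF c])
  show ?thesis
  proof (rule sfam_of_basis)
    fix js assume js: "set js \<subseteq> {..<m}"
    show "smooth_on m (img c) (\<lambda>y. rep c \<xi> y (map std_vec js))"
    proof (cases "length js = k")
      case True
      then have "chart_smooth M c (\<lambda>x. \<xi> x (map (\<lambda>j. coord_vec M c x (std_vec j)) js))"
        using \<xi> c js m unfolding forms_def std_vec_def by auto
      then show ?thesis by (simp add: chart_smooth_def rep_def o_def m)
    next
      case False
      then have "rep c \<xi> y (map std_vec js) = 0" for y by (simp add: rep_homog[OF \<xi>])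
      then show ?thesis by (simp add: smooth_const)
    qed
  qed (rule rep_expands[OF \<xi> c])
qed

text \<open>The algebraic conditions at a point need to be checked in one chart only, smoothness in every
  chart of the atlas.\<close>

lemma formsI:
  assumes outside: "\<And>x. x \<notin> S \<Longrightarrow> \<xi> x = 0"
    and form: "\<And>x. x \<in> S \<Longrightarrow> \<exists>c\<in>charts_at M x. full_form c x k (\<xi> x)"
    and smooth: "\<And>c js. c \<in> charts M \<Longrightarrow> set js \<subseteq> {..<m} \<Longrightarrow> smooth_on m (img c) (\<lambda>y. rep c \<xi> y (map std_vec js))"
  shows "\<xi> \<in> forms M k"
  unfolding forms_def
proof (intro CollectI conjI allI ballI impI)
  fix x vs assume *: "\<not> (x \<in> S \<and> length vs = k \<and> set vs \<subseteq> tangent_space M x)"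
  show "\<xi> x vs = 0"
  proof (cases "x \<in> S")
    case True
    from form[OF this] obtain c where c: "c \<in> charts_at M x" "full_form c x k (\<xi> x)" by blast
    interpret F: transverse_frame "tangent_space M x" "\<lambda>j. coord_vec M c x (std_vec j)" "\<lambda>j v. v c j" m
      by (rule full_frame[OF c(1)])
    show ?thesis using c(2) * True unfolding F.hform_def F.supported_def by blast
  qed (simp add: outside fun_ops)
next
  fix x us v w ws a b
  assume x: "x \<in> S" and T: "set us \<subseteq> tangent_space M x \<and> v \<in> tangent_space M x \<and>
    w \<in> tangent_space M x \<and> set ws \<subseteq> tangent_space M x"
  from form[OF x] obtain c where c: "c \<in> charts_at M x" "full_form c x k (\<xi> x)" by blast
  interpret F: transverse_frame "tangent_space M x" "\<lambda>j. coord_vec M c x (std_vec j)" "\<lambda>j v. v c j" m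
    by (rule full_frame[OF c(1)])
  have e: "F.expands (\<xi> x)" using c(2) unfolding F.hform_def by blast
  have z: "a *\<^sub>R v + b *\<^sub>R w \<in> tangent_space M x"
    using T by (intro subspace_add subspace_scale subspace_tangent) auto
  show "\<xi> x (us @ tvec_comb a v b w # ws) = a * \<xi> x (us @ v # ws) + b * \<xi> x (us @ w # ws)"
    using F.expandsD[OF e z, of us ws] F.expandsD[OF e, of v us ws] F.expandsD[OF e, of w us ws] T
    by (simp add: tvec_comb_eq fun_ops algebra_simps sum.distrib sum_distrib_left)
next
  fix x and vs :: "'a tvec list" assume nd: "\<not> distinct vs"
  show "\<xi> x vs = 0"
  proof (cases "x \<in> S")
    case True
    from form[OF this] obtain c where c: "c \<in> charts_at M x" "full_form c x k (\<xi> x)" by blast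
    interpret F: transverse_frame "tangent_space M x" "\<lambda>j. coord_vec M c x (std_vec j)" "\<lambda>j v. v c j" m
      by (rule full_frame[OF c(1)])
    show ?thesis using c(2) alternating_not_distinct[OF _ nd] unfolding F.hform_def by blast
  qed (simp add: outside fun_ops)
next
  fix c js assume "c \<in> charts M" "length js = k \<and> set js \<subseteq> {..<mdim M}"
  then show "chart_smooth M c (\<lambda>x. \<xi> x (map (\<lambda>j. coord_vec M c x (\<lambda>i. if i = j then 1 else 0)) js))"
    using smooth[of c js] by (simp add: chart_smooth_def rep_def o_def m std_vec_def[abs_def])
qed

lemma rep_change:
  assumes c: "c \<in> charts M" "c' \<in> charts M" and W: "openin X W" "W \<subseteq> fst c \<inter> fst c'" and y: "y \<in> snd c ` W"
    and e: "coord.expands m (rep c' \<xi> (snd c' (chart_inv c y)))"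
  shows "rep c \<xi> y ws = rep c' \<xi> (snd c' (chart_inv c y))
    (map (euclidean_map.jac m (\<lambda>y. snd c' (chart_inv c y)) y) ws)"
proof -
  interpret T: euclidean_map m "snd c ` W" m "snd c' ` W" "\<lambda>y. snd c' (chart_inv c y)"
    by (rule transition_map[OF c W])
  let ?x = "chart_inv c y"
  have x: "?x \<in> W" using y W c by auto
  have at: "c \<in> charts_at M ?x" "c' \<in> charts_at M ?x" using x W c by (auto simp: charts_at_def)
  have inv: "chart_inv c' (snd c' ?x) = ?x" using x W c by auto
  have "rep c \<xi> y ws = \<xi> ?x (map (coord_vec M c' ?x) (map (\<lambda>w. coord_vec M c ?x w c') ws))"
    unfolding rep_def by (simp add: o_def coord_vec_trans[OF at])
  also have "\<dots> = rep c' \<xi> (snd c' ?x) ([] @ map (\<lambda>w. coord_vec M c ?x w c') ws)"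
    unfolding rep_def by (simp add: inv)
  also have "\<dots> = rep c' \<xi> (snd c' ?x) ([] @ map (T.jac y) ws)"
  proof (rule coord_expands_cong[OF e])
    fix w i assume "i < m"
    then show "coord_vec M c ?x w c' i = T.jac y w i"
      using at y W(2) by (auto simp: coord_vec_apply chart_dderiv_eq T.jac_def)
  qed
  finally show ?thesis by simp
qed

lemma ext_deriv_chart_at:
  assumes "x \<in> S" "set vs \<subseteq> tangent_space M x"
  shows "ext_deriv M \<xi> x vs = coord_d m (rep (chart_at M x) \<xi>) (snd (chart_at M x) x) (map (\<lambda>v. v (chart_at M x)) vs)"
  using assms by (simp add: ext_deriv_def Let_def coord_d_def chart_dderiv_eq rep_def remove_nth_def o_def
      take_map drop_map)

lemma chart_at_in: "x \<in> S \<Longrightarrow> chart_at M x \<in> charts_at M x"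
  unfolding chart_at_def by (rule someI_ex[OF charts_cover])

text \<open>The derivative computed in a chart is independent of the chart, by naturality under the
  transition map.\<close>

lemma coord_d_change:
  assumes \<xi>: "\<xi> \<in> forms M k" and c: "c \<in> charts_at M x" "c' \<in> charts_at M x"
  shows "coord_d m (rep c \<xi>) (snd c x) ws =
    coord_d m (rep c' \<xi>) (snd c' x) (map (\<lambda>w. coord_vec M c x w c') ws)"
proof -
  note cs = charts_atD[OF c(1)] charts_atD[OF c(2)]
  let ?W = "fst c \<inter> fst c'" and ?\<phi> = "\<lambda>y. snd c' (chart_inv c y)"
  have W: "openin X ?W" by (rule overlap_open[OF cs(1,3)])
  interpret T: euclidean_map m "snd c ` ?W" m "snd c' ` ?W" ?\<phi>
    by (rule transition_map[OF cs(1,3) W]) simp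
  interpret C': euclidean_open m "img c'" by (rule euclid_img[OF cs(3)])
  have y: "snd c x \<in> snd c ` ?W" using cs by simp
  have sub: "snd c' ` ?W \<subseteq> img c'" by auto
  have G: "T.tgt.sfam (rep c' \<xi>)"
    using rep_sfam[OF \<xi> cs(3)] smooth_on_subset[OF _ sub] unfolding C'.sfam_def T.tgt.sfam_def by blast
  have E: "coord.expands m (rep c' \<xi> z)" if "z \<in> snd c' ` ?W" for z
    using rep_expands[OF \<xi> cs(3)] that sub by blast
  have "coord_d m (rep c \<xi>) (snd c x) ws = coord_d m (\<lambda>y ws. rep c' \<xi> (?\<phi> y) (map (T.jac y) ws)) (snd c x) ws"
    by (rule fun_cong[OF T.src.coord_d_cong[OF _ y]])
      (use rep_change[OF cs(1,3) W _ _ E[OF T.\<phi>_in]] in auto)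
  also have "\<dots> = coord_d m (rep c' \<xi>) (?\<phi> (snd c x)) (map (T.jac (snd c x)) ws)"
    by (rule T.coord_d_pullback[OF G E rep_alternating[OF \<xi>] y])
  also have "\<dots> = coord_d m (rep c' \<xi>) (snd c' x) ([] @ map (T.jac (snd c x)) ws)"
    using cs by simp
  also have "\<dots> = coord_d m (rep c' \<xi>) (snd c' x) ([] @ map (\<lambda>w. coord_vec M c x w c') ws)"
  proof (rule coord_expands_cong)
    show "coord.expands m (coord_d m (rep c' \<xi>) (snd c' x))"
      by (rule C'.expands_coord_d[OF rep_sfam[OF \<xi> cs(3)] rep_expands[OF \<xi> cs(3)]]) (use cs in auto)
    show "T.jac (snd c x) w i = coord_vec M c x w c' i" if "i < m" for w i
      using that cs c by (simp add: T.jac_def coord_vec_apply chart_dderiv_eq)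
  qed
  finally show ?thesis by simp
qed

lemma ext_deriv_chart:
  assumes \<xi>: "\<xi> \<in> forms M k" and c: "c \<in> charts_at M x" and vs: "set vs \<subseteq> tangent_space M x"
  shows "ext_deriv M \<xi> x vs = coord_d m (rep c \<xi>) (snd c x) (map (\<lambda>v. v c) vs)"
proof -
  let ?c = "chart_at M x"
  have x: "x \<in> S" by (rule charts_at_in_S[OF c])
  have "map (\<lambda>w. coord_vec M c x w ?c) (map (\<lambda>v. v c) vs) = map (\<lambda>v. v ?c) vs"
    using tangent_coord_vec[OF _ c] vs by auto
  with coord_d_change[OF \<xi> c chart_at_in[OF x], of "map (\<lambda>v. v c) vs"]
  show ?thesis unfolding ext_deriv_chart_at[OF x vs, of \<xi>] by (simp only:)
qed

lemma ext_deriv_outside: "\<not> (x \<in> S \<and> set vs \<subseteq> tangent_space M x) \<Longrightarrow> ext_deriv M \<xi> x vs = 0"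
  by (auto simp: ext_deriv_def)

lemma expands_coord_d_rep:
  assumes "\<xi> \<in> forms M k" "c \<in> charts M" "y \<in> img c"
  shows "coord.expands m (coord_d m (rep c \<xi>) y)"
  using euclidean_open.expands_coord_d[OF euclid_img[OF assms(2)] rep_sfam[OF assms(1,2)]]
    rep_expands[OF assms(1,2)] assms(3) by blast

lemma rep_ext_deriv:
  assumes \<xi>: "\<xi> \<in> forms M k" and c: "c \<in> charts M" and y: "y \<in> img c"
  shows "rep c (ext_deriv M \<xi>) y = coord_d m (rep c \<xi>) y"
proof
  fix vs
  let ?x = "chart_inv c y"
  have at: "c \<in> charts_at M ?x" by (rule charts_at_inv[OF c y])
  have "rep c (ext_deriv M \<xi>) y vs = coord_d m (rep c \<xi>) y ([] @ map (\<lambda>v. coord_vec M c ?x v c) vs)"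
    unfolding rep_def[of c "ext_deriv M \<xi>"]
    using ext_deriv_chart[OF \<xi> at, of "map (coord_vec M c ?x) vs"] coord_vec_in_tangent[OF at] y
    by (auto simp: o_def)
  also have "\<dots> = coord_d m (rep c \<xi>) y ([] @ map (\<lambda>v. v) vs)"
    by (rule coord_expands_cong[OF expands_coord_d_rep[OF \<xi> c y]]) (rule coord_vec_self[OF at])
  finally show "rep c (ext_deriv M \<xi>) y vs = coord_d m (rep c \<xi>) y vs" by simp
qed

lemma ext_deriv_in_forms:
  assumes \<xi>: "\<xi> \<in> forms M k"
  shows "ext_deriv M \<xi> \<in> forms M (Suc k)"
proof (rule formsI)
  fix x assume "x \<notin> S"
  then show "ext_deriv M \<xi> x = 0" by (auto simp: fun_eq_iff fun_ops ext_deriv_outside)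
next
  fix x assume x: "x \<in> S"
  from charts_cover[OF x] obtain c where c: "c \<in> charts_at M x" by blast
  note cs = charts_atD[OF c]
  interpret F: transverse_frame "tangent_space M x" "\<lambda>j. coord_vec M c x (std_vec j)" "\<lambda>j v. v c j" m
    by (rule full_frame[OF c])
  interpret C: euclidean_open m "img c" by (rule euclid_img[OF cs(1)])
  have y: "snd c x \<in> img c" using cs by blast
  let ?D = "coord_d m (rep c \<xi>) (snd c x)"
  note eq = ext_deriv_chart[OF \<xi> c]
  have len: "?D vs = 0" if "length vs \<noteq> Suc k" for vs
  proof -
    have "dird m (vs ! i) (\<lambda>y. rep c \<xi> y (remove_nth i vs)) (snd c x) = 0" if "i < length vs" for i
      using that \<open>length vs \<noteq> Suc k\<close> by (subst rep_homog[OF \<xi>]) auto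
    then show ?thesis by (simp add: coord_d_def)
  qed
  have "F.supported (Suc k) (ext_deriv M \<xi> x)"
    unfolding F.supported_def
  proof (intro allI impI)
    fix vs assume "length vs \<noteq> Suc k \<or> \<not> set vs \<subseteq> tangent_space M x"
    then show "ext_deriv M \<xi> x vs = 0"
      using eq[of vs] len[of "map (\<lambda>v. v c) vs"] ext_deriv_outside
      by (cases "set vs \<subseteq> tangent_space M x") auto
  qed
  moreover have "F.expands (ext_deriv M \<xi> x)"
    unfolding F.expands_def
  proof (intro allI impI)
    fix us v ws assume v: "v \<in> tangent_space M x"
    show "ext_deriv M \<xi> x (us @ v # ws) = (\<Sum>j<m. v c j * ext_deriv M \<xi> x (us @ coord_vec M c x (std_vec j) # ws))"
    proof (cases "set us \<subseteq> tangent_space M x \<and> set ws \<subseteq> tangent_space M x")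
      case True
      have "ext_deriv M \<xi> x (us @ v # ws) = ?D (map (\<lambda>v. v c) us @ v c # map (\<lambda>v. v c) ws)"
        using eq[of "us @ v # ws"] True v by simp
      also have "\<dots> = (\<Sum>j<m. v c j * ?D (map (\<lambda>v. v c) us @ std_vec j # map (\<lambda>v. v c) ws))"
        by (rule coord.expandsD[OF expands_coord_d_rep[OF \<xi> cs(1) y] UNIV_I])
      also have "\<dots> = (\<Sum>j<m. v c j * ext_deriv M \<xi> x (us @ coord_vec M c x (std_vec j) # ws))"
        using eq[of "us @ coord_vec M c x (std_vec _) # ws"] True F.E_in
        by (intro sum.cong refl) (simp add: coord_vec_std_self[OF c])
      finally show ?thesis .
    next
      case False
      then have "ext_deriv M \<xi> x (us @ z # ws) = 0" for z by (intro ext_deriv_outside) auto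
      then show ?thesis by simp
    qed
  qed
  moreover have "alternating (ext_deriv M \<xi> x)"
    unfolding alternating_def
  proof (intro allI)
    fix us v w ws
    show "ext_deriv M \<xi> x (us @ v # w # ws) = - ext_deriv M \<xi> x (us @ w # v # ws)"
    proof (cases "set (us @ v # w # ws) \<subseteq> tangent_space M x")
      case True
      have "alternating ?D"
        by (rule C.alternating_coord_d[OF rep_sfam[OF \<xi> cs(1)] rep_alternating[OF \<xi>] y])
      from alternatingD[OF this, of "map (\<lambda>v. v c) us" "v c" "w c" "map (\<lambda>v. v c) ws"] show ?thesis
        using eq[of "us @ v # w # ws"] eq[of "us @ w # v # ws"] True by simp
    next
      case False
      then have "ext_deriv M \<xi> x (us @ v # w # ws) = 0" "ext_deriv M \<xi> x (us @ w # v # ws) = 0"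
        by (intro ext_deriv_outside; auto)+
      then show ?thesis by simp
    qed
  qed
  ultimately show "\<exists>c\<in>charts_at M x. full_form c x (Suc k) (ext_deriv M \<xi> x)"
    using c F.hform_def by blast
next
  fix c js assume c: "c \<in> charts M"
  interpret C: euclidean_open m "img c" by (rule euclid_img[OF c])
  have "smooth_on m (img c) (\<lambda>y. coord_d m (rep c \<xi>) y (map std_vec js))"
    by (rule C.sfamD[OF C.sfam_coord_d[OF rep_sfam[OF \<xi> c]]])
  then show "smooth_on m (img c) (\<lambda>y. rep c (ext_deriv M \<xi>) y (map std_vec js))"
    using C.smooth_on_cong[of "\<lambda>y. rep c (ext_deriv M \<xi>) y (map std_vec js)"] rep_ext_deriv[OF \<xi> c] by simp
qed

end

section \<open>Algebra of differential forms\<close>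

lemma wedge_map: "wedge (\<lambda>vs. \<alpha> (map f vs)) (\<lambda>vs. \<beta> (map f vs)) vs = wedge \<alpha> \<beta> (map f vs)"
  by (simp add: wedge_def nths_map)

lemma wedge_cong_on:
  assumes "\<And>ws. set ws \<subseteq> set vs \<Longrightarrow> \<alpha> ws = \<alpha>' ws" "\<And>ws. set ws \<subseteq> set vs \<Longrightarrow> \<beta> ws = \<beta>' ws"
  shows "wedge \<alpha> \<beta> vs = wedge \<alpha>' \<beta>' vs"
  unfolding wedge_def by (intro sum.cong refl) (simp add: assms set_nths_subset)

context smooth_mfd
begin

lemma forms_outside: "\<xi> \<in> forms M k \<Longrightarrow> x \<notin> S \<Longrightarrow> \<xi> x = 0"
  using forms_support by (simp add: fun_eq_iff fun_ops)

lemma rep_wedge: "rep c (wedge_form \<xi> \<eta>) y = wedge (rep c \<xi> y) (rep c \<eta> y)"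
  by (simp add: fun_eq_iff rep_def wedge_form_def wedge_map)

lemma wedge_in_forms:
  assumes \<xi>: "\<xi> \<in> forms M a" and \<eta>: "\<eta> \<in> forms M b"
  shows "wedge_form \<xi> \<eta> \<in> forms M (a + b)"
proof (rule formsI)
  fix x assume "x \<notin> S"
  then show "wedge_form \<xi> \<eta> x = 0"
    by (simp add: wedge_form_def forms_outside[OF \<xi>] wedge_simps)
next
  fix x assume "x \<in> S"
  from charts_cover[OF this] obtain c where c: "c \<in> charts_at M x" by blast
  interpret F: transverse_frame "tangent_space M x" "\<lambda>j. coord_vec M c x (std_vec j)" "\<lambda>j v. v c j" m
    by (rule full_frame[OF c])
  show "\<exists>c\<in>charts_at M x. full_form c x (a + b) (wedge_form \<xi> \<eta> x)"
    using F.hform_wedge[OF forms_full_form[OF \<xi> c] forms_full_form[OF \<eta> c]] c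
    by (auto simp: wedge_form_def)
next
  fix c js assume c: "c \<in> charts M"
  interpret C: euclidean_open m "img c" by (rule euclid_img[OF c])
  show "smooth_on m (img c) (\<lambda>y. rep c (wedge_form \<xi> \<eta>) y (map std_vec js))"
    unfolding rep_wedge by (rule C.sfamD[OF C.sfam_wedge[OF rep_sfam[OF \<xi> c] rep_sfam[OF \<eta> c]]])
qed

lemma rep_add: "rep c (\<xi> + \<eta>) y = rep c \<xi> y + rep c \<eta> y"
  and rep_scale: "rep c (a *\<^sub>R \<xi>) y = a *\<^sub>R rep c \<xi> y"
  by (simp_all add: fun_eq_iff rep_def fun_ops)

lemma forms_add:
  assumes \<xi>: "\<xi> \<in> forms M k" and \<eta>: "\<eta> \<in> forms M k"
  shows "\<xi> + \<eta> \<in> forms M k"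
proof (rule formsI)
  fix x assume "x \<notin> S"
  then show "(\<xi> + \<eta>) x = 0" by (simp add: fun_ops forms_outside[OF \<xi>] forms_outside[OF \<eta>])
next
  fix x assume "x \<in> S"
  from charts_cover[OF this] obtain c where c: "c \<in> charts_at M x" by blast
  interpret F: transverse_frame "tangent_space M x" "\<lambda>j. coord_vec M c x (std_vec j)" "\<lambda>j v. v c j" m
    by (rule full_frame[OF c])
  show "\<exists>c\<in>charts_at M x. full_form c x k ((\<xi> + \<eta>) x)"
    using F.hform_add[OF forms_full_form[OF \<xi> c] forms_full_form[OF \<eta> c]] c by (auto simp: fun_ops)
next
  fix c js assume c: "c \<in> charts M"
  interpret C: euclidean_open m "img c" by (rule euclid_img[OF c])
  show "smooth_on m (img c) (\<lambda>y. rep c (\<xi> + \<eta>) y (map std_vec js))"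
    unfolding rep_add by (rule C.sfamD[OF C.sfam_add[OF rep_sfam[OF \<xi> c] rep_sfam[OF \<eta> c]]])
qed

lemma forms_scale:
  assumes \<xi>: "\<xi> \<in> forms M k"
  shows "a *\<^sub>R \<xi> \<in> forms M k"
proof (rule formsI)
  fix x assume "x \<notin> S"
  then show "(a *\<^sub>R \<xi>) x = 0" by (simp add: fun_ops forms_outside[OF \<xi>])
next
  fix x assume "x \<in> S"
  from charts_cover[OF this] obtain c where c: "c \<in> charts_at M x" by blast
  interpret F: transverse_frame "tangent_space M x" "\<lambda>j. coord_vec M c x (std_vec j)" "\<lambda>j v. v c j" m
    by (rule full_frame[OF c])
  show "\<exists>c\<in>charts_at M x. full_form c x k ((a *\<^sub>R \<xi>) x)"
    using F.hform_scale[OF forms_full_form[OF \<xi> c]] c by (auto simp: fun_ops)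
next
  fix c js assume c: "c \<in> charts M"
  interpret C: euclidean_open m "img c" by (rule euclid_img[OF c])
  show "smooth_on m (img c) (\<lambda>y. rep c (a *\<^sub>R \<xi>) y (map std_vec js))"
    unfolding rep_scale by (rule C.sfamD[OF C.sfam_scale[OF rep_sfam[OF \<xi> c]]])
qed

lemma forms_0: "0 \<in> forms M k"
proof (rule formsI)
  fix x assume "x \<in> S"
  from charts_cover[OF this] obtain c where c: "c \<in> charts_at M x" by blast
  interpret F: transverse_frame "tangent_space M x" "\<lambda>j. coord_vec M c x (std_vec j)" "\<lambda>j v. v c j" m
    by (rule full_frame[OF c])
  show "\<exists>c\<in>charts_at M x. full_form c x k (0 x)" using F.hform_0 c by (auto simp: fun_ops)
next
  fix c js assume c: "c \<in> charts M"
  interpret C: euclidean_open m "img c" by (rule euclid_img[OF c])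
  show "smooth_on m (img c) (\<lambda>y. rep c 0 y (map std_vec js))"
    unfolding rep_def fun_ops by (rule C.smooth_const)
qed (simp add: fun_ops)

lemma ext_deriv_add:
  assumes \<xi>: "\<xi> \<in> forms M k" and \<eta>: "\<eta> \<in> forms M k"
  shows "ext_deriv M (\<xi> + \<eta>) = ext_deriv M \<xi> + ext_deriv M \<eta>"
proof (intro ext)
  fix x vs
  show "ext_deriv M (\<xi> + \<eta>) x vs = (ext_deriv M \<xi> + ext_deriv M \<eta>) x vs"
  proof (cases "x \<in> S \<and> set vs \<subseteq> tangent_space M x")
    case True
    from charts_cover True obtain c where c: "c \<in> charts_at M x" by blast
    note cs = charts_atD[OF c]
    interpret C: euclidean_open m "img c" by (rule euclid_img[OF cs(1)])
    have y: "snd c x \<in> img c" using cs by blast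
    show ?thesis
      using True C.coord_d_add[OF rep_sfam[OF \<xi> cs(1)] rep_sfam[OF \<eta> cs(1)] y]
      by (simp add: ext_deriv_chart[OF forms_add[OF \<xi> \<eta>] c] ext_deriv_chart[OF \<xi> c]
          ext_deriv_chart[OF \<eta> c] rep_add[abs_def] fun_ops)
  qed (simp add: ext_deriv_outside fun_ops)
qed

lemma ext_deriv_scale:
  assumes \<xi>: "\<xi> \<in> forms M k"
  shows "ext_deriv M (a *\<^sub>R \<xi>) = a *\<^sub>R ext_deriv M \<xi>"
proof (intro ext)
  fix x vs
  show "ext_deriv M (a *\<^sub>R \<xi>) x vs = (a *\<^sub>R ext_deriv M \<xi>) x vs"
  proof (cases "x \<in> S \<and> set vs \<subseteq> tangent_space M x")
    case True
    from charts_cover True obtain c where c: "c \<in> charts_at M x" by blast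
    note cs = charts_atD[OF c]
    interpret C: euclidean_open m "img c" by (rule euclid_img[OF cs(1)])
    have y: "snd c x \<in> img c" using cs by blast
    show ?thesis
      using True C.coord_d_scale[OF rep_sfam[OF \<xi> cs(1)] y]
      by (simp add: ext_deriv_chart[OF forms_scale[OF \<xi>] c] ext_deriv_chart[OF \<xi> c] rep_scale[abs_def] fun_ops)
  qed (simp add: ext_deriv_outside fun_ops)
qed

lemma ext_deriv_ext_deriv:
  assumes \<xi>: "\<xi> \<in> forms M k"
  shows "ext_deriv M (ext_deriv M \<xi>) = 0"
proof (intro ext)
  fix x vs
  show "ext_deriv M (ext_deriv M \<xi>) x vs = 0 x vs"
  proof (cases "x \<in> S \<and> set vs \<subseteq> tangent_space M x")
    case True
    from charts_cover True obtain c where c: "c \<in> charts_at M x" by blast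
    note cs = charts_atD[OF c]
    interpret C: euclidean_open m "img c" by (rule euclid_img[OF cs(1)])
    have y: "snd c x \<in> img c" using cs by blast
    have "ext_deriv M (ext_deriv M \<xi>) x vs = coord_d m (rep c (ext_deriv M \<xi>)) (snd c x) (map (\<lambda>v. v c) vs)"
      using ext_deriv_chart[OF ext_deriv_in_forms[OF \<xi>] c] True by blast
    also have "coord_d m (rep c (ext_deriv M \<xi>)) (snd c x) = coord_d m (coord_d m (rep c \<xi>)) (snd c x)"
      by (rule C.coord_d_cong[OF rep_ext_deriv[OF \<xi> cs(1)] y])
    also have "\<dots> = 0" by (rule C.coord_d_d[OF rep_sfam[OF \<xi> cs(1)] y])
    finally show ?thesis by (simp add: fun_ops)
  qed (simp add: ext_deriv_outside fun_ops)
qed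

lemma rep_at:
  assumes "c \<in> charts_at M x" "set vs \<subseteq> tangent_space M x"
  shows "rep c \<xi> (snd c x) (map (\<lambda>v. v c) vs) = \<xi> x vs"
proof -
  have "map (coord_vec M c x) (map (\<lambda>v. v c) vs) = vs"
    using tangent_coord_vec[OF _ assms(1)] assms(2) by (auto intro!: map_idI)
  then show ?thesis unfolding rep_def using charts_atD[OF assms(1)] by (simp only: chart_inv_left)
qed

lemma ext_deriv_wedge_closed:
  assumes \<omega>: "\<omega> \<in> forms M 2" "ext_deriv M \<omega> = 0" and \<xi>: "\<xi> \<in> forms M k"
  shows "ext_deriv M (wedge_form \<omega> \<xi>) = wedge_form \<omega> (ext_deriv M \<xi>)"
proof (intro ext)
  fix x vs
  have d\<xi>: "ext_deriv M \<xi> \<in> forms M (Suc k)" by (rule ext_deriv_in_forms[OF \<xi>])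
  show "ext_deriv M (wedge_form \<omega> \<xi>) x vs = wedge_form \<omega> (ext_deriv M \<xi>) x vs"
  proof (cases "x \<in> S \<and> set vs \<subseteq> tangent_space M x")
    case True
    from charts_cover True obtain c where c: "c \<in> charts_at M x" by blast
    note cs = charts_atD[OF c]
    interpret C: euclidean_open m "img c" by (rule euclid_img[OF cs(1)])
    have y: "snd c x \<in> img c" using cs by blast
    let ?h = "\<lambda>v. v c" and ?y = "snd c x"
    note s = rep_sfam[OF \<omega>(1) cs(1)] rep_sfam[OF \<xi> cs(1)]
    have "homog 2 (rep c \<omega> ?y)" using rep_homog[OF \<omega>(1)] by (simp add: homog_def)
    then have tw: "twist (rep c \<omega> ?y) = rep c \<omega> ?y" using twist_homog by fastforce
    have d0: "coord_d m (rep c \<omega>) ?y = 0"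
      using rep_ext_deriv[OF \<omega>(1) cs(1) y] \<omega>(2) by (simp add: rep_def fun_ops zero_fun_def)
    have "ext_deriv M (wedge_form \<omega> \<xi>) x vs = coord_d m (\<lambda>y. wedge (rep c \<omega> y) (rep c \<xi> y)) ?y (map ?h vs)"
      using ext_deriv_chart[OF wedge_in_forms[OF \<omega>(1) \<xi>] c, of vs] True
      by (simp add: rep_wedge[abs_def])
    also have "\<dots> = wedge (rep c \<omega> ?y) (rep c (ext_deriv M \<xi>) ?y) (map ?h vs)"
      unfolding C.leibniz[OF s y] d0 tw rep_ext_deriv[OF \<xi> cs(1) y] by (simp add: wedge_simps)
    also have "\<dots> = wedge (\<lambda>vs. rep c \<omega> ?y (map ?h vs)) (\<lambda>vs. rep c (ext_deriv M \<xi>) ?y (map ?h vs)) vs"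
      by (rule wedge_map[symmetric])
    also have "\<dots> = wedge (\<omega> x) (ext_deriv M \<xi> x) vs"
    proof (rule wedge_cong_on)
      fix ws assume "set ws \<subseteq> set vs"
      then have "set ws \<subseteq> tangent_space M x" using True by blast
      then show "rep c \<omega> ?y (map ?h ws) = \<omega> x ws" "rep c (ext_deriv M \<xi>) ?y (map ?h ws) = ext_deriv M \<xi> x ws"
        using rep_at[OF c] by blast+
    qed
    finally show ?thesis by (simp add: wedge_form_def)
  next
    case False
    then have "ext_deriv M (wedge_form \<omega> \<xi>) x vs = 0" by (rule ext_deriv_outside)
    moreover have "wedge_form \<omega> (ext_deriv M \<xi>) x vs = 0"
      by (rule forms_support[OF wedge_in_forms[OF \<omega>(1) d\<xi>]]) (use False in blast)
    ultimately show ?thesis by simp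
  qed
qed

text \<open>If \<open>\<iota>\<^sub>T \<xi> = 0\<close> then \<open>L\<^sub>T \<xi> = \<iota>\<^sub>T d\<xi>\<close>: the vanishing of \<open>d (\<iota>\<^sub>T \<xi>)\<close>, computed by
  \<open>coord_d_contr_field\<close>, evaluates the sum over the brackets \<open>[T, V\<^sub>i]\<close>.\<close>

lemma cartan_formula:
  assumes \<xi>: "\<xi> \<in> forms M k" and T: "T \<in> vector_fields M" and 0: "interior_prod T \<xi> = zero_form"
    and x: "x \<in> S" and vs: "set vs \<subseteq> tangent_space M x"
  shows "lie_deriv M T \<xi> x vs = ext_deriv M \<xi> x (T x # vs)"
proof -
  define c where "c = chart_at M x"
  have c: "c \<in> charts_at M x" unfolding c_def by (rule chart_at_in[OF x])
  note cs = charts_atD[OF c]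
  interpret C: euclidean_open m "img c" by (rule euclid_img[OF cs(1)])
  have y: "snd c x \<in> img c" using cs by blast
  have Tx: "T z \<in> tangent_space M z" if "z \<in> S" for z using T that by (simp add: vector_fields_def)
  define Y where "Y y = T (chart_inv c y) c" for y
  define vs' where "vs' = map (\<lambda>v. v c) vs"
  let ?F = "rep c \<xi>" and ?y = "snd c x"
  have Yx: "Y ?y = T x c" using cs by (simp add: Y_def)
  have Ysmooth: "smooth_on m (img c) (\<lambda>y. Y y j)" if "j < m" for j
    using T cs(1) that unfolding vector_fields_def Y_def chart_smooth_def m by blast
  have "contr (Y y) (?F y) = 0" if "y \<in> img c" for y
  proof
    fix ws
    let ?z = "chart_inv c y"
    have z: "c \<in> charts_at M ?z" by (rule charts_at_inv[OF cs(1) that])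
    have "coord_vec M c ?z (Y y) = T ?z"
      unfolding Y_def by (rule tangent_coord_vec[OF Tx[OF charts_at_in_S[OF z]] z])
    then show "contr (Y y) (?F y) ws = 0 ws"
      using fun_cong[OF fun_cong[OF 0, of ?z], of "map (coord_vec M c ?z) ws"]
      by (simp add: contr_apply rep_def interior_prod_def fun_ops)
  qed
  then have "coord_d m (\<lambda>y. contr (Y y) (?F y)) ?y = coord_d m (\<lambda>_. 0) ?y"
    by (rule C.coord_d_cong[OF _ y])
  then have "0 = coord_d m (\<lambda>y. contr (Y ?y) (?F y)) ?y vs' +
      (\<Sum>l<length vs'. (-1) ^ l * ?F ?y ((\<lambda>j. dird m (vs' ! l) (\<lambda>y. Y y j) ?y) # remove_nth l vs'))"
    using C.coord_d_contr_field[OF rep_sfam[OF \<xi> cs(1)] rep_expands[OF \<xi> cs(1)] y, where X = Y and vs = vs', OF _ Ysmooth]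
    by (simp add: C.coord_d_0 fun_ops)
  also have "(\<Sum>l<length vs'. (-1) ^ l * ?F ?y ((\<lambda>j. dird m (vs' ! l) (\<lambda>y. Y y j) ?y) # remove_nth l vs')) =
      (\<Sum>l<length vs'. ?F ?y (vs'[l := (\<lambda>j. dird m (vs' ! l) (\<lambda>y. Y y j) ?y)]))"
    by (rule alternating_sum_update[OF rep_alternating[OF \<xi>]])
  also have "\<dots> = (\<Sum>l<length vs. \<xi> x (vs[l := coord_vec M c x (\<lambda>j. chart_dderiv M c ((vs ! l) c) (\<lambda>z. T z c j) x)]))"
  proof (rule sum.cong)
    fix l assume l: "l \<in> {..<length vs}"
    have "map (coord_vec M c x) vs' = vs"
      unfolding vs'_def using tangent_coord_vec[OF _ c] vs by (auto intro!: map_idI)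
    then show "?F ?y (vs'[l := (\<lambda>j. dird m (vs' ! l) (\<lambda>y. Y y j) ?y)]) =
        \<xi> x (vs[l := coord_vec M c x (\<lambda>j. chart_dderiv M c ((vs ! l) c) (\<lambda>z. T z c j) x)])"
      unfolding rep_def using cs l by (simp add: map_update chart_dderiv_eq Y_def vs'_def)
  qed (simp add: vs'_def)
  finally have sum: "(\<Sum>l<length vs. \<xi> x (vs[l := coord_vec M c x (\<lambda>j. chart_dderiv M c ((vs ! l) c) (\<lambda>z. T z c j) x)])) =
      - coord_d m (\<lambda>y. contr (T x c) (?F y)) ?y vs'"
    by (simp add: Yx)
  have "lie_deriv M T \<xi> x vs = dird m (T x c) (\<lambda>y. ?F y vs') ?y - coord_d m (\<lambda>y. contr (T x c) (?F y)) ?y vs'"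
    unfolding lie_deriv_def Let_def c_def[symmetric] sum
    using x vs by (simp add: chart_dderiv_eq rep_def vs'_def o_def)
  also have "\<dots> = coord_d m ?F ?y (T x c # vs')" by (rule coord_d_Cons[symmetric])
  also have "\<dots> = ext_deriv M \<xi> x (T x # vs)"
    using ext_deriv_chart[OF \<xi> c, of "T x # vs"] Tx[OF x] vs by (simp add: vs'_def)
  finally show ?thesis .
qed

end

section \<open>Smooth bump functions\<close>

text \<open>The functions $P(1/t)\,e^{-1/t}$, extended by zero to \<open>t \<le> 0\<close>.  This class is closed under
  differentiation, which shows that its members are smooth.\<close>

definition flat_fun :: "real poly \<Rightarrow> real \<Rightarrow> real" where
  "flat_fun P t = (if t \<le> 0 then 0 else poly P (inverse t) * exp (- inverse t))"

definition flat_next :: "real poly \<Rightarrow> real poly" where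
  "flat_next P = [:0, 0, 1:] * (P - pderiv P)"

lemma poly_times_exp_tendsto_0: "((\<lambda>s. poly P s * exp (- s)) \<longlongrightarrow> (0::real)) at_top"
proof -
  have "((\<lambda>s. \<Sum>i\<le>degree P. coeff P i * (s ^ i / exp s)) \<longlongrightarrow> (\<Sum>i\<le>degree P. coeff P i * 0)) at_top"
    by (intro tendsto_sum tendsto_mult tendsto_const tendsto_power_div_exp_0)
  then show ?thesis by (simp add: poly_altdef sum_distrib_right exp_minus divide_inverse mult.assoc)
qed

lemma flat_fun_deriv: "(flat_fun P has_real_derivative flat_fun (flat_next P) t) (at t)"
proof (cases t "0::real" rule: linorder_cases)
  case less
  have "((\<lambda>_. 0) has_real_derivative 0) (at t)" by simp
  then have "(flat_fun P has_real_derivative 0) (at t)"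
    by (rule has_field_derivative_transform_within_open[of _ _ _ "{..<0}"]) (use less in \<open>auto simp: flat_fun_def\<close>)
  then show ?thesis using less by (simp add: flat_fun_def)
next
  case greater
  have "((\<lambda>t. poly P (inverse t) * exp (- inverse t)) has_real_derivative
      flat_fun (flat_next P) t) (at t)"
    using greater
    by (auto intro!: derivative_eq_intros DERIV_chain2[OF poly_DERIV]
        simp: flat_fun_def flat_next_def algebra_simps power2_eq_square)
  then show ?thesis
    by (rule has_field_derivative_transform_within_open[of _ _ _ "{0<..}"]) (use greater in \<open>auto simp: flat_fun_def\<close>)
next
  case equal
  have "((\<lambda>h. poly (pCons 0 P) (inverse h) * exp (- inverse h)) \<longlongrightarrow> 0) (at_right (0::real))"
    using filterlim_compose[OF poly_times_exp_tendsto_0 filterlim_inverse_at_top_right] .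
  then have "((\<lambda>h. flat_fun P h / h) \<longlongrightarrow> 0) (at_right 0)"
    by (rule Lim_transform_eventually)
      (auto simp: eventually_at_filter flat_fun_def divide_inverse mult_ac)
  moreover have "((\<lambda>h. flat_fun P h / h) \<longlongrightarrow> 0) (at_left 0)"
    by (rule Lim_transform_eventually[OF tendsto_const]) (auto simp: eventually_at_filter flat_fun_def)
  ultimately have "((\<lambda>h. flat_fun P h / h) \<longlongrightarrow> 0) (at 0)"
    by (simp add: filterlim_split_at)
  then show ?thesis using equal by (simp add: has_field_derivative_iff flat_fun_def)
qed

definition cube_bump :: "nat \<Rightarrow> (nat \<Rightarrow> real) \<Rightarrow> real \<Rightarrow> (nat \<Rightarrow> real) \<Rightarrow> real" where
  "cube_bump m y0 r y = (\<Prod>i<m. flat_fun 1 (r - (y i - y0 i)) * flat_fun 1 (r + (y i - y0 i)))"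

lemma (in euclidean_open) smooth_cube_bump: "smooth_on m U (cube_bump m y0 r)"
proof -
  have h: "((\<lambda>t. flat_fun ((flat_next ^^ k) 1) t) has_real_derivative flat_fun ((flat_next ^^ Suc k) 1) t) (at t)" for k t
    using flat_fun_deriv[of "(flat_next ^^ k) 1" t] by simp
  have "smooth_on m U (\<lambda>y. flat_fun ((flat_next ^^ 0) 1) (f y))" if "smooth_on m U f" for f
    unfolding smooth_on_iff_Ck
    using Ck_compose_real[where h = "\<lambda>k. flat_fun ((flat_next ^^ k) 1)", OF h] smooth_imp_Ck[OF that] by blast
  then have flat: "smooth_on m U (\<lambda>y. flat_fun 1 (f y))" if "smooth_on m U f" for f using that by simp
  show ?thesis
    unfolding cube_bump_def[abs_def]
    by (intro smooth_prod smooth_mult flat smooth_diff smooth_add smooth_const smooth_coord)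
qed

lemma cube_bump_center: "r > 0 \<Longrightarrow> cube_bump m y0 r y0 > 0"
  unfolding cube_bump_def by (intro prod_pos) (auto simp: flat_fun_def)

lemma cube_bump_outside: "i < m \<Longrightarrow> \<bar>y i - y0 i\<bar> > r \<Longrightarrow> cube_bump m y0 r y = 0"
  unfolding cube_bump_def by (rule prod_zero) (auto simp: flat_fun_def intro!: bexI[of _ i])

section \<open>Foliated manifolds and basic forms\<close>

locale foliated_mfd = smooth_mfd M m for M :: "'a foliated" and m +
  fixes p q :: nat
  assumes foliated: "foliated_manifold M" and p: "leaf_dim M = p" and q: "codim M = q"
begin

lemma mpq: "m = p + q"
  using m p q by simp

lemma foliated_charts_sub: "c \<in> foliated_charts M \<Longrightarrow> c \<in> charts M"
  and foliated_cover: "x \<in> S \<Longrightarrow> \<exists>c\<in>foliated_charts M. x \<in> fst c"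
  and foliated_trans: "c \<in> foliated_charts M \<Longrightarrow> c' \<in> foliated_charts M \<Longrightarrow> foliated_transition p q X c c'"
  using foliated unfolding foliated_manifold_def p q by blast+

abbreviation fol_at :: "'a \<Rightarrow> 'a chart set" where
  "fol_at x \<equiv> {c \<in> foliated_charts M. x \<in> fst c}"

lemma fol_at_charts: "c \<in> fol_at x \<Longrightarrow> c \<in> charts_at M x"
  using foliated_charts_sub by (auto simp: charts_at_def)

text \<open>A foliated transition map takes plaques to plaques, so the transverse coordinates of the one
  chart do not vary along the leaf coordinates of the other.\<close>

lemma transverse_coord_const:
  assumes c: "c \<in> fol_at x" and c': "c' \<in> fol_at x" and a: "a < p" and i: "i \<in> {p..<p + q}"
  shows "pderivative a (\<lambda>y. snd c' (chart_inv c y) i) (snd c x) = 0"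
proof -
  note ch = foliated_charts_sub[of c] foliated_charts_sub[of c']
  have "c \<in> foliated_charts M" "c' \<in> foliated_charts M" and "x \<in> fst c \<inter> fst c'" using c c' by auto
  from bspec[OF foliated_trans[OF this(1,2), unfolded foliated_transition_def] this(3)] obtain W
    where W: "openin X W" "x \<in> W" "W \<subseteq> fst c \<inter> fst c'"
    and const: "\<forall>y\<in>W. \<forall>z\<in>W. (\<forall>i\<in>{p..<p + q}. snd c y i = snd c z i) \<longrightarrow>
      (\<forall>i\<in>{p..<p + q}. snd c' y i = snd c' z i)"
    by (elim exE conjE)
  have cW: "openin EE (snd c ` W)" using image_open[OF ch(1)] c W by blast
  have "\<forall>\<^sub>F t in nhds (snd c x a). (snd c x)(a := t) \<in> snd c ` W"
    by (rule eventually_line_in[OF cW]) (use W(2) a mpq in auto)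
  then have "\<forall>\<^sub>F t in nhds (snd c x a). snd c' (chart_inv c ((snd c x)(a := t))) i = snd c' x i"
  proof (rule eventually_mono)
    fix t assume "(snd c x)(a := t) \<in> snd c ` W"
    then obtain z where z: "z \<in> W" "snd c z = (snd c x)(a := t)" by auto
    then have "\<forall>i\<in>{p..<p + q}. snd c z i = snd c x i" using a by auto
    then have "snd c' z i = snd c' x i" using const z(1) W(2) i by blast
    moreover have "chart_inv c (snd c z) = z" using z(1) W(3) ch(1) c by auto
    ultimately show "snd c' (chart_inv c ((snd c x)(a := t))) i = snd c' x i"
      unfolding z(2) by simp
  qed
  then have "deriv (\<lambda>t. snd c' (chart_inv c ((snd c x)(a := t))) i) (snd c x a) = deriv (\<lambda>_. snd c' x i) (snd c x a)"
    by (rule deriv_cong_ev) simp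
  then show ?thesis unfolding pderivative_def by simp
qed

lemma leaf_spaceI:
  assumes v: "v \<in> tangent_space M x" and c: "c \<in> fol_at x" and 0: "\<And>i. i \<in> {p..<m} \<Longrightarrow> v c i = 0"
  shows "v \<in> leaf_space M x"
  unfolding leaf_space_def
proof (intro CollectI conjI v ballI impI)
  fix c' i assume c': "c' \<in> foliated_charts M" "x \<in> fst c'" and i: "i \<in> {leaf_dim M..<mdim M}"
  have at: "c \<in> charts_at M x" "c' \<in> charts_at M x" using fol_at_charts[of _ x] c c' by auto
  have im: "i < m" "i \<in> {p..<p + q}" using i m p mpq by auto
  have "v c' i = coord_vec M c x (v c) c' i" using tangent_coord_vec[OF v at(1)] by simp
  also have "\<dots> = (\<Sum>j<m. v c j * pderivative j (\<lambda>y. snd c' (chart_inv c y) i) (snd c x))"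
    using at(2) im by (simp add: coord_vec_apply chart_dderiv_eq dird_def)
  also have "\<dots> = 0"
  proof (intro sum.neutral ballI)
    fix j assume "j \<in> {..<m}"
    then show "v c j * pderivative j (\<lambda>y. snd c' (chart_inv c y) i) (snd c x) = 0"
      using 0[of j] transverse_coord_const[OF c _ _ im(2), of c' j] c' by (cases "j < p") auto
  qed
  finally show "v c' i = 0" .
qed

lemma leaf_spaceD:
  assumes "v \<in> leaf_space M x"
  shows "v \<in> tangent_space M x" "c \<in> fol_at x \<Longrightarrow> i \<in> {p..<m} \<Longrightarrow> v c i = 0"
  using assms unfolding leaf_space_def by (auto simp: p q mpq)

lemma compact_cube: "compactin EE {y \<in> topspace EE. \<forall>i<m. \<bar>y i - y0 i\<bar> \<le> r}"
proof -
  let ?B = "\<lambda>i. if i < m then {y0 i - r..y0 i + r} else {0::real}"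
  have "{y \<in> topspace EE. \<forall>i<m. \<bar>y i - y0 i\<bar> \<le> r} = PiE UNIV ?B"
  proof (intro set_eqI iffI)
    fix y assume "y \<in> {y \<in> topspace EE. \<forall>i<m. \<bar>y i - y0 i\<bar> \<le> r}"
    then show "y \<in> PiE UNIV ?B" by (auto simp: mem_Euclidean_space abs_le_iff algebra_simps)
  next
    fix y assume *: "y \<in> PiE UNIV ?B"
    have y: "y i \<in> ?B i" for i by (rule PiE_mem[OF * UNIV_I])
    have "y i = 0" if "i \<ge> m" for i using y[of i] that by simp
    moreover have "\<bar>y i - y0 i\<bar> \<le> r" if "i < m" for i using y[of i] that by (simp add: abs_le_iff)
    ultimately show "y \<in> {y \<in> topspace EE. \<forall>i<m. \<bar>y i - y0 i\<bar> \<le> r}"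
      by (simp add: mem_Euclidean_space)
  qed
  moreover have "compactin (powertop_real UNIV) (PiE UNIV ?B)"
    unfolding compactin_PiE by (auto simp: compactin_euclidean_iff)
  moreover have "PiE UNIV ?B \<subseteq> {x. \<forall>i\<ge>m. x i = 0}"
  proof
    fix y assume *: "y \<in> PiE UNIV ?B"
    have "y i = 0" if "i \<ge> m" for i using PiE_mem[OF * UNIV_I, of i] that by simp
    then show "y \<in> {x. \<forall>i\<ge>m. x i = 0}" by simp
  qed
  ultimately show ?thesis unfolding Euclidean_space_def compactin_subtopology by simp
qed

text \<open>Closed in the manifold, and not only in the chart, because compact sets in a Hausdorff space are
  closed.  So a field supported in the cube can be extended by zero.\<close>

lemma closed_chart_cube:
  assumes c: "c \<in> charts M" and K: "K \<subseteq> img c" "compactin EE K"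
  shows "closedin X (chart_inv c ` K)"
proof -
  obtain g where g: "homeomorphic_maps (subtopology X (fst c)) (subtopology EE (img c)) (snd c) g"
    using chart_homeo[OF c] homeomorphic_map_maps by blast
  have top: "topspace (subtopology X (fst c)) = fst c" "topspace (subtopology EE (img c)) = img c"
    using dom_subset[OF c] openin_subset[OF img_open[OF c]] by auto
  have "g y = chart_inv c y" if "y \<in> img c" for y
    using that g c unfolding homeomorphic_maps_def top by force
  then have "g ` K = chart_inv c ` K" using K(1) by (intro image_cong) auto
  moreover have "compactin (subtopology EE (img c)) K" using K by (simp add: compactin_subtopology)
  then have "compactin (subtopology X (fst c)) (g ` K)"
    by (rule image_compactin) (use g in \<open>simp add: homeomorphic_maps_def\<close>)
  ultimately have "compactin X (chart_inv c ` K)" by (simp add: compactin_subtopology)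
  moreover have "Hausdorff_space X" using smooth_manifold by (simp add: smooth_manifold_def)
  ultimately show ?thesis using compactin_imp_closedin by blast
qed

text \<open>The vector is extended with constant coordinates in a foliated chart, and multiplied by a bump
  function.\<close>

lemma leaf_field_through:
  assumes x: "x \<in> S" and v: "v \<in> leaf_space M x"
  shows "\<exists>T\<in>leaf_fields M. T x = v"
proof -
  obtain c where c: "c \<in> fol_at x" using foliated_cover[OF x] by blast
  note at = fol_at_charts[OF c] and cs = charts_atD[OF fol_at_charts[OF c]]
  define u where "u = v c"
  have u0: "u i = 0" if "i \<in> {p..<m}" for i unfolding u_def using leaf_spaceD(2)[OF v c that] .
  let ?y0 = "snd c x"
  obtain \<delta> where \<delta>: "\<delta> > 0"
    "\<And>y. y \<in> topspace EE \<Longrightarrow> (\<And>i. i < m \<Longrightarrow> \<bar>y i - ?y0 i\<bar> < \<delta>) \<Longrightarrow> y \<in> img c"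
    using openin_box[OF img_open[OF cs(1)], of ?y0] cs(2) by blast
  define r where "r = \<delta> / 2"
  define K where "K = {y \<in> topspace EE. \<forall>i<m. \<bar>y i - ?y0 i\<bar> \<le> r}"
  have r: "r > 0" "r < \<delta>" using \<delta>(1) by (auto simp: r_def)
  have K: "K \<subseteq> img c" unfolding K_def using \<delta>(2) r by (auto intro: le_less_trans)
  have closed: "closedin X (chart_inv c ` K)"
    using closed_chart_cube[OF cs(1) K] compact_cube unfolding K_def by blast
  \<comment> \<open>Normalised to the value 1 at the given point.\<close>
  define b where "b y = cube_bump m ?y0 r y / cube_bump m ?y0 r ?y0" for y
  have b1: "b ?y0 = 1" using cube_bump_center[OF r(1), of m ?y0] by (simp add: b_def)
  have b0: "b y = 0" if yb: "y \<in> img c" "y \<notin> K" for y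
  proof -
    have "y \<in> topspace EE" using yb(1) open_subset_Euclidean[OF img_open[OF cs(1)]] by blast
    then obtain i where "i < m" "\<bar>y i - ?y0 i\<bar> > r" using yb(2) by (auto simp: K_def not_le)
    then show ?thesis by (simp add: b_def cube_bump_outside)
  qed
  define T where "T z = (if z \<in> fst c then b (snd c z) *\<^sub>R coord_vec M c z u else 0)" for z
  have T_tan: "T z \<in> tangent_space M z" for z
  proof (cases "z \<in> fst c")
    case True
    then show ?thesis
      using coord_vec_in_tangent[of c z u] cs(1) by (auto simp: T_def charts_at_def intro: subspace_scale[OF subspace_tangent])
  qed (simp add: T_def subspace_0[OF subspace_tangent])
  have T_leaf: "T z \<in> leaf_space M z" if zS: "z \<in> S" for z
  proof (cases "z \<in> fst c")
    case True
    then have z: "c \<in> fol_at z" using c by simp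
    show ?thesis
    proof (rule leaf_spaceI[OF T_tan z])
      fix i assume i: "i \<in> {p..<m}"
      then show "T z c i = 0"
        using True u0[OF i] coord_vec_self[OF fol_at_charts[OF z], of i u] by (simp add: T_def fun_ops)
    qed
  next
    case False
    obtain c' where c': "c' \<in> fol_at z" using foliated_cover[OF zS] by blast
    have "T z = 0" using False by (simp add: T_def)
    then show ?thesis by (intro leaf_spaceI[OF T_tan c']) (simp add: fun_ops)
  qed
  have T_smooth: "smooth_on m (img c') (\<lambda>y. T (chart_inv c' y) c' i)" if c': "c' \<in> charts M" and i: "i < m" for c' i
  proof (rule smooth_on_local[OF img_open[OF c']])
    fix y assume y: "y \<in> img c'"
    let ?z = "chart_inv c' y"
    show "\<exists>V. openin EE V \<and> y \<in> V \<and> V \<subseteq> img c' \<and> smooth_on m V (\<lambda>y. T (chart_inv c' y) c' i)"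
    proof (cases "?z \<in> fst c")
      case True
      let ?W = "fst c \<inter> fst c'"
      have W: "openin X ?W" by (rule overlap_open[OF cs(1) c'])
      interpret P: euclidean_map m "snd c' ` ?W" m "snd c ` ?W" "\<lambda>y. snd c (chart_inv c' y)"
        by (rule transition_map[OF c' cs(1) W]) auto
      have "smooth_on m (snd c ` ?W) b"
        unfolding b_def[abs_def] divide_inverse
        by (intro P.tgt.smooth_mult P.tgt.smooth_const P.tgt.smooth_cube_bump)
      then have s1: "smooth_on m (snd c' ` ?W) (\<lambda>y. b (snd c (chart_inv c' y)))"
        by (rule P.smooth_compose)
      have "smooth_on m (snd c ` ?W) (dird m u (\<lambda>y. snd c' (chart_inv c y) i))"
        by (rule P.tgt.smooth_dird) (rule coord_smooth[OF cs(1) c' _ i], simp)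
      then have s2: "smooth_on m (snd c' ` ?W) (\<lambda>y. dird m u (\<lambda>y. snd c' (chart_inv c y) i) (snd c (chart_inv c' y)))"
        by (rule P.smooth_compose)
      have "T (chart_inv c' y) c' i = b (snd c (chart_inv c' y)) *
          dird m u (\<lambda>y. snd c' (chart_inv c y) i) (snd c (chart_inv c' y))" if "y \<in> snd c' ` ?W" for y
      proof -
        have z: "chart_inv c' y \<in> ?W" using that c' by auto
        then have "c' \<in> charts_at M (chart_inv c' y)" using c' by (simp add: charts_at_def)
        then show ?thesis using z i by (simp add: T_def fun_ops coord_vec_apply chart_dderiv_eq)
      qed
      then have "smooth_on m (snd c' ` ?W) (\<lambda>y. T (chart_inv c' y) c' i)"
        using P.src.smooth_on_cong P.src.smooth_mult[OF s1 s2] by (metis (no_types, lifting))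
      moreover have "y \<in> snd c' ` ?W" using True y by (metis IntI chart_inv_in chart_inv_right image_eqI)
      ultimately show ?thesis using P.src.openU by blast
    next
      case False
      let ?W = "fst c' - chart_inv c ` K"
      have W: "openin X ?W" by (rule openin_diff[OF dom_open[OF c'] closed])
      have sW: "openin EE (snd c' ` ?W)" by (rule image_open[OF c' W]) auto
      interpret P: euclidean_open m "snd c' ` ?W" by unfold_locales (rule sW)
      have "T (chart_inv c' y) c' i = 0" if "y \<in> snd c' ` ?W" for y
      proof -
        have z: "chart_inv c' y \<in> ?W" using that c' by auto
        show ?thesis
        proof (cases "chart_inv c' y \<in> fst c")
          case True
          then have "snd c (chart_inv c' y) \<notin> K" using z cs(1) by (metis DiffD2 chart_inv_left image_eqI)
          then show ?thesis using b0 True by (simp add: T_def fun_ops)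
        qed (simp add: T_def fun_ops)
      qed
      then have "smooth_on m (snd c' ` ?W) (\<lambda>y. T (chart_inv c' y) c' i)"
        using P.smooth_on_cong[of "\<lambda>y. T (chart_inv c' y) c' i" "\<lambda>_. 0"] P.smooth_const by simp
      moreover have "?z \<notin> chart_inv c ` K" using False K cs(1) by auto
      then have "y \<in> snd c' ` ?W" using y by (metis DiffI chart_inv_in chart_inv_right image_eqI)
      ultimately show ?thesis using sW by blast
    qed
  qed
  have "T \<in> leaf_fields M"
    unfolding leaf_fields_def vector_fields_def using T_tan T_leaf T_smooth
    by (auto simp: chart_smooth_def m)
  moreover have "T x = v"
    using cs(2) b1 tangent_coord_vec[OF leaf_spaceD(1)[OF v] at] by (simp add: T_def u_def)
  ultimately show ?thesis by blast
qed

definition horizontal :: "'a dform \<Rightarrow> bool" where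
  "horizontal \<xi> \<longleftrightarrow> (\<forall>x v vs. x \<in> S \<longrightarrow> v \<in> leaf_space M x \<longrightarrow> \<xi> x (v # vs) = 0)"

text \<open>Cartan's formula replaces the Lie derivative by \<open>\<iota>\<^sub>T d\<xi>\<close>, and every vector tangent to a leaf is the
  value of a leaf field; so the conditions on all leaf fields become conditions at each point.\<close>

lemma basic_forms_iff:
  "\<xi> \<in> basic_forms M k \<longleftrightarrow> \<xi> \<in> forms M k \<and> horizontal \<xi> \<and> horizontal (ext_deriv M \<xi>)"
proof
  assume b: "\<xi> \<in> basic_forms M k"
  then have \<xi>: "\<xi> \<in> forms M k" by (simp add: basic_forms_def)
  have T: "interior_prod T \<xi> = zero_form" "lie_deriv M T \<xi> = zero_form" if "T \<in> leaf_fields M" for T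
    using b that by (auto simp: basic_forms_def)
  have "\<xi> x (v # vs) = 0 \<and> ext_deriv M \<xi> x (v # vs) = 0" if x: "x \<in> S" and v: "v \<in> leaf_space M x" for x v vs
  proof -
    obtain Y where Y: "Y \<in> leaf_fields M" "Y x = v" using leaf_field_through[OF x v] by blast
    have "\<xi> x (v # vs) = 0"
      using fun_cong[OF fun_cong[OF T(1)[OF Y(1)], of x], of vs] Y(2) by (simp add: interior_prod_def)
    moreover have "ext_deriv M \<xi> x (v # vs) = 0"
    proof (cases "set vs \<subseteq> tangent_space M x")
      case True
      have "Y \<in> vector_fields M" using Y(1) by (simp add: leaf_fields_def)
      from cartan_formula[OF \<xi> this T(1)[OF Y(1)] x True] show ?thesis
        using T(2)[OF Y(1)] Y(2) by simp
    next
      case False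
      then show ?thesis by (intro ext_deriv_outside) auto
    qed
    ultimately show ?thesis by simp
  qed
  then show "\<xi> \<in> forms M k \<and> horizontal \<xi> \<and> horizontal (ext_deriv M \<xi>)"
    using \<xi> by (auto simp: horizontal_def)
next
  assume a: "\<xi> \<in> forms M k \<and> horizontal \<xi> \<and> horizontal (ext_deriv M \<xi>)"
  then have \<xi>: "\<xi> \<in> forms M k" by simp
  have "interior_prod Y \<xi> = zero_form \<and> lie_deriv M Y \<xi> = zero_form" if Y: "Y \<in> leaf_fields M" for Y
  proof -
    have leaf: "Y x \<in> leaf_space M x" if "x \<in> S" for x using Y that by (simp add: leaf_fields_def)
    have 0: "interior_prod Y \<xi> = zero_form"
    proof (intro ext)
      fix x vs show "interior_prod Y \<xi> x vs = 0"
      proof (cases "x \<in> S")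
        case True
        then show ?thesis using a leaf by (simp add: interior_prod_def horizontal_def)
      next
        case False
        then show ?thesis using forms_support[OF \<xi>] by (simp add: interior_prod_def)
      qed
    qed
    have Yv: "Y \<in> vector_fields M" using Y by (simp add: leaf_fields_def)
    have "lie_deriv M Y \<xi> = zero_form"
    proof (intro ext)
      fix x vs show "lie_deriv M Y \<xi> x vs = 0"
      proof (cases "x \<in> S \<and> set vs \<subseteq> tangent_space M x")
        case True
        then show ?thesis using cartan_formula[OF \<xi> Yv 0] a leaf by (simp add: horizontal_def)
      qed (auto simp: lie_deriv_def)
    qed
    with 0 show ?thesis by simp
  qed
  then show "\<xi> \<in> basic_forms M k" using \<xi> by (simp add: basic_forms_def)
qed

end

section \<open>Inverse matrices depending smoothly on parameters\<close>

definition inverse_matrices :: "nat \<Rightarrow> (nat \<Rightarrow> nat \<Rightarrow> real) \<Rightarrow> (nat \<Rightarrow> nat \<Rightarrow> real) \<Rightarrow> bool" where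
  "inverse_matrices q A W \<longleftrightarrow>
     (\<forall>i<q. \<forall>k<q. (\<Sum>j<q. W i j * A j k) = (if i = k then 1 else 0)) \<and>
     (\<forall>i<q. \<forall>k<q. (\<Sum>j<q. A i j * W j k) = (if i = k then 1 else 0))"

lemma inverse_matricesD:
  assumes "inverse_matrices q A W" "i < q" "k < q"
  shows "(\<Sum>j<q. W i j * A j k) = (if i = k then 1 else 0)" "(\<Sum>j<q. A i j * W j k) = (if i = k then 1 else 0)"
  using assms unfolding inverse_matrices_def by blast+

lemma std_vec_combination: "(\<Sum>i<q. v i *\<^sub>R std_vec i) = (\<lambda>i. if i < q then v i else 0)"
  by (rule ext) (simp add: sum_fun_apply fun_ops std_vec_def if_distrib cong: if_cong)

lemma independent_std_vec: "independent (std_vec ` {..<q})"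
proof -
  have inj: "inj_on std_vec {..<q}"
    by (rule inj_onI) (metis std_vec_def zero_neq_one)
  have "\<forall>v\<in>std_vec ` {..<q}. u v = 0" if "(\<Sum>v\<in>std_vec ` {..<q}. u v *\<^sub>R v) = 0" for u
  proof -
    have "(\<Sum>i<q. u (std_vec i) *\<^sub>R std_vec i) = 0"
      using that by (simp add: sum.reindex[OF inj] o_def)
    then have "(\<lambda>i. if i < q then u (std_vec i) else 0) = 0"
      by (simp only: std_vec_combination)
    then have "u (std_vec i) = 0" if "i < q" for i using fun_cong[of _ _ i] that by (fastforce simp: fun_ops)
    then show ?thesis by auto
  qed
  then show ?thesis by (subst dependent_finite) auto
qed

text \<open>A square matrix with trivial kernel acts as an injective, hence surjective, endomorphism of the
  span of the first \<open>q\<close> standard vectors.\<close>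

lemma inverse_matrix_exists:
  fixes A :: "nat \<Rightarrow> nat \<Rightarrow> real"
  assumes inj: "\<And>v i. (\<And>j. j < q \<Longrightarrow> (\<Sum>i<q. v i * A i j) = 0) \<Longrightarrow> i < q \<Longrightarrow> v i = 0"
  shows "\<exists>W. inverse_matrices q A W"
proof -
  define f where "f v = (\<lambda>j. if j < q then \<Sum>i<q. v i * A i j else 0)" for v
  have lin: "linear f"
    by (rule linearI) (auto simp: f_def fun_eq_iff fun_ops algebra_simps sum.distrib sum_distrib_left)
  let ?B = "std_vec ` {..<q}"
  have supp: "v i = 0" if "v \<in> span ?B" "i \<ge> q" for v i
  proof -
    have "subspace {v :: nat \<Rightarrow> real. v i = 0}" by (auto simp: subspace_def fun_ops)
    moreover have "?B \<subseteq> {v. v i = 0}" using that(2) by (auto simp: std_vec_def)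
    ultimately show ?thesis using span_minimal that(1) by blast
  qed
  have ker: "v = 0" if "v \<in> span ?B" "f v = 0" for v
  proof
    fix i show "v i = 0 i"
    proof (cases "i < q")
      case True
      have "(\<Sum>i<q. v i * A i j) = 0" if "j < q" for j
        using fun_cong[OF \<open>f v = 0\<close>, of j] that by (simp add: f_def fun_ops)
      then show ?thesis using inj[of v i] True by (simp add: fun_ops)
    qed (use supp that(1) in \<open>simp add: fun_ops\<close>)
  qed
  have inj_span: "inj_on f (span ?B)"
  proof (rule inj_onI)
    fix v w assume "v \<in> span ?B" "w \<in> span ?B" "f v = f w"
    then have "v - w = 0" using ker[OF span_diff[of v ?B w]] by (simp add: linear_diff[OF lin])
    then show "v = w" by simp
  qed
  have indep: "independent (f ` ?B)"
    by (rule linear_independent_injective_image[OF lin independent_std_vec inj_span])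
  have in_span: "v \<in> span ?B" if "\<And>i. i \<ge> q \<Longrightarrow> v i = 0" for v :: "nat \<Rightarrow> real"
  proof -
    have "v = (\<Sum>i<q. v i *\<^sub>R std_vec i)" using that by (auto simp: std_vec_combination fun_eq_iff not_less)
    also have "\<dots> \<in> span ?B" by (intro span_sum span_scale span_base) auto
    finally show ?thesis .
  qed
  have cardB: "card ?B = q"
    using independent_std_vec by (subst card_image) (auto intro!: inj_onI, metis std_vec_def zero_neq_one)
  have cardf: "card (f ` ?B) = q"
    using card_image[OF inj_on_subset[OF inj_span span_superset]] cardB by simp
  have surj: "std_vec k \<in> span (f ` ?B)" if k: "k < q" for k
  proof (rule ccontr)
    assume n: "std_vec k \<notin> span (f ` ?B)"
    then have "independent (insert (std_vec k) (f ` ?B))"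
      using indep independent_insertI by blast
    moreover have "insert (std_vec k) (f ` ?B) \<subseteq> span ?B"
    proof -
      have "f v \<in> span ?B" for v by (rule in_span) (simp add: f_def)
      moreover have "std_vec k \<in> span ?B" using k by (intro span_base imageI) simp
      ultimately show ?thesis by blast
    qed
    ultimately have "card (insert (std_vec k) (f ` ?B)) \<le> card ?B"
      using independent_span_bound[of ?B] by blast
    moreover have "std_vec k \<notin> f ` ?B" using n by (rule contrapos_nn) (rule span_base)
    ultimately show False using cardf cardB by simp
  qed
  have "\<exists>w. f w = std_vec k" if "k < q" for k
  proof -
    have "std_vec k \<in> f ` span ?B" using surj[OF that] by (simp only: linear_span_image[OF lin])
    then show ?thesis by (elim imageE) (rule exI, erule sym)
  qed
  then have "\<forall>k\<in>{..<q}. \<exists>w. f w = std_vec k" by simp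
  from bchoice[OF this] obtain W where W: "\<And>k. k < q \<Longrightarrow> f (W k) = std_vec k" by auto
  have WA: "(\<Sum>j<q. W i j * A j k) = (if i = k then 1 else 0)" if "i < q" "k < q" for i k
    using fun_cong[OF W[OF that(1)], of k] that by (auto simp: f_def std_vec_def)
  have "(\<Sum>j<q. A i j * W j k) = (if i = k then 1 else 0)" if ik: "i < q" "k < q" for i k
  proof -
    define r where "r k = (\<Sum>j<q. A i j * W j k) - (if i = k then 1 else 0)" for k
    have "(\<Sum>k<q. r k * A k l) = 0" if l: "l < q" for l
    proof -
      have "(\<Sum>k<q. (\<Sum>j<q. A i j * W j k) * A k l) = (\<Sum>k<q. \<Sum>j<q. A i j * (W j k * A k l))"
        by (simp add: sum_distrib_right mult.assoc)
      also have "\<dots> = (\<Sum>j<q. \<Sum>k<q. A i j * (W j k * A k l))" by (rule sum.swap)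
      also have "\<dots> = (\<Sum>j<q. A i j * (if j = l then 1 else 0))"
        using WA l by (intro sum.cong refl) (simp flip: sum_distrib_left)
      also have "\<dots> = A i l" using l by (simp add: if_distrib cong: if_cong)
      finally show ?thesis
        using ik(1) by (simp add: r_def left_diff_distrib sum_subtractf if_distrib[of "\<lambda>c. c * _"] cong: if_cong)
    qed
    then have "r k = 0" using inj[of r k] ik(2) by blast
    then show ?thesis by (simp add: r_def)
  qed
  then show ?thesis using WA unfolding inverse_matrices_def by blast
qed

text \<open>The resolvent identity $W - W_0 = W (A_0 - A) W_0$.\<close>

lemma inverse_difference:
  assumes "inverse_matrices q A W" "inverse_matrices q A0 W0" "i < q" "k < q"
  shows "W i k - W0 i k = (\<Sum>j<q. \<Sum>l<q. W i j * (A0 j l - A j l) * W0 l k)"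
proof -
  have "(\<Sum>j<q. \<Sum>l<q. W i j * A0 j l * W0 l k) = (\<Sum>j<q. W i j * (\<Sum>l<q. A0 j l * W0 l k))"
    by (simp add: sum_distrib_left mult.assoc)
  also have "\<dots> = W i k"
  proof -
    have "(\<Sum>j<q. W i j * (\<Sum>l<q. A0 j l * W0 l k)) = (\<Sum>j<q. W i j * (if j = k then 1 else 0))"
      using inverse_matricesD(2)[OF assms(2) _ assms(4)] by (intro sum.cong refl) simp
    then show ?thesis using assms(4) by (simp add: if_distrib cong: if_cong)
  qed
  finally have 1: "(\<Sum>j<q. \<Sum>l<q. W i j * A0 j l * W0 l k) = W i k" .
  have "(\<Sum>j<q. \<Sum>l<q. W i j * A j l * W0 l k) = (\<Sum>l<q. (\<Sum>j<q. W i j * A j l) * W0 l k)"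
    by (subst sum.swap) (simp add: sum_distrib_right)
  also have "\<dots> = W0 i k"
  proof -
    have "(\<Sum>l<q. (\<Sum>j<q. W i j * A j l) * W0 l k) = (\<Sum>l<q. (if i = l then 1 else 0) * W0 l k)"
      using inverse_matricesD(1)[OF assms(1,3)] by (intro sum.cong refl) simp
    then show ?thesis using assms(3) by (simp add: if_distrib[of "\<lambda>c. c * _"] cong: if_cong)
  qed
  finally show ?thesis
    using 1 by (simp add: right_diff_distrib left_diff_distrib sum_subtractf)
qed

text \<open>Let \<open>s\<close> be the sum of the absolute values of the entries.  The resolvent identity bounds
  \<open>s (W y)\<close> by \<open>2 * s W0\<close> once \<open>A y\<close> is close to \<open>A0\<close>, and then \<open>W y - W0\<close> by a multiple of the
  distance of \<open>A y\<close> from \<open>A0\<close>.\<close>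

lemma tendsto_inverse_matrix:
  assumes inv: "\<forall>\<^sub>F y in F. inverse_matrices q (A y) (W y)" and inv0: "inverse_matrices q A0 W0"
    and lim: "\<And>j l. j < q \<Longrightarrow> l < q \<Longrightarrow> ((\<lambda>y. A y j l) \<longlongrightarrow> A0 j l) F"
    and ik: "i < q" "k < q"
  shows "((\<lambda>y. W y i k) \<longlongrightarrow> W0 i k) F"
proof -
  define s where "s W = (\<Sum>i<q. \<Sum>j<q. \<bar>W i j\<bar>)" for W :: "nat \<Rightarrow> nat \<Rightarrow> real"
  define \<eta> where "\<eta> y = (\<Sum>j<q. \<Sum>l<q. \<bar>A0 j l - A y j l\<bar>)" for y
  have entry: "\<bar>W i j\<bar> \<le> s W" if "i < q" "j < q" for W i j
  proof -
    have "\<bar>W i j\<bar> \<le> (\<Sum>j<q. \<bar>W i j\<bar>)" using that by (intro member_le_sum) auto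
    also have "\<dots> \<le> s W" unfolding s_def using that by (intro member_le_sum) (auto intro: sum_nonneg)
    finally show ?thesis .
  qed
  have s0: "s W \<ge> 0" for W unfolding s_def by (intro sum_nonneg) auto
  have \<eta>0: "\<eta> y \<ge> 0" for y unfolding \<eta>_def by (intro sum_nonneg) auto
  have bound: "\<bar>W y i k - W0 i k\<bar> \<le> s (W y) * \<eta> y * s W0"
    if y: "inverse_matrices q (A y) (W y)" and ik: "i < q" "k < q" for y i k
  proof -
    have "\<bar>W y i k - W0 i k\<bar> \<le> (\<Sum>j<q. \<Sum>l<q. \<bar>W y i j * (A0 j l - A y j l) * W0 l k\<bar>)"
      unfolding inverse_difference[OF y inv0 ik] by (intro order_trans[OF sum_abs] sum_mono sum_abs)
    also have "\<dots> \<le> (\<Sum>j<q. \<Sum>l<q. s (W y) * \<bar>A0 j l - A y j l\<bar> * s W0)"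
      using entry ik s0 by (intro sum_mono) (auto simp: abs_mult intro!: mult_mono)
    also have "\<dots> = s (W y) * \<eta> y * s W0"
      by (simp add: \<eta>_def sum_distrib_left sum_distrib_right)
    finally show ?thesis .
  qed
  have \<eta>lim: "(\<eta> \<longlongrightarrow> 0) F"
  proof -
    have "(\<eta> \<longlongrightarrow> (\<Sum>j<q. \<Sum>l<q. \<bar>A0 j l - A0 j l\<bar>)) F"
      unfolding \<eta>_def[abs_def] by (intro tendsto_sum tendsto_rabs tendsto_diff tendsto_const lim) auto
    then show ?thesis by simp
  qed
  \<comment> \<open>Summing the bound over all entries contributes the factor \<open>C\<close>, and \<open>C * \<eta> y \<le> 1 / 2\<close> makes it harmless.\<close>
  define C where "C = real q * real q * s W0"
  have C0: "C \<ge> 0" using s0 by (simp add: C_def)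
  have "\<forall>\<^sub>F y in F. \<eta> y < 1 / (2 * C + 2)"
    by (rule order_tendstoD(2)[OF \<eta>lim]) (use C0 in simp)
  with inv have small: "\<forall>\<^sub>F y in F. \<bar>W y i k - W0 i k\<bar> \<le> 2 * s W0 * \<eta> y * s W0"
  proof eventually_elim
    case (elim y)
    have "s (W y) - s W0 \<le> (\<Sum>i<q. \<Sum>k<q. \<bar>W y i k - W0 i k\<bar>)"
      unfolding s_def sum_subtractf[symmetric] by (intro sum_mono) auto
    also have "\<dots> \<le> (\<Sum>i<q. \<Sum>k<q. s (W y) * \<eta> y * s W0)"
      using bound[OF elim(1)] by (intro sum_mono) auto
    also have "\<dots> = s (W y) * (C * \<eta> y)" by (simp add: C_def)
    also have "\<dots> \<le> s (W y) * (1 / 2)"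
    proof (rule mult_left_mono[OF _ s0])
      have "C * \<eta> y \<le> C * (1 / (2 * C + 2))" using elim(2) C0 by (intro mult_left_mono) auto
      also have "\<dots> \<le> 1 / 2" using C0 by (simp add: field_simps)
      finally show "C * \<eta> y \<le> 1 / 2" .
    qed
    finally have "s (W y) \<le> 2 * s W0" by simp
    then have "s (W y) * \<eta> y * s W0 \<le> 2 * s W0 * \<eta> y * s W0"
      using s0 \<eta>0 by (intro mult_right_mono) auto
    then show ?case using bound[OF elim(1) ik] by linarith
  qed
  have "((\<lambda>y. 2 * s W0 * \<eta> y * s W0) \<longlongrightarrow> 2 * s W0 * 0 * s W0) F"
    by (intro tendsto_intros \<eta>lim)
  then have null: "((\<lambda>y. 2 * s W0 * \<eta> y * s W0) \<longlongrightarrow> 0) F" by simp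
  have "\<forall>\<^sub>F y in F. norm (W y i k - W0 i k) \<le> 2 * s W0 * \<eta> y * s W0"
    using small by (simp only: real_norm_def)
  then show ?thesis by (rule LIM_zero_cancel[OF Lim_null_comparison[OF _ null]])
qed

context euclidean_open
begin

text \<open>The resolvent identity also gives $dW = -W\,dA\,W$.  So every order of differentiability of \<open>W\<close>
  yields the next.\<close>

lemma smooth_inverse_matrix:
  assumes A: "\<And>j l. j < q \<Longrightarrow> l < q \<Longrightarrow> smooth_on m U (\<lambda>y. A y j l)"
    and inv: "\<And>y. y \<in> U \<Longrightarrow> inverse_matrices q (A y) (W y)"
    and ik: "i < q" "k < q"
  shows "smooth_on m U (\<lambda>y. W y i k)"
proof -
  have cont: "continuous_on U (\<lambda>y. W y i k)" if "i < q" "k < q" for i k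
    unfolding continuous_on_def
  proof
    fix x assume x: "x \<in> U"
    have "\<forall>\<^sub>F y in at x within U. inverse_matrices q (A y) (W y)"
      unfolding eventually_at_filter using inv by auto
    then show "((\<lambda>y. W y i k) \<longlongrightarrow> W x i k) (at x within U)"
      by (rule tendsto_inverse_matrix[OF _ inv[OF x] _ that])
        (use Ck_continuous[OF smooth_imp_Ck[OF A]] x in \<open>auto simp: continuous_on_def\<close>)
  qed
  define W' where "W' a i k y = - (\<Sum>j<q. \<Sum>l<q. W y i j * pderivative a (\<lambda>y. A y j l) y * W y l k)" for a i k y
  have deriv: "((\<lambda>t. W (x(a := t)) i k) has_real_derivative W' a i k x) (at (x a))"
    if x: "x \<in> U" and a: "a < m" and ik: "i < q" "k < q" for x a i k
    unfolding has_field_derivative_iff fun_upd_triv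
  proof -
    have line: "\<forall>\<^sub>F t in at (x a). inverse_matrices q (A (x(a := t))) (W (x(a := t)))"
      unfolding eventually_at_filter
      by (rule eventually_mono[OF eventually_line_in[OF openU x a]]) (intro impI inv)
    have Ad: "((\<lambda>t. A (x(a := t)) j l) has_real_derivative pderivative a (\<lambda>y. A y j l) x) (at (x a))"
      if "j < q" "l < q" for j l
      using has_pderivative[OF smooth_imp_Ck[OF A[OF that]] x a] .
    have Alim: "((\<lambda>t. A (x(a := t)) j l) \<longlongrightarrow> A x j l) (at (x a))" if "j < q" "l < q" for j l
      using DERIV_isCont[OF Ad[OF that]] unfolding isCont_def fun_upd_triv .
    have Wlim: "((\<lambda>t. W (x(a := t)) i j) \<longlongrightarrow> W x i j) (at (x a))" if "i < q" "j < q" for i j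
      by (rule tendsto_inverse_matrix[OF line inv[OF x] Alim that])
    have Aquot: "((\<lambda>t. (A (x(a := t)) j l - A x j l) / (t - x a)) \<longlongrightarrow> pderivative a (\<lambda>y. A y j l) x) (at (x a))"
      if "j < q" "l < q" for j l
      using Ad[OF that] unfolding has_field_derivative_iff fun_upd_triv .
    have "((\<lambda>t. - (\<Sum>j<q. \<Sum>l<q. W (x(a := t)) i j * ((A (x(a := t)) j l - A x j l) / (t - x a)) * W x l k))
        \<longlongrightarrow> W' a i k x) (at (x a))"
      unfolding W'_def using ik
      by (intro tendsto_minus tendsto_sum tendsto_mult Wlim Aquot tendsto_const) auto
    moreover have "\<forall>\<^sub>F t in at (x a).
        - (\<Sum>j<q. \<Sum>l<q. W (x(a := t)) i j * ((A (x(a := t)) j l - A x j l) / (t - x a)) * W x l k) =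
        (W (x(a := t)) i k - W x i k) / (t - x a)"
      using line
    proof eventually_elim
      case (elim t)
      show ?case
        unfolding inverse_difference[OF elim inv[OF x] ik] sum_divide_distrib sum_negf[symmetric]
        by (intro sum.cong refl) (simp add: diff_divide_distrib algebra_simps)
    qed
    ultimately show "((\<lambda>t. (W (x(a := t)) i k - W x i k) / (t - x a)) \<longlongrightarrow> W' a i k x) (at (x a))"
      by (rule Lim_transform_eventually)
  qed
  have "Ck m U N (\<lambda>y. W y i k)" if "i < q" "k < q" for N i k
    using that
  proof (induction N arbitrary: i k)
    case (Suc N)
    show ?case
    proof (rule Ck_SucI[where f' = "\<lambda>a. W' a i k"])
      fix a assume "a < m"
      have "Ck m U N (\<lambda>y. (\<Sum>j<q. \<Sum>l<q. (-1) * W y i j * pderivative a (\<lambda>y. A y j l) y * W y l k))"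
        using Suc \<open>a < m\<close> smooth_imp_Ck[OF smooth_pderivative[OF A]]
        by (intro Ck_sum Ck_mult Ck_const) auto
      then show "Ck m U N (W' a i k)" by (simp add: W'_def[abs_def] sum_negf)
    qed (fact cont[OF Suc.prems], rule deriv[OF _ _ Suc.prems])
  qed (use cont in simp)
  then show ?thesis using ik by (simp add: smooth_on_iff_Ck)
qed

end

section \<open>The symplectic contraction of basic forms\<close>

locale symplectic_mfd = foliated_mfd M m p q for M :: "'a foliated" and m p q +
  fixes \<omega> :: "'a dform" and n :: nat
  assumes symplectic: "transversely_symplectic M \<omega>" and q2n: "q = 2 * n"
begin

text \<open>The transverse coordinate vectors of a foliated chart.\<close>

definition transverse_vec :: "'a chart \<Rightarrow> 'a \<Rightarrow> nat \<Rightarrow> 'a tvec" where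
  "transverse_vec c x i = coord_vec M c x (std_vec (p + i))"

abbreviation hor_form :: "'a chart \<Rightarrow> 'a \<Rightarrow> nat \<Rightarrow> 'a tvec altform \<Rightarrow> bool" where
  "hor_form c x \<equiv> transverse_frame.hform (tangent_space M x) (transverse_vec c x) (\<lambda>i v. v c (p + i)) q"

lemma hor_frame: "c \<in> fol_at x \<Longrightarrow> transverse_frame (tangent_space M x) (transverse_vec c x) q"
  unfolding transverse_vec_def by unfold_locales (rule coord_vec_in_tangent[OF fol_at_charts])

lemma leaf_coord_vec: "c \<in> fol_at x \<Longrightarrow> j < p \<Longrightarrow> coord_vec M c x (std_vec j) \<in> leaf_space M x"
  using coord_vec_std_self[OF fol_at_charts, of c x j] mpq
  by (intro leaf_spaceI[of _ x c] coord_vec_in_tangent fol_at_charts) (auto simp: std_vec_def)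

lemma sum_split_pq: "(\<Sum>j<m. f j) = (\<Sum>j<p. f j) + (\<Sum>i<q. f (p + i))"
  for f :: "nat \<Rightarrow> 'b::comm_monoid_add"
  unfolding mpq lessThan_atLeast0
  using sum.atLeastLessThan_concat[of 0 p "p + q" f] sum.shift_bounds_nat_ivl[of f 0 p q] by (simp add: add.commute)

text \<open>In a foliated chart, a form that annihilates the leaf vectors is determined by the transverse
  coordinates of its arguments.\<close>

lemma full_to_hor:
  assumes c: "c \<in> fol_at x" and \<alpha>: "full_form c x k \<alpha>" and hor: "\<And>v vs. v \<in> leaf_space M x \<Longrightarrow> \<alpha> (v # vs) = 0"
  shows "hor_form c x k \<alpha>"
proof -
  interpret F: transverse_frame "tangent_space M x" "\<lambda>j. coord_vec M c x (std_vec j)" "\<lambda>j v. v c j" m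
    by (rule full_frame[OF fol_at_charts[OF c]])
  interpret H: transverse_frame "tangent_space M x" "transverse_vec c x" "\<lambda>i v. v c (p + i)" q
    by (rule hor_frame[OF c])
  have alt: "alternating \<alpha>" and exp: "F.expands \<alpha>" using \<alpha> by (auto simp: F.hform_def)
  have 0: "\<alpha> (us @ v # ws) = 0" if "v \<in> leaf_space M x" for us v ws
    using alternating_move_front[OF alt, of us v ws] hor[OF that] by simp
  have "H.expands \<alpha>"
    unfolding H.expands_def
  proof (intro allI impI)
    fix us v ws assume v: "v \<in> tangent_space M x"
    show "\<alpha> (us @ v # ws) = (\<Sum>i<q. v c (p + i) * \<alpha> (us @ transverse_vec c x i # ws))"
      unfolding F.expandsD[OF exp v, of us ws] sum_split_pq transverse_vec_def
      using 0[OF leaf_coord_vec[OF c]] by simp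
  qed
  then show ?thesis
    using \<alpha> by (simp add: H.hform_def F.hform_def H.supported_def F.supported_def)
qed

lemma hor_to_full:
  assumes c: "c \<in> fol_at x" and \<alpha>: "hor_form c x k \<alpha>"
  shows "full_form c x k \<alpha>" and "v \<in> leaf_space M x \<Longrightarrow> \<alpha> (v # vs) = 0"
proof -
  interpret F: transverse_frame "tangent_space M x" "\<lambda>j. coord_vec M c x (std_vec j)" "\<lambda>j v. v c j" m
    by (rule full_frame[OF fol_at_charts[OF c]])
  interpret H: transverse_frame "tangent_space M x" "transverse_vec c x" "\<lambda>i v. v c (p + i)" q
    by (rule hor_frame[OF c])
  have exp: "H.expands \<alpha>" using \<alpha> by (auto simp: H.hform_def)
  have 0: "\<alpha> (us @ v # ws) = 0" if v: "v \<in> leaf_space M x" for us v ws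
  proof -
    have "v c (p + i) = 0" if "i < q" for i
      using leaf_spaceD(2)[OF v c] that mpq by simp
    then show ?thesis using H.expandsD[OF exp leaf_spaceD(1)[OF v], of us ws] by simp
  qed
  show "v \<in> leaf_space M x \<Longrightarrow> \<alpha> (v # vs) = 0" using 0[of v "[]"] by simp
  have "F.expands \<alpha>"
    unfolding F.expands_def
  proof (intro allI impI)
    fix us v ws assume v: "v \<in> tangent_space M x"
    show "\<alpha> (us @ v # ws) = (\<Sum>j<m. v c j * \<alpha> (us @ coord_vec M c x (std_vec j) # ws))"
      unfolding H.expandsD[OF exp v, of us ws] sum_split_pq transverse_vec_def
      using 0[OF leaf_coord_vec[OF c]] by simp
  qed
  then show "full_form c x k \<alpha>"
    using \<alpha> by (simp add: H.hform_def F.hform_def H.supported_def F.supported_def)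
qed

lemma basic_hor_form:
  assumes "\<xi> \<in> basic_forms M k" "c \<in> fol_at x"
  shows "hor_form c x k (\<xi> x)"
proof -
  have \<xi>: "\<xi> \<in> forms M k" "horizontal \<xi>" using assms(1) basic_forms_iff by auto
  have x: "x \<in> S" using charts_at_in_S[OF fol_at_charts[OF assms(2)]] .
  show ?thesis
    by (rule full_to_hor[OF assms(2) forms_full_form[OF \<xi>(1) fol_at_charts[OF assms(2)]]])
      (use \<xi>(2) x in \<open>simp add: horizontal_def\<close>)
qed

lemma basic_vanishes_above:
  assumes "\<xi> \<in> basic_forms M k" "k > q"
  shows "\<xi> = 0"
proof
  fix x show "\<xi> x = 0 x"
  proof (cases "x \<in> S")
    case True
    then obtain c where c: "c \<in> fol_at x" using foliated_cover by blast
    interpret H: transverse_frame "tangent_space M x" "transverse_vec c x" "\<lambda>i v. v c (p + i)" q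
      by (rule hor_frame[OF c])
    show ?thesis using H.hform_vanishes_above[OF basic_hor_form[OF assms(1) c] assms(2)] by (simp add: fun_ops)
  next
    case False
    then show ?thesis using forms_outside[of \<xi> k x] assms(1) basic_forms_iff[of \<xi> k] by (simp add: fun_ops)
  qed
qed

lemma \<omega>_basic: "\<omega> \<in> basic_forms M 2" and \<omega>_closed: "ext_deriv M \<omega> = 0"
  and \<omega>_nondeg: "x \<in> S \<Longrightarrow> v \<in> tangent_space M x \<Longrightarrow> (\<And>w. w \<in> tangent_space M x \<Longrightarrow> \<omega> x [v, w] = 0) \<Longrightarrow>
    v \<in> leaf_space M x"
  using symplectic unfolding transversely_symplectic_def by (auto simp: zero_fun_def)

lemma \<omega>_form: "\<omega> \<in> forms M 2"
  using \<omega>_basic basic_forms_iff by simp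

definition \<Omega> :: "'a chart \<Rightarrow> 'a \<Rightarrow> nat \<Rightarrow> nat \<Rightarrow> real" where
  "\<Omega> c x i j = \<omega> x [transverse_vec c x i, transverse_vec c x j]"

definition gram_inv :: "'a chart \<Rightarrow> 'a \<Rightarrow> nat \<Rightarrow> nat \<Rightarrow> real" where
  "gram_inv c x = (SOME W. inverse_matrices q (\<Omega> c x) W)"

text \<open>A kernel vector of the matrix would be a combination of the transverse coordinate vectors that
  is orthogonal to all vectors for \<open>\<omega>\<close>, hence tangent to the leaf, hence zero.\<close>

lemma inverse_\<Omega>:
  assumes c: "c \<in> fol_at x"
  shows "inverse_matrices q (\<Omega> c x) (gram_inv c x)"
  unfolding gram_inv_def
proof (rule someI_ex[of "inverse_matrices q (\<Omega> c x)"], rule inverse_matrix_exists)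
  fix v i assume 0: "\<And>j. j < q \<Longrightarrow> (\<Sum>i<q. v i * \<Omega> c x i j) = 0" and i: "i < q"
  note at = fol_at_charts[OF c]
  have x: "x \<in> S" using charts_at_in_S[OF at] .
  interpret H: transverse_frame "tangent_space M x" "transverse_vec c x" "\<lambda>i v. v c (p + i)" q
    by (rule hor_frame[OF c])
  have exp: "H.expands (\<omega> x)" using basic_hor_form[OF \<omega>_basic c] by (simp add: H.hform_def)
  define u where "u = (\<Sum>i<q. v i *\<^sub>R transverse_vec c x i)"
  have u: "u \<in> tangent_space M x"
    unfolding u_def using H.E_in by (intro subspace_sum subspace_scale subspace_tangent) auto
  have "\<omega> x [u, w] = 0" if w: "w \<in> tangent_space M x" for w
  proof -
    have "\<omega> x [u, w] = (\<Sum>i<q. v i * \<omega> x [transverse_vec c x i, w])"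
      using forms_sum[OF \<omega>_form, of "{..<q}" "transverse_vec c x" x "[]" v "[w]"] H.E_in by (simp add: u_def)
    also have "\<dots> = (\<Sum>i<q. v i * (\<Sum>j<q. w c (p + j) * \<Omega> c x i j))"
      using H.expandsD[OF exp w, of "[transverse_vec c x _]" "[]"] by (simp add: \<Omega>_def)
    also have "\<dots> = (\<Sum>j<q. w c (p + j) * (\<Sum>i<q. v i * \<Omega> c x i j))"
      unfolding sum_distrib_left by (subst sum.swap) (simp add: mult_ac)
    finally show ?thesis using 0 by simp
  qed
  then have "u \<in> leaf_space M x" using \<omega>_nondeg[OF x u] by blast
  then have "u c (p + i) = 0" using leaf_spaceD(2)[OF _ c, of u "p + i"] i mpq by simp
  moreover have "u c (p + i) = (\<Sum>j<q. v j * std_vec (p + j) (p + i))"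
    unfolding u_def transverse_vec_def using coord_vec_std_self[OF at] mpq
    by (simp add: sum_fun_apply fun_ops)
  ultimately show "v i = 0" using i by (simp add: std_vec_def if_distrib cong: if_cong)
qed

lemma symp_frame:
  assumes c: "c \<in> fol_at x"
  shows "symplectic_frame (tangent_space M x) (transverse_vec c x) (\<lambda>i v. v c (p + i)) q (\<omega> x) (gram_inv c x) n"
proof -
  interpret H: transverse_frame "tangent_space M x" "transverse_vec c x" "\<lambda>i v. v c (p + i)" q
    by (rule hor_frame[OF c])
  show ?thesis
    by unfold_locales (use q2n basic_hor_form[OF \<omega>_basic c] inverse_\<Omega>[OF c] in
      \<open>auto simp: inverse_matrices_def \<Omega>_def\<close>)
qed

text \<open>At every point an arbitrary foliated chart is used.  By \<open>lam_chart\<close> the value on horizontal forms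
  does not depend on it, so that a single chart serves for a whole neighbourhood.\<close>

definition lam :: "'a dform \<Rightarrow> 'a dform" where
  "lam \<xi> = (\<lambda>x. if x \<in> S then let c = (SOME c. c \<in> fol_at x) in poisson_contr q (gram_inv c x) (transverse_vec c x) (\<xi> x) else 0)"

lemma linear_lam: "linear lam"
proof (rule linearI)
  show "lam (\<xi> + \<eta>) = lam \<xi> + lam \<eta>" for \<xi> \<eta>
    by (simp add: fun_eq_iff[where 'a = 'a] lam_def fun_ops Let_def linear_add[OF linear_poisson_contr])
  show "lam (a *\<^sub>R \<xi>) = a *\<^sub>R lam \<xi>" for a \<xi>
    by (simp add: fun_eq_iff[where 'a = 'a] lam_def fun_ops Let_def linear_scale[OF linear_poisson_contr])
qed

text \<open>In both charts the operator satisfies the commutation rule \<open>\<Lambda>_flat\<close>, which determines it.\<close>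

lemma lam_chart:
  assumes c: "c \<in> fol_at x" and \<xi>: "hor_form c x k (\<xi> x)" "\<And>c'. c' \<in> fol_at x \<Longrightarrow> hor_form c' x k (\<xi> x)"
  shows "lam \<xi> x = poisson_contr q (gram_inv c x) (transverse_vec c x) (\<xi> x)"
proof -
  define c' where "c' = (SOME c. c \<in> fol_at x)"
  have c': "c' \<in> fol_at x" unfolding c'_def by (rule someI[of "\<lambda>c. c \<in> fol_at x", OF c])
  interpret C: symplectic_frame "tangent_space M x" "transverse_vec c x" "\<lambda>i v. v c (p + i)" q "\<omega> x" "gram_inv c x" n
    by (rule symp_frame[OF c])
  interpret C': symplectic_frame "tangent_space M x" "transverse_vec c' x" "\<lambda>i v. v c' (p + i)" q "\<omega> x" "gram_inv c' x" n
    by (rule symp_frame[OF c'])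
  have "x \<in> S" using charts_at_in_S[OF fol_at_charts[OF c]] .
  then have "lam \<xi> x = C'.\<Lambda> (\<xi> x)" by (simp add: lam_def c'_def Let_def)
  also have "\<dots> = C.\<Lambda> (\<xi> x)"
    by (rule C.\<Lambda>_unique[where P = C'.hform, OF linear_poisson_contr C'.\<Lambda>_flat _ C'.hform_contr \<xi>(1) \<xi>(2)[OF c']])
      (auto intro: C'.\<Lambda>_low_degree)
  finally show ?thesis .
qed

lemma lam_basic_chart:
  "c \<in> fol_at x \<Longrightarrow> \<xi> \<in> basic_forms M k \<Longrightarrow> lam \<xi> x = poisson_contr q (gram_inv c x) (transverse_vec c x) (\<xi> x)"
  using lam_chart basic_hor_form by blast

text \<open>Smoothness in foliated charts carries over to the other charts of the atlas by the transition
  maps.\<close>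

lemma forms_from_foliated_charts:
  assumes outside: "\<And>x. x \<notin> S \<Longrightarrow> \<xi> x = 0"
    and form: "\<And>x c. c \<in> fol_at x \<Longrightarrow> full_form c x k (\<xi> x)"
    and smooth: "\<And>c js. c \<in> foliated_charts M \<Longrightarrow> set js \<subseteq> {..<m} \<Longrightarrow> smooth_on m (img c) (\<lambda>y. rep c \<xi> y (map std_vec js))"
  shows "\<xi> \<in> forms M k"
proof (rule formsI[OF outside])
  fix x assume "x \<in> S"
  then obtain c where "c \<in> fol_at x" using foliated_cover by blast
  then show "\<exists>c\<in>charts_at M x. full_form c x k (\<xi> x)" using form fol_at_charts by blast
next
  fix c' js assume c': "c' \<in> charts M" and js: "set js \<subseteq> {..<m}"
  show "smooth_on m (img c') (\<lambda>y. rep c' \<xi> y (map std_vec js))"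
  proof (rule smooth_on_local[OF img_open[OF c']])
    fix y assume y: "y \<in> img c'"
    have "chart_inv c' y \<in> S" using charts_at_in_S[OF charts_at_inv[OF c' y]] .
    then obtain c where c: "c \<in> foliated_charts M" "chart_inv c' y \<in> fst c" using foliated_cover by blast
    note ch = foliated_charts_sub[OF c(1)]
    let ?W = "fst c' \<inter> fst c" and ?\<phi> = "\<lambda>y. snd c (chart_inv c' y)"
    have W: "openin X ?W" by (rule overlap_open[OF c' ch])
    interpret P: euclidean_map m "snd c' ` ?W" m "snd c ` ?W" ?\<phi>
      by (rule transition_map[OF c' ch W]) simp
    interpret C: euclidean_open m "img c" by (rule euclid_img[OF ch])
    have exp: "coord.expands m (rep c \<xi> z)" if z: "z \<in> img c" for z
    proof -
      have "c \<in> fol_at (chart_inv c z)" using c(1) z by simp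
      then show ?thesis
        unfolding rep_def by (intro full_form_pull_expands[OF form]) (auto simp: charts_at_inv[OF ch z])
    qed
    have sf: "C.sfam (rep c \<xi>)" by (rule C.sfam_of_basis[OF smooth[OF c(1)] exp])
    have G: "P.tgt.sfam (rep c \<xi>)"
      unfolding P.tgt.sfam_def by (intro allI smooth_on_subset[OF C.sfamD[OF sf]]) blast
    have E: "coord.expands m (rep c \<xi> z)" if "z \<in> snd c ` ?W" for z using exp that by blast
    have "smooth_on m (snd c' ` ?W) (\<lambda>y. rep c \<xi> (?\<phi> y) (map (\<lambda>u. u y) (map (\<lambda>j y. P.jac y (std_vec j)) js)))"
      by (rule P.smooth_expand[OF G E]) (use P.smooth_jac in auto)
    moreover have "rep c' \<xi> y (map std_vec js) = rep c \<xi> (?\<phi> y) (map (\<lambda>u. u y) (map (\<lambda>j y. P.jac y (std_vec j)) js))"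
      if "y \<in> snd c' ` ?W" for y
      using rep_change[OF c' ch W _ that E[OF P.\<phi>_in[OF that]], of "map std_vec js"] by (simp add: o_def)
    ultimately have "smooth_on m (snd c' ` ?W) (\<lambda>y. rep c' \<xi> y (map std_vec js))"
      by (subst P.src.smooth_on_cong)
    moreover have "y \<in> snd c' ` ?W" 
      by (rule image_eqI[of _ _ "chart_inv c' y"]) (use c(2) y in simp_all)
    ultimately show "\<exists>V. openin EE V \<and> y \<in> V \<and> V \<subseteq> img c' \<and> smooth_on m V (\<lambda>y. rep c' \<xi> y (map std_vec js))"
      using P.src.openU by blast
  qed
qed

lemma \<Omega>_rep: "\<Omega> c (chart_inv c y) i j = rep c \<omega> y [std_vec (p + i), std_vec (p + j)]"
  by (simp add: \<Omega>_def rep_def transverse_vec_def)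

lemma smooth_gram_inv:
  assumes c: "c \<in> foliated_charts M" and "i < q" "j < q"
  shows "smooth_on m (img c) (\<lambda>y. gram_inv c (chart_inv c y) i j)"
proof -
  note ch = foliated_charts_sub[OF c]
  interpret C: euclidean_open m "img c" by (rule euclid_img[OF ch])
  have "smooth_on m (img c) (\<lambda>y. \<Omega> c (chart_inv c y) i j)" for i j
    unfolding \<Omega>_rep by (rule C.sfamD[OF rep_sfam[OF \<omega>_form ch]])
  moreover have "inverse_matrices q (\<Omega> c (chart_inv c y)) (gram_inv c (chart_inv c y))" if "y \<in> img c" for y
    by (rule inverse_\<Omega>) (use c that in simp)
  ultimately show ?thesis
    by (intro C.smooth_inverse_matrix[where A = "\<lambda>y. \<Omega> c (chart_inv c y)" and W = "\<lambda>y. gram_inv c (chart_inv c y)"])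
      (use assms in auto)
qed

lemma rep_lam:
  assumes c: "c \<in> foliated_charts M" and y: "y \<in> img c" and \<xi>: "\<xi> \<in> basic_forms M k"
  shows "rep c (lam \<xi>) y vs = (\<Sum>i<q. \<Sum>j<q. (1/2) *
    (gram_inv c (chart_inv c y) i j * rep c \<xi> y (std_vec (p + j) # std_vec (p + i) # vs)))"
proof -
  have "c \<in> fol_at (chart_inv c y)" using c y by simp
  from lam_basic_chart[OF this \<xi>] show ?thesis
    by (simp add: rep_def poisson_contr_def transverse_vec_def sum_distrib_left)
qed

lemma lam_in_forms:
  assumes \<xi>: "\<xi> \<in> basic_forms M k"
  shows "lam \<xi> \<in> forms M (k - 2)" and "horizontal (lam \<xi>)"
proof -
  have hor: "hor_form c x (k - 2) (lam \<xi> x)" if c: "c \<in> fol_at x" for c x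
  proof -
    interpret C: symplectic_frame "tangent_space M x" "transverse_vec c x" "\<lambda>i v. v c (p + i)" q "\<omega> x" "gram_inv c x" n
      by (rule symp_frame[OF c])
    show ?thesis unfolding lam_basic_chart[OF c \<xi>] by (rule C.hform_\<Lambda>[OF basic_hor_form[OF \<xi> c]])
  qed
  show "horizontal (lam \<xi>)"
    unfolding horizontal_def
  proof (intro allI impI)
    fix x v vs assume "x \<in> S" "v \<in> leaf_space M x"
    moreover obtain c where "c \<in> fol_at x" using foliated_cover[OF \<open>x \<in> S\<close>] by blast
    ultimately show "lam \<xi> x (v # vs) = 0" using hor_to_full(2)[OF _ hor] by blast
  qed
  show "lam \<xi> \<in> forms M (k - 2)"
  proof (rule forms_from_foliated_charts)
    show "lam \<xi> x = 0" if "x \<notin> S" for x using that by (simp add: lam_def)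
    show "full_form c x (k - 2) (lam \<xi> x)" if "c \<in> fol_at x" for x c
      using hor_to_full(1)[OF that hor[OF that]] .
    fix c js assume c: "c \<in> foliated_charts M"
    note ch = foliated_charts_sub[OF c]
    interpret C: euclidean_open m "img c" by (rule euclid_img[OF ch])
    have \<xi>f: "\<xi> \<in> forms M k" using \<xi> basic_forms_iff by simp
    have "smooth_on m (img c) (\<lambda>y. \<Sum>i<q. \<Sum>j<q. (1/2) *
      (gram_inv c (chart_inv c y) i j * rep c \<xi> y (std_vec (p + j) # std_vec (p + i) # map std_vec js)))"
      by (intro C.smooth_sum C.smooth_mult C.smooth_const smooth_gram_inv[OF c] C.sfamD[OF rep_sfam[OF \<xi>f ch]]) auto
    then show "smooth_on m (img c) (\<lambda>y. rep c (lam \<xi>) y (map std_vec js))"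
      using C.smooth_on_cong[of "\<lambda>y. rep c (lam \<xi>) y (map std_vec js)"] rep_lam[OF c _ \<xi>] by simp
  qed
qed

text \<open>Along a leaf vector, Cartan's formula for a horizontal form reduces to the directional
  derivative.\<close>

lemma ext_deriv_leaf:
  assumes \<xi>: "\<xi> \<in> forms M k" "horizontal \<xi>" and c: "c \<in> fol_at x" and v: "v \<in> leaf_space M x"
    and vs: "set vs \<subseteq> tangent_space M x"
  shows "ext_deriv M \<xi> x (v # vs) = dird m (v c) (\<lambda>y. rep c \<xi> y (map (\<lambda>v. v c) vs)) (snd c x)"
proof -
  note at = fol_at_charts[OF c] and cs = charts_atD[OF fol_at_charts[OF c]]
  interpret C: euclidean_open m "img c" by (rule euclid_img[OF cs(1)])
  have y: "snd c x \<in> img c" using cs by blast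
  have "contr (v c) (rep c \<xi> y) = 0" if y: "y \<in> img c" for y
  proof
    fix ws
    let ?z = "chart_inv c y"
    have z: "c \<in> fol_at ?z" using c y by simp
    have "coord_vec M c ?z (v c) \<in> leaf_space M ?z"
      by (rule leaf_spaceI[OF coord_vec_in_tangent[OF fol_at_charts[OF z]] z])
        (use leaf_spaceD(2)[OF v c] coord_vec_self[OF fol_at_charts[OF z]] in simp)
    then show "contr (v c) (rep c \<xi> y) ws = 0 ws"
      using \<xi>(2) charts_at_in_S[OF fol_at_charts[OF z]] by (simp add: contr_apply rep_def horizontal_def fun_ops)
  qed
  then have "coord_d m (\<lambda>y. contr (v c) (rep c \<xi> y)) (snd c x) = coord_d m (\<lambda>_. 0) (snd c x)"
    by (rule C.coord_d_cong[OF _ y])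
  then show ?thesis
    using ext_deriv_chart[OF \<xi>(1) at, of "v # vs"] leaf_spaceD(1)[OF v] vs
    by (simp add: coord_d_Cons C.coord_d_0 fun_ops)
qed

lemma basic_leaf_derivative:
  assumes \<xi>: "\<xi> \<in> basic_forms M k" and c: "c \<in> fol_at x" and v: "v \<in> leaf_space M x"
  shows "dird m (v c) (\<lambda>y. rep c \<xi> y ws) (snd c x) = 0"
proof -
  note at = fol_at_charts[OF c] and cs = charts_atD[OF fol_at_charts[OF c]]
  interpret C: euclidean_open m "img c" by (rule euclid_img[OF cs(1)])
  have y: "snd c x \<in> img c" using cs by blast
  have \<xi>': "\<xi> \<in> forms M k" "horizontal \<xi>" "horizontal (ext_deriv M \<xi>)" using \<xi> basic_forms_iff by auto
  let ?vs = "map (coord_vec M c x) ws"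
  have "0 = ext_deriv M \<xi> x (v # ?vs)"
    using \<xi>'(3) v charts_at_in_S[OF at] by (simp add: horizontal_def)
  also have "\<dots> = dird m (v c) (\<lambda>y. rep c \<xi> y (map (\<lambda>v. v c) ?vs)) (snd c x)"
    by (rule ext_deriv_leaf[OF \<xi>'(1,2) c v]) (use coord_vec_in_tangent[OF at] in auto)
  also have "\<dots> = dird m (v c) (\<lambda>y. rep c \<xi> y ws) (snd c x)"
  proof (rule C.dird_cong[OF _ y])
    fix y assume "y \<in> img c"
    then show "rep c \<xi> y (map (\<lambda>v. v c) ?vs) = rep c \<xi> y ws"
      using coord_expands_cong[OF rep_expands[OF \<xi>'(1) cs(1)], of y ws "\<lambda>w. coord_vec M c x w c" "\<lambda>w. w" "[]"]
        coord_vec_self[OF at] by (simp add: o_def)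
  qed
  finally show ?thesis by simp
qed

text \<open>The matrix of \<open>\<omega>\<close> is constant along the leaves because \<open>\<omega>\<close> is basic; differentiating the
  equation for the inverse matrix shows the same for the inverse.\<close>

lemma gram_inv_leaf_derivative:
  assumes c: "c \<in> fol_at x" and v: "v \<in> leaf_space M x" and ik: "i < q" "k < q"
  shows "dird m (v c) (\<lambda>y. gram_inv c (chart_inv c y) i k) (snd c x) = 0"
proof -
  have cf: "c \<in> foliated_charts M" using c by simp
  note cs = charts_atD[OF fol_at_charts[OF c]]
  interpret C: euclidean_open m "img c" by (rule euclid_img[OF cs(1)])
  have y: "snd c x \<in> img c" using cs by blast
  let ?W = "\<lambda>y. gram_inv c (chart_inv c y)" and ?O = "\<lambda>y. \<Omega> c (chart_inv c y)" and ?d = "\<lambda>f. dird m (v c) f (snd c x)"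
  have sW: "smooth_on m (img c) (\<lambda>y. ?W y i j)" if "i < q" "j < q" for i j by (rule smooth_gram_inv[OF cf that])
  have sO: "smooth_on m (img c) (\<lambda>y. ?O y i j)" for i j
    unfolding \<Omega>_rep by (rule C.sfamD[OF rep_sfam[OF \<omega>_form cs(1)]])
  have dO: "?d (\<lambda>y. ?O y i j) = 0" for i j
    unfolding \<Omega>_rep by (rule basic_leaf_derivative[OF \<omega>_basic c v])
  have inv: "inverse_matrices q (?O y) (?W y)" if "y \<in> img c" for y
    by (rule inverse_\<Omega>) (use cf that in simp)
  have x: "chart_inv c (snd c x) = x" using cs by simp
  have *: "(\<Sum>j<q. ?d (\<lambda>y. ?W y i j) * \<Omega> c x j l) = 0" if l: "l < q" for l
  proof -
    have "0 = ?d (\<lambda>_. if i = l then 1 else 0)" by (rule C.dird_const[symmetric])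
    also have "\<dots> = ?d (\<lambda>y. \<Sum>j<q. ?W y i j * ?O y j l)"
      by (rule C.dird_cong[OF _ y]) (rule inverse_matricesD(1)[OF inv ik(1) l, symmetric])
    also have "\<dots> = (\<Sum>j<q. ?d (\<lambda>y. ?W y i j * ?O y j l))"
      by (rule C.dird_sum[OF _ y]) (use C.smooth_mult sW ik(1) sO in auto)
    also have "\<dots> = (\<Sum>j<q. ?d (\<lambda>y. ?W y i j) * \<Omega> c x j l)"
      by (intro sum.cong refl) (simp add: C.dird_mult[OF sW sO y] ik(1) dO x)
    finally show ?thesis by simp
  qed
  have "?d (\<lambda>y. ?W y i k) = (\<Sum>j<q. ?d (\<lambda>y. ?W y i j) * (\<Sum>l<q. \<Omega> c x j l * gram_inv c x l k))"
  proof -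
    have "(\<Sum>j<q. ?d (\<lambda>y. ?W y i j) * (\<Sum>l<q. \<Omega> c x j l * gram_inv c x l k)) =
        (\<Sum>j<q. ?d (\<lambda>y. ?W y i j) * (if j = k then 1 else 0))"
      using inverse_matricesD(2)[OF inverse_\<Omega>[OF c] _ ik(2)] by (intro sum.cong refl) simp
    then show ?thesis using ik(2) by (simp add: if_distrib cong: if_cong)
  qed
  also have "\<dots> = (\<Sum>l<q. (\<Sum>j<q. ?d (\<lambda>y. ?W y i j) * \<Omega> c x j l) * gram_inv c x l k)"
    unfolding sum_distrib_left sum_distrib_right by (subst sum.swap) (simp add: mult.assoc)
  also have "\<dots> = 0" using * by simp
  finally show ?thesis .
qed

text \<open>The coordinate expression of \<open>\<Lambda> \<xi>\<close> consists of entries of the inverse matrix and values of \<open>\<xi>\<close>,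
  which are all constant along the leaves.\<close>

lemma lam_basic:
  assumes \<xi>: "\<xi> \<in> basic_forms M k"
  shows "lam \<xi> \<in> basic_forms M (k - 2)"
proof -
  note lf = lam_in_forms[OF \<xi>]
  have \<xi>f: "\<xi> \<in> forms M k" using \<xi> basic_forms_iff by simp
  have "ext_deriv M (lam \<xi>) x (v # vs) = 0" if x: "x \<in> S" and v: "v \<in> leaf_space M x" for x v vs
  proof (cases "set vs \<subseteq> tangent_space M x")
    case True
    obtain c where c: "c \<in> fol_at x" using foliated_cover[OF x] by blast
    then have cf: "c \<in> foliated_charts M" by simp
    note cs = charts_atD[OF fol_at_charts[OF c]]
    interpret C: euclidean_open m "img c" by (rule euclid_img[OF cs(1)])
    have y: "snd c x \<in> img c" using cs by blast
    let ?vs = "map (\<lambda>v. v c) vs"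
    let ?t = "\<lambda>i j y. gram_inv c (chart_inv c y) i j * rep c \<xi> y (std_vec (p + j) # std_vec (p + i) # ?vs)"
    note s = C.sfamD[OF rep_sfam[OF \<xi>f cs(1)]]
    have sm: "smooth_on m (img c) (?t i j)" if "i < q" "j < q" for i j
      by (intro C.smooth_mult smooth_gram_inv[OF cf that] s)
    have "dird m (v c) (?t i j) (snd c x) = 0" if "i < q" "j < q" for i j
      using gram_inv_leaf_derivative[OF c v that] basic_leaf_derivative[OF \<xi> c v]
      by (simp add: C.dird_mult[OF smooth_gram_inv[OF cf that] s y])
    then have 0: "dird m (v c) (\<lambda>y. (1/2) * ?t i j y) (snd c x) = 0" if "i < q" "j < q" for i j
      unfolding C.dird_scale[OF sm[OF that] y] using that by simp
    have "ext_deriv M (lam \<xi>) x (v # vs) = dird m (v c) (\<lambda>y. rep c (lam \<xi>) y ?vs) (snd c x)"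
      by (rule ext_deriv_leaf[OF lf c v True])
    also have "\<dots> = dird m (v c) (\<lambda>y. \<Sum>i<q. \<Sum>j<q. (1/2) * ?t i j y) (snd c x)"
      by (rule C.dird_cong[OF rep_lam[OF cf _ \<xi>] y])
    also have "\<dots> = (\<Sum>i<q. dird m (v c) (\<lambda>y. \<Sum>j<q. (1/2) * ?t i j y) (snd c x))"
      by (rule C.dird_sum[OF _ y]) (intro C.smooth_sum C.smooth_scale sm, auto)
    also have "\<dots> = (\<Sum>i<q. \<Sum>j<q. dird m (v c) (\<lambda>y. (1/2) * ?t i j y) (snd c x))"
      by (intro sum.cong refl C.dird_sum[OF _ y] C.smooth_scale sm) auto
    also have "\<dots> = 0" by (intro sum.neutral ballI) (use 0 in auto)
    finally show ?thesis .
  next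
    case False
    then show ?thesis by (intro ext_deriv_outside) auto
  qed
  then show ?thesis using lf unfolding basic_forms_iff by (simp add: horizontal_def)
qed

end

section \<open>The representation on basic forms\<close>

context symplectic_mfd
begin

definition lef :: "'a dform \<Rightarrow> 'a dform" where
  "lef = wedge_form \<omega>"

lemma lef_apply: "lef \<xi> x = wedge (\<omega> x) (\<xi> x)"
  by (simp add: lef_def wedge_form_def)

lemma linear_lef: "linear lef"
  by (rule linearI) (rule ext, simp add: lef_apply fun_ops wedge_simps)+

lemma basic_in_forms: "\<xi> \<in> basic_forms M k \<Longrightarrow> \<xi> \<in> forms M k"
  using basic_forms_iff by simp

lemma subspace_basic: "subspace (basic_forms M k)"
proof (rule subspaceI)
  show "0 \<in> basic_forms M k"
    using ext_deriv_scale[OF forms_0, of 0] by (simp add: basic_forms_iff forms_0 horizontal_def fun_ops)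
next
  fix \<xi> \<eta> assume "\<xi> \<in> basic_forms M k" "\<eta> \<in> basic_forms M k"
  then have a: "\<xi> \<in> forms M k" "horizontal \<xi>" "horizontal (ext_deriv M \<xi>)"
    and b: "\<eta> \<in> forms M k" "horizontal \<eta>" "horizontal (ext_deriv M \<eta>)"
    unfolding basic_forms_iff by blast+
  show "\<xi> + \<eta> \<in> basic_forms M k"
    unfolding basic_forms_iff ext_deriv_add[OF a(1) b(1)]
    using forms_add[OF a(1) b(1)] a(2,3) b(2,3) by (simp add: horizontal_def fun_ops)
next
  fix a :: real and \<xi> assume "\<xi> \<in> basic_forms M k"
  then have a: "\<xi> \<in> forms M k" "horizontal \<xi>" "horizontal (ext_deriv M \<xi>)"
    unfolding basic_forms_iff by blast+
  show "a *\<^sub>R \<xi> \<in> basic_forms M k"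
    unfolding basic_forms_iff ext_deriv_scale[OF a(1)]
    using forms_scale[OF a(1)] a(2,3) by (simp add: horizontal_def fun_ops)
qed

lemma ext_deriv_0: "ext_deriv M 0 = 0"
  using ext_deriv_scale[OF forms_0, of 0] by simp

lemma ext_deriv_basic: "\<xi> \<in> basic_forms M k \<Longrightarrow> ext_deriv M \<xi> \<in> basic_forms M (Suc k)"
  unfolding basic_forms_iff using ext_deriv_in_forms[of \<xi> k] ext_deriv_ext_deriv[of \<xi> k] by (simp add: horizontal_def fun_ops)

lemma horizontal_wedge:
  assumes \<xi>: "\<xi> \<in> forms M k" "horizontal \<xi>"
  shows "horizontal (lef \<xi>)"
  unfolding horizontal_def
proof (intro allI impI)
  fix x v vs assume x: "x \<in> S" and v: "v \<in> leaf_space M x"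
  obtain c where c: "c \<in> fol_at x" using foliated_cover[OF x] by blast
  interpret H: transverse_frame "tangent_space M x" "transverse_vec c x" "\<lambda>i v. v c (p + i)" q
    by (rule hor_frame[OF c])
  have "hor_form c x k (\<xi> x)"
    by (rule full_to_hor[OF c forms_full_form[OF \<xi>(1) fol_at_charts[OF c]]])
      (use \<xi>(2) x in \<open>simp add: horizontal_def\<close>)
  then have "hor_form c x (2 + k) (lef \<xi> x)"
    unfolding lef_apply by (rule H.hform_wedge[OF basic_hor_form[OF \<omega>_basic c]])
  then show "lef \<xi> x (v # vs) = 0" by (rule hor_to_full(2)[OF c _ v])
qed

lemma ext_deriv_lef: "\<xi> \<in> basic_forms M k \<Longrightarrow> ext_deriv M (lef \<xi>) = lef (ext_deriv M \<xi>)"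
  unfolding lef_def by (rule ext_deriv_wedge_closed[OF \<omega>_form \<omega>_closed basic_in_forms])

lemma lef_basic:
  assumes \<xi>: "\<xi> \<in> basic_forms M k"
  shows "lef \<xi> \<in> basic_forms M (k + 2)"
proof -
  note b = \<xi>[unfolded basic_forms_iff]
  have "lef \<xi> \<in> forms M (k + 2)"
    unfolding lef_def using wedge_in_forms[OF \<omega>_form, of \<xi> k] b by (simp add: add.commute)
  then show ?thesis
    unfolding basic_forms_iff ext_deriv_lef[OF \<xi>]
    using horizontal_wedge[of \<xi> k] horizontal_wedge[of "ext_deriv M \<xi>" "Suc k"] ext_deriv_in_forms[of \<xi> k] b by blast
qed

lemma lam_lef:
  assumes \<xi>: "\<xi> \<in> basic_forms M k"
  shows "lam (lef \<xi>) = lef (lam \<xi>) + (real n - real k) *\<^sub>R \<xi>"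
proof
  fix x
  show "lam (lef \<xi>) x = (lef (lam \<xi>) + (real n - real k) *\<^sub>R \<xi>) x"
  proof (cases "x \<in> S")
    case True
    then obtain c where c: "c \<in> fol_at x" using foliated_cover by blast
    interpret C: symplectic_frame "tangent_space M x" "transverse_vec c x" "\<lambda>i v. v c (p + i)" q "\<omega> x" "gram_inv c x" n
      by (rule symp_frame[OF c])
    show ?thesis
      using C.\<Lambda>_L[OF basic_hor_form[OF \<xi> c]]
      by (simp add: fun_ops lef_apply lam_basic_chart[OF c \<xi>] lam_basic_chart[OF c lef_basic[OF \<xi>]])
  next
    case False
    have "\<omega> x = 0" "\<xi> x = 0" using forms_outside[OF _ False] \<omega>_form basic_in_forms[OF \<xi>] by blast+
    then show ?thesis using False by (simp add: fun_ops lef_apply lam_def wedge_simps)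
  qed
qed

lemma lam_low:
  assumes \<xi>: "\<xi> \<in> basic_forms M k" and k: "k < 2"
  shows "lam \<xi> = 0"
proof
  fix x
  show "lam \<xi> x = 0 x"
  proof (cases "x \<in> S")
    case True
    then obtain c where c: "c \<in> fol_at x" using foliated_cover by blast
    interpret C: symplectic_frame "tangent_space M x" "transverse_vec c x" "\<lambda>i v. v c (p + i)" q "\<omega> x" "gram_inv c x" n
      by (rule symp_frame[OF c])
    show ?thesis
      using C.\<Lambda>_low_degree[OF basic_hor_form[OF \<xi> c] k] by (simp add: fun_ops lam_basic_chart[OF c \<xi>])
  qed (simp add: lam_def fun_ops)
qed

text \<open>Basic \<open>k\<close>-forms have weight \<open>n - k\<close>.  The weights above \<open>n\<close>, which would belong to negative degrees,
  get the zero space.\<close>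

definition wt :: "int \<Rightarrow> 'a dform set" where
  "wt w = (if w \<le> int n then basic_forms M (nat (int n - w)) else {0})"

lemma wt_nat: "wt (int n - int k) = basic_forms M k"
  by (simp add: wt_def)

lemma wt_cases:
  assumes "\<xi> \<in> wt w"
  obtains (deg) k where "w = int n - int k" "\<xi> \<in> basic_forms M k" | (high) "w > int n" "\<xi> = 0"
proof (cases "w \<le> int n")
  case True
  then show ?thesis using assms by (intro deg[of "nat (int n - w)"]) (auto simp: wt_def)
qed (use assms high in \<open>auto simp: wt_def\<close>)

lemma zero_in_wt: "0 \<in> wt w"
  using subspace_0[OF subspace_basic] by (simp add: wt_def)

lemma sl2_wt: "sl2_differential wt lef lam n (ext_deriv M)"
proof (intro sl2_differential.intro sl2_graded.intro sl2_differential_axioms.intro, goal_cases)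
  case (1 w)
  then show ?case using subspace_basic by (auto simp: wt_def subspace_def fun_ops)
next
  case 2
  show ?case by (rule linear_lef)
next
  case 3
  show ?case by (rule linear_lam)
next
  case (4 \<xi> w)
  then show ?case
  proof (cases rule: wt_cases)
    case (deg k)
    then have "w - 2 = int n - int (k + 2)" by simp
    then show ?thesis using lef_basic[OF deg(2)] by (simp only: wt_nat)
  next
    case high
    then show ?thesis by (simp add: linear_0[OF linear_lef] zero_in_wt)
  qed
next
  case (5 \<xi> w)
  then show ?case
  proof (cases rule: wt_cases)
    case (deg k)
    show ?thesis
    proof (cases "k < 2")
      case True
      then show ?thesis using lam_low[OF deg(2)] by (simp add: zero_in_wt)
    next
      case False
      then have "w + 2 = int n - int (k - 2)" using deg by simp
      then show ?thesis using lam_basic[OF deg(2)] by (simp only: wt_nat)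
    qed
  next
    case high
    then show ?thesis by (simp add: linear_0[OF linear_lam] zero_in_wt)
  qed
next
  case (6 \<xi> w)
  then show ?case
  proof (cases rule: wt_cases)
    case (deg k)
    then show ?thesis using lam_lef[OF deg(2)] by simp
  next
    case high
    then show ?thesis by (simp add: linear_0[OF linear_lam] linear_0[OF linear_lef])
  qed
next
  case (7 \<xi> w)
  then show ?case
  proof (cases rule: wt_cases)
    case (deg k)
    then have "k > q" using 7(2) q2n by simp
    then show ?thesis by (rule basic_vanishes_above[OF deg(2)])
  qed
next
  case (8 \<xi> w \<eta>)
  show ?case
  proof (cases "w \<le> int n")
    case True
    then show ?thesis
      using 8 ext_deriv_add[OF basic_in_forms[of \<xi> "nat (int n - w)"] basic_in_forms[of \<eta> "nat (int n - w)"]]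
      by (simp add: wt_def)
  next
    case False
    then show ?thesis using 8 by (simp add: wt_def ext_deriv_0)
  qed
next
  case (9 \<xi> w a)
  show ?case
  proof (cases "w \<le> int n")
    case True
    then show ?thesis
      using 9 ext_deriv_scale[OF basic_in_forms[of \<xi> "nat (int n - w)"], of a] by (simp add: wt_def)
  next
    case False
    then show ?thesis using 9 by (simp add: wt_def ext_deriv_0)
  qed
next
  case (10 \<xi> w)
  then show ?case
  proof (cases rule: wt_cases)
    case (deg k)
    then have "w - 1 = int n - int (Suc k)" by simp
    then show ?thesis using ext_deriv_basic[OF deg(2)] by (simp only: wt_nat)
  next
    case high
    then show ?thesis by (simp add: ext_deriv_0 zero_in_wt)
  qed
next
  case (11 \<xi> w)
  then show ?case
    by (cases rule: wt_cases) (auto simp: ext_deriv_0 ext_deriv_ext_deriv[OF basic_in_forms])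
next
  case (12 \<xi> w)
  then show ?case
    by (cases rule: wt_cases) (auto simp: ext_deriv_0 ext_deriv_lef linear_0[OF linear_lef])
qed

sublocale B: sl2_differential wt lef lam n "ext_deriv M"
  by (rule sl2_wt)

section \<open>The transverse star operator\<close>

lemma lam_pow_chart:
  assumes c: "c \<in> fol_at x" and \<xi>: "\<xi> \<in> basic_forms M k"
  shows "(lam ^^ j) \<xi> x = (poisson_contr q (gram_inv c x) (transverse_vec c x) ^^ j) (\<xi> x) \<and> (lam ^^ j) \<xi> \<in> basic_forms M (k - 2 * j)"
proof (induction j)
  case (Suc j)
  then show ?case using lam_basic_chart[OF c, of "(lam ^^ j) \<xi>" "k - 2 * j"] lam_basic[of "(lam ^^ j) \<xi>" "k - 2 * j"]
    by (simp add: diff_diff_left add.commute)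
qed (simp add: \<xi>)

lemma lef_pow_apply: "(lef ^^ j) \<xi> x = (wedge (\<omega> x) ^^ j) (\<xi> x)"
  by (induction j) (simp_all add: lef_apply)

lemma weyl_star_chart:
  assumes c: "c \<in> fol_at x" and \<xi>: "\<xi> \<in> basic_forms M k"
  shows "weyl_star lef lam J w \<xi> x =
    weyl_star (wedge (\<omega> x)) (poisson_contr q (gram_inv c x) (transverse_vec c x)) J w (\<xi> x)"
proof -
  have "divided_power lam (int j) \<xi> x = divided_power (poisson_contr q (gram_inv c x) (transverse_vec c x)) (int j) (\<xi> x)" for j
    using lam_pow_chart[OF c \<xi>, of j] by (simp add: divided_power_nat fun_ops)
  moreover have "divided_power lef a \<eta> x = divided_power (wedge (\<omega> x)) a (\<eta> x)" for a \<eta>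
    by (simp add: divided_power_def fun_ops lef_pow_apply)
  ultimately show ?thesis by (simp add: weyl_star_def sum_fun_apply fun_ops)
qed

text \<open>The vectors without leaf coordinates in some foliated chart; outside the manifold the only
  tangent vector is zero.\<close>

definition coord_complement :: "'a \<Rightarrow> 'a tvec set" where
  "coord_complement x = {v \<in> tangent_space M x. x \<in> S \<longrightarrow> (\<forall>i<p. v (SOME c. c \<in> fol_at x) i = 0)}"

lemma complementary_exists: "complementary_distribution M coord_complement"
  unfolding complementary_distribution_def tvec_comb_eq tvec_zero_eq
proof (intro allI)
  fix x
  note sub = subspace_tangent[of x]
  define c where "c = (SOME c. c \<in> fol_at x)"
  have c: "c \<in> fol_at x" if "x \<in> S"
    unfolding c_def using foliated_cover[OF that] by (intro someI_ex[of "\<lambda>c. c \<in> fol_at x"]) blast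
  have D: "v \<in> coord_complement x \<longleftrightarrow> v \<in> tangent_space M x \<and> (x \<in> S \<longrightarrow> (\<forall>i<p. v c i = 0))" for v
    by (simp add: coord_complement_def c_def)
  have zero: "0 \<in> coord_complement x" "0 \<in> leaf_space M x"
    using subspace_0[OF sub] by (auto simp: D leaf_space_def fun_ops)
  have one: "v = 0" if v: "v \<in> coord_complement x" "v \<in> leaf_space M x" for v
  proof (cases "x \<in> S")
    case True
    have "v c i = 0" for i
    proof (cases "i < m")
      case True
      then show ?thesis using v D[of v] \<open>x \<in> S\<close> leaf_spaceD(2)[OF v(2) c[OF \<open>x \<in> S\<close>], of i]
        by (cases "i < p") auto
    next
      case False
      then show ?thesis
        using tangent_coord_vec[OF leaf_spaceD(1)[OF v(2)] fol_at_charts[OF c[OF \<open>x \<in> S\<close>]]]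
          coord_vec_support[of i c x "v c" c] by simp
    qed
    then have "v c = 0" by (simp add: fun_eq_iff fun_ops)
    then show ?thesis
      using tangent_coord_vec[OF leaf_spaceD(1)[OF v(2)] fol_at_charts[OF c[OF True]]]
        coord_vec_expand[of c x 0] by (simp add: fun_ops)
  next
    case False
    then show ?thesis using D[of v] v(1) tangent_outside[OF False] by simp
  qed
  have split: "\<exists>u\<in>coord_complement x. \<exists>w\<in>leaf_space M x. v = 1 *\<^sub>R u + 1 *\<^sub>R w" if v: "v \<in> tangent_space M x" for v
  proof (cases "x \<in> S")
    case True
    note at = fol_at_charts[OF c[OF True]]
    define w where "w = (\<Sum>j<p. v c j *\<^sub>R coord_vec M c x (std_vec j))"
    have wt: "w \<in> tangent_space M x"
      unfolding w_def by (intro subspace_sum subspace_scale sub coord_vec_in_tangent at)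
    have wc: "w c i = (if i < p then v c i else 0)" for i
      unfolding w_def using coord_vec_std_self[OF at] mpq
      by (simp add: sum_fun_apply fun_ops std_vec_def if_distrib cong: if_cong)
    have "w \<in> leaf_space M x" by (rule leaf_spaceI[OF wt c[OF True]]) (simp add: wc)
    moreover have "v - w \<in> coord_complement x"
      using subspace_diff[OF sub v wt] by (simp add: D fun_ops wc)
    ultimately show ?thesis by (intro bexI[of _ "v - w"] bexI[of _ w]) simp_all
  next
    case False
    then have "v = 0" using v tangent_outside by blast
    then show ?thesis using zero by (intro bexI[of _ 0]) simp_all
  qed
  have lin: "a *\<^sub>R v + b *\<^sub>R w \<in> coord_complement x" if "v \<in> coord_complement x" "w \<in> coord_complement x" for a b v w
    using that subspace_add[OF sub subspace_scale[OF sub] subspace_scale[OF sub], of v w a b]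
    by (simp add: D fun_ops)
  show "0 \<in> coord_complement x \<and> coord_complement x \<subseteq> tangent_space M x \<and>
      (\<forall>v\<in>coord_complement x. \<forall>w\<in>coord_complement x. \<forall>a b. a *\<^sub>R v + b *\<^sub>R w \<in> coord_complement x) \<and>
      coord_complement x \<inter> leaf_space M x = {0} \<and>
      (\<forall>v\<in>tangent_space M x. \<exists>u\<in>coord_complement x. \<exists>w\<in>leaf_space M x. v = 1 *\<^sub>R u + 1 *\<^sub>R w)"
    using zero one split lin by (auto simp: D)
qed

text \<open>Correct the vector given by row \<open>i\<close> of the inverse matrix by a leaf vector, which \<open>\<omega>\<close>
  annihilates.\<close>

lemma complement_flat:
  assumes D: "complementary_distribution M D" and c: "c \<in> fol_at x" and i: "i < q"
  shows "\<exists>X\<in>D x. contr X (\<omega> x) = transverse_frame.coframe (tangent_space M x) (\<lambda>i v. v c (p + i)) i"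
proof -
  interpret C: symplectic_frame "tangent_space M x" "transverse_vec c x" "\<lambda>i v. v c (p + i)" q "\<omega> x" "gram_inv c x" n
    by (rule symp_frame[OF c])
  define Y where "Y = (\<Sum>j<q. gram_inv c x i j *\<^sub>R transverse_vec c x j)"
  have "Y \<in> tangent_space M x"
    unfolding Y_def using C.E_in by (intro subspace_sum subspace_scale subspace_tangent) auto
  then obtain X w where X: "X \<in> D x" "w \<in> leaf_space M x" "Y = 1 *\<^sub>R X + 1 *\<^sub>R w"
    using D unfolding complementary_distribution_def tvec_comb_eq by meson
  have Xt: "X \<in> tangent_space M x" using D X(1) unfolding complementary_distribution_def by blast
  have x: "x \<in> S" using charts_at_in_S[OF fol_at_charts[OF c]] .
  have "contr Y (\<omega> x) = (\<Sum>j<q. gram_inv c x i j *\<^sub>R contr (transverse_vec c x j) (\<omega> x))"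
  proof
    fix vs show "contr Y (\<omega> x) vs = (\<Sum>j<q. gram_inv c x i j *\<^sub>R contr (transverse_vec c x j) (\<omega> x)) vs"
      using forms_sum[OF \<omega>_form, of "{..<q}" "transverse_vec c x" x "[]" "gram_inv c x i" vs] C.E_in
      by (simp add: contr_apply Y_def sum_fun_apply fun_ops)
  qed
  then have Y: "contr Y (\<omega> x) = C.coframe i" using C.sum_W_flat[OF i] by simp
  have "contr X (\<omega> x) vs = contr Y (\<omega> x) vs" for vs
    using forms_linear[OF \<omega>_form Xt leaf_spaceD(1)[OF X(2)], of "[]" 1 1 vs] \<omega>_basic x X(2)
    unfolding X(3) contr_apply basic_forms_iff horizontal_def by simp
  then show ?thesis using X(1) Y by (intro bexI[of _ X] ext) simp_all
qed

text \<open>Outside the manifold, the forms are zero and the star operator has to be zero as well.  The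
  case \<open>n = 0\<close> is special, since there $\omega^n$ is the constant 1 and not zero.\<close>

lemma star_outside:
  assumes P: "P \<in> multivecs k {0}" "flat_map 0 P = 0"
  shows "contract P (wedge_power n 0) = (0 :: 'a tvec altform)"
proof -
  have "contract P (wedge_power n 0) = (0 :: 'a tvec altform)" if "n = 0"
  proof -
    interpret Z: symplectic_frame "{0}" "\<lambda>_. 0 :: 'a tvec" "\<lambda>_ _. 0" 0 0 "\<lambda>_ _. 0" 0
    proof -
      interpret T: transverse_frame "{0}" "\<lambda>_. 0 :: 'a tvec" "\<lambda>_ _. 0" 0 by unfold_locales simp
      show "symplectic_frame {0} (\<lambda>_. 0 :: 'a tvec) (\<lambda>_ _. 0) 0 0 (\<lambda>_ _. 0) 0"
        by unfold_locales (simp_all add: T.hform_0)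
    qed
    show ?thesis
      using Z.star_pointwise[OF P(1), of k] P(2) that linear_0[OF Z.linear_weyl_star] by simp
  qed
  moreover have "contract P (wedge_power n 0) = (0 :: 'a tvec altform)" if "n > 0"
  proof -
    have "wedge_power n 0 = (0 :: 'a tvec altform)"
      using that by (cases n) (simp_all add: wedge_power_def wedge_simps)
    then show ?thesis by (simp add: contract_def fun_eq_iff fun_ops case_prod_unfold)
  qed
  ultimately show ?thesis by blast
qed

text \<open>At each point the chosen multivector exists by \<open>complement_flat\<close>, and the value of the star
  operator does not depend on the choice by \<open>star_pointwise\<close>.\<close>

lemma transverse_star_eq:
  assumes \<xi>: "\<xi> \<in> basic_forms M k" and J: "k \<le> 2 * J"
  shows "transverse_star M n \<omega> k \<xi> = (star_sign k * fact n) *\<^sub>R weyl_star lef lam J (int n - int k) \<xi>"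
proof
  fix x
  define D where "D = (SOME D. complementary_distribution M D)"
  have D: "complementary_distribution M D"
    unfolding D_def by (rule someI[of "complementary_distribution M", OF complementary_exists])
  then have DT: "D x \<subseteq> tangent_space M x" unfolding complementary_distribution_def by blast
  define P where "P = (SOME P. P \<in> multivecs k (D x) \<and> flat_map (\<omega> x) P = \<xi> x)"
  have star: "transverse_star M n \<omega> k \<xi> x = contract P (wedge_power n (\<omega> x))"
    by (simp add: transverse_star_def P_def D_def Let_def)
  have P: "P \<in> multivecs k (D x) \<and> flat_map (\<omega> x) P = \<xi> x" if "\<exists>P\<in>multivecs k (D x). flat_map (\<omega> x) P = \<xi> x"
    unfolding P_def by (rule someI_ex) (use that in blast)
  show "transverse_star M n \<omega> k \<xi> x = ((star_sign k * fact n) *\<^sub>R weyl_star lef lam J (int n - int k) \<xi>) x"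
  proof (cases "x \<in> S")
    case True
    then obtain c where c: "c \<in> fol_at x" using foliated_cover by blast
    interpret C: symplectic_frame "tangent_space M x" "transverse_vec c x" "\<lambda>i v. v c (p + i)" q "\<omega> x" "gram_inv c x" n
      by (rule symp_frame[OF c])
    have P: "P \<in> multivecs k (D x)" "flat_map (\<omega> x) P = \<xi> x"
      using P[OF C.flat_map_surj[OF complement_flat[OF D c] basic_hor_form[OF \<xi> c]]] by blast+
    have "P \<in> multivecs k (tangent_space M x)" using P(1) DT unfolding multivecs_def by blast
    from C.star_pointwise[OF this J] show ?thesis
      unfolding star P(2) by (simp add: fun_ops weyl_star_chart[OF c \<xi>])
  next
    case False
    have 0: "\<omega> x = 0" "\<xi> x = 0" using forms_outside[OF _ False] \<omega>_form basic_in_forms[OF \<xi>] by blast+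
    have "flat_map (\<omega> x) [] = \<xi> x" "[] \<in> multivecs k (D x)"
      by (simp_all add: flat_map_def multivecs_def 0 fun_eq_iff fun_ops)
    then have P: "P \<in> multivecs k (D x)" "flat_map (\<omega> x) P = \<xi> x" using P by blast+
    have "P \<in> multivecs k {0}" using P(1) DT tangent_outside[OF False] unfolding multivecs_def by blast
    then have "contract P (wedge_power n (\<omega> x)) = 0" using star_outside P(2) 0 by simp
    moreover have "weyl_star lef lam J (int n - int k) \<xi> x = 0"
    proof -
      have "\<xi> \<in> wt (int n - int k)" using \<xi> by (simp only: wt_nat)
      from B.weyl_star_in[OF this, of J] have "weyl_star lef lam J (int n - int k) \<xi> \<in> wt (- (int n - int k))" .
      then show ?thesis
        by (cases rule: wt_cases) (auto simp: fun_ops forms_outside[OF basic_in_forms False])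
    qed
    ultimately show ?thesis by (simp add: star fun_ops)
  qed
qed

lemma transverse_star_0: "transverse_star M n \<omega> k 0 = 0"
  using transverse_star_eq[OF subspace_0[OF subspace_basic], of k k] by simp

text \<open>The outer star is injective, and it is applied to a multiple of the form on the right-hand
  side.  That form has degree up to \<open>2n + 1\<close>, so the sum is cut off at \<open>n + 1\<close> to satisfy
  \<open>k \<le> 2J\<close> in \<open>transverse_star_eq\<close>.\<close>

lemma codifferential_eq_0_iff:
  assumes \<xi>: "\<xi> \<in> basic_forms M k"
  shows "codifferential M n \<omega> k \<xi> = 0 \<longleftrightarrow> ext_deriv M (weyl_star lef lam (n + 1) (int n - int k) \<xi>) = 0"
proof -
  let ?w = "weyl_star lef lam (n + 1) (int n - int k) \<xi>"
  let ?l = "2 * n + 1 - k"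
  have codiff: "codifferential M n \<omega> k \<xi> = (-1) ^ k *\<^sub>R transverse_star M n \<omega> ?l (ext_deriv M (transverse_star M n \<omega> k \<xi>))"
    by (simp add: codifferential_def fun_eq_iff fun_ops)
  show ?thesis
  proof (cases "k \<le> 2 * n")
    case False
    then have "\<xi> = 0" using basic_vanishes_above[OF \<xi>] q2n by simp
    then show ?thesis
      unfolding codiff by (simp add: transverse_star_0 ext_deriv_0)
  next
    case True
    have "\<xi> \<in> wt (int n - int k)" using \<xi> by (simp only: wt_nat)
    from B.weyl_star_in[OF this] have w: "?w \<in> wt (- (int n - int k))" .
    moreover have "- (int n - int k) = int n - int (2 * n - k)" using True by simp
    ultimately have wb: "?w \<in> basic_forms M (2 * n - k)" by (simp only: wt_nat)
    have l: "?l = Suc (2 * n - k)" using True by simp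
    have dw: "ext_deriv M ?w \<in> basic_forms M ?l" unfolding l by (rule ext_deriv_basic[OF wb])
    let ?a = "star_sign k * fact n"
    have star: "transverse_star M n \<omega> k \<xi> = ?a *\<^sub>R ?w" by (rule transverse_star_eq[OF \<xi>]) (use True in simp)
    have d: "ext_deriv M (transverse_star M n \<omega> k \<xi>) = ?a *\<^sub>R ext_deriv M ?w"
      unfolding star by (rule ext_deriv_scale[OF basic_in_forms[OF wb]])
    have a: "?a \<noteq> 0" "star_sign ?l * fact n \<noteq> (0::real)" using star_sign_nonzero by simp_all
    have ds: "?a *\<^sub>R ext_deriv M ?w \<in> basic_forms M ?l" by (rule subspace_scale[OF subspace_basic dw])
    have star2: "transverse_star M n \<omega> ?l (?a *\<^sub>R ext_deriv M ?w) =
        (star_sign ?l * fact n) *\<^sub>R weyl_star lef lam (n + 1) (int n - int ?l) (?a *\<^sub>R ext_deriv M ?w)"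
      by (rule transverse_star_eq[OF ds]) simp
    have "codifferential M n \<omega> k \<xi> = 0 \<longleftrightarrow> weyl_star lef lam (n + 1) (int n - int ?l) (?a *\<^sub>R ext_deriv M ?w) = 0"
      unfolding codiff d star2 using a by simp
    also have "\<dots> \<longleftrightarrow> ?a *\<^sub>R ext_deriv M ?w = 0"
      using B.weyl_star_inj[of "?a *\<^sub>R ext_deriv M ?w" "int n - int ?l" "n + 1"] ds wt_nat[of ?l] by auto
    also have "\<dots> \<longleftrightarrow> ext_deriv M ?w = 0" using a by simp
    finally show ?thesis .
  qed
qed

section \<open>Basic cohomology classes\<close>

lemma closed_basic_iff: "\<xi> \<in> closed_basic M k \<longleftrightarrow> \<xi> \<in> basic_forms M k \<and> ext_deriv M \<xi> = 0"
  by (simp add: closed_basic_def zero_fun_def)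

text \<open>The primitives of exact \<open>k\<close>-forms have weight \<open>n - k + 1\<close>; for \<open>k = 0\<close> this weight space is zero.\<close>

lemma exact_basic_eq: "exact_basic M k = ext_deriv M ` wt (int n - int k + 1)"
proof (cases k)
  case 0
  then show ?thesis by (simp add: exact_basic_def wt_def ext_deriv_0) (simp add: zero_fun_def)
next
  case (Suc j)
  then have "int n - int k + 1 = int n - int j" by simp
  then show ?thesis by (simp add: exact_basic_def Suc wt_nat)
qed

lemma subspace_exact: "subspace (exact_basic M k)"
proof -
  let ?W = "wt (int n - int k + 1)"
  have "a *\<^sub>R ext_deriv M \<xi> + b *\<^sub>R ext_deriv M \<eta> \<in> ext_deriv M ` ?W" if "\<xi> \<in> ?W" "\<eta> \<in> ?W" for a b \<xi> \<eta>
  proof -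
    have s: "a *\<^sub>R \<xi> \<in> ?W" "b *\<^sub>R \<eta> \<in> ?W" using that by (simp_all add: subspace_scale[OF B.subspace_U])
    have "a *\<^sub>R ext_deriv M \<xi> + b *\<^sub>R ext_deriv M \<eta> = ext_deriv M (a *\<^sub>R \<xi> + b *\<^sub>R \<eta>)"
      unfolding B.d_add[OF s] B.d_scale[OF that(1)] B.d_scale[OF that(2)] ..
    then show ?thesis by (simp only:) (intro imageI subspace_add[OF B.subspace_U] s)
  qed
  note comb = this
  show ?thesis
    unfolding exact_basic_eq
  proof (rule subspaceI)
    show "0 \<in> ext_deriv M ` ?W" using zero_in_wt ext_deriv_0 by (intro image_eqI[of _ _ 0]) simp_all
    show "x + y \<in> ext_deriv M ` ?W" if "x \<in> ext_deriv M ` ?W" "y \<in> ext_deriv M ` ?W" for x y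
      using that comb[of _ _ 1 1] by auto
    show "a *\<^sub>R x \<in> ext_deriv M ` ?W" if "x \<in> ext_deriv M ` ?W" for a x
      using that comb[of _ _ a 0] by auto
  qed
qed

lemma cohomologous_iff:
  "(\<xi>, \<eta>) \<in> cohomologous M k \<longleftrightarrow>
     \<xi> \<in> closed_basic M k \<and> \<eta> \<in> closed_basic M k \<and> (\<exists>\<zeta>\<in>wt (int n - int k + 1). \<xi> = \<eta> + ext_deriv M \<zeta>)"
proof -
  have "(\<lambda>x vs. \<xi> x vs - \<eta> x vs) = \<xi> - \<eta>" by (simp add: fun_eq_iff fun_ops)
  then show ?thesis
    by (auto simp: cohomologous_def exact_basic_eq image_iff algebra_simps)
qed

lemma equiv_cohomologous: "equiv (closed_basic M k) (cohomologous M k)"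
proof (rule equivI)
  have eq: "(\<lambda>x vs. \<xi> x vs - \<eta> x vs) = \<xi> - \<eta>" for \<xi> \<eta> :: "'a dform" by (simp add: fun_eq_iff fun_ops)
  note coh = cohomologous_def[of M k, unfolded eq]
  show "cohomologous M k \<subseteq> closed_basic M k \<times> closed_basic M k"
    by (auto simp: coh)
  show "refl_on (closed_basic M k) (cohomologous M k)"
    using subspace_0[OF subspace_exact] by (auto simp: refl_on_def coh)
  show "sym (cohomologous M k)"
    using subspace_diff[OF subspace_exact subspace_0[OF subspace_exact]] by (fastforce simp: sym_def coh)
  show "trans (cohomologous M k)"
    using subspace_add[OF subspace_exact] by (fastforce simp: trans_def coh)
qed

abbreviation coh_class :: "nat \<Rightarrow> 'a dform \<Rightarrow> 'a dform set" where
  "coh_class k \<xi> \<equiv> cohomologous M k `` {\<xi>}"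

lemma coh_class_eq_iff:
  "\<xi> \<in> closed_basic M k \<Longrightarrow> \<eta> \<in> closed_basic M k \<Longrightarrow>
    coh_class k \<xi> = coh_class k \<eta> \<longleftrightarrow> (\<exists>\<zeta>\<in>wt (int n - int k + 1). \<xi> = \<eta> + ext_deriv M \<zeta>)"
  using eq_equiv_class_iff[OF equiv_cohomologous] by (simp add: cohomologous_iff)

lemma basic_cohomology_eq: "basic_cohomology M k = coh_class k ` closed_basic M k"
  by (auto simp: basic_cohomology_def quotient_def)

lemma lef_cohomologous:
  assumes "(\<xi>, \<eta>) \<in> cohomologous M k"
  shows "(lef \<xi>, lef \<eta>) \<in> cohomologous M (k + 2)"
proof -
  from assms obtain \<zeta> where \<xi>: "\<xi> \<in> basic_forms M k" "ext_deriv M \<xi> = 0"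
    and \<eta>: "\<eta> \<in> basic_forms M k" "ext_deriv M \<eta> = 0"
    and \<zeta>: "\<zeta> \<in> wt (int n - int k + 1)" "\<xi> = \<eta> + ext_deriv M \<zeta>"
    by (auto simp: cohomologous_iff closed_basic_iff)
  have "lef \<zeta> \<in> wt (int n - int (k + 2) + 1)" using B.L_in[OF \<zeta>(1)] by (simp add: algebra_simps)
  moreover have "lef \<xi> = lef \<eta> + ext_deriv M (lef \<zeta>)"
    by (simp add: \<zeta>(2) B.L_simps B.d_L[OF \<zeta>(1)])
  ultimately show ?thesis
    unfolding cohomologous_iff closed_basic_iff
    using lef_basic[OF \<xi>(1)] lef_basic[OF \<eta>(1)] ext_deriv_lef[OF \<xi>(1)] ext_deriv_lef[OF \<eta>(1)] \<xi>(2) \<eta>(2)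
    by (auto simp: B.L_simps)
qed

lemma lefschetz_class:
  assumes \<xi>: "\<xi> \<in> closed_basic M k"
  shows "lefschetz M \<omega> k (coh_class k \<xi>) = coh_class (k + 2) (lef \<xi>)"
proof -
  have "coh_class (k + 2) (lef \<eta>) = coh_class (k + 2) (lef \<xi>)" if "\<eta> \<in> coh_class k \<xi>" for \<eta>
    using equiv_class_eq[OF equiv_cohomologous lef_cohomologous[of \<xi> \<eta> k]] that by simp
  moreover have "\<xi> \<in> coh_class k \<xi>" by (rule equiv_class_self[OF equiv_cohomologous \<xi>])
  ultimately show ?thesis unfolding lefschetz_def lef_def by blast
qed

lemma lefschetz_power_class:
  assumes \<xi>: "\<xi> \<in> closed_basic M k"
  shows "lefschetz_power M \<omega> j k (coh_class k \<xi>) = coh_class (k + 2 * j) ((lef ^^ j) \<xi>) \<and>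
    (lef ^^ j) \<xi> \<in> closed_basic M (k + 2 * j)"
proof (induction j)
  case (Suc j)
  let ?\<eta> = "(lef ^^ j) \<xi>"
  have \<eta>: "?\<eta> \<in> basic_forms M (k + 2 * j)" "ext_deriv M ?\<eta> = 0" using Suc by (simp_all add: closed_basic_iff)
  have "lef ?\<eta> \<in> closed_basic M (k + 2 * j + 2)"
    using lef_basic[OF \<eta>(1)] ext_deriv_lef[OF \<eta>(1)] \<eta>(2) by (simp add: closed_basic_iff B.L_simps)
  then show ?case using Suc lefschetz_class[of ?\<eta> "k + 2 * j"] by (simp add: ac_simps)
qed (simp add: \<xi>)

text \<open>Degrees are translated to weights; weights above \<open>n\<close> contribute nothing.\<close>

lemma harmonic_representatives_iff:
  "(\<forall>k. \<forall>C\<in>basic_cohomology M k. \<exists>\<xi>\<in>C. ext_deriv M \<xi> = zero_form \<and> codifferential M n \<omega> k \<xi> = zero_form) \<longleftrightarrow>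
   (\<forall>w. \<forall>\<xi>\<in>wt w. ext_deriv M \<xi> = 0 \<longrightarrow>
      (\<exists>\<eta>\<in>wt w. ext_deriv M \<eta> = 0 \<and> ext_deriv M (weyl_star lef lam (n + 1) w \<eta>) = 0 \<and>
         (\<exists>\<zeta>\<in>wt (w + 1). \<xi> = \<eta> + ext_deriv M \<zeta>)))"
    (is "?lhs \<longleftrightarrow> (\<forall>w. ?harm w)")
proof -
  have zero: "zero_form = (0 :: 'a dform)" by (simp add: zero_fun_def)
  have high: "?harm w" if "\<not> w \<le> int n" for w
    using that zero_in_wt[of "w + 1"] by (auto simp: wt_def ext_deriv_0)
  have deg: "(\<forall>C\<in>basic_cohomology M k. \<exists>\<xi>\<in>C. ext_deriv M \<xi> = 0 \<and> codifferential M n \<omega> k \<xi> = 0) \<longleftrightarrow>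
      ?harm (int n - int k)" for k
  proof -
    have "(\<exists>\<eta>\<in>coh_class k \<xi>. ext_deriv M \<eta> = 0 \<and> codifferential M n \<omega> k \<eta> = 0) \<longleftrightarrow>
        (\<exists>\<eta>\<in>basic_forms M k. ext_deriv M \<eta> = 0 \<and> ext_deriv M (weyl_star lef lam (n + 1) (int n - int k) \<eta>) = 0 \<and>
         (\<exists>\<zeta>\<in>wt (int n - int k + 1). \<xi> = \<eta> + ext_deriv M \<zeta>))" if "\<xi> \<in> closed_basic M k" for \<xi>
    proof -
      define R where "R \<eta> \<longleftrightarrow> (\<exists>\<zeta>\<in>wt (int n - int k + 1). \<xi> = \<eta> + ext_deriv M \<zeta>)" for \<eta>
      have "\<eta> \<in> coh_class k \<xi> \<longleftrightarrow> \<eta> \<in> basic_forms M k \<and> ext_deriv M \<eta> = 0 \<and> R \<eta>" for \<eta>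
        using that unfolding Image_singleton_iff cohomologous_iff R_def closed_basic_iff by blast
      then show ?thesis
        unfolding R_def[symmetric] using codifferential_eq_0_iff[of _ k] by blast
    qed
    note classwise = ball_cong[OF refl this]
    show ?thesis
      unfolding basic_cohomology_eq ball_simps wt_nat
      by (rule trans[OF classwise]) (simp_all only: Ball_def closed_basic_iff imp_conjL)
  qed
  have "(\<forall>k. ?harm (int n - int k)) \<longleftrightarrow> (\<forall>w. ?harm w)"
  proof (intro iffI allI)
    fix w assume *: "\<forall>k. ?harm (int n - int k)"
    show "?harm w"
    proof (cases "w \<le> int n")
      case True
      then have "int n - int (nat (int n - w)) = w" by simp
      then show ?thesis using spec[OF *, of "nat (int n - w)"] by (simp only:)
    qed (rule high)
  qed blast
  then show ?thesis unfolding zero deg by blast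
qed

lemma image_eq_iff_covered: "F ` A \<subseteq> G ` B \<Longrightarrow> F ` A = G ` B \<longleftrightarrow> (\<forall>b\<in>B. \<exists>a\<in>A. G b = F a)"
  by blast

text \<open>The image of the Lefschetz map consists of the classes of $L^k\eta$ and always lies in the
  cohomology of degree \<open>n + k\<close>, so equality means that every closed form is cohomologous to some
  $L^k\eta$.  For \<open>k > n\<close> the weight space \<open>-k\<close> is zero.\<close>

lemma hard_lefschetz_iff:
  "(\<forall>k\<in>{0..n}. lefschetz_power M \<omega> k (n - k) ` basic_cohomology M (n - k) = basic_cohomology M (n + k)) \<longleftrightarrow>
   (\<forall>k. \<forall>\<xi>\<in>wt (- int k). ext_deriv M \<xi> = 0 \<longrightarrow>
      (\<exists>\<eta>\<in>wt (int k). ext_deriv M \<eta> = 0 \<and> (\<exists>\<zeta>\<in>wt (1 - int k). \<xi> = (lef ^^ k) \<eta> + ext_deriv M \<zeta>)))"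
    (is "_ \<longleftrightarrow> (\<forall>k. ?lef k)")
proof -
  have high: "?lef k" if "\<not> k \<le> n" for k
  proof (intro ballI impI)
    fix \<xi> assume "\<xi> \<in> wt (- int k)"
    then have "\<xi> = 0" by (rule B.bounded) (use that in simp)
    then show "\<exists>\<eta>\<in>wt (int k). ext_deriv M \<eta> = 0 \<and> (\<exists>\<zeta>\<in>wt (1 - int k). \<xi> = (lef ^^ k) \<eta> + ext_deriv M \<zeta>)"
      using zero_in_wt by (intro bexI[of _ 0] conjI) (auto simp: ext_deriv_0 linear_0[OF B.linear_L_pow])
  qed
  have deg: "lefschetz_power M \<omega> k (n - k) ` basic_cohomology M (n - k) = basic_cohomology M (n + k) \<longleftrightarrow> ?lef k"
    if k: "k \<le> n" for k
  proof -
    have nk: "n - k + 2 * k = n + k" using k by simp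
    have wts: "wt (- int k) = basic_forms M (n + k)" "wt (int k) = basic_forms M (n - k)"
      "1 - int k = int n - int (n + k) + 1"
      using k by (auto simp: wt_def nat_diff_distrib nat_add_distrib)
    have power: "lefschetz_power M \<omega> k (n - k) (coh_class (n - k) \<eta>) = coh_class (n + k) ((lef ^^ k) \<eta>)"
      "(lef ^^ k) \<eta> \<in> closed_basic M (n + k)" if "\<eta> \<in> closed_basic M (n - k)" for \<eta>
      using lefschetz_power_class[OF that, of k] unfolding nk by blast+
    have image: "lefschetz_power M \<omega> k (n - k) ` basic_cohomology M (n - k) =
        (\<lambda>\<eta>. coh_class (n + k) ((lef ^^ k) \<eta>)) ` closed_basic M (n - k)"
      unfolding basic_cohomology_eq image_image by (rule image_cong[OF refl power(1)])
    have sub: "(\<lambda>\<eta>. coh_class (n + k) ((lef ^^ k) \<eta>)) ` closed_basic M (n - k) \<subseteq>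
        coh_class (n + k) ` closed_basic M (n + k)"
      by (rule image_subsetI) (rule imageI, erule power(2))
    have "lefschetz_power M \<omega> k (n - k) ` basic_cohomology M (n - k) = basic_cohomology M (n + k) \<longleftrightarrow>
        (\<forall>\<xi>\<in>closed_basic M (n + k). \<exists>\<eta>\<in>closed_basic M (n - k). coh_class (n + k) \<xi> = coh_class (n + k) ((lef ^^ k) \<eta>))"
      unfolding image basic_cohomology_eq[of "n + k"] by (rule image_eq_iff_covered[OF sub])
    also have "\<dots> \<longleftrightarrow> (\<forall>\<xi>\<in>closed_basic M (n + k). \<exists>\<eta>\<in>closed_basic M (n - k).
        \<exists>\<zeta>\<in>wt (1 - int k). \<xi> = (lef ^^ k) \<eta> + ext_deriv M \<zeta>)"
      unfolding wts(3) using coh_class_eq_iff[OF _ power(2)] by (intro ball_cong bex_cong refl)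
    finally show ?thesis unfolding wts(1,2) by (simp only: Ball_def Bex_def closed_basic_iff imp_conjL conj_assoc)
  qed
  show ?thesis 
  proof
    assume l: "\<forall>k\<in>{0..n}. lefschetz_power M \<omega> k (n - k) ` basic_cohomology M (n - k) = basic_cohomology M (n + k)"
    show "\<forall>k. ?lef k"
    proof
      fix k show "?lef k"
        by (cases "k \<le> n") (use l deg[of k] high[of k] in simp_all)
    qed
  next
    assume l: "\<forall>k. ?lef k"
    show "\<forall>k\<in>{0..n}. lefschetz_power M \<omega> k (n - k) ` basic_cohomology M (n - k) = basic_cohomology M (n + k)"
    proof
      fix k assume "k \<in> {0..n}"
      then show "lefschetz_power M \<omega> k (n - k) ` basic_cohomology M (n - k) = basic_cohomology M (n + k)"
        using deg[of k] spec[OF l, of k] by simp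
    qed
  qed
qed

theorem harmonic_iff_hard_lefschetz:
  "(\<forall>k. \<forall>C\<in>basic_cohomology M k. \<exists>\<xi>\<in>C. ext_deriv M \<xi> = zero_form \<and> codifferential M n \<omega> k \<xi> = zero_form) \<longleftrightarrow>
   (\<forall>k\<in>{0..n}. lefschetz_power M \<omega> k (n - k) ` basic_cohomology M (n - k) = basic_cohomology M (n + k))"
  unfolding harmonic_representatives_iff hard_lefschetz_iff
  by (rule B.hard_lefschetz_iff_harmonic) simp

end

section \<open>Harmonic representatives and the hard Lefschetz property\<close>

theorem theorem10:
  fixes M :: "'a foliated" and p n :: nat and \<omega> :: "'a dform"
  assumes "foliated_manifold M" and "leaf_dim M = p" and "codim M = 2 * n"
    and "transversely_symplectic M \<omega>"
  shows "(\<forall>k. \<forall>C \<in> basic_cohomology M k. \<exists>\<xi> \<in> C.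
            ext_deriv M \<xi> = zero_form \<and> codifferential M n \<omega> k \<xi> = zero_form) \<longleftrightarrow>
         (\<forall>k \<in> {0..n}. lefschetz_power M \<omega> k (n - k) ` basic_cohomology M (n - k)
            = basic_cohomology M (n + k))"
proof -
  interpret symplectic_mfd M "mdim M" p "2 * n" \<omega> n
    by unfold_locales (use assms in \<open>simp_all add: foliated_manifold_def\<close>)
  show ?thesis by (rule harmonic_iff_hard_lefschetz)
qed

end
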